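(* Let $t\in\mathbb C$, $\underline k:=-\tfrac t2$, and $\lambda\in\mathcal I$. Assume that either $t\notin 2\mathbb Z^{\le0}$, or that $t\in2\mathbb Z^{\le 0}$ and $\lambda$ is $\underline k$-regular. Then the eigenvalue polynomial $\boldsymbol f_\lambda$ of the categorical Capelli operator $\boldsymbol D_{t,\lambda}$ is $$\boldsymbol f_\lambda=\frac{1}{H_\lambda(\underline k)}\,P_\lambda^{\underline k}.$$
   Context: Deligne category. $\mathsf{Rep}(O_t)$ is Deligne's Karoubian $\mathbb C$-linear rigid symmetric monoidal category generated by a self-dual object $\mathsf V_t$ of categorical dimension $t$, with symmetric evaluation $\boldsymbol\epsilon:\mathsf V_t\otimes\mathsf V_t\to\mathbf 1$ and coevaluation $\boldsymbol\iota:\mathbf 1\to\mathsf V_t\otimes\mathsf V_t$, $\boldsymbol\epsilon\boldsymbol\iota=t$, so that $\mathrm{End}(\mathsf V_t^{\otimes d})$ is the Brauer algebra $Br_d(t)$. In its inductive completion put $\mathsf P:=\bigoplus_{d\ge0}\mathsf P^d$, $\mathsf P^d:=\mathsf S^d(\mathsf V_t)$, and $\mathsf{PD}:=\mathsf P\otimes\bigoplus_{p\ge0}\mathsf S^p(\mathsf V_t^* )$. $\mathsf{PD}$ is an associative algebra object acting on $\mathsf P$ as polynomial-coefficient differential operators: $\mathsf P$ acts by multiplication, $\mathsf V_t^*$ by the derivations of $\mathsf P$ extending the evaluation $\mathsf V_t^*\otimes\mathsf V_t\to\mathbf 1$, and $\mathsf S^p(\mathsf V_t^* )$ by their composites (giving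 contractions $\mathsf S^p(\mathsf V_t^* )\otimes\mathsf S^q(\mathsf V_t)\to\mathsf S^{q-p}(\mathsf V_t)$, zero if $p>q$). Put $\mathsf A_t:=\mathrm{Hom}(\mathbf 1,\bigoplus_p\mathsf S^p(\mathsf V_t)\otimes\mathsf S^p(\mathsf V_t^* ))$; this is an algebra acting faithfully on $\mathsf P$. Let $\boldsymbol E_t\in\mathsf A_t$ be the element given by the coevaluation of $\mathsf V_t$ (it acts on $\mathsf P^d$ by $d$). Let $\boldsymbol\Theta_t$ be $\tfrac12$ times multiplication by the element $\mathbf 1\to\mathsf S^2(\mathsf V_t)$ given by $\boldsymbol\iota$, and $\boldsymbol\Delta_t$ be $\tfrac12$ times the action of the corresponding element $\mathbf 1\to\mathsf S^2(\mathsf V_t^* )$; then $[\boldsymbol E_t,\boldsymbol\Delta_t]=-2\boldsymbol\Delta_t$, $[\boldsymbol E_t,\boldsymbol\Theta_t]=2\boldsymbol\Theta_t$, $[\boldsymbol\Delta_t,\boldsymbol\Theta_t]=\boldsymbol E_t+\tfrac t2$. The Casimir operator is $\boldsymbol C_t:=\boldsymbol E_t^2+t\boldsymbol E_t-4\boldsymbol\Theta_t\boldsymbol\Delta_t-2\boldsymbol E_t$, and $\boldsymbol C_{t,d}$ is its restriction to $\mathsf P^d$. Partitions. $\mathcal I:=\{(\lambda_1,\lambda_2)\in\mathbb Z^2:\lambda_1\ge\lambda_2\ge0\}$, $|\lambda|=\lambda_1+\lambda_2$. For an integer $k\ge0$, $\lambda\in\mathcal I$ is $k$-regular if $\lambda_1\le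 k$ or $\lambda_1-\lambda_2=k+1$ or $\lambda_1-\lambda_2\ge2k+3$; $k$-quasiregular if $\lambda_1\ge k+1$ and $\lambda_1-\lambda_2\le k$; $k$-singular if $k+2\le\lambda_1-\lambda_2\le2k+2$. $\mathcal I'_k$ is the set of $k$-regular and $k$-quasiregular elements. Components. Set $\boldsymbol c_\lambda(t):=(\lambda_1-\lambda_2)(\lambda_1-\lambda_2+t-2)$. The minimal polynomial of $\boldsymbol C_{t,d}$ is $\prod_{0\le a\le d,\,a\equiv d\,(2)}(x-a(a+t-2))$; for $|\lambda|=d$ let $m_\lambda\in\{1,2\}$ be the multiplicity of its root $\boldsymbol c_\lambda(t)$ and $\mathsf V_{t,\lambda}:=\ker((\boldsymbol C_{t,d}-\boldsymbol c_\lambda(t))^{m_\lambda})\subseteq\mathsf P^d$. Put $\mathcal S:=\mathcal I$ if $t\notin2\mathbb Z^{\le0}$ and $\mathcal S:=\mathcal I'_{\underline k}$ if $t\in2\mathbb Z^{\le0}$; then $\mathsf P^d\cong\bigoplus_{\lambda\in\mathcal S,|\lambda|=d}\mathsf V_{t,\lambda}$ with indecomposable summands. Capelli operators. For $\lambda\in\mathcal S$, with $d=|\lambda|$, $\boldsymbol D_{t,\lambda}\in\mathsf A_t$ is the element given by the coevaluation $\mathbf 1\to\mathsf V_{t,\lambda}\otimes\mathsf V_{t,\lambda}^*$, where $\mathsf V_{t,\lambda}\otimes\mathsf V_{t,\lambda}^*$ is a direct summand of $\mathsf S^d(\mathsf V_t)\otimes\mathsf S^d(\mathsf V_t^* )$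 via the identification $\mathsf S^d(\mathsf V_t^* )\cong\mathsf S^d(\mathsf V_t)^*$ given by the contraction pairing above. For $\boldsymbol D\in\mathsf A_t$ the eigenvalue polynomial $\boldsymbol f_{\boldsymbol D}\in\mathbb C[x,y]$ is the unique symmetric polynomial such that for all $\mu\in\mathcal S$, $\boldsymbol D|_{\mathsf V_{t,\mu}}=\boldsymbol f_{\boldsymbol D}(\mu_1-\underline k-1,\mu_2)\cdot1+\boldsymbol\eta_\mu$ with $\boldsymbol\eta_\mu^2=0$. Write $\boldsymbol f_\lambda:=\boldsymbol f_{\boldsymbol D_{t,\lambda}}$. Knop–Sahi polynomials. With $a^{\underline r}:=a(a-1)\cdots(a-r+1)$, $$P_\lambda^\kappa(x,y):=\sum_{i+j\le\lambda_1-\lambda_2}\frac{(\lambda_1-\lambda_2)!\,(\kappa+1)^{\underline{\lambda_1-\lambda_2-i}}(\kappa+1)^{\underline{\lambda_1-\lambda_2-j}}}{i!\,j!\,(\lambda_1-\lambda_2-i-j)!\,(\kappa+1)^{\underline{\lambda_1-\lambda_2}}}\,x^{\underline{\lambda_2+i}}y^{\underline{\lambda_2+j}}\in\mathbb Q(\kappa)[x,y],$$ (sum over $i,j\ge 0$), $H_\lambda(\kappa):=(\lambda_1-\lambda_2)!\,\lambda_2!\,(\lambda_1-1-\kappa)^{\underline{\lambda_2}}$. $P_\lambda^{\underline k}$ is obtained by specializing the (reduced) rational coefficients at $\kappa=\underline k$, where they have no pole under the stated hypotheses. *)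

theory Defs
  imports
    Complex_Main
    "HOL-Library.Disjoint_Sets"
    "HOL-Library.Poly_Mapping"
    "HOL-Combinatorics.Permutations"
    "HOL-Computational_Algebra.Computational_Algebra"
    "HOL-Computational_Algebra.Field_as_Ring"
begin

section \<open>The Brauer category\<close>

text \<open>
  A diagram from \<open>V\<^sup>\<otimes>\<^sup>m\<close> to \<open>V\<^sup>\<otimes>\<^sup>n\<close> is a perfect matching of the points
  \<open>(0, i)\<close>, \<open>i < m\<close> (source), and \<open>(1, j)\<close>, \<open>j < n\<close> (target).
\<close>

datatype diagram = Diagram (dsrc: nat) (dtgt: nat) (arcs: "(nat \<times> nat) set set")

definition points :: "nat \<Rightarrow> nat \<Rightarrow> (nat \<times> nat) set" where
  "points m n = {0} \<times> {..<m} \<union> {1} \<times> {..<n}"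

definition brauer_diagram :: "diagram \<Rightarrow> bool" where
  "brauer_diagram D \<longleftrightarrow>
     partition_on (points (dsrc D) (dtgt D)) (arcs D) \<and> (\<forall>A\<in>arcs D. card A = 2)"

text \<open>
  Stacking \<open>E\<close> on top of \<open>D\<close>: the arcs of \<open>E\<close> are moved up one level, so that the target of
  \<open>D\<close> and the source of \<open>E\<close> are glued along level 1 and the target of \<open>E\<close> lies on level 2.
\<close>

definition glued :: "diagram \<Rightarrow> diagram \<Rightarrow> (nat \<times> nat) rel" where
  "glued E D =
     {(x, y). {x, y} \<in> arcs D \<union> (`) (\<lambda>(l, i). (Suc l, i)) ` arcs E}\<^sup>*"

definition stack :: "diagram \<Rightarrow> diagram \<Rightarrow> diagram" where
  "stack E D = Diagram (dsrc D) (dtgt E)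
     {{x, y} | x y. x \<in> points (dsrc D) (dtgt E) \<and> y \<in> points (dsrc D) (dtgt E) \<and> x \<noteq> y
        \<and> ((2 * fst x, snd x), (2 * fst y, snd y)) \<in> glued E D}"

definition loops :: "diagram \<Rightarrow> diagram \<Rightarrow> nat" where
  "loops E D =
     card {C. \<exists>j < dtgt D. C = glued E D `` {(1, j)} \<and> C \<subseteq> {1} \<times> {..<dtgt D}}"

definition juxtapose :: "diagram \<Rightarrow> diagram \<Rightarrow> diagram" where
  "juxtapose D E = Diagram (dsrc D + dsrc E) (dtgt D + dtgt E)
     (arcs D \<union> (`) (\<lambda>(l, i). (l, (if l = 0 then dsrc D else dtgt D) + i)) ` arcs E)"

text \<open>
  Morphisms are formal linear combinations of diagrams. Composition and tensor product are the
  bilinear extensions of stacking (each closed loop contributing a factor \<open>t\<close>) and juxtaposition.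
\<close>

type_synonym morphism = "diagram \<Rightarrow>\<^sub>0 complex"

definition bhom :: "nat \<Rightarrow> nat \<Rightarrow> morphism set" where
  "bhom m n = {f. \<forall>D\<in>Poly_Mapping.keys f. brauer_diagram D \<and> dsrc D = m \<and> dtgt D = n}"

definition bscale :: "complex \<Rightarrow> morphism \<Rightarrow> morphism" (infixr "\<cdot>\<^sub>B" 75) where
  "c \<cdot>\<^sub>B f = Poly_Mapping.map ((*) c) f"

definition bcomp :: "complex \<Rightarrow> morphism \<Rightarrow> morphism \<Rightarrow> morphism" where
  "bcomp t g f = (\<Sum>E\<in>Poly_Mapping.keys g. \<Sum>D\<in>Poly_Mapping.keys f.
     if dsrc E = dtgt D
     then Poly_Mapping.single (stack E D) (Poly_Mapping.lookup g E * Poly_Mapping.lookup f D * t ^ loops E D)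
     else 0)"

abbreviation bcomp_syntax :: "morphism \<Rightarrow> complex \<Rightarrow> morphism \<Rightarrow> morphism"
    ("_ \<odot>\<^bsub>_\<^esub>/ _" [71, 0, 70] 70) where
  "g \<odot>\<^bsub>t\<^esub> f \<equiv> bcomp t g f"

definition btensor :: "morphism \<Rightarrow> morphism \<Rightarrow> morphism" (infixr "\<otimes>\<^sub>B" 73) where
  "f \<otimes>\<^sub>B g = (\<Sum>D\<in>Poly_Mapping.keys f. \<Sum>E\<in>Poly_Mapping.keys g.
     Poly_Mapping.single (juxtapose D E) (Poly_Mapping.lookup f D * Poly_Mapping.lookup g E))"

text \<open>The action of permutations of the tensor factors, given by the symmetric braiding.\<close>

definition bperm :: "nat \<Rightarrow> (nat \<Rightarrow> nat) \<Rightarrow> morphism" where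
  "bperm n \<sigma> = Poly_Mapping.single (Diagram n n {{(0, i), (1, \<sigma> i)} | i. i < n}) 1"

definition bid :: "nat \<Rightarrow> morphism" where
  "bid n = bperm n id"

text \<open>
  The evaluation and coevaluation of the self-dual generator \<open>V\<close>. From here on \<open>V\<^sup>*\<close> is \<open>V\<close>
  itself, with evaluation \<open>bev\<close> and coevaluation \<open>bcoev\<close>.
\<close>

definition bev :: morphism where
  "bev = Poly_Mapping.single (Diagram 2 0 {{(0, 0), (0, 1)}}) 1"

definition bcoev :: morphism where
  "bcoev = Poly_Mapping.single (Diagram 0 2 {{(1, 0), (1, 1)}}) 1"


section \<open>The Karoubi envelope\<close>

text \<open>
  Deligne's category is the Karoubi envelope of the additive envelope of the Brauer category.
  Its objects are direct summands of finite direct sums of tensor powers of \<open>V\<close>; the objects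
  \<open>(n, e)\<close> below, the image of the idempotent \<open>e\<close> on the \<open>n\<close>-th tensor power, form a full
  monoidal subcategory, of which every object of the category is a direct summand of a finite
  direct sum. It suffices to test the universal property of kernels below on these.
\<close>

type_synonym kobject = "nat \<times> morphism"

definition is_object :: "complex \<Rightarrow> kobject \<Rightarrow> bool" where
  "is_object t X \<longleftrightarrow> snd X \<in> bhom (fst X) (fst X) \<and> snd X \<odot>\<^bsub>t\<^esub> snd X = snd X"

definition khom :: "complex \<Rightarrow> kobject \<Rightarrow> kobject \<Rightarrow> morphism set" where
  "khom t X Y = {f \<in> bhom (fst X) (fst Y). f \<odot>\<^bsub>t\<^esub> snd X = f \<and> snd Y \<odot>\<^bsub>t\<^esub> f = f}"

abbreviation ident :: "kobject \<Rightarrow> morphism" where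
  "ident X \<equiv> snd X"

definition ktensor :: "kobject \<Rightarrow> kobject \<Rightarrow> kobject" (infixr "\<otimes>\<^sub>K" 73) where
  "X \<otimes>\<^sub>K Y = (fst X + fst Y, snd X \<otimes>\<^sub>B snd Y)"

definition kunit :: kobject where
  "kunit = (0, bid 0)"

text \<open>The idempotent \<open>p\<close> on \<open>X\<close> has image the kernel of \<open>g\<close>.\<close>

definition projects_onto_kernel :: "complex \<Rightarrow> kobject \<Rightarrow> morphism \<Rightarrow> morphism \<Rightarrow> bool" where
  "projects_onto_kernel t X g p \<longleftrightarrow>
     p \<in> khom t X X \<and> p \<odot>\<^bsub>t\<^esub> p = p \<and> g \<odot>\<^bsub>t\<^esub> p = 0 \<and>
     (\<forall>Y h. is_object t Y \<and> h \<in> khom t Y X \<and> g \<odot>\<^bsub>t\<^esub> h = 0 \<longrightarrow> p \<odot>\<^bsub>t\<^esub> h = h)"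

text \<open>\<open>c\<close> is the coevaluation belonging to the evaluation \<open>ev : Y \<otimes> X \<rightarrow> 1\<close>.\<close>

definition is_coevaluation ::
    "complex \<Rightarrow> kobject \<Rightarrow> kobject \<Rightarrow> morphism \<Rightarrow> morphism \<Rightarrow> bool" where
  "is_coevaluation t X Y ev c \<longleftrightarrow>
     c \<in> khom t kunit (X \<otimes>\<^sub>K Y) \<and>
     (ident X \<otimes>\<^sub>B ev) \<odot>\<^bsub>t\<^esub> (c \<otimes>\<^sub>B ident X) = ident X \<and>
     (ev \<otimes>\<^sub>B ident Y) \<odot>\<^bsub>t\<^esub> (ident Y \<otimes>\<^sub>B c) = ident Y"


section \<open>Symmetric powers and differential operators\<close>

definition symmetrizer :: "nat \<Rightarrow> morphism" where
  "symmetrizer n = (1 / fact n) \<cdot>\<^sub>B (\<Sum>\<sigma> | \<sigma> permutes {..<n}. bperm n \<sigma>)"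

definition Sym :: "nat \<Rightarrow> kobject" where
  "Sym n = (n, symmetrizer n)"

abbreviation Sym_dual :: "nat \<Rightarrow> kobject" where
  "Sym_dual n \<equiv> Sym n"

definition multiplication :: "complex \<Rightarrow> nat \<Rightarrow> nat \<Rightarrow> morphism" where
  "multiplication t p q = symmetrizer (p + q) \<odot>\<^bsub>t\<^esub> (symmetrizer p \<otimes>\<^sub>B symmetrizer q)"

definition to_front :: "nat \<Rightarrow> nat \<Rightarrow> nat" where
  "to_front i j = (if j < i then Suc j else if j = i then 0 else j)"

text \<open>
  The map \<open>V\<^sup>* \<otimes> S\<^sup>q\<^sup>+\<^sup>1(V) \<rightarrow> S\<^sup>q(V)\<close> given by the Leibniz rule: the sum over \<open>i\<close> of the
  contractions of \<open>V\<^sup>*\<close> with the \<open>i\<close>-th factor.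
\<close>

definition derivation :: "complex \<Rightarrow> nat \<Rightarrow> morphism" where
  "derivation t q =
     symmetrizer q \<odot>\<^bsub>t\<^esub>
     (\<Sum>i\<le>q. (bev \<otimes>\<^sub>B bid q) \<odot>\<^bsub>t\<^esub> (bid 1 \<otimes>\<^sub>B bperm (Suc q) (to_front i))) \<odot>\<^bsub>t\<^esub>
     (bid 1 \<otimes>\<^sub>B symmetrizer (Suc q))"

fun iterated_derivation :: "complex \<Rightarrow> nat \<Rightarrow> nat \<Rightarrow> morphism" where
  "iterated_derivation t 0 q = symmetrizer q"
| "iterated_derivation t (Suc p) 0 = 0"
| "iterated_derivation t (Suc p) (Suc q) =
     iterated_derivation t p q \<odot>\<^bsub>t\<^esub> (bid p \<otimes>\<^sub>B derivation t q)"

text \<open>The contraction \<open>S\<^sup>p(V\<^sup>*) \<otimes> S\<^sup>q(V) \<rightarrow> S\<^sup>q\<^sup>-\<^sup>p(V)\<close>, which is zero for \<open>p > q\<close>.\<close>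

definition contraction :: "complex \<Rightarrow> nat \<Rightarrow> nat \<Rightarrow> morphism" where
  "contraction t p q = iterated_derivation t p q \<odot>\<^bsub>t\<^esub> (symmetrizer p \<otimes>\<^sub>B symmetrizer q)"

text \<open>The action on \<open>S\<^sup>q(V)\<close> of an element \<open>x : 1 \<rightarrow> S\<^sup>r(V) \<otimes> S\<^sup>s(V\<^sup>*)\<close>.\<close>

definition action :: "complex \<Rightarrow> nat \<Rightarrow> nat \<Rightarrow> morphism \<Rightarrow> nat \<Rightarrow> morphism" where
  "action t r s x q =
     multiplication t r (q - s) \<odot>\<^bsub>t\<^esub> (symmetrizer r \<otimes>\<^sub>B contraction t s q) \<odot>\<^bsub>t\<^esub>
     (x \<otimes>\<^sub>B symmetrizer q)"

text \<open>
  The invariant differential operators of degree 0 are the finitely supported families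
  \<open>D\<close> of morphisms \<open>D\<^sub>p : 1 \<rightarrow> S\<^sup>p(V) \<otimes> S\<^sup>p(V\<^sup>*)\<close>. This is the action of such a family on \<open>S\<^sup>q(V)\<close>.
\<close>

definition op_action :: "complex \<Rightarrow> (nat \<Rightarrow>\<^sub>0 morphism) \<Rightarrow> nat \<Rightarrow> morphism" where
  "op_action t D q = (\<Sum>p\<in>Poly_Mapping.keys D. action t p p (Poly_Mapping.lookup D p) q)"

definition Euler :: "nat \<Rightarrow>\<^sub>0 morphism" where
  "Euler = Poly_Mapping.single 1 bcoev"

definition Theta :: "complex \<Rightarrow> nat \<Rightarrow> morphism" where
  "Theta t q = (1/2) \<cdot>\<^sub>B action t 2 0 bcoev q"

definition Delta :: "complex \<Rightarrow> nat \<Rightarrow> morphism" where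
  "Delta t q = (1/2) \<cdot>\<^sub>B action t 0 2 bcoev q"

definition Casimir :: "complex \<Rightarrow> nat \<Rightarrow> morphism" where
  "Casimir t d =
     (let E = op_action t Euler d
      in E \<odot>\<^bsub>t\<^esub> E + t \<cdot>\<^sub>B E - 4 \<cdot>\<^sub>B (Theta t (d - 2) \<odot>\<^bsub>t\<^esub> Delta t d) - 2 \<cdot>\<^sub>B E)"


section \<open>Partitions and components\<close>

definition Partitions :: "(nat \<times> nat) set" where
  "Partitions = {(l1, l2). l1 \<ge> l2}"

definition size2 :: "nat \<times> nat \<Rightarrow> nat" where
  "size2 l = fst l + snd l"

definition regular :: "nat \<Rightarrow> nat \<times> nat \<Rightarrow> bool" where
  "regular k l \<longleftrightarrow> fst l \<le> k \<or> fst l - snd l = k + 1 \<or> fst l - snd l \<ge> 2 * k + 3"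

definition quasiregular :: "nat \<Rightarrow> nat \<times> nat \<Rightarrow> bool" where
  "quasiregular k l \<longleftrightarrow> fst l \<ge> k + 1 \<and> fst l - snd l \<le> k"

definition nonpos_even :: "complex set" where
  "nonpos_even = {- 2 * of_nat k | k. True}"

definition index_set :: "complex \<Rightarrow> (nat \<times> nat) set" where
  "index_set t =
     (if t \<in> nonpos_even
      then {l \<in> Partitions. \<exists>k. t = - 2 * of_nat k \<and> (regular k l \<or> quasiregular k l)}
      else Partitions)"

fun endo_power :: "complex \<Rightarrow> kobject \<Rightarrow> morphism \<Rightarrow> nat \<Rightarrow> morphism" where
  "endo_power t X f 0 = ident X"
| "endo_power t X f (Suc n) = f \<odot>\<^bsub>t\<^esub> endo_power t X f n"

definition endo_poly :: "complex \<Rightarrow> kobject \<Rightarrow> complex poly \<Rightarrow> morphism \<Rightarrow> morphism" where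
  "endo_poly t X p f = (\<Sum>i\<le>degree p. coeff p i \<cdot>\<^sub>B endo_power t X f i)"

definition minimal_poly :: "complex \<Rightarrow> kobject \<Rightarrow> morphism \<Rightarrow> complex poly" where
  "minimal_poly t X f = (THE p. lead_coeff p = 1 \<and> endo_poly t X p f = 0 \<and>
     (\<forall>q. q \<noteq> 0 \<and> endo_poly t X q f = 0 \<longrightarrow> degree p \<le> degree q))"

definition casimir_eigenvalue :: "complex \<Rightarrow> nat \<times> nat \<Rightarrow> complex" where
  "casimir_eigenvalue t l =
     of_nat (fst l - snd l) * (of_nat (fst l - snd l) + t - 2)"

definition root_multiplicity :: "complex \<Rightarrow> nat \<times> nat \<Rightarrow> nat" where
  "root_multiplicity t l =
     order (casimir_eigenvalue t l) (minimal_poly t (Sym (size2 l)) (Casimir t (size2 l)))"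

text \<open>The component \<open>V\<^sub>\<lambda>\<close> is the kernel of the following endomorphism of \<open>S\<^sup>|\<^sup>\<lambda>\<^sup>|(V)\<close>.\<close>

definition component_operator :: "complex \<Rightarrow> nat \<times> nat \<Rightarrow> morphism" where
  "component_operator t l =
     (let X = Sym (size2 l)
      in endo_power t X (Casimir t (size2 l) - casimir_eigenvalue t l \<cdot>\<^sub>B ident X)
           (root_multiplicity t l))"

text \<open>
  The idempotent cutting out \<open>V\<^sub>\<lambda>\<close> is the projection along the sum of the other components
  of the same degree.
\<close>

definition component_proj :: "complex \<Rightarrow> nat \<times> nat \<Rightarrow> morphism" where
  "component_proj t l = (THE p.
     projects_onto_kernel t (Sym (size2 l)) (component_operator t l) p \<and>
     (\<forall>m\<in>index_set t. size2 m = size2 l \<and> m \<noteq> l \<longrightarrow>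
        (\<forall>Y h. is_object t Y \<and> h \<in> khom t Y (Sym (size2 l)) \<and>
           component_operator t m \<odot>\<^bsub>t\<^esub> h = 0 \<longrightarrow> p \<odot>\<^bsub>t\<^esub> h = 0)))"

definition component :: "complex \<Rightarrow> nat \<times> nat \<Rightarrow> kobject" where
  "component t l = (size2 l, component_proj t l)"


section \<open>Capelli operators and eigenvalue polynomials\<close>

text \<open>
  The contraction \<open>S\<^sup>d(V\<^sup>*) \<otimes> S\<^sup>d(V) \<rightarrow> 1\<close> identifies \<open>S\<^sup>d(V\<^sup>*)\<close> with the dual of \<open>S\<^sup>d(V)\<close>,
  and \<open>V\<^sub>\<lambda>\<^sup>*\<close> with the image of the transpose of the idempotent of \<open>V\<^sub>\<lambda>\<close>.
\<close>

definition transpose_endo :: "complex \<Rightarrow> nat \<Rightarrow> morphism \<Rightarrow> morphism" where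
  "transpose_endo t d p = (THE q. q \<in> khom t (Sym_dual d) (Sym_dual d) \<and>
     contraction t d d \<odot>\<^bsub>t\<^esub> (q \<otimes>\<^sub>B ident (Sym d)) =
     contraction t d d \<odot>\<^bsub>t\<^esub> (ident (Sym_dual d) \<otimes>\<^sub>B p))"

definition component_dual :: "complex \<Rightarrow> nat \<times> nat \<Rightarrow> kobject" where
  "component_dual t l = (size2 l, transpose_endo t (size2 l) (component_proj t l))"

definition component_ev :: "complex \<Rightarrow> nat \<times> nat \<Rightarrow> morphism" where
  "component_ev t l = contraction t (size2 l) (size2 l) \<odot>\<^bsub>t\<^esub>
     (ident (component_dual t l) \<otimes>\<^sub>B ident (component t l))"

definition Capelli :: "complex \<Rightarrow> nat \<times> nat \<Rightarrow> (nat \<Rightarrow>\<^sub>0 morphism)" where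
  "Capelli t l = Poly_Mapping.single (size2 l)
     (THE c. is_coevaluation t (component t l) (component_dual t l) (component_ev t l) c)"

text \<open>
  An element of \<open>\<complex>[x, y]\<close> is a polynomial in the outer variable \<open>y\<close> whose coefficients are
  polynomials in the inner variable \<open>x\<close>.
\<close>

definition eval2 :: "'a::comm_semiring_0 poly poly \<Rightarrow> 'a \<Rightarrow> 'a \<Rightarrow> 'a" where
  "eval2 f a b = poly (poly f [:b:]) a"

definition symmetric2 :: "'a::zero poly poly \<Rightarrow> bool" where
  "symmetric2 f \<longleftrightarrow> (\<forall>i j. coeff (coeff f i) j = coeff (coeff f j) i)"

definition eigenvalue_poly :: "complex \<Rightarrow> (nat \<Rightarrow>\<^sub>0 morphism) \<Rightarrow> complex poly poly" where
  "eigenvalue_poly t D = (THE f. symmetric2 f \<and>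
     (\<forall>m\<in>index_set t. \<exists>\<eta>\<in>khom t (component t m) (component t m).
        op_action t D (size2 m) \<odot>\<^bsub>t\<^esub> ident (component t m) =
          eval2 f (of_nat (fst m) - (- t / 2) - 1) (of_nat (snd m)) \<cdot>\<^sub>B ident (component t m) + \<eta>
        \<and> \<eta> \<odot>\<^bsub>t\<^esub> \<eta> = 0))"


section \<open>Knop--Sahi polynomials\<close>

definition ffact :: "'a::comm_ring_1 \<Rightarrow> nat \<Rightarrow> 'a" where
  "ffact a r = (\<Prod>i<r. a - of_nat i)"

definition kappa :: "rat poly fract" where
  "kappa = to_fract [:0, 1:]"

definition KS_coeff :: "nat \<Rightarrow> nat \<Rightarrow> nat \<Rightarrow> rat poly fract" where
  "KS_coeff n i j =
     fact n * ffact (kappa + 1) (n - i) * ffact (kappa + 1) (n - j) /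
     (fact i * fact j * fact (n - i - j) * ffact (kappa + 1) n)"

definition KS :: "nat \<times> nat \<Rightarrow> rat poly fract poly poly" where
  "KS l = (let n = fst l - snd l in
     \<Sum>(i, j) \<in> {(i, j). i + j \<le> n}.
       [:[:KS_coeff n i j:]:] * ffact [:[:0, 1:]:] (snd l + i) * ffact [:0, 1:] (snd l + j))"

text \<open>Specialization at \<open>z\<close> of a rational function in reduced form.\<close>

definition specialize :: "complex \<Rightarrow> rat poly fract \<Rightarrow> complex" where
  "specialize z r = (case quot_of_fract r of (a, b) \<Rightarrow>
     poly (map_poly of_rat a) z / poly (map_poly of_rat b) z)"

definition KS_at :: "complex \<Rightarrow> nat \<times> nat \<Rightarrow> complex poly poly" where
  "KS_at z l = map_poly (map_poly (specialize z)) (KS l)"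

definition H_norm :: "nat \<times> nat \<Rightarrow> complex \<Rightarrow> complex" where
  "H_norm l z =
     fact (fst l - snd l) * fact (snd l) * ffact (of_nat (fst l) - 1 - z) (snd l)"

end

theory Submission
  imports Defs "HOL-Combinatorics.Multiset_Permutations"
begin

text \<open>
  Colour the points of diagrams with \<open>N\<close> letters. A diagram becomes a 0/1 matrix indexed by words,
  stacking becomes matrix multiplication at \<open>t = N\<close>, and for \<open>N \<ge> m + n\<close> the matrices separate the
  diagrams from \<open>V\<^sup>\<otimes>\<^sup>m\<close> to \<open>V\<^sup>\<otimes>\<^sup>n\<close>. Since all coefficients are polynomial in \<open>t\<close>, an identity of
  morphisms follows for every \<open>t\<close> from the identity of matrices for all large \<open>N\<close>, which is
  a computation with multisets.

  In this way the powers \<open>\<Theta>\<^sup>j\<Delta>\<^sup>j\<close> are Newton polynomials in the Casimir operator, and they are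
  linearly independent because the diagrams in \<open>\<Theta>\<^sup>j\<Delta>\<^sup>j\<close> have exactly \<open>j\<close> caps. This yields the minimal polynomial
  of the Casimir operator. If its eigenvalue on \<open>V\<^sub>\<lambda>\<close> is simple, the idempotent of \<open>V\<^sub>\<lambda>\<close> is the Newton
  interpolation of a Kronecker delta, and on \<open>S\<^sup>q(V)\<close> each summand \<open>\<Theta>\<^sup>j\<Delta>\<^sup>j\<close> of it acts as a binomial
  multiple of \<open>\<Theta>\<^sup>j\<Delta>\<^sup>j\<close>. The resulting eigenvalue is the expansion of the Knop--Sahi polynomial in the
  products \<open>x\<close> falling \<open>j\<close> times \<open>y\<close> falling \<open>j\<close>, by the Chu--Vandermonde identity.
\<close>

text \<open>The minimal polynomial, the idempotents, the transpose, the coevaluation and the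
  eigenvalue polynomial are definite descriptions, so each needs a uniqueness proof before anything
  can be computed with it. For t = -2k the Casimir operator need not be semisimple: its level i on
  degree d is quadratic in i, and levels i < j coincide if i + j + k + 1 = d. Then i belongs to a
  singular partition, which the index set omits, and j to a quasiregular one, whose component is a
  generalized eigenspace with a nilpotent of square zero. Such components enter only as complements
  and as places where an operator is evaluated. Regularity of \<lambda> makes its own eigenvalue
  simple, so that interpolation of values suffices, and it keeps \<kappa> away from the poles of the
  Knop-Sahi coefficients. The shifted coordinates come from a factorization: on the component of
  \<mu> the eigenvalue of \<Theta>\<Delta> - node_i is (\<mu>_2 - i)(\<mu>_1 - \<kappa> - 1 - i), so
  that Newton products become products of falling factorials.\<close>

text \<open>
  The orbit of \<open>x\<close> is a path on which \<open>\<delta>\<close> and \<open>\<epsilon>\<close> step alternately, and \<open>y\<close> is its other end. For glued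
  diagrams \<open>\<delta>\<close> and \<open>\<epsilon>\<close> exchange the ends of the arcs of either diagram.
\<close>

lemma involution_pair_orbit:
  fixes \<delta> \<epsilon> :: "'a \<Rightarrow> 'a"
  assumes fin: "finite X"
    and \<delta>X: "\<And>a. a \<in> X \<Longrightarrow> \<delta> a \<in> X" and \<epsilon>X: "\<And>a. a \<in> X \<Longrightarrow> \<epsilon> a \<in> X"
    and \<delta>2: "\<And>a. a \<in> X \<Longrightarrow> \<delta> (\<delta> a) = a" and \<epsilon>2: "\<And>a. a \<in> X \<Longrightarrow> \<epsilon> (\<epsilon> a) = a"
    and nofix: "\<And>a. a \<in> X \<Longrightarrow> \<not> (\<delta> a = a \<and> \<epsilon> a = a)"
    and x: "x \<in> X" "\<epsilon> x = x"
  shows "\<exists>!y. y \<noteq> x \<and> (x, y) \<in> {(a, b). a \<in> X \<and> (b = \<delta> a \<or> b = \<epsilon> a)}\<^sup>* \<and> (\<delta> y = y \<or> \<epsilon> y = y)"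
proof -
  \<comment> \<open>The two involutions generate a dihedral group. Since \<epsilon> fixes x, the
    whole orbit of x is already the cycle of x under the rotation \<rho>.\<close>
  define \<rho> where "\<rho> = \<delta> \<circ> \<epsilon>"
  define r where "r k = (\<rho> ^^ k) x" for k
  have r0: "r 0 = x" and rS: "r (Suc k) = \<delta> (\<epsilon> (r k))" for k
    by (simp_all add: r_def \<rho>_def)
  have rX: "r k \<in> X" for k
    by (induction k) (use x \<delta>X \<epsilon>X in \<open>auto simp: r0 rS\<close>)
  have \<rho>inj: "a = b" if "a \<in> X" "b \<in> X" "\<delta> (\<epsilon> a) = \<delta> (\<epsilon> b)" for a b
    using that \<delta>2 \<epsilon>2 \<epsilon>X by metis
  have shift: "r (j + i) = r (k + i) \<Longrightarrow> r j = r k" for i j k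
  proof (induction i)
    case (Suc i)
    then have "\<delta> (\<epsilon> (r (j + i))) = \<delta> (\<epsilon> (r (k + i)))" by (simp add: rS)
    with Suc.IH show ?case using \<rho>inj rX by blast
  qed simp
  have "\<exists>n>0. r n = x"
  proof -
    have "\<not> inj r"
      using fin rX by (metis finite_subset image_subsetI infinite_UNIV_nat finite_imageD)
    then obtain j k where "j < k" "r j = r k"
      by (metis injI linorder_neqE_nat)
    then have "r (0 + j) = r ((k - j) + j)" by simp
    then have "r 0 = r (k - j)" by (rule shift)
    then show ?thesis using \<open>j < k\<close> r0 by (metis zero_less_diff)
  qed
  define n where "n = (LEAST n. n > 0 \<and> r n = x)"
  have n: "n > 0" "r n = x"
    using LeastI_ex[OF \<open>\<exists>n>0. r n = x\<close>] by (auto simp: n_def)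
  have least: "0 < k \<Longrightarrow> k < n \<Longrightarrow> r k \<noteq> x" for k
    using not_less_Least by (fastforce simp: n_def)
  have distinct: "j = k" if "r j = r k" "1 \<le> j" "j \<le> n" "1 \<le> k" "k \<le> n" for j k
  proof -
    have False if "r j = r k" "1 \<le> j" "j < k" "k \<le> n" for j k
    proof -
      have "r (0 + j) = r ((k - j) + j)" using that by simp
      then have "r 0 = r (k - j)" by (rule shift)
      moreover have "0 < k - j" "k - j < n" using that by auto
      ultimately show False using least[of "k - j"] r0 by simp
    qed
    then show ?thesis using that by (metis linorder_neqE_nat)
  qed
  \<comment> \<open>On the cycle of length n based at a fixed point of \<epsilon>, both involutions
    are reflections: \<epsilon> is k to n - k, and \<delta> is k to n - k + 1.\<close>
  have \<epsilon>r: "k \<le> n \<Longrightarrow> \<epsilon> (r k) = r (n - k)" for k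
  proof (induction k)
    case 0
    then show ?case using x n r0 by simp
  next
    case (Suc k)
    have "\<delta> (\<epsilon> (\<epsilon> (r (Suc k)))) = \<epsilon> (r k)" using \<epsilon>2 rX \<delta>2 \<epsilon>X rS by metis
    also have "\<dots> = r (n - k)" using Suc by simp
    also have "\<dots> = r (Suc (n - Suc k))" using Suc.prems by (simp add: Suc_diff_Suc)
    also have "\<dots> = \<delta> (\<epsilon> (r (n - Suc k)))" by (rule rS)
    finally show ?case using \<rho>inj rX \<epsilon>X by blast
  qed
  have \<delta>r: "\<delta> (r k) = r (n - k + 1)" if "1 \<le> k" "k \<le> n" for k
  proof -
    obtain j where j: "k = Suc j" using \<open>1 \<le> k\<close> by (cases k) auto
    have "\<delta> (r k) = \<epsilon> (r j)" using \<delta>2 \<epsilon>X rX rS j by metis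
    also have "\<dots> = r (n - j)" using \<epsilon>r that j by simp
    finally show ?thesis using that j by (simp add: Suc_diff_Suc)
  qed
  let ?R = "{(a, b). a \<in> X \<and> (b = \<delta> a \<or> b = \<epsilon> a)}\<^sup>*"
  have reach: "(x, r k) \<in> ?R" for k
  proof (induction k)
    case (Suc k)
    have "(r k, \<epsilon> (r k)) \<in> ?R" "(\<epsilon> (r k), \<delta> (\<epsilon> (r k))) \<in> ?R"
      using rX \<epsilon>X by (auto intro!: r_into_rtrancl)
    with Suc show ?case unfolding rS by (meson rtrancl_trans)
  qed (simp add: r0)
  have rn0: "r 0 = r n" using n r0 by simp
  have orbit: "\<exists>k. 1 \<le> k \<and> k \<le> n \<and> y = r k" if "(x, y) \<in> ?R" for y
    using that
  proof (induction rule: rtrancl_induct)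
    case base
    then show ?case using n by (metis One_nat_def Suc_leI order_refl)
  next
    case (step y z)
    then obtain k where k: "1 \<le> k" "k \<le> n" "y = r k" by blast
    have "z = r (n - k + 1) \<or> z = r (n - k)" using step.hyps k \<delta>r \<epsilon>r by auto
    moreover have "\<exists>i. 1 \<le> i \<and> i \<le> n \<and> r (n - k) = r i"
      using k rn0 n by (cases "k = n") (auto intro: exI[of _ n] exI[of _ "n - k"])
    moreover have "1 \<le> n - k + 1" "n - k + 1 \<le> n" using k by auto
    ultimately show ?case by metis
  qed
  have n2: "n \<noteq> 1"
  proof
    assume "n = 1"
    then have "r 1 = x" using n by simp
    then have "\<delta> x = x" using \<delta>r[of 1] \<open>n = 1\<close> by simp
    then show False using nofix x by blast
  qed
  have \<epsilon>fix: "\<epsilon> (r k) = r k \<longleftrightarrow> 2 * k = n \<or> k = n" if "1 \<le> k" "k \<le> n" for k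
  proof (cases "k = n")
    case True
    then show ?thesis using n x by simp
  next
    case False
    then have "r (n - k) = r k \<longleftrightarrow> n - k = k" using that distinct[of "n - k" k] by auto
    then show ?thesis using \<epsilon>r that False by auto
  qed
  have \<delta>fix: "\<delta> (r k) = r k \<longleftrightarrow> 2 * k = n + 1" if "1 \<le> k" "k \<le> n" for k
  proof -
    have "r (n - k + 1) = r k \<longleftrightarrow> n - k + 1 = k" using that distinct[of "n - k + 1" k] by auto
    then show ?thesis using \<delta>r that by auto
  qed
  \<comment> \<open>The ends of the path are the fixed points of the reflections. Apart from x
    itself, which is r n, these satisfy 2k = n or 2k = n + 1, and exactly one of n and n + 1 is
    even.\<close>
  define h where "h = (n + 1) div 2"
  have h: "1 \<le> h" "h < n" "2 * h = n \<or> 2 * h = n + 1" using n n2 by (auto simp: h_def)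
  show ?thesis
  proof (rule ex1I[of _ "r h"], intro conjI)
    show "r h \<noteq> x" using least h by simp
    show "(x, r h) \<in> ?R" by (rule reach)
    show "\<delta> (r h) = r h \<or> \<epsilon> (r h) = r h" using \<epsilon>fix \<delta>fix h by auto
  next
    fix y assume y: "y \<noteq> x \<and> (x, y) \<in> ?R \<and> (\<delta> y = y \<or> \<epsilon> y = y)"
    then obtain k where k: "1 \<le> k" "k \<le> n" "y = r k" using orbit by blast
    with y n have "k \<noteq> n" by blast
    then have "2 * k = n \<or> 2 * k = n + 1" using y k \<epsilon>fix \<delta>fix by blast
    then have "k = h" using h by presburger
    then show "y = r h" using k by simp
  qed
qed

section \<open>Diagrams\<close>

lemma finite_points [simp]: "finite (points m n)"
  by (simp add: points_def)

lemma brauer_diagram_arc: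
  assumes "brauer_diagram D" "{x, y} \<in> arcs D"
  shows "x \<in> points (dsrc D) (dtgt D)" "y \<in> points (dsrc D) (dtgt D)" "x \<noteq> y"
proof -
  have "\<Union> (arcs D) = points (dsrc D) (dtgt D)" "card {x, y} = 2"
    using assms by (auto simp: brauer_diagram_def partition_on_def)
  then show "x \<in> points (dsrc D) (dtgt D)" "y \<in> points (dsrc D) (dtgt D)" "x \<noteq> y"
    using assms(2) by auto
qed

lemma brauer_diagram_partner:
  assumes "brauer_diagram D" "x \<in> points (dsrc D) (dtgt D)"
  shows "\<exists>!y. {x, y} \<in> arcs D"
proof -
  have part: "partition_on (points (dsrc D) (dtgt D)) (arcs D)"
    and two: "\<And>A. A \<in> arcs D \<Longrightarrow> card A = 2"
    using assms(1) by (auto simp: brauer_diagram_def)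
  obtain A where A: "A \<in> arcs D" "x \<in> A"
    using part assms(2) by (auto simp: partition_on_def)
  then obtain y where y: "A = {x, y}"
    using two[OF A(1)] by (auto simp: card_2_iff)
  have "z = y" if "{x, z} \<in> arcs D" for z
  proof -
    have "{x, z} = {x, y}"
      using disjointD[OF partition_onD2[OF part] that, of A] A y by blast
    moreover have "x \<noteq> z" "x \<noteq> y" using brauer_diagram_arc[OF assms(1)] that A y by auto
    ultimately show ?thesis by (auto simp: doubleton_eq_iff)
  qed
  then show ?thesis using A y by blast
qed

lemma brauer_diagramI:
  assumes arc: "\<And>A. A \<in> arcs D \<Longrightarrow>
      \<exists>x y. A = {x, y} \<and> x \<noteq> y \<and> x \<in> points (dsrc D) (dtgt D) \<and> y \<in> points (dsrc D) (dtgt D)"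
    and partner: "\<And>x. x \<in> points (dsrc D) (dtgt D) \<Longrightarrow> \<exists>!y. {x, y} \<in> arcs D"
  shows "brauer_diagram D"
proof -
  have "A = B" if AB: "A \<in> arcs D" "B \<in> arcs D" "A \<inter> B \<noteq> {}" for A B
  proof -
    obtain p where p: "p \<in> A" "p \<in> B" using AB by blast
    obtain q where q: "A = {p, q}" "p \<in> points (dsrc D) (dtgt D)"
      using arc[OF AB(1)] p(1) by (auto simp: insert_commute)
    obtain q' where q': "B = {p, q'}"
      using arc[OF AB(2)] p(2) by (auto simp: insert_commute)
    show ?thesis using partner[OF q(2)] AB q(1) q' by blast
  qed
  moreover have "\<Union> (arcs D) = points (dsrc D) (dtgt D)"
  proof
    show "\<Union> (arcs D) \<subseteq> points (dsrc D) (dtgt D)" using arc by fastforce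
    show "points (dsrc D) (dtgt D) \<subseteq> \<Union> (arcs D)" using partner by blast
  qed
  moreover have "{} \<notin> arcs D" using arc by blast
  moreover have "card A = 2" if "A \<in> arcs D" for A
    using arc[OF that] by auto
  ultimately show ?thesis
    by (auto simp: brauer_diagram_def partition_on_def disjoint_def)
qed

definition partner :: "diagram \<Rightarrow> nat \<times> nat \<Rightarrow> nat \<times> nat" where
  "partner D x = (THE y. {x, y} \<in> arcs D)"

lemma partner_arc:
  assumes "brauer_diagram D" "x \<in> points (dsrc D) (dtgt D)"
  shows "{x, y} \<in> arcs D \<longleftrightarrow> y = partner D x"
  using brauer_diagram_partner[OF assms] theI'[OF brauer_diagram_partner[OF assms]]
  unfolding partner_def by blast

lemma partner_props:
  assumes "brauer_diagram D" "x \<in> points (dsrc D) (dtgt D)"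
  shows "partner D x \<in> points (dsrc D) (dtgt D)" "partner D x \<noteq> x" "partner D (partner D x) = x"
proof -
  have *: "{x, partner D x} \<in> arcs D" using partner_arc[OF assms] by simp
  show 1: "partner D x \<in> points (dsrc D) (dtgt D)" "partner D x \<noteq> x"
    using brauer_diagram_arc[OF assms(1) *] by auto
  show "partner D (partner D x) = x"
    using * partner_arc[OF assms(1) 1(1)] by (metis insert_commute)
qed

section \<open>The relation generated by two stacked diagrams\<close>

definition lift :: "nat \<times> nat \<Rightarrow> nat \<times> nat" where
  "lift p = (Suc (fst p), snd p)"

lemma lift_eq: "(\<lambda>(l, i). (Suc l, i)) = lift"
  by (auto simp: lift_def)

text \<open>Source and target of the stacked diagram are levels 0 and 1, but levels 0 and 2 of the
  glued picture.\<close>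

abbreviation (input) outer :: "nat \<times> nat \<Rightarrow> nat \<times> nat" where
  "outer p \<equiv> (2 * fst p, snd p)"

definition glued_edges :: "diagram \<Rightarrow> diagram \<Rightarrow> (nat \<times> nat) rel" where
  "glued_edges E D = {(x, y). {x, y} \<in> arcs D \<union> (`) lift ` arcs E}"

lemma glued_rtrancl: "glued E D = (glued_edges E D)\<^sup>*"
  by (simp add: glued_def glued_edges_def lift_eq)

lemma glued_refl [simp]: "(x, x) \<in> glued E D"
  by (simp add: glued_rtrancl)

lemma glued_sym: "(x, y) \<in> glued E D \<Longrightarrow> (y, x) \<in> glued E D"
proof -
  have "sym (glued_edges E D)" by (auto simp: sym_def glued_edges_def insert_commute)
  then have "sym (glued E D)" unfolding glued_rtrancl by (rule sym_rtrancl)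
  then show "(x, y) \<in> glued E D \<Longrightarrow> (y, x) \<in> glued E D" by (rule symD)
qed

lemma glued_trans: "(x, y) \<in> glued E D \<Longrightarrow> (y, z) \<in> glued E D \<Longrightarrow> (x, z) \<in> glued E D"
  unfolding glued_rtrancl by (rule rtrancl_trans)

lemma glued_class_eq: "(x, y) \<in> glued E D \<Longrightarrow> glued E D `` {x} = glued E D `` {y}"
  using glued_sym glued_trans by blast

definition glued_points :: "diagram \<Rightarrow> diagram \<Rightarrow> (nat \<times> nat) set" where
  "glued_points E D = {0} \<times> {..<dsrc D} \<union> {1} \<times> {..<dtgt D} \<union> {2} \<times> {..<dtgt E}"

lemma lift_doubleton: "{x, y} \<in> (`) lift ` arcs E \<longleftrightarrow>
    (\<exists>x' y'. x = lift x' \<and> y = lift y' \<and> {x', y'} \<in> arcs E)" if "brauer_diagram E"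
proof
  assume "{x, y} \<in> (`) lift ` arcs E"
  then obtain A where A: "A \<in> arcs E" "{x, y} = lift ` A" by blast
  obtain p q where pq: "A = {p, q}" using \<open>brauer_diagram E\<close> A(1) by (fastforce simp: brauer_diagram_def card_2_iff)
  then have "{x, y} = {lift p, lift q}" using A(2) by simp
  then show "\<exists>x' y'. x = lift x' \<and> y = lift y' \<and> {x', y'} \<in> arcs E"
    using A(1) pq unfolding doubleton_eq_iff by (metis insert_commute)
next
  assume "\<exists>x' y'. x = lift x' \<and> y = lift y' \<and> {x', y'} \<in> arcs E"
  then obtain x' y' where "x = lift x'" "y = lift y'" "{x', y'} \<in> arcs E" by blast
  then show "{x, y} \<in> (`) lift ` arcs E" by (auto simp: image_iff intro!: bexI[of _ "{x', y'}"])
qed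

lemma glued_edges_points:
  assumes "brauer_diagram E" "brauer_diagram D" "dsrc E = dtgt D" "(x, y) \<in> glued_edges E D"
  shows "x \<in> glued_points E D" "y \<in> glued_points E D"
proof -
  have "{x, y} \<in> arcs D \<or> (\<exists>x' y'. x = lift x' \<and> y = lift y' \<and> {x', y'} \<in> arcs E)"
    using assms(4)
    unfolding glued_edges_def Un_iff mem_Collect_eq case_prod_conv lift_doubleton[OF assms(1)] .
  then have "x \<in> glued_points E D \<and> y \<in> glued_points E D"
  proof
    assume "{x, y} \<in> arcs D"
    from brauer_diagram_arc[OF assms(2) this] show ?thesis
      by (auto simp: glued_points_def points_def)
  next
    assume "\<exists>x' y'. x = lift x' \<and> y = lift y' \<and> {x', y'} \<in> arcs E"
    then obtain x' y' where *: "x = lift x'" "y = lift y'" "{x', y'} \<in> arcs E" by blast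
    from brauer_diagram_arc[OF assms(1) *(3)] show ?thesis
      using assms(3) *(1,2) by (auto simp: glued_points_def points_def lift_def)
  qed
  then show "x \<in> glued_points E D" "y \<in> glued_points E D" by auto
qed

lemma glued_in_points:
  assumes "brauer_diagram E" "brauer_diagram D" "dsrc E = dtgt D"
    "(x, y) \<in> glued E D" "x \<in> glued_points E D"
  shows "y \<in> glued_points E D"
  using assms(4) unfolding glued_rtrancl
  by (cases rule: rtranclE) (use assms glued_edges_points in auto)

text \<open>Each partner map is extended by the identity to the level that its diagram does not
  touch. A glued point is then fixed by one of the two involutions exactly if it lies on an outer
  level, and \<open>involution_pair_orbit\<close> applies. This is what makes the stack of two
  matchings a matching.\<close>

lemma glued_unique_end:
  assumes E: "brauer_diagram E" and D: "brauer_diagram D" and ED: "dsrc E = dtgt D"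
    and x: "x \<in> glued_points E D" "fst x \<noteq> 1"
  shows "\<exists>!y. y \<noteq> x \<and> (x, y) \<in> glued E D \<and> fst y \<noteq> 1"
proof -
  let ?X = "glued_points E D"
  define \<delta> where "\<delta> p = (if fst p = 2 then p else partner D p)" for p :: "nat \<times> nat"
  define \<epsilon> where "\<epsilon> p = (if fst p = 0 then p else lift (partner E (fst p - 1, snd p)))" for p :: "nat \<times> nat"
  have fin: "finite ?X" by (simp add: glued_points_def)
  have XD: "p \<in> ?X \<and> fst p \<noteq> 2 \<longleftrightarrow> p \<in> points (dsrc D) (dtgt D)" for p
    by (auto simp: glued_points_def points_def)
  have XE: "p \<in> ?X \<and> fst p \<noteq> 0 \<longleftrightarrow> (\<exists>q. p = lift q \<and> q \<in> points (dsrc E) (dtgt E))" for p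
    by (cases p; cases "fst p") (auto simp: glued_points_def points_def ED lift_def)
  have \<delta>: "\<delta> p \<in> ?X" "\<delta> (\<delta> p) = p" "\<delta> p = p \<longleftrightarrow> fst p = 2" if p: "p \<in> ?X" for p
  proof -
    show "\<delta> p \<in> ?X" "\<delta> (\<delta> p) = p" "\<delta> p = p \<longleftrightarrow> fst p = 2"
      using p XD[of p] XD[of "partner D p"] partner_props[OF D, of p] by (auto simp: \<delta>_def)
  qed
  have \<epsilon>lift: "\<epsilon> (lift q) = lift (partner E q)" for q by (cases q) (simp add: \<epsilon>_def lift_def)
  have \<epsilon>: "\<epsilon> p \<in> ?X \<and> \<epsilon> (\<epsilon> p) = p \<and> (\<epsilon> p = p \<longleftrightarrow> fst p = 0)" if p: "p \<in> ?X" for p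
  proof (cases "fst p = 0")
    case True
    then show ?thesis using p by (simp add: \<epsilon>_def)
  next
    case False
    then obtain q where q: "p = lift q" "q \<in> points (dsrc E) (dtgt E)" using p XE by blast
    have "lift (partner E q) \<in> ?X" using XE[of "lift (partner E q)"] partner_props[OF E q(2)] by blast
    then show ?thesis
      using False partner_props[OF E q(2)] unfolding q(1) \<epsilon>lift by (auto simp: lift_def prod_eq_iff)
  qed
  \<comment> \<open>A step of \<delta> or \<epsilon> is an edge or stays in place, and every edge is
    such a step; hence \<open>S\<close> and \<open>glued_edges E D\<close> have the same reflexive
    transitive closure.\<close>
  define S where "S = {(a, b). a \<in> ?X \<and> (b = \<delta> a \<or> b = \<epsilon> a)}"
  have "S \<subseteq> (glued_edges E D)\<^sup>=" "glued_edges E D \<subseteq> S"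
  proof -
    show "S \<subseteq> (glued_edges E D)\<^sup>="
    proof
      fix s assume "s \<in> S"
      then obtain a b where s: "s = (a, b)" "a \<in> ?X" "b = \<delta> a \<or> b = \<epsilon> a" by (auto simp: S_def)
      from s(3) have "b = a \<or> (a, b) \<in> glued_edges E D"
      proof
        assume "b = \<delta> a"
        then show ?thesis
          using XD[of a] s(2) partner_arc[OF D, of a] by (auto simp: \<delta>_def glued_edges_def)
      next
        assume b: "b = \<epsilon> a"
        show ?thesis
        proof (cases "fst a = 0")
          case False
          then obtain q where q: "a = lift q" "q \<in> points (dsrc E) (dtgt E)" using s XE by blast
          then have "{q, partner E q} \<in> arcs E" using partner_arc[OF E] by simp
          then show ?thesis using q b \<epsilon>lift
            unfolding glued_edges_def Un_iff mem_Collect_eq case_prod_conv lift_doubleton[OF E] by blast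
        qed (simp add: b \<epsilon>_def)
      qed
      then show "s \<in> (glued_edges E D)\<^sup>=" using s by auto
    qed
    show "glued_edges E D \<subseteq> S"
    proof
      fix s assume s: "s \<in> glued_edges E D"
      obtain a b where ab: "s = (a, b)" by (rule prod.exhaust)
      have aX: "a \<in> ?X" using glued_edges_points[OF E D ED] s ab by blast
      have "{a, b} \<in> arcs D \<or> (\<exists>a' b'. a = lift a' \<and> b = lift b' \<and> {a', b'} \<in> arcs E)"
        using s unfolding ab glued_edges_def Un_iff mem_Collect_eq case_prod_conv lift_doubleton[OF E] .
      then have "b = \<delta> a \<or> b = \<epsilon> a"
      proof
        assume *: "{a, b} \<in> arcs D"
        then have "a \<in> points (dsrc D) (dtgt D)" using brauer_diagram_arc[OF D] by blast
        then show ?thesis using * partner_arc[OF D] XD[of a] by (auto simp: \<delta>_def)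
      next
        assume "\<exists>a' b'. a = lift a' \<and> b = lift b' \<and> {a', b'} \<in> arcs E"
        then obtain a' b' where *: "a = lift a'" "b = lift b'" "{a', b'} \<in> arcs E" by blast
        then have "a' \<in> points (dsrc E) (dtgt E)" using brauer_diagram_arc[OF E] by blast
        then have "b' = partner E a'" using * partner_arc[OF E] by blast
        then show ?thesis using * \<epsilon>lift by simp
      qed
      then show "s \<in> S" using ab aX by (auto simp: S_def)
    qed
  qed
  then have G: "glued E D = S\<^sup>*"
    unfolding glued_rtrancl by (metis rtrancl_mono rtrancl_reflcl subset_antisym)
  have inX: "y \<in> ?X" if "(x, y) \<in> glued E D" for y
    using glued_in_points[OF E D ED that x(1)] .
  have ends: "\<delta> y = y \<or> \<epsilon> y = y \<longleftrightarrow> fst y \<noteq> 1" if "y \<in> ?X" for y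
    using \<delta>(3)[OF that] \<epsilon>[OF that] that by (auto simp: glued_points_def)
  have nofix: "\<not> (\<delta> a = a \<and> \<epsilon> a = a)" if "a \<in> ?X" for a
    using \<delta>(3)[OF that] \<epsilon>[OF that] by auto
  have "\<exists>!y. y \<noteq> x \<and> (x, y) \<in> S\<^sup>* \<and> (\<delta> y = y \<or> \<epsilon> y = y)"
  proof (cases "fst x = 0")
    case True
    show ?thesis unfolding S_def
      by (rule involution_pair_orbit) (use True x fin \<delta> \<epsilon> nofix in auto)
  next
    case False
    then have "fst x = 2" using x by (auto simp: glued_points_def)
    then have fx: "\<delta> x = x" using x \<delta>(3) by simp
    \<comment> \<open>The orbit lemma starts at a fixed point of its second involution. On level 2
      this is \<delta>, so that the two involutions exchange their roles.\<close>
    have "\<exists>!y. y \<noteq> x \<and> (x, y) \<in> {(a, b). a \<in> ?X \<and> (b = \<epsilon> a \<or> b = \<delta> a)}\<^sup>* \<and> (\<epsilon> y = y \<or> \<delta> y = y)"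
      by (rule involution_pair_orbit) (use fx x fin \<delta> \<epsilon> nofix in auto)
    then show ?thesis unfolding S_def by (simp add: disj_commute)
  qed
  moreover have "(x, y) \<in> S\<^sup>* \<and> (\<delta> y = y \<or> \<epsilon> y = y) \<longleftrightarrow> (x, y) \<in> glued E D \<and> fst y \<noteq> 1" for y
    using ends inX unfolding G by blast
  ultimately show ?thesis by simp
qed

lemma dsrc_stack [simp]: "dsrc (stack E D) = dsrc D" and dtgt_stack [simp]: "dtgt (stack E D) = dtgt E"
  by (simp_all add: stack_def)

lemma arcs_stack: "{x, y} \<in> arcs (stack E D) \<longleftrightarrow>
    x \<in> points (dsrc D) (dtgt E) \<and> y \<in> points (dsrc D) (dtgt E) \<and> x \<noteq> y
        \<and> (outer x, outer y) \<in> glued E D"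
  (is "_ \<longleftrightarrow> ?P x y")
proof -
  have "?P x y" if "?P y x" using that glued_sym by blast
  then show ?thesis unfolding stack_def diagram.sel mem_Collect_eq doubleton_eq_iff by blast
qed

lemma outer_points:
  "q \<in> glued_points E D \<and> fst q \<noteq> 1 \<longleftrightarrow> (\<exists>p\<in>points (dsrc D) (dtgt E). q = outer p)"
proof
  assume q: "q \<in> glued_points E D \<and> fst q \<noteq> 1"
  then have "q = outer (fst q div 2, snd q)" "(fst q div 2, snd q) \<in> points (dsrc D) (dtgt E)"
    by (auto simp: glued_points_def points_def)
  then show "\<exists>p\<in>points (dsrc D) (dtgt E). q = outer p" by blast
qed (auto simp: glued_points_def points_def)

lemma outer_inj: "p \<in> points m n \<Longrightarrow> q \<in> points m n \<Longrightarrow> outer p = outer q \<Longrightarrow> p = q"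
  by (auto simp: points_def)

lemma brauer_diagram_stack:
  assumes E: "brauer_diagram E" and D: "brauer_diagram D" and ED: "dsrc E = dtgt D"
  shows "brauer_diagram (stack E D)"
proof (rule brauer_diagramI)
  fix A assume "A \<in> arcs (stack E D)"
  then show "\<exists>x y. A = {x, y} \<and> x \<noteq> y \<and> x \<in> points (dsrc (stack E D)) (dtgt (stack E D))
      \<and> y \<in> points (dsrc (stack E D)) (dtgt (stack E D))"
    by (auto simp: stack_def)
next
  fix x assume "x \<in> points (dsrc (stack E D)) (dtgt (stack E D))"
  then have x: "x \<in> points (dsrc D) (dtgt E)" by simp
  have "outer x \<in> glued_points E D" "fst (outer x) \<noteq> 1" using outer_points[of "outer x"] x by blast+
  then obtain y where y: "y \<noteq> outer x" "(outer x, y) \<in> glued E D" "fst y \<noteq> 1"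
    and uniq: "\<And>z. z \<noteq> outer x \<Longrightarrow> (outer x, z) \<in> glued E D \<Longrightarrow> fst z \<noteq> 1 \<Longrightarrow> z = y"
    using glued_unique_end[OF E D ED, of "outer x"] by blast
  have "y \<in> glued_points E D"
    using glued_in_points[OF E D ED y(2)] \<open>outer x \<in> glued_points E D\<close> .
  then obtain y' where y': "y' \<in> points (dsrc D) (dtgt E)" "y = outer y'"
    using outer_points y(3) by blast
  show "\<exists>!y. {x, y} \<in> arcs (stack E D)"
  proof (rule ex1I)
    show "{x, y'} \<in> arcs (stack E D)" unfolding arcs_stack using x y y' by auto
  next
    fix z assume "{x, z} \<in> arcs (stack E D)"
    then have z: "z \<in> points (dsrc D) (dtgt E)" "x \<noteq> z" "(outer x, outer z) \<in> glued E D"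
      unfolding arcs_stack by auto
    have "outer z \<noteq> outer x" using z x outer_inj by metis
    moreover have "fst (outer z) \<noteq> 1" by simp
    ultimately have "outer z = y" using uniq z(3) by blast
    then show "z = y'" using outer_inj[OF z(1) y'(1)] y'(2) by blast
  qed
qed

section \<open>Colourings of diagrams\<close>

definition words :: "nat \<Rightarrow> nat \<Rightarrow> nat list set" where
  "words N n = {w. length w = n \<and> set w \<subseteq> {..<N}}"

definition colour :: "nat list \<Rightarrow> nat list \<Rightarrow> nat \<times> nat \<Rightarrow> nat" where
  "colour u v p = (if fst p = 0 then u ! snd p else v ! snd p)"

definition monochromatic :: "diagram \<Rightarrow> nat list \<Rightarrow> nat list \<Rightarrow> bool" where
  "monochromatic D u v \<longleftrightarrow> (\<forall>x y. {x, y} \<in> arcs D \<longrightarrow> colour u v x = colour u v y)"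

lemma finite_words [simp]: "finite (words N n)"
proof -
  have "words N n = {w. set w \<subseteq> {..<N} \<and> length w = n}" by (auto simp: words_def)
  then show ?thesis by (simp add: finite_lists_length_eq)
qed

lemma length_words: "w \<in> words N n \<Longrightarrow> length w = n"
  by (simp add: words_def)

lemma nth_words:
  assumes "w \<in> words N n" "i < n"
  shows "w ! i < N"
proof -
  have "w ! i \<in> set w" using assms length_words by (metis nth_mem)
  then show ?thesis using assms(1) by (auto simp: words_def)
qed

lemma wordsI:
  assumes "length w = n" "\<And>i. i < n \<Longrightarrow> w ! i < N"
  shows "w \<in> words N n"
proof -
  have "x < N" if "x \<in> set w" for x
    using that assms unfolding in_set_conv_nth by blast
  then show ?thesis using assms(1) by (auto simp: words_def)
qed

text \<open>A middle word fits both diagrams if and only if the resulting colouring is constant on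
  the classes of \<open>glued E D\<close>. A class that reaches an outer level has its colour forced
  by u or v, while every closed loop may be coloured freely in N ways. This matches the factor t for
  each loop in \<open>bcomp\<close> at t = N.\<close>

lemma card_monochromatic_words:
  assumes E: "brauer_diagram E" and D: "brauer_diagram D" and ED: "dsrc E = dtgt D"
    and u: "u \<in> words N (dsrc D)" and v: "v \<in> words N (dtgt E)"
  shows "card {w \<in> words N (dtgt D). monochromatic D u w \<and> monochromatic E w v} =
    (if monochromatic (stack E D) u v then N ^ loops E D else 0)"
proof -
  let ?G = "glued E D"
  let ?C = "\<lambda>j. ?G `` {(1, j)}"
  let ?M = "{1} \<times> {..<dtgt D} :: (nat \<times> nat) set"
  define tc where "tc w p = (if fst p = 0 then u ! snd p else if fst p = 1 then w ! snd p else v ! snd p)"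
    for w :: "nat list" and p :: "nat \<times> nat"
  define L where "L = {C. \<exists>j < dtgt D. C = ?C j \<and> C \<subseteq> ?M}"
  define W where "W = {w \<in> words N (dtgt D). monochromatic D u w \<and> monochromatic E w v}"
  have L_sub: "C \<subseteq> ?M" if "C \<in> L" for C
    using that by (auto simp: L_def)
  have monochromatic_iff: "monochromatic D u w \<and> monochromatic E w v \<longleftrightarrow> (\<forall>a b. (a, b) \<in> ?G \<longrightarrow> tc w a = tc w b)" for w
  proof -
    have 1: "colour u w x = tc w x" if "x \<in> points (dsrc D) (dtgt D)" for x
      using that by (auto simp: colour_def tc_def points_def)
    have 2: "colour w v x = tc w (lift x)" if "x \<in> points (dsrc E) (dtgt E)" for x
      using that by (auto simp: colour_def tc_def points_def lift_def)
    have "monochromatic D u w \<and> monochromatic E w v \<longleftrightarrow> (\<forall>a b. (a, b) \<in> glued_edges E D \<longrightarrow> tc w a = tc w b)"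
      unfolding monochromatic_def glued_edges_def Un_iff mem_Collect_eq case_prod_conv lift_doubleton[OF E]
      using 1 2 brauer_diagram_arc[OF D] brauer_diagram_arc[OF E] by metis
    also have "\<dots> \<longleftrightarrow> (\<forall>a b. (a, b) \<in> ?G \<longrightarrow> tc w a = tc w b)"
    proof
      assume *: "\<forall>a b. (a, b) \<in> glued_edges E D \<longrightarrow> tc w a = tc w b"
      have "tc w a = tc w b" if "(a, b) \<in> ?G" for a b
        using that unfolding glued_rtrancl by (induction rule: rtrancl_induct) (use * in auto)
      then show "\<forall>a b. (a, b) \<in> ?G \<longrightarrow> tc w a = tc w b" by blast
    qed (simp add: glued_rtrancl r_into_rtrancl)
    finally show ?thesis .
  qed
  have tc_outer: "tc w (outer p) = colour u v p" if "p \<in> points (dsrc D) (dtgt E)" for p w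
    using that by (auto simp: tc_def colour_def points_def)
  show ?thesis
  proof (cases "monochromatic (stack E D) u v")
    case False
    then obtain x y where xy: "{x, y} \<in> arcs (stack E D)" "colour u v x \<noteq> colour u v y"
      by (auto simp: monochromatic_def)
    then have "W = {}"
      using monochromatic_iff tc_outer unfolding W_def arcs_stack by fastforce
    then show ?thesis using False by (simp add: W_def)
  next
    case True
    define bc where "bc p = (if fst p = 0 then u ! snd p else v ! snd p)" for p :: "nat \<times> nat"
    have tcbc: "fst p \<noteq> 1 \<Longrightarrow> tc w p = bc p" for w p by (simp add: tc_def bc_def)
    have bc: "bc p = bc q" if pq: "p \<in> glued_points E D" "q \<in> glued_points E D" "fst p \<noteq> 1" "fst q \<noteq> 1"
      "(p, q) \<in> ?G" for p q
    proof -
      obtain p' where p': "p' \<in> points (dsrc D) (dtgt E)" "p = outer p'"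
        using pq(1,3) outer_points[of p E D] by blast
      obtain q' where q': "q' \<in> points (dsrc D) (dtgt E)" "q = outer q'"
        using pq(2,4) outer_points[of q E D] by blast
      have "colour u v p' = colour u v q'"
      proof (cases "p' = q'")
        case False
        then have "{p', q'} \<in> arcs (stack E D)" 
          unfolding arcs_stack using p' q' pq(5) by (intro conjI) simp_all
        then show ?thesis using True unfolding monochromatic_def by blast
      qed simp
      then show ?thesis using p' q' by (auto simp: bc_def colour_def)
    qed
    have bcN: "bc p < N" if "p \<in> glued_points E D" "fst p \<noteq> 1" for p
      using that nth_words[OF u] nth_words[OF v] by (auto simp: bc_def glued_points_def)
    have C_points: "?C j \<subseteq> glued_points E D" if "j < dtgt D" for j
      using glued_in_points[OF E D ED] that by (auto simp: glued_points_def)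
    have C_end: "\<exists>p. p \<in> ?C j \<and> fst p \<noteq> 1" if "j < dtgt D" "?C j \<notin> L" for j
      using C_points that by (fastforce simp: L_def glued_points_def)
    \<comment> \<open>An outer point of the class of the middle point j; its colour is prescribed by
      u and v.\<close>
    define e where "e j = (SOME p. p \<in> ?C j \<and> fst p \<noteq> 1)" for j
    have e: "e j \<in> ?C j" "fst (e j) \<noteq> 1" "e j \<in> glued_points E D" if "j < dtgt D" "?C j \<notin> L" for j
      using someI_ex[OF C_end[OF that]] C_points[OF that(1)] unfolding e_def by blast+
    \<comment> \<open>Fitting words correspond to colourings of the loops: \<open>f\<close> reads
      off the colour at a chosen point of each loop, and \<open>g\<close> fills in the forced
      colours on all other classes.\<close>
    define f where "f w = (\<lambda>C\<in>L. w ! snd (SOME p. p \<in> C))" for w :: "nat list"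
    define g where "g \<phi> = map (\<lambda>j. if ?C j \<in> L then \<phi> (?C j) else bc (e j)) [0..<dtgt D]" for \<phi>
    have some: "\<exists>i<dtgt D. (SOME p. p \<in> ?C j) = (1, i) \<and> ((1, j), (1, i)) \<in> ?G" if "?C j \<in> L" for j
    proof -
      have "(SOME p. p \<in> ?C j) \<in> ?C j" by (rule someI[of _ "(1, j)"]) simp
      moreover have "?C j \<subseteq> ?M" using that by (auto simp: L_def)
      ultimately show ?thesis by (cases "SOME p. p \<in> ?C j") auto
    qed
    have "bij_betw f W (L \<rightarrow>\<^sub>E {..<N})"
    proof (rule bij_betw_byWitness[of _ g])
      show "\<forall>w\<in>W. g (f w) = w"
      proof
        fix w assume w: "w \<in> W"
        then have len: "length w = dtgt D" and tcw: "\<And>a b. (a, b) \<in> ?G \<Longrightarrow> tc w a = tc w b"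
          using monochromatic_iff by (auto simp: W_def length_words)
        show "g (f w) = w"
        proof (rule nth_equalityI)
          fix j assume "j < length (g (f w))"
          then have j: "j < dtgt D" by (simp add: g_def)
          show "g (f w) ! j = w ! j"
          proof (cases "?C j \<in> L")
            case True
            then obtain i where i: "(SOME p. p \<in> ?C j) = (1, i)" "((1, j), (1, i)) \<in> ?G"
              using some by blast
            show ?thesis using True j i tcw[OF i(2)] by (simp add: g_def f_def tc_def)
          next
            case False
            have "bc (e j) = tc w (e j)" using tcbc e False j by simp
            also have "\<dots> = tc w (1, j)" using tcw e(1)[OF j False] by auto
            finally show ?thesis using False j by (simp add: g_def tc_def)
          qed
        qed (simp add: g_def len)
      qed
      show "\<forall>\<phi>\<in>L \<rightarrow>\<^sub>E {..<N}. f (g \<phi>) = \<phi>"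
      proof
        fix \<phi> assume \<phi>: "\<phi> \<in> L \<rightarrow>\<^sub>E {..<N}"
        show "f (g \<phi>) = \<phi>"
        proof
          fix C
          show "f (g \<phi>) C = \<phi> C"
          proof (cases "C \<in> L")
            case True
            then obtain j where j: "j < dtgt D" "C = ?C j" by (auto simp: L_def)
            then obtain i where i: "i < dtgt D" "(SOME p. p \<in> C) = (1, i)" "((1, j), (1, i)) \<in> ?G"
              using some True by blast
            have "?C i = C" using glued_class_eq[OF i(3)] j by simp
            then show ?thesis using True i by (simp add: f_def g_def)
          next
            case False
            then show ?thesis using PiE_arb[OF \<phi> False] by (simp add: f_def)
          qed
        qed
      qed
      show "f ` W \<subseteq> L \<rightarrow>\<^sub>E {..<N}"
      proof
        fix \<phi> assume "\<phi> \<in> f ` W"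
        then obtain w where w: "w \<in> W" "\<phi> = f w" by blast
        have "w ! snd (SOME p. p \<in> C) < N" if C: "C \<in> L" for C
        proof -
          obtain j where j: "C = ?C j" using C by (auto simp: L_def)
          then obtain i where "i < dtgt D" "(SOME p. p \<in> C) = (1, i)" using some C by blast
          then show ?thesis using w nth_words[of w N] by (auto simp: W_def)
        qed
        then show "\<phi> \<in> L \<rightarrow>\<^sub>E {..<N}" using w by (auto simp: f_def)
      qed
      show "g ` (L \<rightarrow>\<^sub>E {..<N}) \<subseteq> W"
      proof
        fix w assume "w \<in> g ` (L \<rightarrow>\<^sub>E {..<N})"
        then obtain \<phi> where \<phi>: "\<phi> \<in> L \<rightarrow>\<^sub>E {..<N}" "w = g \<phi>" by blast
        have "w ! j < N" if j: "j < dtgt D" for j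
        proof (cases "?C j \<in> L")
          case True
          then have "\<phi> (?C j) < N" using PiE_mem[OF \<phi>(1)] by blast
          then show ?thesis using True j \<phi>(2) by (simp add: g_def)
        next
          case False
          then show ?thesis using bcN[OF e(3,2)[OF j False]] j \<phi>(2) by (simp add: g_def)
        qed
        moreover have "length w = dtgt D" using \<phi>(2) by (simp add: g_def)
        ultimately have "w \<in> words N (dtgt D)" by (rule wordsI[rotated])
        moreover have "tc w a = tc w b" if ab: "(a, b) \<in> ?G" for a b
        proof (cases "a \<in> glued_points E D")
          case False
          have "b = a"
            using ab unfolding glued_rtrancl
            by (cases rule: converse_rtranclE) (use False glued_edges_points(1)[OF E D ED] in blast)+
          then show ?thesis by simp
        next
          case True
          then have bX: "b \<in> glued_points E D" using glued_in_points[OF E D ED ab] by simp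
          \<comment> \<open>A colour computed from a class alone. Once the colour of every point is
            seen to be that of its class, glued points have equal colours.\<close>
          define cc where "cc C = (if C \<in> L then \<phi> C else bc (SOME p. p \<in> C \<and> fst p \<noteq> 1))" for C
          have "tc w p = cc (?G `` {p})" if p: "p \<in> glued_points E D" for p
          proof (cases "fst p = 1")
            case True
            then obtain j where "p = (1, j)" "j < dtgt D" using p by (auto simp: glued_points_def)
            then show ?thesis using \<phi> by (simp add: tc_def cc_def g_def e_def)
          next
            case False
            let ?q = "SOME q. q \<in> ?G `` {p} \<and> fst q \<noteq> 1"
            have q: "?q \<in> ?G `` {p} \<and> fst ?q \<noteq> 1" by (rule someI[of _ p]) (use False in simp)
            then have "?q \<in> glued_points E D" using glued_in_points[OF E D ED _ p] by blast
            then have "bc ?q = bc p" using bc[of p ?q] p False q by auto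
            moreover have "cc (?G `` {p}) = bc ?q"
            proof -
              have "p \<in> ?G `` {p}" by simp
              have "?G `` {p} \<notin> L"
              proof
                assume "?G `` {p} \<in> L"
                then have "p \<in> ?M" using L_sub \<open>p \<in> ?G `` {p}\<close> by blast
                then show False using False by (simp add: mem_Times_iff)
              qed
              then show ?thesis unfolding cc_def by (rule if_not_P)
            qed
            ultimately show ?thesis using tcbc[OF False] by metis
          qed
          then show ?thesis using True bX glued_class_eq[OF ab] by simp
        qed
        ultimately show "w \<in> W" using monochromatic_iff unfolding W_def by blast
      qed
    qed
    then have "card W = card (L \<rightarrow>\<^sub>E {..<N})" by (rule bij_betw_same_card)
    also have "\<dots> = N ^ card L" by (subst card_PiE) (auto simp: L_def)
    finally show ?thesis using True by (simp add: W_def loops_def L_def)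
  qed
qed

declare sum_mult_of_bool_eq [simp del] sum_of_bool_mult_eq [simp del]

section \<open>Linear combinations of diagrams\<close>

definition diagrams :: "nat \<Rightarrow> nat \<Rightarrow> diagram set" where
  "diagrams m n = {D. brauer_diagram D \<and> dsrc D = m \<and> dtgt D = n}"

lemma finite_diagrams [simp]: "finite (diagrams m n)"
proof (rule finite_subset)
  show "diagrams m n \<subseteq> Diagram m n ` Pow (Pow (points m n))"
  proof
    fix D assume D: "D \<in> diagrams m n"
    then have "arcs D \<subseteq> Pow (points m n)"
      by (auto simp: diagrams_def brauer_diagram_def partition_on_def)
    moreover have "D = Diagram m n (arcs D)" using D by (cases D) (simp add: diagrams_def)
    ultimately show "D \<in> Diagram m n ` Pow (Pow (points m n))" by blast
  qed
qed simp

lemma bhom_iff: "f \<in> bhom m n \<longleftrightarrow> Poly_Mapping.keys f \<subseteq> diagrams m n"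
  by (auto simp: bhom_def diagrams_def)

lemma lookup_bscale [simp]: "Poly_Mapping.lookup (c \<cdot>\<^sub>B f) D = c * Poly_Mapping.lookup f D"
  by (auto simp: bscale_def Poly_Mapping.map.rep_eq when_def)

lemma bscale_simps [simp]:
  "0 \<cdot>\<^sub>B f = 0" "1 \<cdot>\<^sub>B f = f" "c \<cdot>\<^sub>B (0 :: morphism) = 0" "c \<cdot>\<^sub>B d \<cdot>\<^sub>B f = (c * d) \<cdot>\<^sub>B f"
  by (auto intro!: poly_mapping_eqI)

lemma bscale_left_distrib: "(c + d) \<cdot>\<^sub>B f = c \<cdot>\<^sub>B f + d \<cdot>\<^sub>B f"
  and bscale_minus_left: "(- c) \<cdot>\<^sub>B f = - (c \<cdot>\<^sub>B f)"
  and bscale_diff_left: "(c - d) \<cdot>\<^sub>B f = c \<cdot>\<^sub>B f - d \<cdot>\<^sub>B f"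
  by (auto intro!: poly_mapping_eqI simp: lookup_add lookup_minus algebra_simps)

lemma bscale_sum_right: "c \<cdot>\<^sub>B sum f A = (\<Sum>a\<in>A. c \<cdot>\<^sub>B f a)"
  by (rule poly_mapping_eqI) (simp add: lookup_sum sum_distrib_left)

lemma bhom_lookup: "f \<in> bhom m n \<longleftrightarrow> (\<forall>D. D \<notin> diagrams m n \<longrightarrow> Poly_Mapping.lookup f D = 0)"
  unfolding bhom_iff by (auto simp: in_keys_iff subset_iff)

lemma bhom_0 [simp, intro]: "0 \<in> bhom m n"
  and bhom_add [intro]: "f \<in> bhom m n \<Longrightarrow> g \<in> bhom m n \<Longrightarrow> f + g \<in> bhom m n"
  and bhom_diff [intro]: "f \<in> bhom m n \<Longrightarrow> g \<in> bhom m n \<Longrightarrow> f - g \<in> bhom m n"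
  and bhom_bscale [intro]: "f \<in> bhom m n \<Longrightarrow> c \<cdot>\<^sub>B f \<in> bhom m n"
  by (auto simp: bhom_lookup lookup_add lookup_minus)

lemma bhom_sum [intro]: "(\<And>a. a \<in> A \<Longrightarrow> f a \<in> bhom m n) \<Longrightarrow> sum f A \<in> bhom m n"
  by (auto simp: bhom_lookup lookup_sum intro!: sum.neutral)

lemma bhom_single [intro]: "D \<in> diagrams m n \<Longrightarrow> Poly_Mapping.single D c \<in> bhom m n"
  by (auto simp: bhom_lookup lookup_single when_def)

lemma stack_diagrams: "E \<in> diagrams m n \<Longrightarrow> D \<in> diagrams l m \<Longrightarrow> stack E D \<in> diagrams l n"
  by (auto simp: diagrams_def intro!: brauer_diagram_stack)

text \<open>Summing over all diagrams instead of the supports makes the ranges independent of the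
  morphisms, so that bilinearity and polynomial dependence on t can be read off. The test
  \<open>dsrc E = dtgt D\<close> disappears.\<close>

lemma bcomp_eq:
  assumes "f \<in> bhom l m" "g \<in> bhom m n"
  shows "g \<odot>\<^bsub>t\<^esub> f = (\<Sum>E\<in>diagrams m n. \<Sum>D\<in>diagrams l m. Poly_Mapping.single (stack E D)
    (Poly_Mapping.lookup g E * Poly_Mapping.lookup f D * t ^ loops E D))"
proof -
  have "g \<odot>\<^bsub>t\<^esub> f = (\<Sum>E\<in>Poly_Mapping.keys g. \<Sum>D\<in>Poly_Mapping.keys f. Poly_Mapping.single (stack E D)
    (Poly_Mapping.lookup g E * Poly_Mapping.lookup f D * t ^ loops E D))"
    unfolding bcomp_def by (intro sum.cong refl) (use assms in \<open>auto simp: bhom_iff diagrams_def\<close>)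
  also have "\<dots> = (\<Sum>E\<in>Poly_Mapping.keys g. \<Sum>D\<in>diagrams l m. Poly_Mapping.single (stack E D)
    (Poly_Mapping.lookup g E * Poly_Mapping.lookup f D * t ^ loops E D))"
    by (intro sum.cong refl sum.mono_neutral_left) (use assms in \<open>auto simp: bhom_iff in_keys_iff\<close>)
  also have "\<dots> = (\<Sum>E\<in>diagrams m n. \<Sum>D\<in>diagrams l m. Poly_Mapping.single (stack E D)
    (Poly_Mapping.lookup g E * Poly_Mapping.lookup f D * t ^ loops E D))"
    by (intro sum.mono_neutral_left) (use assms in \<open>auto simp: bhom_iff in_keys_iff\<close>)
  finally show ?thesis .
qed

lemma btensor_eq:
  assumes "f \<in> bhom m n" "g \<in> bhom p q"
  shows "f \<otimes>\<^sub>B g = (\<Sum>D\<in>diagrams m n. \<Sum>E\<in>diagrams p q. Poly_Mapping.single (juxtapose D E)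
    (Poly_Mapping.lookup f D * Poly_Mapping.lookup g E))"
proof -
  have "f \<otimes>\<^sub>B g = (\<Sum>D\<in>Poly_Mapping.keys f. \<Sum>E\<in>diagrams p q. Poly_Mapping.single (juxtapose D E)
    (Poly_Mapping.lookup f D * Poly_Mapping.lookup g E))"
    unfolding btensor_def
    by (intro sum.cong refl sum.mono_neutral_left) (use assms in \<open>auto simp: bhom_iff in_keys_iff\<close>)
  also have "\<dots> = (\<Sum>D\<in>diagrams m n. \<Sum>E\<in>diagrams p q. Poly_Mapping.single (juxtapose D E)
    (Poly_Mapping.lookup f D * Poly_Mapping.lookup g E))"
    by (intro sum.mono_neutral_left) (use assms in \<open>auto simp: bhom_iff in_keys_iff\<close>)
  finally show ?thesis .
qed

lemma bhom_bcomp [intro]: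
  "f \<in> bhom l m \<Longrightarrow> g \<in> bhom m n \<Longrightarrow> g \<odot>\<^bsub>t\<^esub> f \<in> bhom l n"
  by (subst bcomp_eq) (auto intro: stack_diagrams)

section \<open>Relabelled and juxtaposed diagrams\<close>

definition relabel :: "(nat \<times> nat \<Rightarrow> nat \<times> nat) \<Rightarrow> diagram \<Rightarrow> nat \<Rightarrow> nat \<Rightarrow> diagram" where
  "relabel h D m n = Diagram m n ((`) h ` arcs D)"

lemma arcs_subset_points: "brauer_diagram D \<Longrightarrow> A \<in> arcs D \<Longrightarrow> A \<subseteq> points (dsrc D) (dtgt D)"
  by (auto simp: brauer_diagram_def partition_on_def)

lemma partition_on_image:
  assumes "partition_on A P" "inj_on h A"
  shows "partition_on (h ` A) ((`) h ` P)"
proof -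
  have "{} \<notin> (`) h ` P" using partition_onD3[OF assms(1)] by auto
  then show ?thesis using partition_on_inj_image[OF assms] by simp
qed

lemma card_arc_image:
  assumes "brauer_diagram D" "inj_on h (points (dsrc D) (dtgt D))" "A \<in> arcs D"
  shows "card (h ` A) = 2"
proof -
  have "inj_on h A" by (rule inj_on_subset[OF assms(2) arcs_subset_points[OF assms(1,3)]])
  then show ?thesis using assms by (simp add: card_image brauer_diagram_def)
qed

lemma relabel_diagrams:
  assumes "D \<in> diagrams m n" "bij_betw h (points m n) (points m n)"
  shows "relabel h D m n \<in> diagrams m n"
  using assms partition_on_image[of "points m n" "arcs D" h] card_arc_image[of D h]
  unfolding diagrams_def brauer_diagram_def relabel_def bij_betw_def by auto

lemma juxtapose_diagrams:
  assumes "D \<in> diagrams m n" "E \<in> diagrams p q"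
  shows "juxtapose D E \<in> diagrams (m + p) (n + q)"
proof -
  define h where "h = (\<lambda>(l, i). (l, (if l = 0 then m else n) + i) :: nat \<times> nat)"
  have D: "brauer_diagram D" "dsrc D = m" "dtgt D = n" and E: "brauer_diagram E" "dsrc E = p" "dtgt E = q"
    using assms by (auto simp: diagrams_def)
  have inj: "inj_on h (points p q)" by (auto simp: inj_on_def h_def split: if_splits)
  have "partition_on (points m n \<union> h ` points p q) (arcs D \<union> (`) h ` arcs E)"
  proof -
    have disj: "points m n \<inter> h ` points p q = {}"
      by (auto simp: points_def h_def)
    have P: "partition_on (points m n) (arcs D)" using D by (simp add: brauer_diagram_def)
    have Q: "partition_on (h ` points p q) ((`) h ` arcs E)"
      using E inj by (intro partition_on_image) (auto simp: brauer_diagram_def)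
    have "disjnt A B" if "A \<in> arcs D \<union> (`) h ` arcs E" "B \<in> arcs D \<union> (`) h ` arcs E" "A \<noteq> B" for A B
    proof -
      have sub: "C \<in> arcs D \<Longrightarrow> C \<subseteq> points m n" "C \<in> (`) h ` arcs E \<Longrightarrow> C \<subseteq> h ` points p q" for C
        using partition_onD1[OF P] partition_onD1[OF Q] by auto
      from that(1,2) show ?thesis
      proof (elim UnE)
        assume "A \<in> arcs D" "B \<in> arcs D"
        then show ?thesis using disjointD[OF partition_onD2[OF P]] that(3) by (simp add: disjnt_def)
      next
        assume "A \<in> (`) h ` arcs E" "B \<in> (`) h ` arcs E"
        then show ?thesis using disjointD[OF partition_onD2[OF Q]] that(3) by (simp add: disjnt_def)
      qed (use sub disj in \<open>unfold disjnt_def, blast+\<close>)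
    qed
    then show ?thesis
      using partition_onD1[OF P] partition_onD1[OF Q] partition_onD3[OF P] partition_onD3[OF Q]
      unfolding partition_on_def disjoint_def disjnt_def by auto
  qed
  moreover have "points m n \<union> h ` points p q = points (m + p) (n + q)"
  proof -
    have "{m..<m + p} = (+) m ` {..<p}" "{n..<n + q} = (+) n ` {..<q}"
      by (simp_all add: lessThan_atLeast0 image_add_atLeastLessThan add.commute)
    moreover have "{..<m + p} = {..<m} \<union> {m..<m + p}" "{..<n + q} = {..<n} \<union> {n..<n + q}" by auto
    moreover have "h ` points p q = {0} \<times> (+) m ` {..<p} \<union> {1} \<times> (+) n ` {..<q}"
      by (force simp: points_def h_def)
    ultimately show ?thesis by (auto simp: points_def)
  qed
  moreover have "card A = 2" if "A \<in> arcs D \<union> (`) h ` arcs E" for A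
    using that card_arc_image[of E h] D E inj by (auto simp: brauer_diagram_def)
  moreover have "juxtapose D E = Diagram (m + p) (n + q) (arcs D \<union> (`) h ` arcs E)"
    unfolding juxtapose_def h_def D E ..
  ultimately show ?thesis
    by (auto simp: diagrams_def brauer_diagram_def)
qed

lemma bhom_btensor [intro]:
  "f \<in> bhom m n \<Longrightarrow> g \<in> bhom p q \<Longrightarrow> f \<otimes>\<^sub>B g \<in> bhom (m + p) (n + q)"
  by (subst btensor_eq) (auto intro: juxtapose_diagrams)

lemma perm_diagram: "\<sigma> permutes {..<n} \<Longrightarrow> Diagram n n {{(0, i), (1, \<sigma> i)} | i. i < n} \<in> diagrams n n"
proof -
  assume \<sigma>: "\<sigma> permutes {..<n}"
  have in_range: "\<sigma> i < n \<longleftrightarrow> i < n" for i using permutes_in_image[OF \<sigma>, of i] by simp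
  have inj: "\<sigma> i = \<sigma> j \<longleftrightarrow> i = j" for i j using permutes_inj[OF \<sigma>] by (auto dest: injD)
  have "brauer_diagram (Diagram n n {{(0, i), (1, \<sigma> i)} | i. i < n})"
  proof (rule brauer_diagramI, goal_cases)
    case (1 A)
    then obtain i where i: "A = {(0, i), (1, \<sigma> i)}" "i < n" by auto
    show ?case
      by (rule exI[of _ "(0, i)"], rule exI[of _ "(1, \<sigma> i)"]) (use i in \<open>simp add: points_def in_range\<close>)
  next
    case (2 x)
    then consider i where "x = (0, i)" "i < n" | i where "x = (1, i)" "i < n"
      by (auto simp: points_def)
    then show ?case
    proof cases
      case 1
      then show ?thesis by (intro ex1I[of _ "(1, \<sigma> i)"]) (auto simp: doubleton_eq_iff)
    next
      case 2
      define j where "j = inv \<sigma> i"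
      have j: "\<sigma> j = i" using permutes_inverses[OF \<sigma>] by (simp add: j_def)
      then have "j < n" using in_range 2 by metis
      then show ?thesis using 2 j by (intro ex1I[of _ "(0, j)"]) (auto simp: doubleton_eq_iff inj)
    qed
  qed
  then show ?thesis by (simp add: diagrams_def)
qed

lemma bhom_bperm [intro]: "\<sigma> permutes {..<n} \<Longrightarrow> bperm n \<sigma> \<in> bhom n n"
  unfolding bperm_def by (intro bhom_single perm_diagram)

lemma bhom_bid [intro]: "bid n \<in> bhom n n"
  unfolding bid_def by (intro bhom_bperm permutes_id)

lemma bhom_bev [intro]: "bev \<in> bhom 2 0"
  unfolding bev_def diagrams_def
  by (intro bhom_single)
    (auto simp: diagrams_def brauer_diagram_def points_def partition_on_def disjoint_def less_2_cases_iff)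

lemma bhom_bcoev [intro]: "bcoev \<in> bhom 0 2"
  unfolding bcoev_def diagrams_def
  by (intro bhom_single)
    (auto simp: diagrams_def brauer_diagram_def points_def partition_on_def disjoint_def less_2_cases_iff)

section \<open>Evaluation on words\<close>

text \<open>The matrix coefficient of \<open>f\<close> under the functor that sends the generator to
  the N-dimensional space with its standard symmetric form; \<open>u\<close> indexes the input and
  \<open>v\<close> the output.\<close>

definition entry :: "morphism \<Rightarrow> nat list \<Rightarrow> nat list \<Rightarrow> complex" where
  "entry f u v = (\<Sum>D\<in>Poly_Mapping.keys f. Poly_Mapping.lookup f D * of_bool (monochromatic D u v))"

lemma entry_eq_sum:
  assumes "finite S" "Poly_Mapping.keys f \<subseteq> S"
  shows "entry f u v = (\<Sum>D\<in>S. Poly_Mapping.lookup f D * of_bool (monochromatic D u v))"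
  unfolding entry_def using assms by (intro sum.mono_neutral_left) (auto simp: in_keys_iff)

lemma entry_0 [simp]: "entry 0 u v = 0"
  by (simp add: entry_def)

lemma entry_single [simp]: "entry (Poly_Mapping.single D c) u v = c * of_bool (monochromatic D u v)"
  by (subst entry_eq_sum[of "{D}"]) auto

lemma entry_add [simp]: "entry (f + g) u v = entry f u v + entry g u v"
proof -
  let ?S = "Poly_Mapping.keys f \<union> Poly_Mapping.keys g"
  have "Poly_Mapping.keys (f + g) \<subseteq> ?S" by (rule Poly_Mapping.keys_add)
  then show ?thesis
    using entry_eq_sum[of ?S f] entry_eq_sum[of ?S g] entry_eq_sum[of ?S "f + g"]
    by (simp add: lookup_add sum.distrib algebra_simps)
qed

lemma entry_bscale [simp]: "entry (c \<cdot>\<^sub>B f) u v = c * entry f u v"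
proof -
  have "Poly_Mapping.keys (c \<cdot>\<^sub>B f) \<subseteq> Poly_Mapping.keys f" by (auto simp: in_keys_iff)
  then show ?thesis
    using entry_eq_sum[of "Poly_Mapping.keys f" f] entry_eq_sum[of "Poly_Mapping.keys f" "c \<cdot>\<^sub>B f"]
    by (simp add: sum_distrib_left algebra_simps)
qed

lemma entry_uminus [simp]: "entry (- f) u v = - entry f u v"
  using entry_bscale[of "- 1" f u v] by (simp add: bscale_minus_left)

lemma entry_diff [simp]: "entry (f - g) u v = entry f u v - entry g u v"
  using entry_add[of f "- g" u v] by simp

lemma entry_sum [simp]: "entry (sum f A) u v = (\<Sum>a\<in>A. entry (f a) u v)"
  by (induction A rule: infinite_finite_induct) auto

text \<open>Functoriality, valid at t = N because \<open>card_monochromatic_words\<close> turns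
  every loop into a factor N.\<close>

lemma entry_bcomp:
  assumes f: "f \<in> bhom l m" and g: "g \<in> bhom m n"
    and u: "u \<in> words N l" and v: "v \<in> words N n"
  shows "entry (g \<odot>\<^bsub>of_nat N\<^esub> f) u v = (\<Sum>w\<in>words N m. entry f u w * entry g w v)"
proof -
  let ?f = "Poly_Mapping.lookup f" and ?g = "Poly_Mapping.lookup g"
  have count: "(\<Sum>w\<in>words N m. of_bool (monochromatic D u w) * of_bool (monochromatic E w v)) =
      of_nat N ^ loops E D * (of_bool (monochromatic (stack E D) u v) :: complex)"
    if "E \<in> diagrams m n" "D \<in> diagrams l m" for E D
  proof -
    have "(\<Sum>w\<in>words N m. of_bool (monochromatic D u w) * of_bool (monochromatic E w v) :: complex) =
        of_nat (card {w \<in> words N m. monochromatic D u w \<and> monochromatic E w v})"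
      by (simp add: of_bool_conj[symmetric] Int_def)
    also have "\<dots> = of_nat (if monochromatic (stack E D) u v then N ^ loops E D else 0)"
      using card_monochromatic_words[of E D u N v] that u v by (simp add: diagrams_def)
    finally show ?thesis by simp
  qed
  have "entry (g \<odot>\<^bsub>of_nat N\<^esub> f) u v = (\<Sum>E\<in>diagrams m n. \<Sum>D\<in>diagrams l m.
      ?g E * ?f D * of_nat N ^ loops E D * of_bool (monochromatic (stack E D) u v))"
    unfolding bcomp_eq[OF f g] by (simp add: mult.assoc)
  also have "\<dots> = (\<Sum>E\<in>diagrams m n. \<Sum>D\<in>diagrams l m. \<Sum>w\<in>words N m.
      ?g E * ?f D * (of_bool (monochromatic D u w) * of_bool (monochromatic E w v)))"
    by (intro sum.cong refl) (simp add: count sum_distrib_left[symmetric] mult.assoc)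
  also have "\<dots> = (\<Sum>w\<in>words N m. \<Sum>E\<in>diagrams m n. \<Sum>D\<in>diagrams l m.
      ?g E * ?f D * (of_bool (monochromatic D u w) * of_bool (monochromatic E w v)))"
    by (subst (2) sum.swap, subst sum.swap) (rule refl)
  also have "\<dots> = (\<Sum>w\<in>words N m. entry f u w * entry g w v)"
  proof (intro sum.cong refl)
    fix w
    have "entry f u w * entry g w v = (\<Sum>D\<in>diagrams l m. ?f D * of_bool (monochromatic D u w)) *
        (\<Sum>E\<in>diagrams m n. ?g E * of_bool (monochromatic E w v))"
      using f g by (simp add: entry_eq_sum[of "diagrams l m"] entry_eq_sum[of "diagrams m n"] bhom_iff)
    then show "(\<Sum>E\<in>diagrams m n. \<Sum>D\<in>diagrams l m.
      ?g E * ?f D * (of_bool (monochromatic D u w) * of_bool (monochromatic E w v))) = entry f u w * entry g w v"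
      by (simp add: sum_product algebra_simps sum.swap[of _ "diagrams l m"])
  qed
  finally show ?thesis .
qed

lemma monochromatic_relabel:
  assumes "brauer_diagram D"
    and "\<And>p. p \<in> points (dsrc D) (dtgt D) \<Longrightarrow> colour u' v' p = colour u v (h p)"
  shows "monochromatic (relabel h D m n) u v \<longleftrightarrow> monochromatic D u' v'"
proof -
  have "monochromatic (relabel h D m n) u v \<longleftrightarrow>
      (\<forall>x y. {x, y} \<in> arcs D \<longrightarrow> colour u v (h x) = colour u v (h y))"
  proof -
    have "(\<exists>A\<in>arcs D. {x, y} = h ` A) \<longleftrightarrow> (\<exists>x' y'. {x', y'} \<in> arcs D \<and> x = h x' \<and> y = h y')" for x y
    proof
      assume "\<exists>A\<in>arcs D. {x, y} = h ` A"
      then obtain A where A: "A \<in> arcs D" "{x, y} = h ` A" by blast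
      obtain p q where "A = {p, q}"
        using assms(1) A(1) by (fastforce simp: brauer_diagram_def card_2_iff)
      then show "\<exists>x' y'. {x', y'} \<in> arcs D \<and> x = h x' \<and> y = h y'"
      proof -
        have "x = h p \<and> y = h q \<or> x = h q \<and> y = h p"
          using A(2) \<open>A = {p, q}\<close> by (auto simp: doubleton_eq_iff)
        moreover have "{p, q} \<in> arcs D" "{q, p} \<in> arcs D"
          using A(1) \<open>A = {p, q}\<close> by (simp_all add: insert_commute)
        ultimately show ?thesis by blast
      qed
    next
      assume "\<exists>x' y'. {x', y'} \<in> arcs D \<and> x = h x' \<and> y = h y'"
      then obtain x' y' where "{x', y'} \<in> arcs D" "x = h x'" "y = h y'" by blast
      then show "\<exists>A\<in>arcs D. {x, y} = h ` A" by (intro bexI[of _ "{x', y'}"]) auto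
    qed
    then have *: "{x, y} \<in> arcs (relabel h D m n) \<longleftrightarrow> (\<exists>x' y'. {x', y'} \<in> arcs D \<and> x = h x' \<and> y = h y')" for x y
      
      by (simp add: relabel_def image_iff)
    show ?thesis unfolding monochromatic_def * by blast
  qed
  also have "\<dots> \<longleftrightarrow> monochromatic D u' v'"
  proof -
    have "colour u v (h x) = colour u' v' x \<and> colour u v (h y) = colour u' v' y" if "{x, y} \<in> arcs D" for x y
      using brauer_diagram_arc[OF assms(1) that] assms(2) by simp
    then show ?thesis unfolding monochromatic_def by auto
  qed
  finally show ?thesis .
qed

lemma monochromatic_juxtapose:
  assumes "D \<in> diagrams m n" "E \<in> diagrams p q" "length u = m" "length v = n"
  shows "monochromatic (juxtapose D E) (u @ u') (v @ v') \<longleftrightarrow> monochromatic D u v \<and> monochromatic E u' v'"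
proof -
  define h where "h = (\<lambda>(l, i). (l, (if l = 0 then m else n) + i) :: nat \<times> nat)"
  have D: "brauer_diagram D" "dsrc D = m" "dtgt D = n" and E: "brauer_diagram E" "dsrc E = p" "dtgt E = q"
    using assms by (auto simp: diagrams_def)
  have "monochromatic (juxtapose D E) (u @ u') (v @ v') \<longleftrightarrow>
      monochromatic D (u @ u') (v @ v') \<and> monochromatic (relabel h E 0 0) (u @ u') (v @ v')"
    unfolding monochromatic_def juxtapose_def relabel_def h_def using D by auto
  also have "monochromatic (relabel h E 0 0) (u @ u') (v @ v') \<longleftrightarrow> monochromatic E u' v'"
    by (rule monochromatic_relabel) (use E assms in \<open>auto simp: colour_def h_def split: prod.splits\<close>)
  also have "monochromatic D (u @ u') (v @ v') \<longleftrightarrow> monochromatic D u v"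
  proof -
    have "colour (u @ u') (v @ v') x = colour u v x" if "x \<in> points m n" for x
      using that assms by (auto simp: colour_def points_def nth_append)
    then show ?thesis using brauer_diagram_arc[OF D(1)] D unfolding monochromatic_def by metis
  qed
  finally show ?thesis .
qed

lemma entry_btensor:
  assumes f: "f \<in> bhom m n" and g: "g \<in> bhom p q" and "length u = m" "length v = n"
  shows "entry (f \<otimes>\<^sub>B g) (u @ u') (v @ v') = entry f u v * entry g u' v'"
proof -
  let ?f = "Poly_Mapping.lookup f" and ?g = "Poly_Mapping.lookup g"
  have "entry (f \<otimes>\<^sub>B g) (u @ u') (v @ v') = (\<Sum>D\<in>diagrams m n. \<Sum>E\<in>diagrams p q.
     ?f D * ?g E * of_bool (monochromatic (juxtapose D E) (u @ u') (v @ v')))"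
    unfolding btensor_eq[OF f g] by simp
  also have "\<dots> = (\<Sum>D\<in>diagrams m n. \<Sum>E\<in>diagrams p q.
     (?f D * of_bool (monochromatic D u v)) * (?g E * of_bool (monochromatic E u' v')))"
    by (intro sum.cong refl) (use assms in \<open>simp add: monochromatic_juxtapose\<close>)
  also have "\<dots> = entry f u v * entry g u' v'"
    using f g by (simp add: entry_eq_sum[of "diagrams m n"] entry_eq_sum[of "diagrams p q"] bhom_iff sum_product)
  finally show ?thesis .
qed

lemma entry_bperm: "entry (bperm n \<sigma>) u v = of_bool (\<forall>i<n. u ! i = v ! \<sigma> i)"
proof -
  have "monochromatic (Diagram n n {{(0, i), (1, \<sigma> i)} | i. i < n}) u v \<longleftrightarrow> (\<forall>i<n. u ! i = v ! \<sigma> i)"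
  proof
    assume mono: "monochromatic (Diagram n n {{(0, i), (1, \<sigma> i)} | i. i < n}) u v"
    have "u ! i = v ! \<sigma> i" if "i < n" for i
    proof -
      have "{(0, i), (1, \<sigma> i)} \<in> arcs (Diagram n n {{(0, i), (1, \<sigma> i)} | i. i < n})"
        using that by auto
      then have "colour u v (0, i) = colour u v (1, \<sigma> i)"
        using mono unfolding monochromatic_def by blast
      then show ?thesis by (simp add: colour_def)
    qed
    then show "\<forall>i<n. u ! i = v ! \<sigma> i" by blast
  next
    assume *: "\<forall>i<n. u ! i = v ! \<sigma> i"
    have "colour u v x = colour u v y" if xy: "{x, y} \<in> arcs (Diagram n n {{(0, i), (1, \<sigma> i)} | i. i < n})" for x y
    proof -
      obtain i where "i < n" "{x, y} = {(0, i), (1, \<sigma> i)}" using xy by auto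
      then show ?thesis using * by (auto simp: doubleton_eq_iff colour_def)
    qed
    then show "monochromatic (Diagram n n {{(0, i), (1, \<sigma> i)} | i. i < n}) u v"
      unfolding monochromatic_def by blast
  qed
  then show ?thesis by (simp add: bperm_def)
qed

lemma entry_bid:
  assumes "length u = n" "length v = n"
  shows "entry (bid n) u v = of_bool (u = v)"
  using assms by (auto simp: bid_def entry_bperm list_eq_iff_nth_eq)

lemma entry_bev: "entry bev [i, j] [] = of_bool (i = j)"
  and entry_bcoev: "entry bcoev [] [i, j] = of_bool (i = j)"
  by (auto simp: bev_def bcoev_def monochromatic_def colour_def doubleton_eq_iff)

text \<open>Both ends of an arc of D get the same colour and different arcs get different colours:
  the points are numbered, and an arc is coloured by the smaller number of its ends. A matching that
  respects this colouring has the arcs of D.\<close>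

lemma separating_colouring:
  assumes D: "D \<in> diagrams m n" and N: "m + n \<le> N"
  obtains u v where "u \<in> words N m" "v \<in> words N n"
    "\<And>E. E \<in> diagrams m n \<Longrightarrow> monochromatic E u v \<longleftrightarrow> E = D"
proof -
  have bD: "brauer_diagram D" "dsrc D = m" "dtgt D = n" using D by (auto simp: diagrams_def)
  define num where "num p = (if fst p = 0 then snd p else m + snd p)" for p :: "nat \<times> nat"
  have num: "num p = num q \<longleftrightarrow> p = q" "num p < m + n" if "p \<in> points m n" "q \<in> points m n" for p q
    using that by (auto simp: num_def points_def split: if_splits)
  define c where "c p = min (num p) (num (partner D p))" for p
  have partner: "partner D p \<in> points m n" "partner D (partner D p) = p" if "p \<in> points m n" for p
    using partner_props[OF bD(1)] that bD by auto
  have c: "c p = c q \<longleftrightarrow> q = p \<or> q = partner D p" "c p < N" if pq: "p \<in> points m n" "q \<in> points m n" for p q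
  proof -
    have "num p < m + n" using num(2)[OF pq(1) pq(1)] .
    then show "c p < N" using N by (simp add: c_def)
    show "c p = c q \<longleftrightarrow> q = p \<or> q = partner D p"
    proof
      assume "c p = c q"
      then have "num p = num q \<or> num p = num (partner D q) \<or> num (partner D p) = num q
          \<or> num (partner D p) = num (partner D q)"
        by (auto simp: c_def min_def split: if_splits)
      then show "q = p \<or> q = partner D p" using num partner pq by metis
    qed (auto simp: c_def partner pq)
  qed
  define u where "u = map (\<lambda>i. c (0, i)) [0..<m]"
  define v where "v = map (\<lambda>i. c (1, i)) [0..<n]"
  have colour: "colour u v p = c p" if "p \<in> points m n" for p
    using that by (auto simp: colour_def u_def v_def points_def)
  have "u \<in> words N m" "v \<in> words N n"
    using c(2)[of "(0, _)" "(0, _)"] c(2)[of "(1, _)" "(1, _)"]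
    by (auto intro!: wordsI simp: u_def v_def points_def)
  moreover have "monochromatic E u v \<longleftrightarrow> E = D" if E: "E \<in> diagrams m n" for E
  proof
    have bE: "brauer_diagram E" "dsrc E = m" "dtgt E = n" using E by (auto simp: diagrams_def)
    assume mono: "monochromatic E u v"
    have eq: "partner E p = partner D p" if p: "p \<in> points m n" for p
    proof -
      have "{p, partner E p} \<in> arcs E" using partner_arc[OF bE(1)] p bE by simp
      then have "c p = c (partner E p)" "partner E p \<noteq> p" "partner E p \<in> points m n"
        using mono brauer_diagram_arc[OF bE(1)] colour bE p unfolding monochromatic_def by metis+
      then show ?thesis using c p by blast
    qed
    have arcs: "arcs F = {{p, partner F p} | p. p \<in> points m n}"
      if F: "brauer_diagram F" "dsrc F = m" "dtgt F = n" for F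
    proof -
      have "\<exists>p\<in>points m n. A = {p, partner F p}" if A: "A \<in> arcs F" for A
      proof -
        obtain p q where pq: "A = {p, q}"
          using A F(1) by (fastforce simp: brauer_diagram_def card_2_iff)
        have "p \<in> points m n" using brauer_diagram_arc[OF F(1)] A pq F by blast
        moreover have "q = partner F p" using partner_arc[OF F(1)] A pq F calculation by blast
        ultimately show ?thesis using pq by blast
      qed
      moreover have "{p, partner F p} \<in> arcs F" if "p \<in> points m n" for p
        using partner_arc[OF F(1)] F that by blast
      ultimately show ?thesis by blast
    qed
    have "arcs E = arcs D" unfolding arcs[OF bE] arcs[OF bD] using eq by metis
    then show "E = D" using bE bD by (cases E; cases D) simp
  next
    assume "E = D"
    moreover have "c p = c q" if "{p, q} \<in> arcs D" for p q
    proof -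
      have "p \<in> points m n" "q \<in> points m n" using brauer_diagram_arc[OF bD(1) that] bD by auto
      then show ?thesis using c partner_arc[OF bD(1)] that bD by blast
    qed
    ultimately show "monochromatic E u v"
      using brauer_diagram_arc[OF bD(1)] bD colour unfolding monochromatic_def by metis
  qed
  ultimately show ?thesis by (rule that)
qed

lemma entry_faithful:
  assumes f: "f \<in> bhom m n" and N: "m + n \<le> N"
    and 0: "\<And>u v. u \<in> words N m \<Longrightarrow> v \<in> words N n \<Longrightarrow> entry f u v = 0"
  shows "f = 0"
proof (rule poly_mapping_eqI)
  fix D
  show "Poly_Mapping.lookup f D = Poly_Mapping.lookup 0 D"
  proof (cases "D \<in> diagrams m n")
    case True
    then obtain u v where uv: "u \<in> words N m" "v \<in> words N n"
      "\<And>E. E \<in> diagrams m n \<Longrightarrow> monochromatic E u v \<longleftrightarrow> E = D"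
      using separating_colouring[OF _ N] by metis
    have "0 = entry f u v" using 0 uv by simp
    also have "\<dots> = (\<Sum>E\<in>diagrams m n. Poly_Mapping.lookup f E * of_bool (monochromatic E u v))"
      using f by (intro entry_eq_sum) (auto simp: bhom_iff)
    also have "\<dots> = (\<Sum>E\<in>diagrams m n. if E = D then Poly_Mapping.lookup f E else 0)"
      by (intro sum.cong refl) (simp add: uv(3))
    also have "\<dots> = Poly_Mapping.lookup f D" using True by simp
    finally show ?thesis by simp
  qed (use f in \<open>simp add: bhom_lookup\<close>)
qed

section \<open>Polynomial families\<close>

definition polynomial_fun :: "(complex \<Rightarrow> complex) \<Rightarrow> bool" where
  "polynomial_fun F \<longleftrightarrow> (\<exists>P. \<forall>t. F t = poly P t)"

lemma polynomial_fun_const [intro, simp]: "polynomial_fun (\<lambda>_. c)"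
  unfolding polynomial_fun_def by (rule exI[of _ "[:c:]"]) simp

lemma polynomial_fun_ident [intro, simp]: "polynomial_fun (\<lambda>t. t)"
  unfolding polynomial_fun_def by (rule exI[of _ "[:0, 1:]"]) simp

lemma polynomial_fun_add [intro]: "polynomial_fun F \<Longrightarrow> polynomial_fun G \<Longrightarrow> polynomial_fun (\<lambda>t. F t + G t)"
  unfolding polynomial_fun_def by (metis poly_add)

lemma polynomial_fun_mult [intro]: "polynomial_fun F \<Longrightarrow> polynomial_fun G \<Longrightarrow> polynomial_fun (\<lambda>t. F t * G t)"
  unfolding polynomial_fun_def by (metis poly_mult)

lemma polynomial_fun_diff [intro]: "polynomial_fun F \<Longrightarrow> polynomial_fun G \<Longrightarrow> polynomial_fun (\<lambda>t. F t - G t)"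
  unfolding polynomial_fun_def by (metis poly_diff)

lemma polynomial_fun_power [intro]: "polynomial_fun F \<Longrightarrow> polynomial_fun (\<lambda>t. F t ^ k)"
  unfolding polynomial_fun_def by (metis poly_power)

lemma polynomial_fun_divide [intro]: "polynomial_fun F \<Longrightarrow> polynomial_fun (\<lambda>t. F t / c)"
  using polynomial_fun_mult[of F "\<lambda>_. inverse c"] by (simp add: divide_inverse)

lemma polynomial_fun_sum [intro]:
  "(\<And>a. a \<in> A \<Longrightarrow> polynomial_fun (F a)) \<Longrightarrow> polynomial_fun (\<lambda>t. \<Sum>a\<in>A. F a t)"
  by (induction A rule: infinite_finite_induct) auto

lemma polynomial_fun_eq_0:
  assumes "polynomial_fun F" and "\<And>N. N \<ge> M \<Longrightarrow> F (of_nat N) = 0"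
  shows "F t = 0"
proof -
  obtain P where P: "F t = poly P t" for t using assms(1) by (auto simp: polynomial_fun_def)
  have "of_nat ` {M..} \<subseteq> {x. poly P x = 0}" using assms(2) P by auto
  moreover have "infinite (of_nat ` {M..} :: complex set)"
    by (subst finite_image_iff) (auto simp: inj_on_def infinite_Ici)
  ultimately have "P = 0" using poly_roots_finite finite_subset by blast
  then show ?thesis using P by simp
qed

definition polyfam :: "nat \<Rightarrow> nat \<Rightarrow> (complex \<Rightarrow> morphism) \<Rightarrow> bool" where
  "polyfam m n X \<longleftrightarrow> (\<forall>t. X t \<in> bhom m n) \<and> (\<forall>D. polynomial_fun (\<lambda>t. Poly_Mapping.lookup (X t) D))"

lemma polyfam_bhom: "polyfam m n X \<Longrightarrow> X t \<in> bhom m n"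
  by (simp add: polyfam_def)

lemma polyfam_const [intro]: "f \<in> bhom m n \<Longrightarrow> polyfam m n (\<lambda>_. f)"
  by (simp add: polyfam_def)

lemma polyfam_add [intro]: "polyfam m n X \<Longrightarrow> polyfam m n Y \<Longrightarrow> polyfam m n (\<lambda>t. X t + Y t)"
  by (auto simp: polyfam_def lookup_add)

lemma polyfam_sum [intro]: "(\<And>a. a \<in> A \<Longrightarrow> polyfam m n (X a)) \<Longrightarrow> polyfam m n (\<lambda>t. \<Sum>a\<in>A. X a t)"
  by (auto simp: polyfam_def lookup_sum)

lemma polyfam_bscale [intro]: "polynomial_fun c \<Longrightarrow> polyfam m n X \<Longrightarrow> polyfam m n (\<lambda>t. c t \<cdot>\<^sub>B X t)"
  by (auto simp: polyfam_def)

lemma polyfam_bcomp [intro]: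
  assumes X: "polyfam l m X" and Y: "polyfam m n Y"
  shows "polyfam l n (\<lambda>t. Y t \<odot>\<^bsub>t\<^esub> X t)"
proof -
  have "polynomial_fun (\<lambda>t. Poly_Mapping.lookup (Y t \<odot>\<^bsub>t\<^esub> X t) F)" for F
  proof -
    have "Poly_Mapping.lookup (Y t \<odot>\<^bsub>t\<^esub> X t) F = (\<Sum>E\<in>diagrams m n. \<Sum>D\<in>diagrams l m.
        if stack E D = F then Poly_Mapping.lookup (Y t) E * Poly_Mapping.lookup (X t) D * t ^ loops E D else 0)" for t
      unfolding bcomp_eq[OF polyfam_bhom[OF X] polyfam_bhom[OF Y]]
      by (simp add: lookup_sum lookup_single when_def)
    moreover have "polynomial_fun (\<lambda>t. if stack E D = F
        then Poly_Mapping.lookup (Y t) E * Poly_Mapping.lookup (X t) D * t ^ loops E D else 0)" for E D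
      using X Y by (cases "stack E D = F")
        (auto simp: polyfam_def intro!: polynomial_fun_mult polynomial_fun_power)
    ultimately show ?thesis by (simp only:) (intro polynomial_fun_sum)
  qed
  then show ?thesis using X Y by (auto simp: polyfam_def)
qed

lemma polyfam_btensor [intro]:
  assumes X: "polyfam m n X" and Y: "polyfam p q Y"
  shows "polyfam (m + p) (n + q) (\<lambda>t. X t \<otimes>\<^sub>B Y t)"
proof -
  have "polynomial_fun (\<lambda>t. Poly_Mapping.lookup (X t \<otimes>\<^sub>B Y t) F)" for F
  proof -
    have "Poly_Mapping.lookup (X t \<otimes>\<^sub>B Y t) F = (\<Sum>D\<in>diagrams m n. \<Sum>E\<in>diagrams p q.
        if juxtapose D E = F then Poly_Mapping.lookup (X t) D * Poly_Mapping.lookup (Y t) E else 0)" for t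
      unfolding btensor_eq[OF polyfam_bhom[OF X] polyfam_bhom[OF Y]]
      by (simp add: lookup_sum lookup_single when_def)
    moreover have "polynomial_fun (\<lambda>t. if juxtapose D E = F
        then Poly_Mapping.lookup (X t) D * Poly_Mapping.lookup (Y t) E else 0)" for E D
      using X Y by (cases "juxtapose D E = F")
        (auto simp: polyfam_def intro!: polynomial_fun_mult)
    ultimately show ?thesis by (simp only:) (intro polynomial_fun_sum)
  qed
  then show ?thesis using X Y by (auto simp: polyfam_def)
qed

lemma polyfam_eqI:
  assumes X: "polyfam m n X" and Y: "polyfam m n Y"
    and eq: "\<And>N u v. u \<in> words N m \<Longrightarrow> v \<in> words N n \<Longrightarrow> entry (X (of_nat N)) u v = entry (Y (of_nat N)) u v"
  shows "X t = Y t"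
proof -
  have large: "X (of_nat N) - Y (of_nat N) = 0" if "N \<ge> m + n" for N
    by (rule entry_faithful[OF _ that]) (use eq X Y in \<open>auto simp: polyfam_def\<close>)
  have "Poly_Mapping.lookup (X t) D - Poly_Mapping.lookup (Y t) D = 0" for D
    by (rule polynomial_fun_eq_0[where F = "\<lambda>t. Poly_Mapping.lookup (X t) D - Poly_Mapping.lookup (Y t) D" and M = "m + n"])
      (use X Y large in \<open>auto simp: polyfam_def\<close>)
  then show ?thesis by (auto intro: poly_mapping_eqI)
qed

section \<open>Sums over words\<close>

lemma words_0 [simp]: "words N 0 = {[]}"
  by (auto simp: words_def)

lemma append_in_words: "u \<in> words N m \<Longrightarrow> v \<in> words N n \<Longrightarrow> u @ v \<in> words N (m + n)"
  by (auto simp: words_def)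

lemma Cons_in_words: "i # w \<in> words N (Suc n) \<longleftrightarrow> i < N \<and> w \<in> words N n"
  by (auto simp: words_def)

lemma words_split:
  assumes "w \<in> words N (m + n)"
  obtains u v where "u \<in> words N m" "v \<in> words N n" "w = u @ v"
proof (rule that)
  show "take m w \<in> words N m" "drop m w \<in> words N n"
    using assms set_take_subset[of m w] set_drop_subset[of m w] by (auto simp: words_def)
qed simp

lemma words_SucE:
  assumes "w \<in> words N (Suc n)"
  obtains i v where "i < N" "v \<in> words N n" "w = i # v"
  using assms by (cases w) (auto simp: words_def)

lemma sum_words_add:
  fixes F :: "nat list \<Rightarrow> 'a::comm_monoid_add"
  shows "(\<Sum>w\<in>words N (m + n). F w) = (\<Sum>u\<in>words N m. \<Sum>v\<in>words N n. F (u @ v))"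
proof -
  have inj: "inj_on (\<lambda>(u, v). u @ v) (words N m \<times> words N n)"
    by (auto simp: inj_on_def words_def)
  have "words N (m + n) = (\<lambda>(u, v). u @ v) ` (words N m \<times> words N n)"
  proof
    show "words N (m + n) \<subseteq> (\<lambda>(u, v). u @ v) ` (words N m \<times> words N n)"
      by (force elim: words_split)
  qed (auto intro: append_in_words)
  then show ?thesis
    unfolding sum.cartesian_product by (simp only: sum.reindex[OF inj]) (simp add: case_prod_unfold)
qed

lemma sum_words_Suc:
  fixes F :: "nat list \<Rightarrow> 'a::comm_monoid_add"
  shows "(\<Sum>w\<in>words N (Suc n). F w) = (\<Sum>i<N. \<Sum>v\<in>words N n. F (i # v))"
proof -
  have inj: "inj_on (\<lambda>(i, v). i # v) ({..<N} \<times> words N n)"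
    by (auto simp: inj_on_def)
  have "words N (Suc n) = (\<lambda>(i, v). i # v) ` ({..<N} \<times> words N n)"
  proof
    show "words N (Suc n) \<subseteq> (\<lambda>(i, v). i # v) ` ({..<N} \<times> words N n)"
      by (force elim: words_SucE)
  qed (auto simp: Cons_in_words)
  then show ?thesis
    unfolding sum.cartesian_product by (simp only: sum.reindex[OF inj]) (simp add: case_prod_unfold)
qed

lemma sum_delta_right:
  fixes F :: "'a \<Rightarrow> complex"
  assumes "finite A" "a \<in> A"
  shows "(\<Sum>x\<in>A. F x * of_bool (x = a)) = F a" "(\<Sum>x\<in>A. F x * of_bool (a = x)) = F a"
    "(\<Sum>x\<in>A. of_bool (x = a) * F x) = F a" "(\<Sum>x\<in>A. of_bool (a = x) * F x) = F a"
  using assms by (simp_all add: of_bool_def if_distrib if_distribR cong: if_cong)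

section \<open>Laws of the Brauer category\<close>

text \<open>For diagrams one would have to compare the loops of three glued diagrams. For matrices
  the law is an exchange of two finite sums.\<close>

lemma bcomp_assoc:
  assumes f: "f \<in> bhom k l" and g: "g \<in> bhom l m" and h: "h \<in> bhom m n"
  shows "(h \<odot>\<^bsub>t\<^esub> g) \<odot>\<^bsub>t\<^esub> f = h \<odot>\<^bsub>t\<^esub> (g \<odot>\<^bsub>t\<^esub> f)"
proof (rule polyfam_eqI[where X = "\<lambda>t. (h \<odot>\<^bsub>t\<^esub> g) \<odot>\<^bsub>t\<^esub> f" and Y = "\<lambda>t. h \<odot>\<^bsub>t\<^esub> (g \<odot>\<^bsub>t\<^esub> f)"])
  show "polyfam k n (\<lambda>t. (h \<odot>\<^bsub>t\<^esub> g) \<odot>\<^bsub>t\<^esub> f)" "polyfam k n (\<lambda>t. h \<odot>\<^bsub>t\<^esub> (g \<odot>\<^bsub>t\<^esub> f))"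
    by (rule assms polyfam_bcomp polyfam_btensor polyfam_const)+
  fix N u v assume u: "u \<in> words N k" and v: "v \<in> words N n"
  have "entry ((h \<odot>\<^bsub>of_nat N\<^esub> g) \<odot>\<^bsub>of_nat N\<^esub> f) u v =
      (\<Sum>w\<in>words N l. \<Sum>x\<in>words N m. entry f u w * (entry g w x * entry h x v))"
    using u v by (subst entry_bcomp[OF f bhom_bcomp[OF g h]])
      (auto simp: entry_bcomp[OF g h] sum_distrib_left)
  also have "\<dots> = (\<Sum>x\<in>words N m. \<Sum>w\<in>words N l. entry f u w * entry g w x * entry h x v)"
    by (subst sum.swap) (simp add: mult.assoc)
  also have "\<dots> = entry (h \<odot>\<^bsub>of_nat N\<^esub> (g \<odot>\<^bsub>of_nat N\<^esub> f)) u v"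
    using u v by (subst entry_bcomp[OF bhom_bcomp[OF f g] h])
      (auto simp: entry_bcomp[OF f g] sum_distrib_right)
  finally show "entry ((h \<odot>\<^bsub>of_nat N\<^esub> g) \<odot>\<^bsub>of_nat N\<^esub> f) u v =
      entry (h \<odot>\<^bsub>of_nat N\<^esub> (g \<odot>\<^bsub>of_nat N\<^esub> f)) u v" .
qed

lemma bid_bcomp:
  assumes f: "f \<in> bhom m n"
  shows "bid n \<odot>\<^bsub>t\<^esub> f = f"
proof (rule polyfam_eqI[where X = "\<lambda>t. bid n \<odot>\<^bsub>t\<^esub> f" and Y = "\<lambda>t. f"])
  show "polyfam m n (\<lambda>t. bid n \<odot>\<^bsub>t\<^esub> f)" "polyfam m n (\<lambda>t. f)"
    by (rule f bhom_bid polyfam_bcomp polyfam_const)+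
  fix N u v assume u: "u \<in> words N m" and v: "v \<in> words N n"
  have "entry (bid n \<odot>\<^bsub>of_nat N\<^esub> f) u v = (\<Sum>w\<in>words N n. entry f u w * of_bool (w = v))"
    using u v by (subst entry_bcomp[OF f bhom_bid]) (auto simp: entry_bid length_words intro!: sum.cong)
  then show "entry (bid n \<odot>\<^bsub>of_nat N\<^esub> f) u v = entry f u v" using v by (simp add: sum_delta_right)
qed

lemma bcomp_bid:
  assumes f: "f \<in> bhom m n"
  shows "f \<odot>\<^bsub>t\<^esub> bid m = f"
proof (rule polyfam_eqI[where X = "\<lambda>t. f \<odot>\<^bsub>t\<^esub> bid m" and Y = "\<lambda>t. f"])
  show "polyfam m n (\<lambda>t. f \<odot>\<^bsub>t\<^esub> bid m)" "polyfam m n (\<lambda>t. f)"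
    by (rule f bhom_bid polyfam_bcomp polyfam_const)+
  fix N u v assume u: "u \<in> words N m" and v: "v \<in> words N n"
  have "entry (f \<odot>\<^bsub>of_nat N\<^esub> bid m) u v = (\<Sum>w\<in>words N m. of_bool (u = w) * entry f w v)"
    using u v by (subst entry_bcomp[OF bhom_bid f]) (auto simp: entry_bid length_words intro!: sum.cong)
  then show "entry (f \<odot>\<^bsub>of_nat N\<^esub> bid m) u v = entry f u v" using u by (simp add: sum_delta_right)
qed

lemma bcomp_add_left:
  "f \<in> bhom l m \<Longrightarrow> g \<in> bhom m n \<Longrightarrow> g' \<in> bhom m n \<Longrightarrow> (g + g') \<odot>\<^bsub>t\<^esub> f = g \<odot>\<^bsub>t\<^esub> f + g' \<odot>\<^bsub>t\<^esub> f"
  by (subst (1 2 3) bcomp_eq)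
    (auto simp: lookup_add distrib_right single_add sum.distrib)

lemma bcomp_add_right:
  "f \<in> bhom l m \<Longrightarrow> f' \<in> bhom l m \<Longrightarrow> g \<in> bhom m n \<Longrightarrow> g \<odot>\<^bsub>t\<^esub> (f + f') = g \<odot>\<^bsub>t\<^esub> f + g \<odot>\<^bsub>t\<^esub> f'"
  by (subst (1 2 3) bcomp_eq)
    (auto simp: lookup_add distrib_right distrib_left single_add sum.distrib)

lemma bscale_single [simp]: "c \<cdot>\<^sub>B Poly_Mapping.single D d = Poly_Mapping.single D (c * d)"
  by (rule poly_mapping_eqI) (simp add: lookup_single when_def)

lemma bcomp_bscale_left:
  "f \<in> bhom l m \<Longrightarrow> g \<in> bhom m n \<Longrightarrow> (c \<cdot>\<^sub>B g) \<odot>\<^bsub>t\<^esub> f = c \<cdot>\<^sub>B (g \<odot>\<^bsub>t\<^esub> f)"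
  by (subst (1 2) bcomp_eq) (auto simp: bscale_sum_right mult.assoc)

lemma bcomp_bscale_right:
  "f \<in> bhom l m \<Longrightarrow> g \<in> bhom m n \<Longrightarrow> g \<odot>\<^bsub>t\<^esub> (c \<cdot>\<^sub>B f) = c \<cdot>\<^sub>B (g \<odot>\<^bsub>t\<^esub> f)"
  by (subst (1 2) bcomp_eq) (auto simp: bscale_sum_right mult.assoc mult.left_commute)

lemma bcomp_0_left [simp]: "0 \<odot>\<^bsub>t\<^esub> f = 0" and bcomp_0_right [simp]: "f \<odot>\<^bsub>t\<^esub> 0 = 0"
  by (simp_all add: bcomp_def)

lemma bcomp_diff_left:
  "f \<in> bhom l m \<Longrightarrow> g \<in> bhom m n \<Longrightarrow> g' \<in> bhom m n \<Longrightarrow> (g - g') \<odot>\<^bsub>t\<^esub> f = g \<odot>\<^bsub>t\<^esub> f - g' \<odot>\<^bsub>t\<^esub> f"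
  using bcomp_add_left[OF _ bhom_diff, of f l m g n g' g' t] by (simp add: eq_diff_eq)

lemma bcomp_sum_left:
  assumes "f \<in> bhom l m" "\<And>a. a \<in> A \<Longrightarrow> g a \<in> bhom m n"
  shows "(\<Sum>a\<in>A. g a) \<odot>\<^bsub>t\<^esub> f = (\<Sum>a\<in>A. g a \<odot>\<^bsub>t\<^esub> f)"
  using assms(2)
proof (induction A rule: infinite_finite_induct)
  case (insert a A)
  have "sum g A \<in> bhom m n" using insert.prems by (intro bhom_sum) auto
  then show ?case using insert bcomp_add_left[OF assms(1), of "g a" n "sum g A" t] by auto
qed auto

lemma bcomp_sum_right:
  assumes "g \<in> bhom m n" "\<And>a. a \<in> A \<Longrightarrow> f a \<in> bhom l m"
  shows "g \<odot>\<^bsub>t\<^esub> (\<Sum>a\<in>A. f a) = (\<Sum>a\<in>A. g \<odot>\<^bsub>t\<^esub> f a)"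
  using assms(2)
proof (induction A rule: infinite_finite_induct)
  case (insert a A)
  have "sum f A \<in> bhom l m" using insert.prems by (intro bhom_sum) auto
  then show ?case using insert bcomp_add_right[of "f a" l m "sum f A" g n t] assms(1) by auto
qed auto

lemma btensor_add_left:
  "f \<in> bhom m n \<Longrightarrow> f' \<in> bhom m n \<Longrightarrow> g \<in> bhom p q \<Longrightarrow> (f + f') \<otimes>\<^sub>B g = f \<otimes>\<^sub>B g + f' \<otimes>\<^sub>B g"
  by (subst (1 2 3) btensor_eq) (auto simp: lookup_add distrib_right single_add sum.distrib)

lemma btensor_bscale_left:
  "f \<in> bhom m n \<Longrightarrow> g \<in> bhom p q \<Longrightarrow> (c \<cdot>\<^sub>B f) \<otimes>\<^sub>B g = c \<cdot>\<^sub>B (f \<otimes>\<^sub>B g)"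
  by (subst (1 2) btensor_eq) (auto simp: bscale_sum_right mult.assoc)

lemma btensor_0_left [simp]: "0 \<otimes>\<^sub>B f = 0" and btensor_0_right [simp]: "f \<otimes>\<^sub>B 0 = 0"
  by (simp_all add: btensor_def)

lemma interchange:
  assumes f: "f \<in> bhom l m" and g: "g \<in> bhom m n" and f': "f' \<in> bhom l' m'" and g': "g' \<in> bhom m' n'"
  shows "(g \<otimes>\<^sub>B g') \<odot>\<^bsub>t\<^esub> (f \<otimes>\<^sub>B f') = (g \<odot>\<^bsub>t\<^esub> f) \<otimes>\<^sub>B (g' \<odot>\<^bsub>t\<^esub> f')"
proof (rule polyfam_eqI[where X = "\<lambda>t. (g \<otimes>\<^sub>B g') \<odot>\<^bsub>t\<^esub> (f \<otimes>\<^sub>B f')"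
      and Y = "\<lambda>t. (g \<odot>\<^bsub>t\<^esub> f) \<otimes>\<^sub>B (g' \<odot>\<^bsub>t\<^esub> f')"])
  show "polyfam (l + l') (n + n') (\<lambda>t. (g \<otimes>\<^sub>B g') \<odot>\<^bsub>t\<^esub> (f \<otimes>\<^sub>B f'))"
    "polyfam (l + l') (n + n') (\<lambda>t. (g \<odot>\<^bsub>t\<^esub> f) \<otimes>\<^sub>B (g' \<odot>\<^bsub>t\<^esub> f'))"
    by (rule assms polyfam_bcomp polyfam_btensor polyfam_const)+
  fix N uu vv assume uu: "uu \<in> words N (l + l')" and vv: "vv \<in> words N (n + n')"
  obtain u u' where u: "u \<in> words N l" "u' \<in> words N l'" "uu = u @ u'" using uu by (rule words_split)
  obtain v v' where v: "v \<in> words N n" "v' \<in> words N n'" "vv = v @ v'" using vv by (rule words_split)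
  have "entry ((g \<otimes>\<^sub>B g') \<odot>\<^bsub>of_nat N\<^esub> (f \<otimes>\<^sub>B f')) uu vv = (\<Sum>w\<in>words N m. \<Sum>w'\<in>words N m'.
      (entry f u w * entry g w v) * (entry f' u' w' * entry g' w' v'))"
    using u v by (subst entry_bcomp[OF bhom_btensor[OF f f'] bhom_btensor[OF g g'] uu vv])
      (simp add: sum_words_add entry_btensor[OF f f'] entry_btensor[OF g g'] length_words mult_ac)
  also have "\<dots> = entry ((g \<odot>\<^bsub>of_nat N\<^esub> f) \<otimes>\<^sub>B (g' \<odot>\<^bsub>of_nat N\<^esub> f')) uu vv"
    using u v by (simp add: entry_btensor[OF bhom_bcomp[OF f g] bhom_bcomp[OF f' g']] length_words
        entry_bcomp[OF f g] entry_bcomp[OF f' g'] sum_product)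
  finally show "entry ((g \<otimes>\<^sub>B g') \<odot>\<^bsub>of_nat N\<^esub> (f \<otimes>\<^sub>B f')) uu vv =
    entry ((g \<odot>\<^bsub>of_nat N\<^esub> f) \<otimes>\<^sub>B (g' \<odot>\<^bsub>of_nat N\<^esub> f')) uu vv" .
qed

lemma btensor_assoc:
  assumes f: "f \<in> bhom m n" and g: "g \<in> bhom m' n'" and h: "h \<in> bhom m'' n''"
  shows "(f \<otimes>\<^sub>B g) \<otimes>\<^sub>B h = f \<otimes>\<^sub>B g \<otimes>\<^sub>B h"
proof (rule polyfam_eqI[where X = "\<lambda>_. (f \<otimes>\<^sub>B g) \<otimes>\<^sub>B h" and Y = "\<lambda>_. f \<otimes>\<^sub>B g \<otimes>\<^sub>B h"])
  show "polyfam (m + m' + m'') (n + n' + n'') (\<lambda>_. (f \<otimes>\<^sub>B g) \<otimes>\<^sub>B h)" using assms by blast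
  have "polyfam (m + (m' + m'')) (n + (n' + n'')) (\<lambda>_. f \<otimes>\<^sub>B g \<otimes>\<^sub>B h)" using assms by blast
  then show "polyfam (m + m' + m'') (n + n' + n'') (\<lambda>_. f \<otimes>\<^sub>B g \<otimes>\<^sub>B h)" by (simp add: add.assoc)
  fix N uu vv assume "uu \<in> words N (m + m' + m'')" "vv \<in> words N (n + n' + n'')"
  then obtain u u' u'' v v' v'' where u: "u \<in> words N m" "u' \<in> words N m'" "u'' \<in> words N m''" "uu = (u @ u') @ u''"
    and v: "v \<in> words N n" "v' \<in> words N n'" "v'' \<in> words N n''" "vv = (v @ v') @ v''"
    by (metis words_split)
  have "entry ((f \<otimes>\<^sub>B g) \<otimes>\<^sub>B h) uu vv = entry f u v * entry g u' v' * entry h u'' v''"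
    unfolding u v using u v
    by (subst entry_btensor[OF bhom_btensor[OF f g] h]; simp add: length_words entry_btensor[OF f g])
  moreover have "entry (f \<otimes>\<^sub>B g \<otimes>\<^sub>B h) uu vv = entry f u v * entry g u' v' * entry h u'' v''"
    unfolding u v append_assoc using u v
    by (subst entry_btensor[OF f bhom_btensor[OF g h]]; simp add: length_words entry_btensor[OF g h])
  ultimately show "entry ((f \<otimes>\<^sub>B g) \<otimes>\<^sub>B h) uu vv = entry (f \<otimes>\<^sub>B g \<otimes>\<^sub>B h) uu vv" by simp
qed

lemma bid_0_btensor: "f \<in> bhom m n \<Longrightarrow> bid 0 \<otimes>\<^sub>B f = f"
proof (rule polyfam_eqI[where X = "\<lambda>_. bid 0 \<otimes>\<^sub>B f" and Y = "\<lambda>_. f"])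
  assume f: "f \<in> bhom m n"
  show "polyfam m n (\<lambda>_. f)" using f by blast
  show "polyfam m n (\<lambda>_. bid 0 \<otimes>\<^sub>B f)" using bhom_btensor[OF bhom_bid[of 0] f] by auto
  fix N u v assume "u \<in> words N m" "v \<in> words N n"
  then show "entry (bid 0 \<otimes>\<^sub>B f) u v = entry f u v"
    using entry_btensor[OF bhom_bid[of 0] f, of "[]" "[]" u v] by (simp add: entry_bid)
qed

lemma btensor_bid_0: "f \<in> bhom m n \<Longrightarrow> f \<otimes>\<^sub>B bid 0 = f"
proof (rule polyfam_eqI[where X = "\<lambda>_. f \<otimes>\<^sub>B bid 0" and Y = "\<lambda>_. f"])
  assume f: "f \<in> bhom m n"
  show "polyfam m n (\<lambda>_. f)" using f by blast
  show "polyfam m n (\<lambda>_. f \<otimes>\<^sub>B bid 0)" using bhom_btensor[OF f bhom_bid[of 0]] by auto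
  fix N u v assume "u \<in> words N m" "v \<in> words N n"
  then show "entry (f \<otimes>\<^sub>B bid 0) u v = entry f u v"
    using entry_btensor[OF f bhom_bid[of 0], of u v "[]" "[]"] by (simp add: entry_bid length_words)
qed

section \<open>The kernel of the symmetrizer\<close>

text \<open>The matrix of the projection onto symmetric tensors: a word is sent to the average of
  its rearrangements, so that the entry depends only on the multisets of letters.\<close>

definition symker :: "nat multiset \<Rightarrow> nat multiset \<Rightarrow> complex" where
  "symker A B = of_bool (A = B) / of_nat (card (permutations_of_multiset B))"

lemma symker_commute: "symker A B = symker B A"
  by (auto simp: symker_def)

lemma card_permutations_nonzero: "card (permutations_of_multiset A) \<noteq> 0"
  by (simp add: permutations_of_multiset_nonempty)

text \<open>Orbit and stabilizer: the permutations that carry v to a given rearrangement form a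
  coset of the stabilizer of v, so that all these sets have the same size, and together they exhaust
  the n! permutations.\<close>

lemma card_permutes_to:
  assumes v: "length v = n" and u: "length u = n"
  shows "of_nat (card {\<sigma>. \<sigma> permutes {..<n} \<and> u = permute_list \<sigma> v}) / fact n = symker (mset u) (mset v)"
proof -
  define S where "S u = {\<sigma>. \<sigma> permutes {..<n} \<and> u = permute_list \<sigma> v}" for u
  have fin: "finite (S u)" for u
    by (rule finite_subset[OF _ finite_permutations[of "{..<n}"]]) (auto simp: S_def)
  have in_perm: "permute_list \<sigma> v \<in> permutations_of_multiset (mset v)" if "\<sigma> permutes {..<n}" for \<sigma>
    using that v by (auto simp: permutations_of_multiset_def intro!: mset_permute_list)
  have same: "card (S w) = card (S v)" if w: "w \<in> permutations_of_multiset (mset v)" for w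
  proof -
    have "mset w = mset v" using w by (simp add: permutations_of_multiset_def)
    then obtain \<tau> where \<tau>: "\<tau> permutes {..<length v}" "permute_list \<tau> v = w"
      by (rule mset_eq_permutation)
    then have \<tau>n: "\<tau> permutes {..<n}" using v by simp
    have "bij_betw (\<lambda>\<sigma>. \<sigma> \<circ> \<tau>) (S v) (S w)"
    proof (rule bij_betw_byWitness[where f' = "\<lambda>\<sigma>. \<sigma> \<circ> inv \<tau>"])
      show "\<forall>\<sigma>\<in>S v. (\<sigma> \<circ> \<tau>) \<circ> inv \<tau> = \<sigma>"
        using permutes_inv_o(1)[OF \<tau>n] by (simp add: o_assoc[symmetric])
      show "\<forall>\<sigma>\<in>S w. (\<sigma> \<circ> inv \<tau>) \<circ> \<tau> = \<sigma>"
        using permutes_inv_o(2)[OF \<tau>n] by (simp add: o_assoc[symmetric])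
      show "(\<lambda>\<sigma>. \<sigma> \<circ> \<tau>) ` S v \<subseteq> S w"
      proof safe
        fix \<sigma> assume "\<sigma> \<in> S v"
        then have \<sigma>: "\<sigma> permutes {..<n}" "permute_list \<sigma> v = v" by (auto simp: S_def)
        have "permute_list (\<sigma> \<circ> \<tau>) v = permute_list \<tau> (permute_list \<sigma> v)"
          using \<tau> by (rule_tac permute_list_compose) simp
        then show "\<sigma> \<circ> \<tau> \<in> S w" using \<sigma> \<tau> \<tau>n by (simp add: S_def permutes_compose)
      qed
      show "(\<lambda>\<sigma>. \<sigma> \<circ> inv \<tau>) ` S w \<subseteq> S v"
      proof safe
        fix \<sigma> assume "\<sigma> \<in> S w"
        then have \<sigma>: "\<sigma> permutes {..<n}" "permute_list \<sigma> v = w" by (auto simp: S_def)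
        have i: "inv \<tau> permutes {..<n}" using permutes_inv[OF \<tau>n] .
        have "permute_list (\<sigma> \<circ> inv \<tau>) v = permute_list (inv \<tau>) (permute_list \<sigma> v)"
          using i v by (rule_tac permute_list_compose) simp
        also have "\<dots> = permute_list (inv \<tau>) (permute_list \<tau> v)" using \<sigma> \<tau> by simp
        also have "\<dots> = permute_list (\<tau> \<circ> inv \<tau>) v"
          using i v by (rule_tac permute_list_compose[symmetric]) simp
        also have "\<dots> = v" using permutes_inv_o(1)[OF \<tau>n] by simp
        finally show "\<sigma> \<circ> inv \<tau> \<in> S v" using \<sigma> i by (simp add: S_def permutes_compose)
      qed
    qed
    then show ?thesis by (rule bij_betw_same_card[symmetric])
  qed
  have "{\<sigma>. \<sigma> permutes {..<n}} = (\<Union>w\<in>permutations_of_multiset (mset v). S w)"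
    using in_perm by (auto simp: S_def)
  then have "card {\<sigma>. \<sigma> permutes {..<n}} = (\<Sum>w\<in>permutations_of_multiset (mset v). card (S w))"
    by (simp, subst card_UN_disjoint) (auto simp: fin, auto simp: S_def)
  then have count: "fact n = card (permutations_of_multiset (mset v)) * card (S v)"
    by (simp add: card_permutations[of _ n] same)
  have nz: "(of_nat (card (permutations_of_multiset (mset v))) :: complex) \<noteq> 0"
    using card_permutations_nonzero by (metis of_nat_eq_0_iff)
  show ?thesis
  proof (cases "mset u = mset v")
    case True
    then have "card (S u) = card (S v)" by (intro same) (simp add: permutations_of_multiset_def)
    moreover have "(fact n :: complex) = of_nat (card (permutations_of_multiset (mset v)) * card (S v))"
      by (metis count of_nat_fact)
    moreover have "(fact n :: complex) \<noteq> 0" by simp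
    ultimately show ?thesis using True nz unfolding symker_def S_def[symmetric] by (simp add: field_simps)
  next
    case False
    then have "S u = {}" using in_perm by (fastforce simp: S_def permutations_of_multiset_def)
    then show ?thesis using False unfolding S_def[symmetric] by (simp add: symker_def)
  qed
qed

lemma entry_bperm_permute:
  assumes "\<sigma> permutes {..<n}" "length u = n" "length v = n"
  shows "entry (bperm n \<sigma>) u v = of_bool (u = permute_list \<sigma> v)"
  using assms by (auto simp: entry_bperm list_eq_iff_nth_eq permute_list_nth)

lemma entry_symmetrizer:
  assumes "length u = n" "length v = n"
  shows "entry (symmetrizer n) u v = symker (mset u) (mset v)"
proof -
  have "entry (symmetrizer n) u v =
      (1 / fact n) * (\<Sum>\<sigma> | \<sigma> permutes {..<n}. of_bool (u = permute_list \<sigma> v))"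
    unfolding symmetrizer_def by (simp add: entry_bperm_permute assms)
  also have "\<dots> = of_nat (card {\<sigma>. \<sigma> permutes {..<n} \<and> u = permute_list \<sigma> v}) / fact n"
    by (simp add: finite_permutations Int_def)
  also have "\<dots> = symker (mset u) (mset v)"
    using assms by (intro card_permutes_to)
  finally show ?thesis .
qed

lemma bhom_symmetrizer [intro]: "symmetrizer n \<in> bhom n n"
  unfolding symmetrizer_def by auto

lemma permutations_subset_words: "v \<in> words N n \<Longrightarrow> permutations_of_multiset (mset v) \<subseteq> words N n"
  by (auto simp: permutations_of_multiset_def words_def dest: mset_eq_setD mset_eq_length)

text \<open>\<open>symker\<close> is the reproducing kernel of the functions of words that depend
  only on the multiset of letters. The four forms differ in the order of the factors and of the
  arguments.\<close>

lemma sum_symker: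
  assumes v: "v \<in> words N n"
  shows "(\<Sum>u\<in>words N n. symker (mset u) (mset v) * h (mset u)) = h (mset v)"
    and "(\<Sum>u\<in>words N n. h (mset u) * symker (mset u) (mset v)) = h (mset v)"
    and "(\<Sum>u\<in>words N n. symker (mset v) (mset u) * h (mset u)) = h (mset v)"
    and "(\<Sum>u\<in>words N n. h (mset u) * symker (mset v) (mset u)) = h (mset v)"
proof -
  let ?P = "permutations_of_multiset (mset v)"
  have "(\<Sum>u\<in>words N n. symker (mset u) (mset v) * h (mset u)) =
      (\<Sum>u\<in>?P. symker (mset u) (mset v) * h (mset u))"
    using permutations_subset_words[OF v]
    by (intro sum.mono_neutral_right) (auto simp: permutations_of_multiset_def symker_def)
  also have "\<dots> = (\<Sum>u\<in>?P. h (mset v) / of_nat (card ?P))"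
    by (intro sum.cong refl) (auto simp: permutations_of_multiset_def symker_def)
  also have "\<dots> = h (mset v)" using card_permutations_nonzero by simp
  finally show 1: "(\<Sum>u\<in>words N n. symker (mset u) (mset v) * h (mset u)) = h (mset v)" .
  then show "(\<Sum>u\<in>words N n. h (mset u) * symker (mset u) (mset v)) = h (mset v)"
    by (simp add: mult.commute)
  show "(\<Sum>u\<in>words N n. symker (mset v) (mset u) * h (mset u)) = h (mset v)"
    using 1 by (simp add: symker_commute)
  show "(\<Sum>u\<in>words N n. h (mset u) * symker (mset v) (mset u)) = h (mset v)"
    using 1 by (simp add: symker_commute mult.commute)
qed

text \<open>Among the rearrangements of c the proportion that begins with i is the multiplicity of i
  divided by the length q + 1, and deleting this first letter leaves the rearrangements of the
  multiset without one i.\<close>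

lemma sum_symker_add_mset:
  assumes c: "c \<in> words N (Suc q)" and i: "i < N"
  shows "(\<Sum>e\<in>words N q. h (mset e) * symker (add_mset i (mset e)) (mset c)) =
    of_nat (count (mset c) i) / of_nat (Suc q) * h (mset c - {#i#})"
proof (cases "i \<in># mset c")
  case False
  then have "add_mset i (mset e) \<noteq> mset c" for e by (metis union_single_eq_member)
  then show ?thesis using False by (simp add: symker_def count_eq_zero_iff)
next
  case True
  define A where "A = mset c - {#i#}"
  have A: "mset c = add_mset i A" using True by (simp add: A_def)
  have P: "permutations_of_multiset A \<subseteq> words N q"
  proof
    fix e assume "e \<in> permutations_of_multiset A"
    then have "mset e = A" by (simp add: permutations_of_multiset_def)
    then have "mset (i # e) = mset c" by (simp add: A)
    then have "i # e \<in> words N (Suc q)" using permutations_subset_words[OF c]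
      by (auto simp: permutations_of_multiset_def)
    then show "e \<in> words N q" by (simp add: Cons_in_words)
  qed
  have size: "size A = q" using A length_words[OF c] by (metis size_add_mset size_mset nat.inject)
  let ?c = "\<lambda>A. card (permutations_of_multiset A)"
  have rec: "?c (mset c) * count (mset c) i = Suc q * ?c A"
    using card_permutations_of_multiset_insert_aux[of A i] size by (simp add: A)
  have nz: "of_nat (?c (mset c)) \<noteq> (0 :: complex)" using card_permutations_nonzero by (metis of_nat_eq_0_iff)
  have "(\<Sum>e\<in>words N q. h (mset e) * symker (add_mset i (mset e)) (mset c)) =
      (\<Sum>e\<in>permutations_of_multiset A. h (mset e) * symker (add_mset i (mset e)) (mset c))"
    using P by (intro sum.mono_neutral_right) (auto simp: permutations_of_multiset_def symker_def A)
  also have "\<dots> = (\<Sum>e\<in>permutations_of_multiset A. h A / of_nat (?c (mset c)))"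
    by (intro sum.cong refl) (auto simp: permutations_of_multiset_def symker_def A)
  also have "\<dots> = of_nat (?c A) * h A / of_nat (?c (mset c))" by simp
  also have "\<dots> = of_nat (count (mset c) i) / of_nat (Suc q) * h A"
  proof -
    have "(of_nat (Suc q) :: complex) * of_nat (?c A) = of_nat (?c (mset c)) * of_nat (count (mset c) i)"
      unfolding of_nat_mult[symmetric] rec ..
    moreover have "(of_nat (Suc q) :: complex) \<noteq> 0" by (metis of_nat_eq_0_iff nat.distinct(2))
    ultimately show ?thesis using nz by (simp add: field_simps del: of_nat_Suc)
  qed
  finally show ?thesis by (simp add: A_def)
qed

declare sum_of_bool_eq [simp del]

section \<open>Entries of the structure morphisms\<close>

lemma polyfam_symmetrizer [intro]: "polyfam n n (\<lambda>_. symmetrizer n)"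
  by (rule polyfam_const) (rule bhom_symmetrizer)

lemma polyfam_bid [intro]: "polyfam n n (\<lambda>_. bid n)"
  by (rule polyfam_const) (rule bhom_bid)

lemma entry_symmetrizer_words:
  "u \<in> words N n \<Longrightarrow> v \<in> words N n \<Longrightarrow> entry (symmetrizer n) u v = symker (mset u) (mset v)"
  by (simp add: entry_symmetrizer length_words)

lemma sum_symker_swap:
  assumes "u \<in> words N n"
  shows "(\<Sum>w\<in>words N n. symker (mset u) (mset w) * symker (mset w + A) B) = symker (mset u + A) B"
    and "(\<Sum>w\<in>words N n. symker (mset u) (mset w) * symker (A + mset w) B) = symker (A + mset u) B"
    and "(\<Sum>w\<in>words N n. symker (mset u) (mset w) * symker B (mset w + A)) = symker B (mset u + A)"
    and "(\<Sum>w\<in>words N n. symker (mset u) (mset w) * symker B (A + mset w)) = symker B (A + mset u)"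
  using sum_symker(3)[OF assms, of "\<lambda>M. symker (M + A) B"] sum_symker(3)[OF assms, of "\<lambda>M. symker (A + M) B"]
    sum_symker(3)[OF assms, of "\<lambda>M. symker B (M + A)"] sum_symker(3)[OF assms, of "\<lambda>M. symker B (A + M)"]
  by auto

lemma multiplication_eq: "multiplication t p q = symmetrizer (p + q)"
proof (rule polyfam_eqI[where X = "\<lambda>t. multiplication t p q" and Y = "\<lambda>_. symmetrizer (p + q)"])
  show "polyfam (p + q) (p + q) (\<lambda>t. multiplication t p q)"
    unfolding multiplication_def by (rule polyfam_bcomp polyfam_btensor polyfam_symmetrizer)+
  show "polyfam (p + q) (p + q) (\<lambda>_. symmetrizer (p + q))" by blast
  fix N u v assume uv: "u \<in> words N (p + q)" "v \<in> words N (p + q)"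
  obtain a b where u: "a \<in> words N p" "b \<in> words N q" "u = a @ b" using uv(1) by (rule words_split)
  have "entry (multiplication (of_nat N) p q) u v = (\<Sum>a'\<in>words N p. \<Sum>b'\<in>words N q.
      symker (mset a) (mset a') * (symker (mset b) (mset b') * symker (mset a' + mset b') (mset v)))"
    unfolding multiplication_def using u uv
    by (subst entry_bcomp[OF bhom_btensor[OF bhom_symmetrizer bhom_symmetrizer] bhom_symmetrizer])
      (auto simp: sum_words_add entry_btensor[OF bhom_symmetrizer bhom_symmetrizer] length_words
        entry_symmetrizer mult.assoc)
  also have "\<dots> = (\<Sum>a'\<in>words N p. symker (mset a) (mset a') * symker (mset a' + mset b) (mset v))"
    using u sum_symker(3)[OF u(2), of "\<lambda>M. symker (mset _ + M) (mset v)"]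
    by (simp add: sum_distrib_left[symmetric])
  also have "\<dots> = symker (mset a + mset b) (mset v)"
    by (rule sum_symker(3)[OF u(1), of "\<lambda>M. symker (M + mset b) (mset v)"])
  finally show "entry (multiplication (of_nat N) p q) u v = entry (symmetrizer (p + q)) u v"
    using u uv by (simp add: entry_symmetrizer_words)
qed

lemma symmetrizer_idem: "symmetrizer n \<odot>\<^bsub>t\<^esub> symmetrizer n = symmetrizer n"
proof (rule polyfam_eqI[where X = "\<lambda>t. symmetrizer n \<odot>\<^bsub>t\<^esub> symmetrizer n" and Y = "\<lambda>_. symmetrizer n"])
  show "polyfam n n (\<lambda>t. symmetrizer n \<odot>\<^bsub>t\<^esub> symmetrizer n)" "polyfam n n (\<lambda>_. symmetrizer n)"
    by (rule polyfam_bcomp polyfam_symmetrizer)+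
  fix N u v assume uv: "u \<in> words N n" "v \<in> words N n"
  then show "entry (symmetrizer n \<odot>\<^bsub>of_nat N\<^esub> symmetrizer n) u v = entry (symmetrizer n) u v"
    using sum_symker(3)[OF uv(1), of "\<lambda>M. symker M (mset v)"]
    by (simp add: entry_bcomp[OF bhom_symmetrizer bhom_symmetrizer uv] entry_symmetrizer_words cong: sum.cong)
qed

lemma to_front_permutes: "i \<le> q \<Longrightarrow> to_front i permutes {..<Suc q}"
  by (rule inj_imp_permutes) (auto simp: to_front_def inj_on_def split: if_splits)

text \<open>Bringing the letter at position i to the front and contracting it with k succeeds
  exactly if b is c with k inserted at position i.\<close>

lemma entry_contract_front:
  assumes b: "b \<in> words N (Suc q)" and c: "c \<in> words N q" and k: "k < N" and i: "i \<le> q"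
  shows "entry ((bev \<otimes>\<^sub>B bid q) \<odot>\<^bsub>of_nat N\<^esub> (bid 1 \<otimes>\<^sub>B bperm (Suc q) (to_front i))) (k # b) c =
    of_bool (b = permute_list (to_front i) (k # c))"
proof -
  note \<sigma> = to_front_permutes[OF i]
  have f: "bid 1 \<otimes>\<^sub>B bperm (Suc q) (to_front i) \<in> bhom (Suc (Suc q)) (Suc (Suc q))"
    using bhom_btensor[OF bhom_bid[of 1] bhom_bperm[OF \<sigma>]] by simp
  have g: "bev \<otimes>\<^sub>B bid q \<in> bhom (Suc (Suc q)) q"
    using bhom_btensor[OF bhom_bev bhom_bid[of q]] by (simp add: numeral_2_eq_2)
  have kb: "k # b \<in> words N (Suc (Suc q))" using b k by (simp add: Cons_in_words)
  have 1: "entry (bid 1 \<otimes>\<^sub>B bperm (Suc q) (to_front i)) (k # b) (k' # b') =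
      of_bool (k = k') * of_bool (b = permute_list (to_front i) b')" if "b' \<in> words N (Suc q)" for k' b'
    using entry_btensor[OF bhom_bid[of 1] bhom_bperm[OF \<sigma>], of "[k]" "[k']" b b'] that b
    by (simp add: entry_bid entry_bperm_permute[OF \<sigma>] length_words)
  have 2: "entry (bev \<otimes>\<^sub>B bid q) (k' # k'' # c') c = of_bool (k' = k'') * of_bool (c' = c)"
    if "c' \<in> words N q" for k' k'' c'
    using entry_btensor[OF bhom_bev bhom_bid[of q], of "[k', k'']" "[]" c' c] that c
    by (simp add: entry_bev entry_bid length_words)
  have "entry ((bev \<otimes>\<^sub>B bid q) \<odot>\<^bsub>of_nat N\<^esub> (bid 1 \<otimes>\<^sub>B bperm (Suc q) (to_front i))) (k # b) c =
      (\<Sum>k'<N. \<Sum>k''<N. \<Sum>c'\<in>words N q. of_bool (k = k') *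
        (of_bool (k' = k'') * (of_bool (b = permute_list (to_front i) (k'' # c')) * of_bool (c' = c))))"
    by (subst entry_bcomp[OF f g kb c])
      (simp add: sum_words_Suc 1 2 Cons_in_words mult_ac del: One_nat_def cong: sum.cong)
  also have "\<dots> = of_bool (b = permute_list (to_front i) (k # c))"
    using k c by (simp add: sum_distrib_left[symmetric] sum_delta_right)
  finally show ?thesis .
qed

section \<open>Derivations and contractions\<close>

definition leibniz :: "complex \<Rightarrow> nat \<Rightarrow> morphism" where
  "leibniz t q = (\<Sum>i\<le>q. (bev \<otimes>\<^sub>B bid q) \<odot>\<^bsub>t\<^esub> (bid 1 \<otimes>\<^sub>B bperm (Suc q) (to_front i)))"

lemma polyfam_leibniz: "polyfam (Suc (Suc q)) q (\<lambda>t. leibniz t q)"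
proof -
  have "polyfam (Suc (Suc q)) q (\<lambda>t. (bev \<otimes>\<^sub>B bid q) \<odot>\<^bsub>t\<^esub> (bid 1 \<otimes>\<^sub>B bperm (Suc q) (to_front i)))"
    if "i \<le> q" for i
  proof (rule polyfam_bcomp)
    show "polyfam (Suc (Suc q)) (Suc (Suc q)) (\<lambda>_. bid 1 \<otimes>\<^sub>B bperm (Suc q) (to_front i))"
      using bhom_btensor[OF bhom_bid[of 1] bhom_bperm[OF to_front_permutes[OF that]]] by auto
    show "polyfam (Suc (Suc q)) q (\<lambda>_. bev \<otimes>\<^sub>B bid q)"
      using bhom_btensor[OF bhom_bev bhom_bid[of q]] by (auto simp: numeral_2_eq_2)
  qed
  then show ?thesis unfolding leibniz_def by (intro polyfam_sum) auto
qed

lemma polyfam_bid_1_symmetrizer: "polyfam (Suc (Suc q)) (Suc (Suc q)) (\<lambda>_. bid 1 \<otimes>\<^sub>B symmetrizer (Suc q))"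
  using bhom_btensor[OF bhom_bid[of 1] bhom_symmetrizer[of "Suc q"]] by auto

lemma polyfam_derivation: "polyfam (Suc (Suc q)) q (\<lambda>t. derivation t q)"
  unfolding derivation_def leibniz_def[symmetric]
  by (intro polyfam_bcomp[OF _ polyfam_symmetrizer] polyfam_bcomp[OF polyfam_bid_1_symmetrizer] polyfam_leibniz)

text \<open>There are q + 1 places at which k can be inserted into c, and all of them give the same
  multiset; hence the factor.\<close>

lemma entry_derivation:
  assumes b: "b \<in> words N (Suc q)" and c: "c \<in> words N q" and k: "k < N"
  shows "entry (derivation (of_nat N) q) (k # b) c = of_nat (Suc q) * symker (mset b) (add_mset k (mset c))"
proof -
  have kb: "k # b \<in> words N (Suc (Suc q))" using b k by (simp add: Cons_in_words)
  have leib: "entry (leibniz (of_nat N) q) (k' # b') c' =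
      (\<Sum>i\<le>q. of_bool (b' = permute_list (to_front i) (k' # c')))"
    if "b' \<in> words N (Suc q)" "c' \<in> words N q" "k' < N" for k' b' c'
    unfolding leibniz_def using that
    by (simp only: entry_sum) (simp add: entry_contract_front del: One_nat_def)
  have sym: "entry (bid 1 \<otimes>\<^sub>B symmetrizer (Suc q)) (k # b) (k' # b') =
      of_bool (k = k') * symker (mset b) (mset b')" if "b' \<in> words N (Suc q)" for k' b'
    using entry_btensor[OF bhom_bid[of 1] bhom_symmetrizer[of "Suc q"], of "[k]" "[k']" b b'] that b
    by (simp add: entry_bid entry_symmetrizer_words length_words)
  have inner: "entry (leibniz (of_nat N) q \<odot>\<^bsub>of_nat N\<^esub> (bid 1 \<otimes>\<^sub>B symmetrizer (Suc q))) (k # b) c' =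
      of_nat (Suc q) * symker (mset b) (add_mset k (mset c'))" if c': "c' \<in> words N q" for c'
  proof -
    have perm: "permute_list (to_front i) (k # c') \<in> words N (Suc q)"
      "mset (permute_list (to_front i) (k # c')) = add_mset k (mset c')" if "i \<le> q" for i
    proof -
      have "to_front i permutes {..<length (k # c')}"
        using to_front_permutes[OF that] length_words[OF c'] by simp
      then have "mset (permute_list (to_front i) (k # c')) = mset (k # c')" by (rule mset_permute_list)
      moreover have "k # c' \<in> words N (Suc q)" using k c' by (simp add: Cons_in_words)
      ultimately show "permute_list (to_front i) (k # c') \<in> words N (Suc q)"
        "mset (permute_list (to_front i) (k # c')) = add_mset k (mset c')"
        using permutations_subset_words[of "k # c'" N "Suc q"] by (auto simp: permutations_of_multiset_def)
    qed
    have "entry (leibniz (of_nat N) q \<odot>\<^bsub>of_nat N\<^esub> (bid 1 \<otimes>\<^sub>B symmetrizer (Suc q))) (k # b) c' =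
        (\<Sum>k'<N. of_bool (k = k') * (\<Sum>b'\<in>words N (Suc q). \<Sum>i\<le>q. symker (mset b) (mset b') *
          of_bool (b' = permute_list (to_front i) (k' # c'))))"
      by (subst entry_bcomp[OF polyfam_bhom[OF polyfam_bid_1_symmetrizer] polyfam_bhom[OF polyfam_leibniz] kb c'])
        (subst sum_words_Suc, simp add: leib sym c' sum_distrib_left mult.assoc del: One_nat_def)
    also have "\<dots> = (\<Sum>b'\<in>words N (Suc q). \<Sum>i\<le>q. symker (mset b) (mset b') *
          of_bool (b' = permute_list (to_front i) (k # c')))"
      using k by (simp add: sum_delta_right)
    also have "\<dots> = (\<Sum>i\<le>q. symker (mset b) (add_mset k (mset c')))"
      by (subst sum.swap) (intro sum.cong refl, simp add: sum_delta_right perm)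
    finally show ?thesis by simp
  qed
  have "entry (derivation (of_nat N) q) (k # b) c =
      (\<Sum>c'\<in>words N q. (of_nat (Suc q) * symker (mset b) (add_mset k (mset c'))) * symker (mset c') (mset c))"
    unfolding derivation_def leibniz_def[symmetric]
    by (subst entry_bcomp[OF bhom_bcomp[OF polyfam_bhom[OF polyfam_bid_1_symmetrizer]
          polyfam_bhom[OF polyfam_leibniz]] bhom_symmetrizer kb c])
      (simp add: inner entry_symmetrizer_words c del: One_nat_def of_nat_Suc cong: sum.cong)
  also have "\<dots> = of_nat (Suc q) * symker (mset b) (add_mset k (mset c))"
    by (rule sum_symker(2)[OF c, of "\<lambda>M. of_nat (Suc q) * symker (mset b) (add_mset k M)"])
  finally show ?thesis .
qed

lemma polyfam_bid_derivation:
  "polyfam (Suc p + Suc q) (p + q) (\<lambda>t. bid p \<otimes>\<^sub>B derivation t q)"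
  using polyfam_btensor[OF polyfam_bid[of p] polyfam_derivation[of q]] by simp

lemma polyfam_iterated_derivation: "polyfam (p + q) (q - p) (\<lambda>t. iterated_derivation t p q)"
proof (induction p arbitrary: q)
  case (Suc p)
  show ?case
  proof (cases q)
    case 0
    then show ?thesis by (simp add: polyfam_const)
  next
    case (Suc q')
    then show ?thesis
      using polyfam_bcomp[OF polyfam_bid_derivation[of p q'] Suc.IH[of q']] by simp
  qed
qed (simp add: polyfam_symmetrizer)

lemma entry_iterated_derivation:
  assumes "p \<le> q" "a \<in> words N p" "b \<in> words N q" "c \<in> words N (q - p)"
  shows "entry (iterated_derivation (of_nat N) p q) (a @ b) c =
    fact q / fact (q - p) * symker (mset b) (mset a + mset c)"
  using assms
proof (induction p arbitrary: q a b c)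
  case 0
  then show ?case by (simp add: entry_symmetrizer_words)
next
  case (Suc p)
  obtain q' where q: "q = Suc q'" using Suc.prems by (cases q) auto
  have pq: "p \<le> q'" using Suc.prems q by simp
  \<comment> \<open>The last factor acts first: the recursion applies \<open>derivation\<close> next
    to the polynomial and keeps the first p factors for later, so that a letter is split off at the
    end of a.\<close>
  have "a \<in> words N (p + 1)" using Suc.prems by simp
  then obtain a0 x where "a0 \<in> words N p" "x \<in> words N 1" "a = a0 @ x" by (rule words_split)
  moreover from this obtain i where "x = [i]" "i < N" by (metis One_nat_def words_SucE words_0 singletonD)
  ultimately have a: "a0 \<in> words N p" "i < N" "a = a0 @ [i]" by auto
  have b: "b \<in> words N (Suc q')" and c: "c \<in> words N (q' - p)" using Suc.prems q by auto
  have ab: "a @ b \<in> words N (Suc p + Suc q')" using append_in_words[OF Suc.prems(2) b] .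
  have tens: "entry (bid p \<otimes>\<^sub>B derivation (of_nat N) q') (a @ b) (a' @ b') =
      of_bool (a0 = a') * (of_nat (Suc q') * symker (mset b) (add_mset i (mset b')))"
    if "a' \<in> words N p" "b' \<in> words N q'" for a' b'
    using entry_btensor[OF bhom_bid[of p] polyfam_bhom[OF polyfam_derivation[of q'], of "of_nat N"], of a0 a' "i # b" b']
      that a b by (simp add: entry_bid entry_derivation length_words)
  have a0c: "a0 @ c \<in> words N q'" using append_in_words[OF a(1) c] pq by simp
  have "entry (iterated_derivation (of_nat N) (Suc p) (Suc q')) (a @ b) c =
      (\<Sum>b'\<in>words N q'. of_nat (Suc q') * symker (mset b) (add_mset i (mset b')) *
        (fact q' / fact (q' - p) * symker (mset b') (mset (a0 @ c))))"
  proof -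
    have "entry (iterated_derivation (of_nat N) (Suc p) (Suc q')) (a @ b) c =
      (\<Sum>a'\<in>words N p. of_bool (a0 = a') * (\<Sum>b'\<in>words N q'. of_nat (Suc q') * symker (mset b) (add_mset i (mset b')) *
        entry (iterated_derivation (of_nat N) p q') (a' @ b') c))"
      unfolding iterated_derivation.simps
      by (subst entry_bcomp[OF polyfam_bhom[OF polyfam_bid_derivation] polyfam_bhom[OF polyfam_iterated_derivation] ab c])
        (simp add: sum_words_add tens sum_distrib_left mult.assoc del: of_nat_Suc cong: sum.cong)
    then show ?thesis using Suc.IH[OF pq a(1) _ c] a(1)
      by (simp add: sum_delta_right del: of_nat_Suc cong: sum.cong)
  qed
  also have "\<dots> = of_nat (Suc q') * (fact q' / fact (q' - p)) *
      (\<Sum>b'\<in>words N q'. symker (mset b) (add_mset i (mset b')) * symker (mset b') (mset (a0 @ c)))"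
    by (simp add: sum_distrib_left mult_ac del: of_nat_Suc)
  also have "(\<Sum>b'\<in>words N q'. symker (mset b) (add_mset i (mset b')) * symker (mset b') (mset (a0 @ c))) =
      symker (mset b) (add_mset i (mset (a0 @ c)))"
    by (rule sum_symker(2)[OF a0c, of "\<lambda>M. symker (mset b) (add_mset i M)"])
  finally show ?case unfolding q a(3) by simp
qed

lemma polyfam_contraction: "polyfam (p + q) (q - p) (\<lambda>t. contraction t p q)"
  unfolding contraction_def
  by (rule polyfam_bcomp polyfam_btensor polyfam_iterated_derivation polyfam_symmetrizer)+

lemma iterated_derivation_eq_0: "q < p \<Longrightarrow> iterated_derivation t p q = 0"
  by (induction t p q rule: iterated_derivation.induct) auto

lemma contraction_eq_0: "q < p \<Longrightarrow> contraction t p q = 0"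
  by (simp add: contraction_def iterated_derivation_eq_0)

lemma entry_contraction:
  assumes pq: "p \<le> q" and a: "a \<in> words N p" and b: "b \<in> words N q" and c: "c \<in> words N (q - p)"
  shows "entry (contraction (of_nat N) p q) (a @ b) c =
    fact q / fact (q - p) * symker (mset b) (mset a + mset c)"
proof -
  let ?F = "fact q / fact (q - p) :: complex"
  have "entry (contraction (of_nat N) p q) (a @ b) c = (\<Sum>a'\<in>words N p. \<Sum>b'\<in>words N q.
      (symker (mset a) (mset a') * symker (mset b) (mset b')) * (?F * symker (mset b') (mset a' + mset c)))"
    unfolding contraction_def using pq a b c
    by (subst entry_bcomp[OF bhom_btensor[OF bhom_symmetrizer bhom_symmetrizer]
          polyfam_bhom[OF polyfam_iterated_derivation] append_in_words[OF a b] c])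
      (simp add: sum_words_add entry_btensor[OF bhom_symmetrizer bhom_symmetrizer]
        entry_symmetrizer_words entry_iterated_derivation length_words cong: sum.cong)
  also have "\<dots> = ?F * (\<Sum>a'\<in>words N p. symker (mset a) (mset a') *
      (\<Sum>b'\<in>words N q. symker (mset b) (mset b') * symker (mset b') (mset a' + mset c)))"
    by (simp add: sum_distrib_left mult_ac)
  also have "\<dots> = ?F * (\<Sum>a'\<in>words N p. symker (mset a) (mset a') * symker (mset b) (mset a' + mset c))"
    by (simp add: sum_symker(3)[OF b, of "\<lambda>M. symker M _"])
  also have "\<dots> = ?F * symker (mset b) (mset a + mset c)"
    by (simp add: sum_symker(3)[OF a, of "\<lambda>M. symker (mset b) (M + mset c)"])
  finally show ?thesis .
qed

lemma polyfam_action: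
  assumes x: "polyfam 0 (r + s) x"
  shows "polyfam q (r + (q - s)) (\<lambda>t. action t r s (x t) q)"
proof -
  have "polyfam (0 + q) ((r + s) + q) (\<lambda>t. x t \<otimes>\<^sub>B symmetrizer q)"
    using x by (rule polyfam_btensor[OF _ polyfam_symmetrizer])
  moreover have "polyfam (r + (s + q)) (r + (q - s)) (\<lambda>t. symmetrizer r \<otimes>\<^sub>B contraction t s q)"
    by (rule polyfam_btensor[OF polyfam_symmetrizer polyfam_contraction])
  ultimately have "polyfam q (r + (q - s)) (\<lambda>t. (symmetrizer r \<otimes>\<^sub>B contraction t s q) \<odot>\<^bsub>t\<^esub> (x t \<otimes>\<^sub>B symmetrizer q))"
    by (intro polyfam_bcomp) (simp_all add: add.assoc)
  then show ?thesis unfolding action_def multiplication_eq by (rule polyfam_bcomp[OF _ polyfam_symmetrizer])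
qed

lemma action_eq_0: "q < s \<Longrightarrow> action t r s x q = 0"
  by (simp add: action_def contraction_eq_0)

text \<open>The element x is a sum of terms that differentiate by the letters of a2 and multiply by
  the letters of a1; b1 is the part of the monomial that is left untouched. The quotient of
  factorials is that of the s-fold derivative.\<close>

lemma entry_action:
  assumes x: "x \<in> bhom 0 (r + s)" and sq: "s \<le> q"
    and b: "b \<in> words N q" and c: "c \<in> words N (r + (q - s))"
  shows "entry (action (of_nat N) r s x q) b c = fact q / fact (q - s) *
    (\<Sum>a1\<in>words N r. \<Sum>a2\<in>words N s. \<Sum>b1\<in>words N (q - s). entry x [] (a1 @ a2) *
      symker (mset b) (mset a2 + mset b1) * symker (mset a1 + mset b1) (mset c))"
proof -
  let ?F = "fact q / fact (q - s) :: complex" and ?x = "\<lambda>a1 a2. entry x [] (a1 @ a2)"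
  let ?S = "\<lambda>u v. symker (mset u) (mset v)"
  let ?g = "symmetrizer r \<otimes>\<^sub>B contraction (of_nat N) s q" and ?f = "x \<otimes>\<^sub>B symmetrizer q"
  have f: "?f \<in> bhom q ((r + s) + q)"
    using bhom_btensor[OF x bhom_symmetrizer[of q]] by simp
  have g: "?g \<in> bhom ((r + s) + q) (r + (q - s))"
    using bhom_btensor[OF bhom_symmetrizer[of r] polyfam_bhom[OF polyfam_contraction[of s q]]]
    by (simp add: add.assoc)
  have ef: "entry ?f b ((a1 @ a2) @ b') = ?x a1 a2 * ?S b b'"
    if "a1 \<in> words N r" "a2 \<in> words N s" "b' \<in> words N q" for a1 a2 b'
    using entry_btensor[OF x bhom_symmetrizer[of q], of "[]" "a1 @ a2" b b'] that b
    by (simp add: length_words entry_symmetrizer_words)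
  have eg: "entry ?g ((a1 @ a2) @ b') (c1 @ b1) = ?S a1 c1 * (?F * symker (mset b') (mset a2 + mset b1))"
    if "a1 \<in> words N r" "a2 \<in> words N s" "b' \<in> words N q" "c1 \<in> words N r" "b1 \<in> words N (q - s)"
    for a1 a2 b' c1 b1
    using entry_btensor[OF bhom_symmetrizer[of r] polyfam_bhom[OF polyfam_contraction[of s q], of "of_nat N"], of a1 c1 "a2 @ b'" b1]
      that by (simp add: length_words entry_symmetrizer_words entry_contraction[OF sq])
  have inner: "entry (?g \<odot>\<^bsub>of_nat N\<^esub> ?f) b (c1 @ b1) =
      (\<Sum>a1\<in>words N r. \<Sum>a2\<in>words N s. ?x a1 a2 * ?S a1 c1 * (?F * symker (mset b) (mset a2 + mset b1)))"
    if c1: "c1 \<in> words N r" and b1: "b1 \<in> words N (q - s)" for c1 b1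
  proof -
    have "entry (?g \<odot>\<^bsub>of_nat N\<^esub> ?f) b (c1 @ b1) = (\<Sum>a1\<in>words N r. \<Sum>a2\<in>words N s. \<Sum>b'\<in>words N q.
        (?x a1 a2 * ?S b b') * (?S a1 c1 * (?F * symker (mset b') (mset a2 + mset b1))))"
      by (subst entry_bcomp[OF f g b append_in_words[OF c1 b1]])
        (simp add: sum_words_add ef eg c1 b1 del: append_assoc cong: sum.cong)
    also have "\<dots> = (\<Sum>a1\<in>words N r. \<Sum>a2\<in>words N s. ?x a1 a2 * ?S a1 c1 *
        (?F * (\<Sum>b'\<in>words N q. ?S b b' * symker (mset b') (mset a2 + mset b1))))"
      by (simp add: sum_distrib_left mult_ac)
    also have "\<dots> = (\<Sum>a1\<in>words N r. \<Sum>a2\<in>words N s. ?x a1 a2 * ?S a1 c1 * (?F * symker (mset b) (mset a2 + mset b1)))"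
      by (simp add: sum_symker(3)[OF b, of "\<lambda>M. symker M _"])
    finally show ?thesis .
  qed
  have "entry (action (of_nat N) r s x q) b c =
      (\<Sum>c1\<in>words N r. \<Sum>b1\<in>words N (q - s). (\<Sum>a1\<in>words N r. \<Sum>a2\<in>words N s.
        ?x a1 a2 * ?S a1 c1 * (?F * symker (mset b) (mset a2 + mset b1))) * symker (mset c1 + mset b1) (mset c))"
    unfolding action_def multiplication_eq using c
    by (subst entry_bcomp[OF bhom_bcomp[OF f g] bhom_symmetrizer b c])
      (simp add: sum_words_add inner c entry_symmetrizer_words append_in_words cong: sum.cong)
  also have "\<dots> = (\<Sum>c1\<in>words N r. \<Sum>b1\<in>words N (q - s). \<Sum>a1\<in>words N r. \<Sum>a2\<in>words N s.
        ?F * ?x a1 a2 * symker (mset b) (mset a2 + mset b1) * (?S a1 c1 * symker (mset c1 + mset b1) (mset c)))"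
    by (simp add: sum_distrib_right sum_distrib_left mult_ac)
  also have "\<dots> = (\<Sum>b1\<in>words N (q - s). \<Sum>a1\<in>words N r. \<Sum>a2\<in>words N s. \<Sum>c1\<in>words N r.
        ?F * ?x a1 a2 * symker (mset b) (mset a2 + mset b1) * (?S a1 c1 * symker (mset c1 + mset b1) (mset c)))"
    by (rule trans[OF sum.swap], rule sum.cong[OF refl], rule trans[OF sum.swap],
        rule sum.cong[OF refl], rule sum.swap)
  also have "\<dots> = (\<Sum>b1\<in>words N (q - s). \<Sum>a1\<in>words N r. \<Sum>a2\<in>words N s.
        ?F * ?x a1 a2 * symker (mset b) (mset a2 + mset b1) * symker (mset a1 + mset b1) (mset c))"
    by (intro sum.cong refl) (simp only: sum_distrib_left[symmetric] sum_symker_swap(1))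
  also have "\<dots> = (\<Sum>a1\<in>words N r. \<Sum>a2\<in>words N s. \<Sum>b1\<in>words N (q - s).
        ?F * ?x a1 a2 * symker (mset b) (mset a2 + mset b1) * symker (mset a1 + mset b1) (mset c))"
    by (rule trans[OF sum.swap], rule sum.cong[OF refl], rule sum.swap)
  also have "\<dots> = ?F * (\<Sum>a1\<in>words N r. \<Sum>a2\<in>words N s. \<Sum>b1\<in>words N (q - s).
        ?x a1 a2 * symker (mset b) (mset a2 + mset b1) * symker (mset a1 + mset b1) (mset c))"
    by (simp add: sum_distrib_left mult.assoc)
  finally show ?thesis .
qed

section \<open>The operators of the Weil representation\<close>

lemma op_action_single: "op_action t (Poly_Mapping.single p c) q = action t p p c q"
  by (cases "c = 0") (auto simp: op_action_def action_def)

lemma words_2: "words N 2 = words N (Suc (Suc 0))" by (simp add: numeral_2_eq_2)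

lemma sum_coevaluation:
  "(\<Sum>w\<in>words N 2. entry bcoev [] w * F w) = (\<Sum>i<N. F [i, i])"
  unfolding words_2 sum_words_Suc by (simp add: entry_bcoev sum_delta_right)

text \<open>The contracted letter i and the remaining word b1 together run through all words of
  length q, and the factor q!/(q-1)! is the eigenvalue. In degree 0 the derivation vanishes.\<close>

lemma Euler_action: "op_action t Euler q = of_nat q \<cdot>\<^sub>B symmetrizer q"
proof (cases q)
  case 0
  then show ?thesis by (simp add: Euler_def op_action_single action_eq_0)
next
  case (Suc p)
  have "action t 1 1 bcoev q = of_nat q \<cdot>\<^sub>B symmetrizer q"
  proof (rule polyfam_eqI[where X = "\<lambda>t. action t 1 1 bcoev q" and Y = "\<lambda>_. of_nat q \<cdot>\<^sub>B symmetrizer q"])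
    have coev: "bcoev \<in> bhom 0 (1 + 1)" using bhom_bcoev unfolding one_add_one .
    have q: "1 + (q - 1) = q" using Suc by simp
    show "polyfam q q (\<lambda>t. action t 1 1 bcoev q)"
      using polyfam_action[OF polyfam_const[OF coev], of q] unfolding q .
    show "polyfam q q (\<lambda>_. of_nat q \<cdot>\<^sub>B symmetrizer q)" by blast
    fix N b c assume b: "b \<in> words N q" and c: "c \<in> words N q"
    have c': "c \<in> words N (1 + (q - 1))" using c unfolding q .
    have "entry (action (of_nat N) 1 1 bcoev q) b c = fact q / fact (q - 1) *
        (\<Sum>i<N. \<Sum>j<N. of_bool (i = j) * (\<Sum>b1\<in>words N p.
          symker (mset b) (add_mset j (mset b1)) * symker (add_mset i (mset b1)) (mset c)))"
      using Suc by (subst entry_action[OF coev _ b c'])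
        (simp_all add: sum_words_Suc entry_bcoev sum_distrib_left mult.assoc)
    also have "\<dots> = of_nat q * (\<Sum>i<N. \<Sum>b1\<in>words N p.
          symker (mset b) (add_mset i (mset b1)) * symker (add_mset i (mset b1)) (mset c))"
      by (simp add: sum_delta_right Suc)
    also have "(\<Sum>i<N. \<Sum>b1\<in>words N p.
          symker (mset b) (add_mset i (mset b1)) * symker (add_mset i (mset b1)) (mset c)) =
        (\<Sum>w\<in>words N q. symker (mset b) (mset w) * symker (mset w) (mset c))"
      by (simp add: Suc sum_words_Suc)
    also have "\<dots> = symker (mset b) (mset c)"
      by (rule sum_symker(2)[OF c, of "symker (mset b)"])
    finally show "entry (action (of_nat N) 1 1 bcoev q) b c = entry (of_nat q \<cdot>\<^sub>B symmetrizer q) b c"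
      using b c by (simp add: entry_symmetrizer_words)
  qed
  then show ?thesis by (simp add: Euler_def op_action_single)
qed

lemma bhom_bcoev_action: "bcoev \<in> bhom 0 (2 + 0)" "bcoev \<in> bhom 0 (0 + 2)"
  using bhom_bcoev by (simp_all only: add_0_left add_0_right)

lemma polyfam_Theta: "polyfam q (2 + q) (\<lambda>t. Theta t q)"
  unfolding Theta_def
  using polyfam_action[OF polyfam_const[OF bhom_bcoev_action(1)], of q] by auto

lemma polyfam_Delta: "polyfam q (q - 2) (\<lambda>t. Delta t q)"
  unfolding Delta_def
  using polyfam_action[OF polyfam_const[OF bhom_bcoev_action(2)], of q] by auto

lemma Delta_eq_0: "q < 2 \<Longrightarrow> Delta t q = 0"
  by (simp add: Delta_def action_eq_0)

lemma entry_Theta: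
  assumes b: "b \<in> words N q" and c: "c \<in> words N (2 + q)"
  shows "entry (Theta (of_nat N) q) b c = 1 / 2 * (\<Sum>i<N. symker ({#i, i#} + mset b) (mset c))"
proof -
  have c': "c \<in> words N (2 + (q - 0))" using c by simp
  have "entry (action (of_nat N) 2 0 bcoev q) b c = (\<Sum>a\<in>words N 2. entry bcoev [] a * (\<Sum>b1\<in>words N q.
      symker (mset b) (mset b1) * symker (mset a + mset b1) (mset c)))"
    by (subst entry_action[OF bhom_bcoev_action(1) _ b c']) (simp_all add: sum_distrib_left mult.assoc)
  also have "\<dots> = (\<Sum>i<N. symker (mset [i, i] + mset b) (mset c))"
    unfolding sum_symker_swap(2)[OF b] by (rule sum_coevaluation)
  finally show ?thesis by (simp add: Theta_def)
qed

lemma entry_Delta: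
  assumes q: "2 \<le> q" and b: "b \<in> words N q" and c: "c \<in> words N (q - 2)"
  shows "entry (Delta (of_nat N) q) b c =
    1 / 2 * (fact q / fact (q - 2)) * (\<Sum>i<N. symker (mset b) ({#i, i#} + mset c))"
proof -
  have c': "c \<in> words N (0 + (q - 2))" using c by simp
  have "entry (action (of_nat N) 0 2 bcoev q) b c = fact q / fact (q - 2) * (\<Sum>a\<in>words N 2. entry bcoev [] a *
      (\<Sum>b1\<in>words N (q - 2). symker (mset b) (mset a + mset b1) * symker (mset b1) (mset c)))"
    using q by (subst entry_action[OF bhom_bcoev_action(2) _ b c']) (simp_all add: sum_distrib_left mult.assoc)
  also have "\<dots> = fact q / fact (q - 2) * (\<Sum>a\<in>words N 2. entry bcoev [] a * symker (mset b) (mset a + mset c))"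
    using sum_symker(2)[OF c, of "\<lambda>M. symker (mset b) (mset _ + M)"] by simp
  also have "\<dots> = fact q / fact (q - 2) * (\<Sum>i<N. symker (mset b) (mset [i, i] + mset c))"
    by (subst sum_coevaluation) (rule refl)
  finally show ?thesis by (simp add: Delta_def)
qed

text \<open>This is \<Theta>\<Delta>. For q < 2 the truncated difference does no harm, since
  \<open>Delta\<close> is zero there.\<close>

definition raise_lower :: "complex \<Rightarrow> nat \<Rightarrow> morphism" where
  "raise_lower t q = Theta t (q - 2) \<odot>\<^bsub>t\<^esub> Delta t q"

lemma raise_lower_eq_0: "q < 2 \<Longrightarrow> raise_lower t q = 0"
  by (simp add: raise_lower_def Delta_eq_0)

lemma polyfam_raise_lower: "polyfam q q (\<lambda>t. raise_lower t q)"
proof (cases "q < 2")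
  case True
  then show ?thesis by (simp add: raise_lower_eq_0 polyfam_const)
next
  case False
  then have "2 + (q - 2) = q" by simp
  then show ?thesis
    unfolding raise_lower_def using polyfam_bcomp[OF polyfam_Delta polyfam_Theta, of q] by simp
qed

lemma entry_raise_lower:
  assumes q: "2 \<le> q" and b: "b \<in> words N q" and c: "c \<in> words N q"
  shows "entry (raise_lower (of_nat N) q) b c = 1 / 4 * (fact q / fact (q - 2)) *
    (\<Sum>e\<in>words N (q - 2). (\<Sum>i<N. symker (mset b) ({#i, i#} + mset e)) *
      (\<Sum>k<N. symker ({#k, k#} + mset e) (mset c)))"
proof -
  have c': "c \<in> words N (2 + (q - 2))" using c q by (simp only: le_add_diff_inverse)
  show ?thesis
    unfolding raise_lower_def using q b c
    by (subst entry_bcomp[OF polyfam_bhom[OF polyfam_Delta] polyfam_bhom[OF polyfam_Theta] b c'])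
      (simp add: entry_Delta[OF q b] entry_Theta[OF _ c'] sum_distrib_left sum_divide_distrib mult_ac
        cong: sum.cong, rule sum.cong[OF refl], rule sum.swap)
qed

lemma Casimir_eq: "Casimir t d = (of_nat d * (of_nat d + t - 2)) \<cdot>\<^sub>B symmetrizer d - 4 \<cdot>\<^sub>B raise_lower t d"
proof -
  have "Casimir t d = (of_nat d * of_nat d + t * of_nat d - 2 * of_nat d) \<cdot>\<^sub>B symmetrizer d - 4 \<cdot>\<^sub>B raise_lower t d"
    unfolding Casimir_def Let_def Euler_action raise_lower_def[symmetric]
    by (simp add: bcomp_bscale_left[OF bhom_symmetrizer bhom_symmetrizer]
        bcomp_bscale_right[OF bhom_symmetrizer bhom_symmetrizer] symmetrizer_idem
        bcomp_bscale_left[OF bhom_bscale[OF bhom_symmetrizer] bhom_symmetrizer]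
        bscale_left_distrib bscale_diff_left)
  then show ?thesis by (simp add: algebra_simps)
qed

text \<open>
  On a function of multisets \<open>M\<close>, viewed as coefficients of divided powers, these are \<open>2\<Delta>\<close> and
  \<open>2\<Theta>\<close>.
\<close>

definition lower :: "nat \<Rightarrow> (nat multiset \<Rightarrow> complex) \<Rightarrow> nat multiset \<Rightarrow> complex" where
  "lower N f M = (\<Sum>i<N. f ({#i, i#} + M))"

definition raise :: "nat \<Rightarrow> (nat multiset \<Rightarrow> complex) \<Rightarrow> nat multiset \<Rightarrow> complex" where
  "raise N f M = (\<Sum>i<N. of_nat (count M i) * (of_nat (count M i) - 1) * f (M - {#i, i#}))"

lemma size_eq_sum_count:
  fixes M :: "nat multiset"
  assumes "set_mset M \<subseteq> {..<N}"
  shows "size M = (\<Sum>i<N. count M i)"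
  unfolding size_multiset_overloaded_eq using assms
  by (intro sum.mono_neutral_left finite_lessThan) (auto simp: count_eq_zero_iff)

lemma pair_subset: "of_nat (count M i) * (of_nat (count M i) - 1 :: complex) \<noteq> 0 \<Longrightarrow> {#i, i#} \<subseteq># M"
proof -
  assume nz: "of_nat (count M i) * (of_nat (count M i) - 1 :: complex) \<noteq> 0"
  have "count M i \<noteq> 0" using nz by (metis mult_zero_left of_nat_0)
  moreover have "count M i \<noteq> 1" using nz by auto
  ultimately have "2 \<le> count M i" by linarith
  then show ?thesis by (auto intro!: mset_subset_eqI)
qed

lemma raise_add: "raise N (\<lambda>M. f M + g M) M = raise N f M + raise N g M"
  by (simp add: raise_def sum.distrib distrib_left)

lemma raise_mult_left: "raise N (\<lambda>M. k * f M) M = k * raise N f M"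
  by (simp add: raise_def sum_distrib_left mult_ac)

lemma raise_cong:
  assumes "\<And>i. i < N \<Longrightarrow> {#i, i#} \<subseteq># M \<Longrightarrow> f (M - {#i, i#}) = g (M - {#i, i#})"
  shows "raise N f M = raise N g M"
  unfolding raise_def using assms pair_subset[of M]
  by (intro sum.cong refl) (metis lessThan_iff mult_zero_left)

text \<open>The relation [\<Delta>, \<Theta>] = E + t/2, scaled by 4. Only the terms with equal
  letters contribute to the commutator, by (c+2)(c+1) - c(c-1) = 4c + 2, and the multiplicities c
  sum to the degree.\<close>

lemma lower_raise:
  assumes M: "set_mset M \<subseteq> {..<N}"
  shows "lower N (raise N f) M =
    raise N (lower N f) M + (4 * of_nat (size M) + 2 * of_nat N) * f M"
proof -
  let ?c = "\<lambda>i. of_nat (count M i) :: complex"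
  have "raise N f ({#i, i#} + M) =
      (\<Sum>j<N. ?c j * (?c j - 1) * f ({#i, i#} + (M - {#j, j#}))) + (4 * ?c i + 2) * f M" if i: "i < N" for i
  proof -
    let ?c' = "\<lambda>j. of_nat (count ({#i, i#} + M) j) :: complex"
    have "?c' j * (?c' j - 1) * f ({#i, i#} + M - {#j, j#}) =
        ?c j * (?c j - 1) * f ({#i, i#} + (M - {#j, j#})) + (if j = i then (4 * ?c i + 2) * f M else 0)" for j
    proof (cases "{#j, j#} \<subseteq># M")
      case True
      then have "{#i, i#} + M - {#j, j#} = {#i, i#} + (M - {#j, j#})" by (rule multiset_diff_union_assoc)
      moreover have "{#i, i#} + (M - {#j, j#}) = M" if "j = i"
        using True unfolding that by (rule subset_mset.add_diff_inverse)
      ultimately show ?thesis by (auto simp: algebra_simps)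
    next
      case False
      then have 0: "?c j * (?c j - 1) = 0" using pair_subset[of M j] by blast
      show ?thesis
      proof (cases "j = i")
        case True
        have "?c' i = ?c i + 2" "{#i, i#} + M - {#i, i#} = M" by simp_all
        moreover have "(?c i + 2) * (?c i + 2 - 1) = ?c i * (?c i - 1) + (4 * ?c i + 2)" by (simp add: algebra_simps)
        ultimately show ?thesis using 0 unfolding True by (simp only: mult_zero_left add_0_left refl if_True)
      next
        case False
        then have "?c' j = ?c j" by simp
        then show ?thesis using False by (simp only: 0 mult_zero_left if_False add_0_right)
      qed
    qed
    then show ?thesis using i by (simp add: raise_def sum.distrib)
  qed
  then have "lower N (raise N f) M =
      (\<Sum>i<N. \<Sum>j<N. ?c j * (?c j - 1) * f ({#i, i#} + (M - {#j, j#}))) + (\<Sum>i<N. (4 * ?c i + 2) * f M)"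
    by (simp add: lower_def sum.distrib)
  also have "(\<Sum>i<N. \<Sum>j<N. ?c j * (?c j - 1) * f ({#i, i#} + (M - {#j, j#}))) = raise N (lower N f) M"
    by (subst sum.swap) (simp add: raise_def lower_def sum_distrib_left)
  also have "(\<Sum>i<N. (4 * ?c i + 2) * f M) = (4 * of_nat (size M) + 2 * of_nat N) * f M"
    by (simp add: size_eq_sum_count[OF M] sum_distrib_left sum_distrib_right sum.distrib algebra_simps)
  finally show ?thesis .
qed

text \<open>The usual sl2 formula: [\<Delta>, \<Theta>^(j+1)] is (j+1)\<Theta>^j (E + t/2 + j). The
  value at M uses f in degree |M| - 2j, on which E + j is |M| - j.\<close>

lemma lower_raise_power:
  assumes "set_mset M \<subseteq> {..<N}"
  shows "lower N ((raise N ^^ Suc j) f) M = (raise N ^^ Suc j) (lower N f) M +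
    4 * of_nat (Suc j) * (of_nat (size M) - of_nat j + of_nat N / 2) * (raise N ^^ j) f M"
  using assms
proof (induction j arbitrary: M)
  case 0
  then show ?case by (simp add: lower_raise algebra_simps)
next
  case (Suc j)
  let ?K = "4 * of_nat (Suc j) * (of_nat (size M) - 2 - of_nat j + of_nat N / 2) :: complex"
  have "raise N (lower N ((raise N ^^ Suc j) f)) M =
      raise N (\<lambda>M'. (raise N ^^ Suc j) (lower N f) M' + ?K * (raise N ^^ j) f M') M"
  proof (rule raise_cong)
    fix i assume i: "{#i, i#} \<subseteq># M"
    then have "size M = size (M - {#i, i#}) + 2"
      by (metis size_Diff_submset size_mset_mono le_add_diff_inverse2 size_add_mset size_empty numeral_2_eq_2)
    then have "of_nat (size (M - {#i, i#})) = (of_nat (size M) - 2 :: complex)" by simp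
    moreover have "set_mset (M - {#i, i#}) \<subseteq> {..<N}" using Suc.prems by (meson in_diffD subset_iff)
    ultimately show "lower N ((raise N ^^ Suc j) f) (M - {#i, i#}) =
        (raise N ^^ Suc j) (lower N f) (M - {#i, i#}) + ?K * (raise N ^^ j) f (M - {#i, i#})"
      using Suc.IH by presburger
  qed
  also have "\<dots> = (raise N ^^ Suc (Suc j)) (lower N f) M + ?K * (raise N ^^ Suc j) f M"
    by (simp only: raise_add raise_mult_left funpow.simps o_apply)
  finally have "lower N ((raise N ^^ Suc (Suc j)) f) M = (raise N ^^ Suc (Suc j)) (lower N f) M +
      ?K * (raise N ^^ Suc j) f M + (4 * of_nat (size M) + 2 * of_nat N) * (raise N ^^ Suc j) f M"
    using lower_raise[OF Suc.prems, of "(raise N ^^ Suc j) f"] by simp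
  then show ?case by (simp add: algebra_simps)
qed

lemma sum_lower_power:
  "(\<Sum>I\<in>words N j. f (mset I + mset I + M)) = (lower N ^^ j) f M"
proof (induction j arbitrary: M)
  case (Suc j)
  have "(\<Sum>I\<in>words N (Suc j). f (mset I + mset I + M)) =
      (\<Sum>i<N. \<Sum>I\<in>words N j. f (mset I + mset I + ({#i, i#} + M)))"
    by (simp add: sum_words_Suc add_ac)
  also have "\<dots> = lower N ((lower N ^^ j) f) M" unfolding lower_def[of N "(lower N ^^ j) f"] by (simp only: Suc.IH)
  finally show ?case by simp
qed simp

lemma sum_raise:
  assumes c: "c \<in> words N (Suc (Suc q))"
  shows "(\<Sum>e\<in>words N q. f (mset e) * (\<Sum>i<N. symker ({#i, i#} + mset e) (mset c))) =
    fact q / fact (Suc (Suc q)) * raise N f (mset c)"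
proof -
  have "(\<Sum>e\<in>words N q. f (mset e) * symker ({#i, i#} + mset e) (mset c)) =
      fact q / fact (Suc (Suc q)) * (of_nat (count (mset c) i) * (of_nat (count (mset c) i) - 1) * f (mset c - {#i, i#}))"
    if i: "i < N" for i
  proof -
    \<comment> \<open>The two letters i are removed from c one at a time: the reproducing property
      inserts an intermediate word w, and \<open>sum_symker_add_mset\<close> is applied on either
      side of it.\<close>
    have "(\<Sum>e\<in>words N q. f (mset e) * symker ({#i, i#} + mset e) (mset c)) =
        (\<Sum>e\<in>words N q. f (mset e) * (\<Sum>w\<in>words N (Suc q).
          symker (add_mset i (mset e)) (mset w) * symker (add_mset i (mset w)) (mset c)))"
    proof (intro sum.cong refl arg_cong2[where f = "(*)"])
      fix e assume "e \<in> words N q"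
      then have "i # e \<in> words N (Suc q)" using i by (simp add: Cons_in_words)
      then show "symker ({#i, i#} + mset e) (mset c) = (\<Sum>w\<in>words N (Suc q).
          symker (add_mset i (mset e)) (mset w) * symker (add_mset i (mset w)) (mset c))"
        using sum_symker_swap(2)[of "i # e" N "Suc q" "{#i#}" "mset c"] by simp
    qed
    also have "\<dots> = (\<Sum>w\<in>words N (Suc q). (\<Sum>e\<in>words N q. f (mset e) * symker (add_mset i (mset e)) (mset w)) *
        symker (add_mset i (mset w)) (mset c))"
      by (simp add: sum_distrib_left sum_distrib_right mult.assoc) (rule sum.swap)
    also have "\<dots> = (\<Sum>w\<in>words N (Suc q). (of_nat (count (mset w) i) / of_nat (Suc q) * f (mset w - {#i#})) *
        symker (add_mset i (mset w)) (mset c))"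
      by (intro sum.cong refl arg_cong2[where f = "(*)"] sum_symker_add_mset i)
    also have "\<dots> = of_nat (count (mset c) i) / of_nat (Suc (Suc q)) *
        (of_nat (count (mset c - {#i#}) i) / of_nat (Suc q) * f (mset c - {#i#} - {#i#}))"
      by (rule sum_symker_add_mset[OF c i, of "\<lambda>M. of_nat (count M i) / of_nat (Suc q) * f (M - {#i#})"])
    also have "\<dots> = fact q / fact (Suc (Suc q)) *
        (of_nat (count (mset c) i) * (of_nat (count (mset c) i) - 1) * f (mset c - {#i, i#}))"
    proof -
      have "of_nat (count (mset c) i) * of_nat (count (mset c) i - 1) =
          (of_nat (count (mset c) i) * (of_nat (count (mset c) i) - 1) :: complex)"
        by (cases "count (mset c) i") auto
      moreover have "fact q / fact (Suc (Suc q)) = (1 / (of_nat (Suc (Suc q)) * of_nat (Suc q)) :: complex)"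
        by (simp add: field_simps del: of_nat_Suc)
      ultimately show ?thesis by (simp add: mult_ac del: of_nat_Suc fact_Suc)
    qed
    finally show ?thesis .
  qed
  then have "(\<Sum>i<N. \<Sum>e\<in>words N q. f (mset e) * symker ({#i, i#} + mset e) (mset c)) =
      fact q / fact (Suc (Suc q)) * raise N f (mset c)"
    by (simp add: raise_def sum_distrib_left)
  then show ?thesis by (subst (asm) sum.swap) (simp add: sum_distrib_left)
qed

lemma sum_raise_power:
  assumes "c \<in> words N (2 * j + q)"
  shows "(\<Sum>J\<in>words N j. \<Sum>e\<in>words N q. f (mset e) * symker (mset J + mset J + mset e) (mset c)) =
    fact q / fact (2 * j + q) * (raise N ^^ j) f (mset c)"
  using assms
proof (induction j arbitrary: c)
  case 0
  then show ?case using sum_symker(2)[of c N q f] by simp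
next
  case (Suc j)
  let ?m = "2 * j + q"
  have c: "c \<in> words N (Suc (Suc ?m))" using Suc.prems by simp
  have ins: "symker (mset (i # J) + mset (i # J) + mset e) (mset c) = (\<Sum>w\<in>words N ?m.
      symker (mset J + mset J + mset e) (mset w) * symker ({#i, i#} + mset w) (mset c))"
    if "J \<in> words N j" "e \<in> words N q" for i J e
  proof -
    have "J @ J @ e \<in> words N ?m" using that by (auto simp: words_def)
    from sum_symker_swap(2)[OF this, of "{#i, i#}" "mset c"] show ?thesis by (simp add: add_ac)
  qed
  have "(\<Sum>J\<in>words N (Suc j). \<Sum>e\<in>words N q. f (mset e) * symker (mset J + mset J + mset e) (mset c)) =
      (\<Sum>i<N. \<Sum>J\<in>words N j. \<Sum>e\<in>words N q. \<Sum>w\<in>words N ?m. f (mset e) *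
        symker (mset J + mset J + mset e) (mset w) * symker ({#i, i#} + mset w) (mset c))"
    unfolding sum_words_Suc by (intro sum.cong refl) (simp only: ins sum_distrib_left mult.assoc)
  also have "\<dots> = (\<Sum>i<N. \<Sum>w\<in>words N ?m. \<Sum>J\<in>words N j. \<Sum>e\<in>words N q. f (mset e) *
        symker (mset J + mset J + mset e) (mset w) * symker ({#i, i#} + mset w) (mset c))"
    by (rule sum.cong[OF refl], rule sym, rule trans[OF sum.swap], rule sum.cong[OF refl], rule sum.swap)
  also have "\<dots> = (\<Sum>w\<in>words N ?m. (\<Sum>J\<in>words N j. \<Sum>e\<in>words N q. f (mset e) *
        symker (mset J + mset J + mset e) (mset w)) * (\<Sum>i<N. symker ({#i, i#} + mset w) (mset c)))"
    by (subst sum.swap) (simp add: sum_distrib_left sum_distrib_right)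
  also have "\<dots> = (\<Sum>w\<in>words N ?m. (fact q / fact ?m * (raise N ^^ j) f (mset w)) *
      (\<Sum>i<N. symker ({#i, i#} + mset w) (mset c)))"
    by (intro sum.cong refl arg_cong2[where f = "(*)"] Suc.IH)
  also have "\<dots> = fact ?m / fact (Suc (Suc ?m)) * raise N (\<lambda>M. fact q / fact ?m * (raise N ^^ j) f M) (mset c)"
    by (rule sum_raise[OF c])
  also have "raise N (\<lambda>M. fact q / fact ?m * (raise N ^^ j) f M) (mset c) =
      fact q / fact ?m * (raise N ^^ Suc j) f (mset c)"
    by (simp only: raise_mult_left funpow.simps o_apply)
  finally show ?case by simp
qed

section \<open>Symmetrized cups and caps\<close>

definition involution_diagram :: "nat \<Rightarrow> nat \<Rightarrow> (nat \<times> nat \<Rightarrow> nat \<times> nat) \<Rightarrow> diagram" where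
  "involution_diagram m n \<pi> = Diagram m n {{p, \<pi> p} | p. p \<in> points m n}"

lemma involution_diagram:
  assumes \<pi>: "\<And>p. p \<in> points m n \<Longrightarrow> \<pi> p \<in> points m n \<and> \<pi> p \<noteq> p \<and> \<pi> (\<pi> p) = p"
  shows "involution_diagram m n \<pi> \<in> diagrams m n"
proof -
  have "brauer_diagram (involution_diagram m n \<pi>)"
  proof (rule brauer_diagramI, goal_cases)
    case (1 A)
    then obtain p where "A = {p, \<pi> p}" "p \<in> points m n" by (auto simp: involution_diagram_def)
    then show ?case
      by (intro exI[of _ p] exI[of _ "\<pi> p"]) (use \<pi> in \<open>auto simp: involution_diagram_def\<close>)
  next
    case (2 p)
    then have p: "p \<in> points m n" by (simp add: involution_diagram_def)
    show ?case
    proof (rule ex1I)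
      show "{p, \<pi> p} \<in> arcs (involution_diagram m n \<pi>)"
        using p unfolding involution_diagram_def diagram.sel by blast
    next
      fix q assume "{p, q} \<in> arcs (involution_diagram m n \<pi>)"
      then obtain r where r: "{p, q} = {r, \<pi> r}" "r \<in> points m n" by (auto simp: involution_diagram_def)
      then have "p = r \<and> q = \<pi> r \<or> p = \<pi> r \<and> q = r" by (auto simp: doubleton_eq_iff)
      then show "q = \<pi> p" using \<pi>[OF r(2)] by auto
    qed
  qed
  then show ?thesis by (simp add: diagrams_def involution_diagram_def)
qed

lemma monochromatic_involution_diagram:
  "monochromatic (involution_diagram m n \<pi>) u v \<longleftrightarrow> (\<forall>p\<in>points m n. colour u v p = colour u v (\<pi> p))"
proof
  assume mono: "monochromatic (involution_diagram m n \<pi>) u v"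
  show "\<forall>p\<in>points m n. colour u v p = colour u v (\<pi> p)"
  proof
    fix p assume "p \<in> points m n"
    then have "{p, \<pi> p} \<in> arcs (involution_diagram m n \<pi>)"
      unfolding involution_diagram_def diagram.sel by blast
    then show "colour u v p = colour u v (\<pi> p)" using mono unfolding monochromatic_def by blast
  qed
next
  assume *: "\<forall>p\<in>points m n. colour u v p = colour u v (\<pi> p)"
  have "colour u v x = colour u v y" if xy: "{x, y} \<in> arcs (involution_diagram m n \<pi>)" for x y
  proof -
    obtain p where "{x, y} = {p, \<pi> p}" "p \<in> points m n" using xy by (auto simp: involution_diagram_def)
    then show ?thesis using * by (auto simp: doubleton_eq_iff)
  qed
  then show "monochromatic (involution_diagram m n \<pi>) u v" unfolding monochromatic_def by blast
qed

text \<open>On each side the points i and j + i with i < j are joined; the remaining points run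
  straight through. Symmetrized, these are the j caps of \<Delta>^j followed by the j cups of
  \<Theta>^j.\<close>

definition cupcap_pairing :: "nat \<Rightarrow> nat \<times> nat \<Rightarrow> nat \<times> nat" where
  "cupcap_pairing j p =
    (if snd p < j then (fst p, j + snd p) else if snd p < 2 * j then (fst p, snd p - j) else (1 - fst p, snd p))"

definition cupcap :: "nat \<Rightarrow> nat \<Rightarrow> diagram" where
  "cupcap q j = involution_diagram q q (cupcap_pairing j)"

lemma points_iff: "p \<in> points m n \<longleftrightarrow> (fst p = 0 \<and> snd p < m) \<or> (fst p = 1 \<and> snd p < n)"
  by (cases p) (auto simp: points_def)

lemma cupcap_diagrams: "2 * j \<le> q \<Longrightarrow> cupcap q j \<in> diagrams q q"
  unfolding cupcap_def
  by (rule involution_diagram) (auto simp: points_iff cupcap_pairing_def prod_eq_iff)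

lemma monochromatic_cupcap:
  assumes "length a1 = j" "length a2 = j" "length c1 = j" "length c2 = j" "length e = r" "length e' = r"
  shows "monochromatic (cupcap (j + (j + r)) j) (a1 @ a2 @ e) (c1 @ c2 @ e') \<longleftrightarrow> a1 = a2 \<and> c1 = c2 \<and> e = e'"
proof
  let ?u = "a1 @ a2 @ e" and ?v = "c1 @ c2 @ e'"
  assume "monochromatic (cupcap (j + (j + r)) j) ?u ?v"
  then have *: "colour ?u ?v (l, i) = colour ?u ?v (cupcap_pairing j (l, i))"
    if "l \<in> {0, 1}" "i < j + (j + r)" for l i
    using that unfolding cupcap_def monochromatic_involution_diagram by (auto simp: points_iff)
  have "a1 ! i = a2 ! i" "c1 ! i = c2 ! i" if "i < j" for i
    using *[of 0 i] *[of 1 i] that assms by (auto simp: colour_def cupcap_pairing_def nth_append)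
  moreover have "e ! i = e' ! i" if "i < r" for i
    using *[of 0 "j + (j + i)"] that assms by (auto simp: colour_def cupcap_pairing_def nth_append)
  ultimately show "a1 = a2 \<and> c1 = c2 \<and> e = e'" using assms by (simp add: list_eq_iff_nth_eq)
next
  assume "a1 = a2 \<and> c1 = c2 \<and> e = e'"
  then show "monochromatic (cupcap (j + (j + r)) j) (a1 @ a2 @ e) (c1 @ c2 @ e')"
    using assms unfolding cupcap_def monochromatic_involution_diagram
    by (auto simp: points_iff colour_def cupcap_pairing_def nth_append)
qed

definition permute_points :: "(nat \<Rightarrow> nat) \<Rightarrow> (nat \<Rightarrow> nat) \<Rightarrow> nat \<times> nat \<Rightarrow> nat \<times> nat" where
  "permute_points \<sigma> \<tau> p = (fst p, (if fst p = 0 then \<sigma> else \<tau>) (snd p))"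

lemma permute_points_bij:
  assumes "\<sigma> permutes {..<m}" "\<tau> permutes {..<n}"
  shows "bij_betw (permute_points \<sigma> \<tau>) (points m n) (points m n)"
proof (rule bij_betw_byWitness[where f' = "permute_points (inv \<sigma>) (inv \<tau>)"])
  have in_range: "\<sigma> i < m \<longleftrightarrow> i < m" "inv \<sigma> i < m \<longleftrightarrow> i < m" "\<tau> i < n \<longleftrightarrow> i < n" "inv \<tau> i < n \<longleftrightarrow> i < n" for i
    using permutes_in_image[OF assms(1), of i] permutes_in_image[OF permutes_inv[OF assms(1)], of i]
      permutes_in_image[OF assms(2), of i] permutes_in_image[OF permutes_inv[OF assms(2)], of i] by simp_all
  show "permute_points \<sigma> \<tau> ` points m n \<subseteq> points m n" "permute_points (inv \<sigma>) (inv \<tau>) ` points m n \<subseteq> points m n"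
    by (auto simp: permute_points_def points_iff in_range)
qed (use permutes_inverses[OF assms(1)] permutes_inverses[OF assms(2)] in \<open>auto simp: permute_points_def points_iff\<close>)

text \<open>Moving the ends of a diagram has the effect of composing with permutations on both
  sides, but does not refer to the parameter t of \<open>bcomp\<close>.\<close>

definition sym_cupcap :: "nat \<Rightarrow> nat \<Rightarrow> morphism" where
  "sym_cupcap q j = (1 / (fact q * fact q)) \<cdot>\<^sub>B (\<Sum>\<sigma> | \<sigma> permutes {..<q}. \<Sum>\<tau> | \<tau> permutes {..<q}.
    Poly_Mapping.single (relabel (permute_points \<sigma> \<tau>) (cupcap q j) q q) 1)"

lemma bhom_sym_cupcap: "2 * j \<le> q \<Longrightarrow> sym_cupcap q j \<in> bhom q q"
  unfolding sym_cupcap_def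
  by (intro bhom_bscale bhom_sum bhom_single relabel_diagrams cupcap_diagrams permute_points_bij) auto

lemma sum_permute_list:
  assumes v: "v \<in> words N n"
  shows "(\<Sum>\<sigma> | \<sigma> permutes {..<n}. G (permute_list \<sigma> v)) = fact n * (\<Sum>w\<in>words N n. symker (mset w) (mset v) * G w)"
proof -
  have len: "length v = n" by (rule length_words[OF v])
  have in_words: "permute_list \<sigma> v \<in> words N n" if "\<sigma> permutes {..<n}" for \<sigma>
    using permutations_subset_words[OF v] mset_permute_list[of \<sigma> v] that len
    by (auto simp: permutations_of_multiset_def)
  have "(\<Sum>\<sigma> | \<sigma> permutes {..<n}. G (permute_list \<sigma> v)) =
      (\<Sum>\<sigma> | \<sigma> permutes {..<n}. \<Sum>w\<in>words N n. of_bool (w = permute_list \<sigma> v) * G w)"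
    by (intro sum.cong refl) (simp add: sum_delta_right in_words)
  also have "\<dots> = (\<Sum>w\<in>words N n. (\<Sum>\<sigma> | \<sigma> permutes {..<n}. of_bool (w = permute_list \<sigma> v)) * G w)"
    by (subst sum.swap) (simp add: sum_distrib_right)
  also have "\<dots> = (\<Sum>w\<in>words N n. (fact n * symker (mset w) (mset v)) * G w)"
  proof (intro sum.cong refl arg_cong2[where f = "(*)"])
    fix w assume "w \<in> words N n"
    then have "symker (mset w) (mset v) = of_nat (card {\<sigma>. \<sigma> permutes {..<n} \<and> w = permute_list \<sigma> v}) / fact n"
      using card_permutes_to[OF len] length_words by metis
    then show "(\<Sum>\<sigma> | \<sigma> permutes {..<n}. of_bool (w = permute_list \<sigma> v)) = fact n * symker (mset w) (mset v)"
      by (simp add: sum_of_bool_eq finite_permutations Int_def)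
  qed
  finally show ?thesis by (simp add: sum_distrib_left mult.assoc)
qed

text \<open>I and J are the colours of the caps and of the cups, each of which occurs twice, and e
  is the word on the through strands.\<close>

definition cupcap_kernel :: "nat \<Rightarrow> nat \<Rightarrow> nat \<Rightarrow> nat multiset \<Rightarrow> nat multiset \<Rightarrow> complex" where
  "cupcap_kernel N q j A B = (\<Sum>I\<in>words N j. \<Sum>J\<in>words N j. \<Sum>e\<in>words N (q - 2 * j).
    symker A (mset I + mset I + mset e) * symker (mset J + mset J + mset e) B)"

lemma cupcap_kernel_commute: "cupcap_kernel N q j A B = cupcap_kernel N q j B A"
  unfolding cupcap_kernel_def by (subst sum.swap) (simp add: symker_commute mult.commute)

lemma entry_sym_cupcap:
  assumes j: "2 * j \<le> q" and u: "u \<in> words N q" and v: "v \<in> words N q"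
  shows "entry (sym_cupcap q j) u v = cupcap_kernel N q j (mset u) (mset v)"
proof -
  obtain r where q: "q = j + (j + r)" using j by (metis le_Suc_ex mult_2 add.assoc)
  have mono: "monochromatic (relabel (permute_points \<sigma> \<tau>) (cupcap q j) q q) u v \<longleftrightarrow>
      monochromatic (cupcap q j) (permute_list \<sigma> u) (permute_list \<tau> v)"
    if "\<sigma> permutes {..<q}" "\<tau> permutes {..<q}" for \<sigma> \<tau>
  proof (rule monochromatic_relabel)
    show "brauer_diagram (cupcap q j)" using cupcap_diagrams[OF j] by (simp add: diagrams_def)
    fix p assume "p \<in> points (dsrc (cupcap q j)) (dtgt (cupcap q j))"
    then have "p \<in> points q q" by (simp add: cupcap_def involution_diagram_def)
    then show "colour (permute_list \<sigma> u) (permute_list \<tau> v) p = colour u v (permute_points \<sigma> \<tau> p)"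
      using that length_words[OF u] length_words[OF v]
      by (auto simp: colour_def permute_points_def points_iff permute_list_nth)
  qed
  have "entry (sym_cupcap q j) u v = 1 / (fact q * fact q) *
      (\<Sum>\<sigma> | \<sigma> permutes {..<q}. \<Sum>\<tau> | \<tau> permutes {..<q}.
        of_bool (monochromatic (cupcap q j) (permute_list \<sigma> u) (permute_list \<tau> v)))"
    unfolding sym_cupcap_def by (simp add: mono)
  also have "\<dots> = (\<Sum>u'\<in>words N q. symker (mset u') (mset u) * (\<Sum>v'\<in>words N q. symker (mset v') (mset v) *
        of_bool (monochromatic (cupcap q j) u' v')))"
  proof -
    have inner: "(\<Sum>\<tau> | \<tau> permutes {..<q}. of_bool (monochromatic (cupcap q j) x (permute_list \<tau> v))) =
        (fact q * (\<Sum>v'\<in>words N q. symker (mset v') (mset v) * of_bool (monochromatic (cupcap q j) x v')) :: complex)" for x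
      by (rule sum_permute_list[OF v])
    show ?thesis
      unfolding inner
        sum_permute_list[OF u, of "\<lambda>x. fact q * (\<Sum>v'\<in>words N q. symker (mset v') (mset v) * of_bool (monochromatic (cupcap q j) x v'))"]
      by (simp add: sum_distrib_left mult_ac)
  qed
  also have "\<dots> = (\<Sum>a1\<in>words N j. \<Sum>a2\<in>words N j. \<Sum>e\<in>words N r.
      \<Sum>c1\<in>words N j. \<Sum>c2\<in>words N j. \<Sum>e'\<in>words N r.
      of_bool (a1 = a2) * (of_bool (c1 = c2) * (of_bool (e = e') *
      (symker (mset u) (mset a1 + mset a2 + mset e) * symker (mset c1 + mset c2 + mset e') (mset v)))))"
    unfolding q sum_words_add sum_distrib_left
    by (intro sum.cong refl) (simp add: monochromatic_cupcap length_words of_bool_conj symker_commute[of _ "mset u"] add.assoc)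
  also have "\<dots> = (\<Sum>a1\<in>words N j. \<Sum>e\<in>words N r. \<Sum>c1\<in>words N j.
      symker (mset u) (mset a1 + mset a1 + mset e) * symker (mset c1 + mset c1 + mset e) (mset v))"
    by (simp add: sum_distrib_left[symmetric] sum_delta_right)
  also have "\<dots> = cupcap_kernel N q j (mset u) (mset v)"
    unfolding cupcap_kernel_def q by (rule sum.cong[OF refl], subst sum.swap) simp
  finally show ?thesis .
qed

text \<open>
  This is \<open>\<Theta>\<^sup>j\<Delta>\<^sup>j\<close> on \<open>S\<^sup>q(V)\<close>, written as a combination of diagrams so that its coefficients do not
  involve \<open>t\<close>.
\<close>

definition theta_delta :: "nat \<Rightarrow> nat \<Rightarrow> morphism" where
  "theta_delta q j = (if 2 * j \<le> q then ((1 / 4) ^ j * (fact q / fact (q - 2 * j))) \<cdot>\<^sub>B sym_cupcap q j else 0)"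

lemma bhom_theta_delta [intro]: "theta_delta q j \<in> bhom q q"
  unfolding theta_delta_def using bhom_sym_cupcap by auto

lemma raise_zero: "raise N (\<lambda>_. 0) M = 0"
  by (simp add: raise_def)

lemma raise_power_eq_0: "size M < 2 * j \<Longrightarrow> (raise N ^^ j) f M = 0"
proof (induction j arbitrary: M)
  case (Suc j)
  have "raise N ((raise N ^^ j) f) M = raise N (\<lambda>_. 0) M"
  proof (rule raise_cong)
    fix i assume "{#i, i#} \<subseteq># M"
    from size_Diff_submset[OF this] size_mset_mono[OF this] Suc.prems
    have "size (M - {#i, i#}) < 2 * j" by simp
    then show "(raise N ^^ j) f (M - {#i, i#}) = 0" by (rule Suc.IH)
  qed
  then show ?case by (simp add: raise_zero)
qed simp

text \<open>Each \<Theta> and each \<Delta> carries a factor 1/2, which gives (1/4)^j, and the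
  quotient of factorials in \<open>theta_delta\<close> cancels the one produced by
  \<open>sum_raise_power\<close>.\<close>

lemma entry_theta_delta:
  assumes b: "b \<in> words N q" and c: "c \<in> words N q"
  shows "entry (theta_delta q j) b c = (1 / 4) ^ j * (raise N ^^ j) ((lower N ^^ j) (symker (mset b))) (mset c)"
proof (cases "2 * j \<le> q")
  case False
  then have "size (mset c) < 2 * j" using length_words[OF c] by simp
  then show ?thesis using False by (simp add: theta_delta_def raise_power_eq_0)
next
  case True
  have c': "c \<in> words N (2 * j + (q - 2 * j))" using c True by simp
  have "cupcap_kernel N q j (mset b) (mset c) = (\<Sum>J\<in>words N j. \<Sum>e\<in>words N (q - 2 * j).
      (\<Sum>I\<in>words N j. symker (mset b) (mset I + mset I + mset e)) * symker (mset J + mset J + mset e) (mset c))"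
    unfolding cupcap_kernel_def sum_distrib_right
    by (rule trans[OF sum.swap], rule sum.cong[OF refl], rule sum.swap)
  also have "\<dots> = fact (q - 2 * j) / fact (2 * j + (q - 2 * j)) *
      (raise N ^^ j) ((lower N ^^ j) (symker (mset b))) (mset c)"
    unfolding sum_lower_power by (rule sum_raise_power[OF c'])
  finally show ?thesis using True b c by (simp add: theta_delta_def entry_sym_cupcap)
qed

lemma theta_delta_0: "theta_delta q 0 = symmetrizer q"
proof (rule polyfam_eqI[where X = "\<lambda>_. theta_delta q 0" and Y = "\<lambda>_. symmetrizer q"])
  show "polyfam q q (\<lambda>_. theta_delta q 0)" "polyfam q q (\<lambda>_. symmetrizer q)"
    by (rule polyfam_const bhom_theta_delta bhom_symmetrizer)+
  fix N b c assume "b \<in> words N q" "c \<in> words N q"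
  then show "entry (theta_delta q 0) b c = entry (symmetrizer q) b c"
    by (simp add: entry_theta_delta entry_symmetrizer_words)
qed

text \<open>Commute the inner \<Delta> past \<Theta>^j. After \<Delta>^j the degree is q - 2j, so
  that the sl2 formula contributes j(q - 2j + t/2 + j - 1).\<close>

lemma raise_lower_theta_delta:
  "raise_lower t q \<odot>\<^bsub>t\<^esub> theta_delta q j =
    theta_delta q (Suc j) + (of_nat j * (of_nat q + t / 2 - 1 - of_nat j)) \<cdot>\<^sub>B theta_delta q j"
proof (rule polyfam_eqI[where X = "\<lambda>t. raise_lower t q \<odot>\<^bsub>t\<^esub> theta_delta q j"
      and Y = "\<lambda>t. theta_delta q (Suc j) + (of_nat j * (of_nat q + t / 2 - 1 - of_nat j)) \<cdot>\<^sub>B theta_delta q j"])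
  show "polyfam q q (\<lambda>t. raise_lower t q \<odot>\<^bsub>t\<^esub> theta_delta q j)"
    by (rule polyfam_bcomp polyfam_raise_lower polyfam_const bhom_theta_delta)+
  show "polyfam q q (\<lambda>t. theta_delta q (Suc j) + (of_nat j * (of_nat q + t / 2 - 1 - of_nat j)) \<cdot>\<^sub>B theta_delta q j)"
    by (intro polyfam_add polyfam_bscale polyfam_const bhom_theta_delta polynomial_fun_mult polynomial_fun_diff
        polynomial_fun_add polynomial_fun_divide polynomial_fun_const polynomial_fun_ident)
  fix N b c assume b: "b \<in> words N q" and c: "c \<in> words N q"
  show "entry (raise_lower (of_nat N) q \<odot>\<^bsub>of_nat N\<^esub> theta_delta q j) b c =
      entry (theta_delta q (Suc j) + (of_nat j * (of_nat q + of_nat N / 2 - 1 - of_nat j)) \<cdot>\<^sub>B theta_delta q j) b c"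
  proof (cases "q < 2")
    case True
    then have "of_nat j \<cdot>\<^sub>B theta_delta q j = 0" "theta_delta q (Suc j) = 0"
      by (cases j; simp add: theta_delta_def)+
    then have "(of_nat j * (of_nat q + of_nat N / 2 - 1 - of_nat j)) \<cdot>\<^sub>B theta_delta q j = 0"
      by (metis bscale_simps(3,4) mult.commute)
    then show ?thesis using True \<open>theta_delta q (Suc j) = 0\<close> by (simp add: raise_lower_eq_0)
  next
    case False
    define f where "f = (lower N ^^ j) (symker (mset b))"
    define G where "G M = (1 / 4) ^ j * (raise N ^^ j) f M" for M
    have q: "Suc (Suc (q - 2)) = q" using False by simp
    have c2: "c \<in> words N (Suc (Suc (q - 2)))" using c unfolding q .
    let ?F = "fact q / fact (q - 2) :: complex"
    have low: "(\<Sum>w\<in>words N q. G (mset w) * (\<Sum>i<N. symker (mset w) ({#i, i#} + mset e))) = lower N G (mset e)"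
      if "e \<in> words N (q - 2)" for e
    proof -
      have "(\<Sum>w\<in>words N q. G (mset w) * symker (mset w) ({#i, i#} + mset e)) = G ({#i, i#} + mset e)" if "i < N" for i
      proof -
        have "i # i # e \<in> words N (Suc (Suc (q - 2)))" using that \<open>e \<in> words N (q - 2)\<close> by (simp add: Cons_in_words)
        from sum_symker(2)[OF this, of G] show ?thesis unfolding q by simp
      qed
      then show ?thesis unfolding lower_def sum_distrib_left by (subst sum.swap) simp
    qed
    have "entry (raise_lower (of_nat N) q \<odot>\<^bsub>of_nat N\<^esub> theta_delta q j) b c =
        (\<Sum>w\<in>words N q. G (mset w) * (1 / 4 * ?F * (\<Sum>e\<in>words N (q - 2).
          (\<Sum>i<N. symker (mset w) ({#i, i#} + mset e)) * (\<Sum>k<N. symker ({#k, k#} + mset e) (mset c)))))"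
      using False b c
      by (subst entry_bcomp[OF bhom_theta_delta polyfam_bhom[OF polyfam_raise_lower] b c])
        (simp add: entry_theta_delta entry_raise_lower G_def f_def cong: sum.cong)
    also have "\<dots> = 1 / 4 * ?F * (\<Sum>e\<in>words N (q - 2).
        (\<Sum>w\<in>words N q. G (mset w) * (\<Sum>i<N. symker (mset w) ({#i, i#} + mset e))) *
        (\<Sum>k<N. symker ({#k, k#} + mset e) (mset c)))"
    proof -
      have "(\<Sum>w\<in>words N q. G (mset w) * (K * (\<Sum>e\<in>words N (q - 2). X w e * Y e))) =
          K * (\<Sum>e\<in>words N (q - 2). (\<Sum>w\<in>words N q. G (mset w) * X w e) * Y e)" for K X Y
        by (simp add: sum_distrib_left sum_distrib_right mult_ac) (rule sum.swap)
      then show ?thesis .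
    qed
    also have "\<dots> = 1 / 4 * ?F * (\<Sum>e\<in>words N (q - 2). lower N G (mset e) *
        (\<Sum>k<N. symker ({#k, k#} + mset e) (mset c)))"
      by (simp only: low cong: sum.cong)
    also have "\<dots> = 1 / 4 * raise N (lower N G) (mset c)"
      by (subst sum_raise[OF c2]) (simp add: q del: fact_Suc)
    also have "raise N (lower N G) (mset c) = (1 / 4) ^ j * raise N (lower N ((raise N ^^ j) f)) (mset c)"
      by (simp add: G_def lower_def raise_def sum_distrib_left mult_ac)
    also have "raise N (lower N ((raise N ^^ j) f)) (mset c) = (raise N ^^ Suc j) (lower N f) (mset c) +
        4 * of_nat j * (of_nat q + of_nat N / 2 - 1 - of_nat j) * (raise N ^^ j) f (mset c)"
    proof (cases j)
      case 0
      then show ?thesis by simp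
    next
      case (Suc i)
      let ?K = "4 * of_nat j * (of_nat q + of_nat N / 2 - 1 - of_nat j) :: complex"
      have "raise N (lower N ((raise N ^^ j) f)) (mset c) =
          raise N (\<lambda>M. (raise N ^^ j) (lower N f) M + ?K * (raise N ^^ i) f M) (mset c)"
      proof (rule raise_cong)
        fix k assume k: "{#k, k#} \<subseteq># mset c"
        have "size (mset c - {#k, k#}) = q - 2"
          using size_Diff_submset[OF k] length_words[OF c] by simp
        then have "of_nat (size (mset c - {#k, k#})) = (of_nat q - 2 :: complex)" using False by (simp add: of_nat_diff)
        then have coeff: "of_nat (size (mset c - {#k, k#})) - of_nat i + of_nat N / 2 =
            (of_nat q + of_nat N / 2 - 1 - of_nat (Suc i) :: complex)" by simp
        have "set_mset (mset c - {#k, k#}) \<subseteq> {..<N}"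
          using c by (force simp: words_def dest: in_diffD[of _ "mset c"])
        from lower_raise_power[OF this, of i f]
        show "lower N ((raise N ^^ j) f) (mset c - {#k, k#}) =
            (raise N ^^ j) (lower N f) (mset c - {#k, k#}) + ?K * (raise N ^^ i) f (mset c - {#k, k#})"
          unfolding Suc coeff .
      qed
      then show ?thesis unfolding Suc by (simp only: raise_add raise_mult_left funpow.simps o_apply)
    qed
    finally show ?thesis
      using b c by (simp add: entry_theta_delta f_def funpow_swap1 algebra_simps)
  qed
qed

section \<open>Linear independence by counting caps\<close>

definition cap_count :: "diagram \<Rightarrow> nat" where
  "cap_count D = card {A \<in> arcs D. A \<subseteq> {0} \<times> UNIV}"

lemma cap_count_relabel:
  assumes "\<sigma> permutes {..<q}" "\<tau> permutes {..<q}" "D \<in> diagrams q q"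
  shows "cap_count (relabel (permute_points \<sigma> \<tau>) D q q) = cap_count D"
proof -
  let ?h = "permute_points \<sigma> \<tau>"
  have inj: "inj_on ?h (points q q)" using permute_points_bij[OF assms(1,2)] by (simp add: bij_betw_def)
  have arcs: "A \<subseteq> points q q" if "A \<in> arcs D" for A
    using assms(3) arcs_subset_points[OF _ that] by (auto simp: diagrams_def)
  have "{A \<in> arcs (relabel ?h D q q). A \<subseteq> {0} \<times> UNIV} = (`) ?h ` {A \<in> arcs D. A \<subseteq> {0} \<times> UNIV}"
  proof -
    have "?h ` A \<subseteq> {0} \<times> UNIV \<longleftrightarrow> A \<subseteq> {0} \<times> UNIV" for A
      by (force simp: permute_points_def)
    then show ?thesis by (auto simp: relabel_def)
  qed
  moreover have "inj_on ((`) ?h) {A \<in> arcs D. A \<subseteq> {0} \<times> UNIV}"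
    using inj arcs by (auto simp: inj_on_def[of "(`) ?h"] inj_on_image_eq_iff)
  ultimately show ?thesis by (simp add: cap_count_def card_image)
qed

lemma cap_count_cupcap:
  assumes "2 * j \<le> q"
  shows "cap_count (cupcap q j) = j"
proof -
  have "{A \<in> arcs (cupcap q j). A \<subseteq> {0} \<times> UNIV} = (\<lambda>i. {(0, i), (0, j + i)}) ` {..<j}"
  proof safe
    fix A assume A: "A \<in> arcs (cupcap q j)" "A \<subseteq> {0} \<times> UNIV"
    then obtain p where p: "A = {p, cupcap_pairing j p}" "p \<in> points q q"
      by (auto simp: cupcap_def involution_diagram_def)
    then have 0: "fst p = 0" "fst (cupcap_pairing j p) = 0" using A(2) by auto
    then consider "snd p < j" | "j \<le> snd p" "snd p < 2 * j"
      by (auto simp: cupcap_pairing_def split: if_splits)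
    then show "A \<in> (\<lambda>i. {(0, i), (0, j + i)}) ` {..<j}"
    proof cases
      case 1
      then show ?thesis using p 0 by (intro image_eqI[of _ _ "snd p"]) (auto simp: cupcap_pairing_def prod_eq_iff)
    next
      case 2
      then show ?thesis using p 0
        by (intro image_eqI[of _ _ "snd p - j"]) (auto simp: cupcap_pairing_def prod_eq_iff)
    qed
  next
    fix i assume i: "i < j"
    then have "{(0, i), (0, j + i)} = {(0, i), cupcap_pairing j (0, i)}" "(0, i) \<in> points q q"
      using assms by (auto simp: cupcap_pairing_def points_iff)
    then show "{(0, i), (0, j + i)} \<in> arcs (cupcap q j)"
      unfolding cupcap_def involution_diagram_def by auto
  qed auto
  moreover have "inj_on (\<lambda>i. {(0 :: nat, i), (0, j + i)}) {..<j}"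
    by (auto simp: inj_on_def doubleton_eq_iff)
  ultimately show ?thesis by (simp add: cap_count_def card_image)
qed

text \<open>The coefficient is a positive multiple of the number of pairs of permutations that carry
  one diagram to the other. For i = j the pair of identities is one; otherwise the numbers of caps
  differ, and permutations of the ends preserve them.\<close>

lemma lookup_sym_cupcap:
  assumes i: "2 * i \<le> q" and j: "2 * j \<le> q"
  shows "Poly_Mapping.lookup (sym_cupcap q j) (cupcap q i) = 0 \<longleftrightarrow> i \<noteq> j"
proof -
  let ?P = "{\<sigma>. \<sigma> permutes {..<q}}"
  let ?S = "(?P \<times> ?P) \<inter> {p. case p of (\<sigma>, \<tau>) \<Rightarrow> relabel (permute_points \<sigma> \<tau>) (cupcap q j) q q = cupcap q i}"
  have "Poly_Mapping.lookup (sym_cupcap q j) (cupcap q i) = 1 / (fact q * fact q) * of_nat (card ?S)"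
  proof -
    have "(\<Sum>\<sigma>\<in>?P. \<Sum>\<tau>\<in>?P. of_bool (relabel (permute_points \<sigma> \<tau>) (cupcap q j) q q = cupcap q i) :: complex) = of_nat (card ?S)"
      unfolding sum.cartesian_product
      by (subst sum_of_bool_eq[symmetric]) (auto simp: finite_permutations intro!: sum.cong)
    then show ?thesis
      by (simp add: sym_cupcap_def lookup_sum lookup_single when_def of_bool_def)
  qed
  moreover have "?S = {}" if "i \<noteq> j"
    using that cap_count_relabel[OF _ _ cupcap_diagrams[OF j]] cap_count_cupcap[OF i] cap_count_cupcap[OF j] by fastforce
  moreover have "(id, id) \<in> ?S" if "i = j"
  proof -
    have "permute_points id id = id" by (auto simp: permute_points_def)
    then show ?thesis using that by (auto simp: permutes_id relabel_def cupcap_def involution_diagram_def)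
  qed
  moreover have "finite ?S"
    by (rule finite_subset[of _ "?P \<times> ?P"]) (auto simp: finite_permutations)
  ultimately show ?thesis
  proof (cases "i = j")
    case True
    then have "card ?S \<noteq> 0" using \<open>i = j \<Longrightarrow> (id, id) \<in> ?S\<close> \<open>finite ?S\<close> by (metis card_0_eq emptyE)
    then show ?thesis
      using True \<open>Poly_Mapping.lookup (sym_cupcap q j) (cupcap q i) = 1 / (fact q * fact q) * of_nat (card ?S)\<close>
      by simp
  qed simp
qed

lemma theta_delta_independent:
  assumes 0: "(\<Sum>j\<le>q div 2. a j \<cdot>\<^sub>B theta_delta q j) = 0" and i: "i \<le> q div 2"
  shows "a i = 0"
proof -
  have "0 = Poly_Mapping.lookup (\<Sum>j\<le>q div 2. a j \<cdot>\<^sub>B theta_delta q j) (cupcap q i)" unfolding 0 by simp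
  also have "\<dots> = (\<Sum>j\<le>q div 2. if j = i then a i * Poly_Mapping.lookup (theta_delta q i) (cupcap q i) else 0)"
    unfolding lookup_sum using i lookup_sym_cupcap[of i q]
    by (intro sum.cong refl) (auto simp: theta_delta_def)
  also have "\<dots> = a i * Poly_Mapping.lookup (theta_delta q i) (cupcap q i)" using i by simp
  finally have "a i * Poly_Mapping.lookup (theta_delta q i) (cupcap q i) = 0" by simp
  moreover have "2 * i \<le> q" using i by linarith
  ultimately show ?thesis using lookup_sym_cupcap[of i q i] by (auto simp: theta_delta_def)
qed

section \<open>Duality\<close>

definition cup_pairing :: "nat \<Rightarrow> nat \<times> nat \<Rightarrow> nat \<times> nat" where
  "cup_pairing d p = (1, if snd p < d then d + snd p else snd p - d)"

definition multicup :: "nat \<Rightarrow> morphism" where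
  "multicup d = Poly_Mapping.single (involution_diagram 0 (d + d) (cup_pairing d)) 1"

lemma bhom_multicup: "multicup d \<in> bhom 0 (d + d)"
  unfolding multicup_def
  by (intro bhom_single involution_diagram) (auto simp: points_iff cup_pairing_def prod_eq_iff)

lemma entry_multicup:
  assumes a: "length a1 = d" "length a2 = d"
  shows "entry (multicup d) [] (a1 @ a2) = of_bool (a1 = a2)"
proof -
  have "monochromatic (involution_diagram 0 (d + d) (cup_pairing d)) [] (a1 @ a2) \<longleftrightarrow> a1 = a2"
  proof
    assume "monochromatic (involution_diagram 0 (d + d) (cup_pairing d)) [] (a1 @ a2)"
    then have *: "colour [] (a1 @ a2) (1, i) = colour [] (a1 @ a2) (cup_pairing d (1, i))" if "i < d" for i
      using that unfolding monochromatic_involution_diagram by (auto simp: points_iff)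
    have "a1 ! i = a2 ! i" if "i < d" for i
      using *[OF that] that a by (auto simp: colour_def cup_pairing_def nth_append)
    then show "a1 = a2" using a by (simp add: list_eq_iff_nth_eq)
  next
    assume "a1 = a2"
    then show "monochromatic (involution_diagram 0 (d + d) (cup_pairing d)) [] (a1 @ a2)"
      unfolding monochromatic_involution_diagram using a
      by (auto simp: points_iff colour_def cup_pairing_def nth_append)
  qed
  then show ?thesis by (simp add: multicup_def)
qed

text \<open>The d-fold derivative of a polynomial of degree d has d! terms, so that the contraction
  pairing is d! times the pairing by \<open>symker\<close>; the factor 1/d! compensates for
  this.\<close>

definition sym_coev :: "complex \<Rightarrow> nat \<Rightarrow> morphism" where
  "sym_coev t d = (1 / fact d) \<cdot>\<^sub>B ((symmetrizer d \<otimes>\<^sub>B bid d) \<odot>\<^bsub>t\<^esub> multicup d)"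

lemma polyfam_sym_coev: "polyfam 0 (d + d) (\<lambda>t. sym_coev t d)"
  unfolding sym_coev_def
  by (rule polyfam_bscale polynomial_fun_const polyfam_bcomp polyfam_btensor polyfam_symmetrizer polyfam_bid
      polyfam_const bhom_multicup)+

lemma entry_sym_coev:
  assumes a: "a1 \<in> words N d" "a2 \<in> words N d"
  shows "entry (sym_coev (of_nat N) d) [] (a1 @ a2) = symker (mset a1) (mset a2) / fact d"
proof -
  have "entry ((symmetrizer d \<otimes>\<^sub>B bid d) \<odot>\<^bsub>of_nat N\<^esub> multicup d) [] (a1 @ a2) =
      (\<Sum>b1\<in>words N d. \<Sum>b2\<in>words N d. of_bool (b1 = b2) * (symker (mset b1) (mset a1) * of_bool (b2 = a2)))"
    using a
    by (subst entry_bcomp[OF bhom_multicup bhom_btensor[OF bhom_symmetrizer bhom_bid] _ append_in_words[OF a]])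
      (simp_all add: sum_words_add entry_multicup length_words entry_btensor[OF bhom_symmetrizer bhom_bid]
        entry_symmetrizer_words entry_bid cong: sum.cong)
  also have "\<dots> = symker (mset a1) (mset a2)"
    using a by (simp add: sum_delta_right symker_commute)
  finally show ?thesis by (simp add: sym_coev_def)
qed

lemma entry_full_contraction:
  assumes "a \<in> words N d" "b \<in> words N d"
  shows "entry (contraction (of_nat N) d d) (a @ b) [] = fact d * symker (mset a) (mset b)"
  using entry_contraction[OF order_refl assms, of "[]"] by (simp add: symker_commute)

lemma polyfam_full_contraction: "polyfam (d + d) 0 (\<lambda>t. contraction t d d)"
  using polyfam_contraction[of d d] by simp

text \<open>On matrices this is the reproducing property of \<open>symker\<close>, used once for
  each of the three contracted words, while d! cancels 1/d!.\<close>

lemma zigzag_left: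
  "(symmetrizer d \<otimes>\<^sub>B contraction t d d) \<odot>\<^bsub>t\<^esub> (sym_coev t d \<otimes>\<^sub>B symmetrizer d) = symmetrizer d"
proof (rule polyfam_eqI[where X = "\<lambda>t. (symmetrizer d \<otimes>\<^sub>B contraction t d d) \<odot>\<^bsub>t\<^esub> (sym_coev t d \<otimes>\<^sub>B symmetrizer d)"
      and Y = "\<lambda>_. symmetrizer d"])
  have f: "polyfam d ((d + d) + d) (\<lambda>t. sym_coev t d \<otimes>\<^sub>B symmetrizer d)"
    using polyfam_btensor[OF polyfam_sym_coev polyfam_symmetrizer, of d d] by simp
  have g: "polyfam ((d + d) + d) d (\<lambda>t. symmetrizer d \<otimes>\<^sub>B contraction t d d)"
    using polyfam_btensor[OF polyfam_symmetrizer polyfam_full_contraction, of d d] by (simp add: add.assoc)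
  show "polyfam d d (\<lambda>t. (symmetrizer d \<otimes>\<^sub>B contraction t d d) \<odot>\<^bsub>t\<^esub> (sym_coev t d \<otimes>\<^sub>B symmetrizer d))"
    by (rule polyfam_bcomp[OF f g])
  fix N b c assume b: "b \<in> words N d" and c: "c \<in> words N d"
  have ef: "entry (sym_coev (of_nat N) d \<otimes>\<^sub>B symmetrizer d) b ((a1 @ a2) @ b') =
      symker (mset a1) (mset a2) / fact d * symker (mset b) (mset b')"
    if "a1 \<in> words N d" "a2 \<in> words N d" "b' \<in> words N d" for a1 a2 b'
    using entry_btensor[OF polyfam_bhom[OF polyfam_sym_coev[of d], of "of_nat N"] bhom_symmetrizer[of d], of "[]" "a1 @ a2" b b'] that b
    by (simp add: length_words entry_sym_coev entry_symmetrizer_words)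
  have eg: "entry (symmetrizer d \<otimes>\<^sub>B contraction (of_nat N) d d) ((a1 @ a2) @ b') c =
      symker (mset a1) (mset c) * (fact d * symker (mset a2) (mset b'))"
    if "a1 \<in> words N d" "a2 \<in> words N d" "b' \<in> words N d" for a1 a2 b'
    using entry_btensor[OF bhom_symmetrizer[of d] polyfam_bhom[OF polyfam_full_contraction[of d], of "of_nat N"], of a1 c "a2 @ b'" "[]"] that c
    by (simp add: length_words entry_full_contraction entry_symmetrizer_words)
  have "entry ((symmetrizer d \<otimes>\<^sub>B contraction (of_nat N) d d) \<odot>\<^bsub>of_nat N\<^esub> (sym_coev (of_nat N) d \<otimes>\<^sub>B symmetrizer d)) b c =
      (\<Sum>a1\<in>words N d. \<Sum>a2\<in>words N d. \<Sum>b'\<in>words N d. symker (mset a1) (mset c) *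
        (symker (mset a1) (mset a2) * (symker (mset b) (mset b') * symker (mset a2) (mset b'))))"
    by (subst entry_bcomp[OF polyfam_bhom[OF f] polyfam_bhom[OF g] b c])
      (simp add: sum_words_add ef eg mult_ac del: append_assoc cong: sum.cong)
  also have "\<dots> = (\<Sum>a1\<in>words N d. symker (mset a1) (mset c) *
      (\<Sum>a2\<in>words N d. symker (mset a1) (mset a2) * (\<Sum>b'\<in>words N d. symker (mset b) (mset b') * symker (mset a2) (mset b'))))"
    by (simp add: sum_distrib_left)
  also have "\<dots> = symker (mset b) (mset c)"
    using sum_symker(1)[OF c, of "symker (mset b)"]
    by (simp add: sum_symker(3)[OF b, of "symker _"] sum_symker(3)[where h = "symker (mset b)"]
        symker_commute[of _ "mset b"] mult.commute[of _ "symker _ (mset c)"] cong: sum.cong)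
  finally show "entry ((symmetrizer d \<otimes>\<^sub>B contraction (of_nat N) d d) \<odot>\<^bsub>of_nat N\<^esub> (sym_coev (of_nat N) d \<otimes>\<^sub>B symmetrizer d)) b c =
      entry (symmetrizer d) b c"
    using b c by (simp add: entry_symmetrizer_words)
qed (rule polyfam_symmetrizer)

lemma zigzag_right:
  "(contraction t d d \<otimes>\<^sub>B symmetrizer d) \<odot>\<^bsub>t\<^esub> (symmetrizer d \<otimes>\<^sub>B sym_coev t d) = symmetrizer d"
proof (rule polyfam_eqI[where X = "\<lambda>t. (contraction t d d \<otimes>\<^sub>B symmetrizer d) \<odot>\<^bsub>t\<^esub> (symmetrizer d \<otimes>\<^sub>B sym_coev t d)"
      and Y = "\<lambda>_. symmetrizer d"])
  have f: "polyfam d ((d + d) + d) (\<lambda>t. symmetrizer d \<otimes>\<^sub>B sym_coev t d)"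
    using polyfam_btensor[OF polyfam_symmetrizer polyfam_sym_coev, of d d] by (simp add: add.assoc)
  have g: "polyfam ((d + d) + d) d (\<lambda>t. contraction t d d \<otimes>\<^sub>B symmetrizer d)"
    using polyfam_btensor[OF polyfam_full_contraction polyfam_symmetrizer, of d d] by simp
  show "polyfam d d (\<lambda>t. (contraction t d d \<otimes>\<^sub>B symmetrizer d) \<odot>\<^bsub>t\<^esub> (symmetrizer d \<otimes>\<^sub>B sym_coev t d))"
    by (rule polyfam_bcomp[OF f g])
  fix N b c assume b: "b \<in> words N d" and c: "c \<in> words N d"
  have ef: "entry (symmetrizer d \<otimes>\<^sub>B sym_coev (of_nat N) d) b ((b' @ a1) @ a2) =
      symker (mset b) (mset b') * (symker (mset a1) (mset a2) / fact d)"
    if "a1 \<in> words N d" "a2 \<in> words N d" "b' \<in> words N d" for a1 a2 b'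
    using entry_btensor[OF bhom_symmetrizer[of d] polyfam_bhom[OF polyfam_sym_coev[of d], of "of_nat N"], of b b' "[]" "a1 @ a2"] that b
    by (simp add: length_words entry_sym_coev entry_symmetrizer_words)
  have eg: "entry (contraction (of_nat N) d d \<otimes>\<^sub>B symmetrizer d) ((b' @ a1) @ a2) c =
      fact d * symker (mset b') (mset a1) * symker (mset a2) (mset c)"
    if "a1 \<in> words N d" "a2 \<in> words N d" "b' \<in> words N d" for a1 a2 b'
    using entry_btensor[OF polyfam_bhom[OF polyfam_full_contraction[of d], of "of_nat N"] bhom_symmetrizer[of d], of "b' @ a1" "[]" a2 c] that c
    by (simp add: length_words entry_full_contraction entry_symmetrizer_words)
  have "entry ((contraction (of_nat N) d d \<otimes>\<^sub>B symmetrizer d) \<odot>\<^bsub>of_nat N\<^esub> (symmetrizer d \<otimes>\<^sub>B sym_coev (of_nat N) d)) b c =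
      (\<Sum>b'\<in>words N d. \<Sum>a1\<in>words N d. \<Sum>a2\<in>words N d. symker (mset b) (mset b') *
        (symker (mset b') (mset a1) * (symker (mset a1) (mset a2) * symker (mset a2) (mset c))))"
    by (subst entry_bcomp[OF polyfam_bhom[OF f] polyfam_bhom[OF g] b c])
      (simp add: sum_words_add ef eg mult_ac del: append_assoc cong: sum.cong)
  also have "\<dots> = (\<Sum>b'\<in>words N d. symker (mset b) (mset b') * (\<Sum>a1\<in>words N d. symker (mset b') (mset a1) *
      (\<Sum>a2\<in>words N d. symker (mset a1) (mset a2) * symker (mset a2) (mset c))))"
    by (simp add: sum_distrib_left)
  also have "\<dots> = symker (mset b) (mset c)"
    by (simp add: sum_symker(3)[where h = "\<lambda>M. symker M (mset c)"] sum_symker(3)[OF b, where h = "\<lambda>M. symker M (mset c)"]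
        cong: sum.cong)
  finally show "entry ((contraction (of_nat N) d d \<otimes>\<^sub>B symmetrizer d) \<odot>\<^bsub>of_nat N\<^esub> (symmetrizer d \<otimes>\<^sub>B sym_coev (of_nat N) d)) b c =
      entry (symmetrizer d) b c"
    using b c by (simp add: entry_symmetrizer_words)
qed (rule polyfam_symmetrizer)

text \<open>
  The condition is on the matrices of \<open>p\<close>, so that it makes \<open>p\<close> an endomorphism of \<open>S\<^sup>d(V)\<close> which is
  equal to its transpose, for all values of \<open>t\<close> at once.
\<close>

definition selfadjoint :: "nat \<Rightarrow> morphism \<Rightarrow> bool" where
  "selfadjoint d p \<longleftrightarrow> p \<in> bhom d d \<and> (\<forall>N. \<exists>K. (\<forall>A B. K A B = K B A) \<and>
    (\<forall>u\<in>words N d. \<forall>v\<in>words N d. entry p u v = K (mset u) (mset v)))"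

lemma selfadjointE:
  assumes "selfadjoint d p"
  obtains K where "\<And>A B. K A B = K B A"
    "\<And>u v. u \<in> words N d \<Longrightarrow> v \<in> words N d \<Longrightarrow> entry p u v = K (mset u) (mset v)"
  using assms unfolding selfadjoint_def by meson

lemma selfadjoint_symmetrizer: "selfadjoint d (symmetrizer d)"
  unfolding selfadjoint_def
  using symker_commute entry_symmetrizer_words by blast

lemma selfadjoint_theta_delta: "selfadjoint d (theta_delta d j)"
proof (cases "2 * j \<le> d")
  case True
  have "\<exists>K. (\<forall>A B. K A B = K B A) \<and>
      (\<forall>u\<in>words N d. \<forall>v\<in>words N d. entry (theta_delta d j) u v = K (mset u) (mset v))" for N
    by (rule exI[of _ "\<lambda>A B. (1 / 4) ^ j * (fact d / fact (d - 2 * j)) * cupcap_kernel N d j A B"])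
      (use True in \<open>auto simp: theta_delta_def entry_sym_cupcap cupcap_kernel_commute\<close>)
  then show ?thesis by (auto simp: selfadjoint_def)
next
  case False
  then show ?thesis by (auto simp: selfadjoint_def theta_delta_def intro!: exI[of _ "\<lambda>_ _. 0"])
qed

lemma selfadjoint_add:
  assumes "selfadjoint d p" "selfadjoint d q"
  shows "selfadjoint d (p + q)"
proof -
  have "\<exists>K. (\<forall>A B. K A B = K B A) \<and> (\<forall>u\<in>words N d. \<forall>v\<in>words N d. entry (p + q) u v = K (mset u) (mset v))" for N
  proof -
    obtain K where K: "\<And>A B. K A B = K B A"
      "\<And>u v. u \<in> words N d \<Longrightarrow> v \<in> words N d \<Longrightarrow> entry p u v = K (mset u) (mset v)"
      using selfadjointE[OF assms(1), where N = N] by metis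
    obtain L where L: "\<And>A B. L A B = L B A"
      "\<And>u v. u \<in> words N d \<Longrightarrow> v \<in> words N d \<Longrightarrow> entry q u v = L (mset u) (mset v)"
      using selfadjointE[OF assms(2), where N = N] by metis
    show ?thesis
    proof (intro exI[of _ "\<lambda>A B. K A B + L A B"] conjI allI ballI)
      show "K A B + L A B = K B A + L B A" for A B using K(1) L(1) by metis
    qed (simp add: K(2) L(2))
  qed
  then show ?thesis using assms by (auto simp: selfadjoint_def)
qed

lemma selfadjoint_bscale:
  assumes "selfadjoint d p"
  shows "selfadjoint d (c \<cdot>\<^sub>B p)"
proof -
  have "\<exists>K. (\<forall>A B. K A B = K B A) \<and> (\<forall>u\<in>words N d. \<forall>v\<in>words N d. entry (c \<cdot>\<^sub>B p) u v = K (mset u) (mset v))" for N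
  proof -
    obtain K where K: "\<And>A B. K A B = K B A"
      "\<And>u v. u \<in> words N d \<Longrightarrow> v \<in> words N d \<Longrightarrow> entry p u v = K (mset u) (mset v)"
      using selfadjointE[OF assms, where N = N] by metis
    show ?thesis
    proof (intro exI[of _ "\<lambda>A B. c * K A B"] conjI allI ballI)
      show "c * K A B = c * K B A" for A B using K(1) by metis
    qed (simp add: K(2))
  qed
  then show ?thesis using assms by (auto simp: selfadjoint_def)
qed

lemma selfadjoint_sum: "(\<And>a. a \<in> A \<Longrightarrow> selfadjoint d (f a)) \<Longrightarrow> selfadjoint d (sum f A)"
proof (induction A rule: infinite_finite_induct)
  case (insert a A)
  then show ?case by (simp add: selfadjoint_add)
qed (auto simp: selfadjoint_def intro!: exI[of _ "\<lambda>_ _. 0"])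

lemma selfadjoint_bhom: "selfadjoint d p \<Longrightarrow> p \<in> bhom d d"
  by (simp add: selfadjoint_def)

text \<open>The contraction only compares multisets. Both sides therefore have matrix d! K, one with
  the arguments exchanged, and K is symmetric.\<close>

lemma contraction_adjoint:
  assumes p: "selfadjoint d p"
  shows "contraction t d d \<odot>\<^bsub>t\<^esub> (p \<otimes>\<^sub>B symmetrizer d) = contraction t d d \<odot>\<^bsub>t\<^esub> (symmetrizer d \<otimes>\<^sub>B p)"
proof (rule polyfam_eqI[where X = "\<lambda>t. contraction t d d \<odot>\<^bsub>t\<^esub> (p \<otimes>\<^sub>B symmetrizer d)"
      and Y = "\<lambda>t. contraction t d d \<odot>\<^bsub>t\<^esub> (symmetrizer d \<otimes>\<^sub>B p)"])
  note ph = selfadjoint_bhom[OF p]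
  show "polyfam (d + d) 0 (\<lambda>t. contraction t d d \<odot>\<^bsub>t\<^esub> (p \<otimes>\<^sub>B symmetrizer d))"
    "polyfam (d + d) 0 (\<lambda>t. contraction t d d \<odot>\<^bsub>t\<^esub> (symmetrizer d \<otimes>\<^sub>B p))"
    by (rule polyfam_bcomp[OF _ polyfam_full_contraction] polyfam_const bhom_btensor ph bhom_symmetrizer)+
  fix N w v assume w: "w \<in> words N (d + d)" and v: "v \<in> words N 0"
  obtain a b where ab: "a \<in> words N d" "b \<in> words N d" "w = a @ b" using w by (rule words_split)
  obtain K where K: "\<And>A B. K A B = K B A"
    "\<And>u v. u \<in> words N d \<Longrightarrow> v \<in> words N d \<Longrightarrow> entry p u v = K (mset u) (mset v)"
    using selfadjointE[OF p, where N = N] by metis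
  have v: "v = []" using v by simp
  have "entry (contraction (of_nat N) d d \<odot>\<^bsub>of_nat N\<^esub> (p \<otimes>\<^sub>B symmetrizer d)) w v =
      (\<Sum>a'\<in>words N d. fact d * K (mset a) (mset a') *
        (\<Sum>b'\<in>words N d. symker (mset b) (mset b') * symker (mset a') (mset b')))"
    unfolding ab v using ab
    by (subst entry_bcomp[OF bhom_btensor[OF ph bhom_symmetrizer] polyfam_bhom[OF polyfam_full_contraction] append_in_words])
      (simp_all add: sum_words_add entry_btensor[OF ph bhom_symmetrizer] length_words K(2) entry_symmetrizer_words
        entry_full_contraction sum_distrib_left mult_ac cong: sum.cong)
  also have "\<dots> = (\<Sum>a'\<in>words N d. symker (mset b) (mset a') * (fact d * K (mset a) (mset a')))"
    by (simp only: sum_symker(3)[OF ab(2), of "symker _"]) (simp only: symker_commute[of _ "mset b"] mult_ac)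
  also have "\<dots> = fact d * K (mset a) (mset b)" by (rule sum_symker(3)[OF ab(2)])
  finally have L: "entry (contraction (of_nat N) d d \<odot>\<^bsub>of_nat N\<^esub> (p \<otimes>\<^sub>B symmetrizer d)) w v = fact d * K (mset a) (mset b)" .
  have "entry (contraction (of_nat N) d d \<odot>\<^bsub>of_nat N\<^esub> (symmetrizer d \<otimes>\<^sub>B p)) w v =
      (\<Sum>a'\<in>words N d. symker (mset a) (mset a') *
        (\<Sum>b'\<in>words N d. (fact d * K (mset b) (mset b')) * symker (mset a') (mset b')))"
    unfolding ab v using ab
    by (subst entry_bcomp[OF bhom_btensor[OF bhom_symmetrizer ph] polyfam_bhom[OF polyfam_full_contraction] append_in_words])
      (simp_all add: sum_words_add entry_btensor[OF bhom_symmetrizer ph] length_words K(2) entry_symmetrizer_words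
        entry_full_contraction sum_distrib_left mult_ac cong: sum.cong)
  also have "\<dots> = (\<Sum>a'\<in>words N d. symker (mset a) (mset a') * (fact d * K (mset b) (mset a')))"
    by (intro sum.cong refl arg_cong2[where f = "(*)"] sum_symker(4))
  also have "\<dots> = fact d * K (mset b) (mset a)" by (rule sum_symker(3)[OF ab(1)])
  finally show "entry (contraction (of_nat N) d d \<odot>\<^bsub>of_nat N\<^esub> (p \<otimes>\<^sub>B symmetrizer d)) w v =
      entry (contraction (of_nat N) d d \<odot>\<^bsub>of_nat N\<^esub> (symmetrizer d \<otimes>\<^sub>B p)) w v"
    using L K(1) by metis
qed

lemma entry_tensor_sym_coev:
  assumes p: "p \<in> bhom d d" and r: "r \<in> bhom d d"
    and K: "\<And>u v. u \<in> words N d \<Longrightarrow> v \<in> words N d \<Longrightarrow> entry p u v = K (mset u) (mset v)"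
    and L: "\<And>u v. u \<in> words N d \<Longrightarrow> v \<in> words N d \<Longrightarrow> entry r u v = L (mset u) (mset v)"
    and c: "c1 \<in> words N d" "c2 \<in> words N d"
  shows "entry ((p \<otimes>\<^sub>B r) \<odot>\<^bsub>of_nat N\<^esub> sym_coev (of_nat N) d) [] (c1 @ c2) =
    (\<Sum>a\<in>words N d. K (mset a) (mset c1) * L (mset a) (mset c2)) / fact d"
proof -
  have "entry ((p \<otimes>\<^sub>B r) \<odot>\<^bsub>of_nat N\<^esub> sym_coev (of_nat N) d) [] (c1 @ c2) =
      (\<Sum>a1\<in>words N d. K (mset a1) (mset c1) * (\<Sum>a2\<in>words N d. symker (mset a1) (mset a2) * L (mset a2) (mset c2))) / fact d"
    using c
    by (subst entry_bcomp[OF polyfam_bhom[OF polyfam_sym_coev] bhom_btensor[OF p r] _ append_in_words])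
      (simp_all add: sum_words_add entry_btensor[OF p r] length_words K L entry_sym_coev
        sum_distrib_left sum_divide_distrib mult_ac cong: sum.cong)
  then show ?thesis
    by (simp add: sum_symker(3)[where h = "\<lambda>M. L M (mset c2)"] cong: sum.cong)
qed

lemma polyfam_tensor_sym_coev:
  "p \<in> bhom d d \<Longrightarrow> r \<in> bhom d d \<Longrightarrow> polyfam 0 (d + d) (\<lambda>t. (p \<otimes>\<^sub>B r) \<odot>\<^bsub>t\<^esub> sym_coev t d)"
  by (rule polyfam_bcomp[OF polyfam_sym_coev polyfam_const]) (rule bhom_btensor)

lemma sym_coev_adjoint:
  assumes p: "selfadjoint d p"
  shows "(symmetrizer d \<otimes>\<^sub>B p) \<odot>\<^bsub>t\<^esub> sym_coev t d = (p \<otimes>\<^sub>B symmetrizer d) \<odot>\<^bsub>t\<^esub> sym_coev t d"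
proof (rule polyfam_eqI[where X = "\<lambda>t. (symmetrizer d \<otimes>\<^sub>B p) \<odot>\<^bsub>t\<^esub> sym_coev t d"
      and Y = "\<lambda>t. (p \<otimes>\<^sub>B symmetrizer d) \<odot>\<^bsub>t\<^esub> sym_coev t d"])
  note ph = selfadjoint_bhom[OF p]
  show "polyfam 0 (d + d) (\<lambda>t. (symmetrizer d \<otimes>\<^sub>B p) \<odot>\<^bsub>t\<^esub> sym_coev t d)"
    "polyfam 0 (d + d) (\<lambda>t. (p \<otimes>\<^sub>B symmetrizer d) \<odot>\<^bsub>t\<^esub> sym_coev t d)"
    by (rule polyfam_tensor_sym_coev ph bhom_symmetrizer)+
  fix N u w assume u: "u \<in> words N 0" and w: "w \<in> words N (d + d)"
  obtain c1 c2 where c: "c1 \<in> words N d" "c2 \<in> words N d" "w = c1 @ c2" using w by (rule words_split)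
  obtain K where K: "\<And>A B. K A B = K B A"
    "\<And>u v. u \<in> words N d \<Longrightarrow> v \<in> words N d \<Longrightarrow> entry p u v = K (mset u) (mset v)"
    using selfadjointE[OF p, where N = N] by metis
  show "entry ((symmetrizer d \<otimes>\<^sub>B p) \<odot>\<^bsub>of_nat N\<^esub> sym_coev (of_nat N) d) u w =
      entry ((p \<otimes>\<^sub>B symmetrizer d) \<odot>\<^bsub>of_nat N\<^esub> sym_coev (of_nat N) d) u w"
    using u K(1) sum_symker(1)[OF c(1), of "\<lambda>M. K M (mset c2)"] sum_symker(2)[OF c(2), of "\<lambda>M. K M (mset c1)"]
    by (simp add: c entry_tensor_sym_coev[OF bhom_symmetrizer ph entry_symmetrizer_words K(2)]
        entry_tensor_sym_coev[OF ph bhom_symmetrizer K(2) entry_symmetrizer_words])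
qed

lemma symmetrizer_sym_coev: "(symmetrizer d \<otimes>\<^sub>B symmetrizer d) \<odot>\<^bsub>t\<^esub> sym_coev t d = sym_coev t d"
proof (rule polyfam_eqI[where X = "\<lambda>t. (symmetrizer d \<otimes>\<^sub>B symmetrizer d) \<odot>\<^bsub>t\<^esub> sym_coev t d"
      and Y = "\<lambda>t. sym_coev t d"])
  show "polyfam 0 (d + d) (\<lambda>t. (symmetrizer d \<otimes>\<^sub>B symmetrizer d) \<odot>\<^bsub>t\<^esub> sym_coev t d)"
    by (rule polyfam_tensor_sym_coev bhom_symmetrizer)+
  fix N u w assume u: "u \<in> words N 0" and w: "w \<in> words N (d + d)"
  obtain c1 c2 where c: "c1 \<in> words N d" "c2 \<in> words N d" "w = c1 @ c2" using w by (rule words_split)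
  show "entry ((symmetrizer d \<otimes>\<^sub>B symmetrizer d) \<odot>\<^bsub>of_nat N\<^esub> sym_coev (of_nat N) d) u w = entry (sym_coev (of_nat N) d) u w"
    using u sum_symker(1)[OF c(1), of "\<lambda>M. symker M (mset c2)"]
    by (simp add: c entry_tensor_sym_coev[OF bhom_symmetrizer bhom_symmetrizer entry_symmetrizer_words entry_symmetrizer_words]
        entry_sym_coev)
qed (rule polyfam_sym_coev)

lemma contraction_symmetrizer: "contraction t d d \<odot>\<^bsub>t\<^esub> (symmetrizer d \<otimes>\<^sub>B symmetrizer d) = contraction t d d"
proof -
  have i: "iterated_derivation t d d \<in> bhom (d + d) 0"
    using polyfam_bhom[OF polyfam_iterated_derivation[of d d]] by simp
  have s: "symmetrizer d \<otimes>\<^sub>B symmetrizer d \<in> bhom (d + d) (d + d)" by blast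
  show ?thesis
    unfolding contraction_def bcomp_assoc[OF s s i]
    by (simp add: interchange[OF bhom_symmetrizer bhom_symmetrizer bhom_symmetrizer bhom_symmetrizer] symmetrizer_idem)
qed

lemma selfadjoint_symmetrizer_left: "selfadjoint d p \<Longrightarrow> symmetrizer d \<odot>\<^bsub>t\<^esub> p = p"
proof (rule polyfam_eqI[where X = "\<lambda>t. symmetrizer d \<odot>\<^bsub>t\<^esub> p" and Y = "\<lambda>_. p"])
  assume p: "selfadjoint d p"
  note ph = selfadjoint_bhom[OF p]
  show "polyfam d d (\<lambda>t. symmetrizer d \<odot>\<^bsub>t\<^esub> p)" "polyfam d d (\<lambda>_. p)"
    by (rule ph polyfam_bcomp polyfam_symmetrizer polyfam_const)+
  fix N u v assume uv: "u \<in> words N d" "v \<in> words N d"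
  obtain K where K: "\<And>A B. K A B = K B A"
    "\<And>u v. u \<in> words N d \<Longrightarrow> v \<in> words N d \<Longrightarrow> entry p u v = K (mset u) (mset v)"
    using selfadjointE[OF p, where N = N] by metis
  show "entry (symmetrizer d \<odot>\<^bsub>of_nat N\<^esub> p) u v = entry p u v"
    using uv sum_symker(2)[OF uv(2), of "K (mset u)"]
    by (simp add: entry_bcomp[OF ph bhom_symmetrizer uv] K(2) entry_symmetrizer_words cong: sum.cong)
qed

lemma selfadjoint_symmetrizer_right: "selfadjoint d p \<Longrightarrow> p \<odot>\<^bsub>t\<^esub> symmetrizer d = p"
proof (rule polyfam_eqI[where X = "\<lambda>t. p \<odot>\<^bsub>t\<^esub> symmetrizer d" and Y = "\<lambda>_. p"])
  assume p: "selfadjoint d p"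
  note ph = selfadjoint_bhom[OF p]
  show "polyfam d d (\<lambda>t. p \<odot>\<^bsub>t\<^esub> symmetrizer d)" "polyfam d d (\<lambda>_. p)"
    by (rule ph polyfam_bcomp polyfam_symmetrizer polyfam_const)+
  fix N u v assume uv: "u \<in> words N d" "v \<in> words N d"
  obtain K where K: "\<And>A B. K A B = K B A"
    "\<And>u v. u \<in> words N d \<Longrightarrow> v \<in> words N d \<Longrightarrow> entry p u v = K (mset u) (mset v)"
    using selfadjointE[OF p, where N = N] by metis
  show "entry (p \<odot>\<^bsub>of_nat N\<^esub> symmetrizer d) u v = entry p u v"
    using uv sum_symker(3)[OF uv(1), of "\<lambda>M. K M (mset v)"]
    by (simp add: entry_bcomp[OF bhom_symmetrizer ph uv] K(2) entry_symmetrizer_words cong: sum.cong)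
qed

text \<open>As a differential operator the element is \<Theta>^j times the invariant operator given
  by the coevaluation of S^(d-2j)(V), times \<Delta>^j. The middle factor acts as the binomial of E
  over d - 2j, and after \<Delta>^j the value of E is q - 2j.\<close>

lemma action_theta_delta:
  assumes j: "2 * j \<le> d"
  shows "action t d d ((theta_delta d j \<otimes>\<^sub>B symmetrizer d) \<odot>\<^bsub>t\<^esub> sym_coev t d) q =
    of_nat ((q - 2 * j) choose (d - 2 * j)) \<cdot>\<^sub>B theta_delta q j"
proof (cases "d \<le> q")
  case False
  then show ?thesis
    by (cases "2 * j \<le> q") (simp_all add: action_eq_0 theta_delta_def binomial_eq_0 j diff_less_mono)
next
  case dq: True
  then have jq: "2 * j \<le> q" and q: "d + (q - d) = q" using j by auto
  let ?x = "\<lambda>t. (theta_delta d j \<otimes>\<^sub>B symmetrizer d) \<odot>\<^bsub>t\<^esub> sym_coev t d"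
  show ?thesis
  proof (rule polyfam_eqI[where X = "\<lambda>t. action t d d (?x t) q"
        and Y = "\<lambda>_. of_nat ((q - 2 * j) choose (d - 2 * j)) \<cdot>\<^sub>B theta_delta q j"])
    have x: "polyfam 0 (d + d) ?x" by (rule polyfam_tensor_sym_coev bhom_theta_delta bhom_symmetrizer)+
    show "polyfam q q (\<lambda>t. action t d d (?x t) q)" using polyfam_action[OF x, of q] unfolding q .
    show "polyfam q q (\<lambda>_. of_nat ((q - 2 * j) choose (d - 2 * j)) \<cdot>\<^sub>B theta_delta q j)"
      by (rule polyfam_const bhom_bscale bhom_theta_delta)+
    fix N b c assume b: "b \<in> words N q" and c: "c \<in> words N q"
    have c': "c \<in> words N (d + (q - d))" using c unfolding q .
    \<comment> \<open>The constant of \<open>theta_delta\<close> in degree d, times the factor 1/d!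
      of \<open>sym_coev\<close>.\<close>
    define k where "k = (1 / 4) ^ j * (fact d / fact (d - 2 * j)) / (fact d :: complex)"
    define r where "r = d - 2 * j"
    have ex: "entry (?x (of_nat N)) [] (a1 @ a2) = k * cupcap_kernel N d j (mset a2) (mset a1)"
      if a: "a1 \<in> words N d" "a2 \<in> words N d" for a1 a2
    proof -
      have "entry (?x (of_nat N)) [] (a1 @ a2) = (\<Sum>a\<in>words N d. (k * fact d * cupcap_kernel N d j (mset a) (mset a1)) *
          symker (mset a) (mset a2)) / fact d"
        by (rule entry_tensor_sym_coev[OF bhom_theta_delta bhom_symmetrizer _ entry_symmetrizer_words a])
          (use j in \<open>auto simp: theta_delta_def entry_sym_cupcap k_def\<close>)
      then show ?thesis
        using sum_symker(2)[OF a(2), of "\<lambda>M. k * fact d * cupcap_kernel N d j M (mset a1)"] by simp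
    qed
    have "entry (action (of_nat N) d d (?x (of_nat N)) q) b c = fact q / fact (q - d) *
        (\<Sum>a1\<in>words N d. \<Sum>a2\<in>words N d. \<Sum>b1\<in>words N (q - d). k * cupcap_kernel N d j (mset a2) (mset a1) *
          symker (mset b) (mset a2 + mset b1) * symker (mset a1 + mset b1) (mset c))"
      by (subst entry_action[OF polyfam_bhom[OF x] dq b c']) (simp add: ex cong: sum.cong)
    also have "\<dots> = fact q / fact (q - d) * k * (\<Sum>a1\<in>words N d. \<Sum>a2\<in>words N d. \<Sum>b1\<in>words N (q - d).
        \<Sum>I\<in>words N j. \<Sum>J\<in>words N j. \<Sum>e\<in>words N r.
          (symker (mset (I @ I @ e)) (mset a2) * symker (mset b) (mset a2 + mset b1)) *
          (symker (mset (J @ J @ e)) (mset a1) * symker (mset a1 + mset b1) (mset c)))"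
      by (simp add: cupcap_kernel_def sum_distrib_left sum_distrib_right r_def mult_ac add.assoc symker_commute[of "mset _" "_ + _"])
    also have "(\<Sum>a1\<in>words N d. \<Sum>a2\<in>words N d. \<Sum>b1\<in>words N (q - d).
        \<Sum>I\<in>words N j. \<Sum>J\<in>words N j. \<Sum>e\<in>words N r.
          (symker (mset (I @ I @ e)) (mset a2) * symker (mset b) (mset a2 + mset b1)) *
          (symker (mset (J @ J @ e)) (mset a1) * symker (mset a1 + mset b1) (mset c))) =
        (\<Sum>b1\<in>words N (q - d). \<Sum>I\<in>words N j. \<Sum>J\<in>words N j. \<Sum>e\<in>words N r.
          (\<Sum>a2\<in>words N d. symker (mset (I @ I @ e)) (mset a2) * symker (mset b) (mset a2 + mset b1)) *
          (\<Sum>a1\<in>words N d. symker (mset (J @ J @ e)) (mset a1) * symker (mset a1 + mset b1) (mset c)))"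
    proof -
      have "(\<Sum>a1\<in>A. \<Sum>a2\<in>A. \<Sum>b\<in>B. \<Sum>i\<in>C. \<Sum>j\<in>C. \<Sum>e\<in>E. X a2 b i j e * Y a1 b i j e) =
          (\<Sum>b\<in>B. \<Sum>i\<in>C. \<Sum>j\<in>C. \<Sum>e\<in>E. (\<Sum>a2\<in>A. X a2 b i j e) * (\<Sum>a1\<in>A. Y a1 b i j e :: complex))"
        for A B C E :: "nat list set" and X Y
      proof -
        have "(\<Sum>a2\<in>A. X a2 b i j e) * (\<Sum>a1\<in>A. Y a1 b i j e) = (\<Sum>p\<in>A \<times> A. X (snd p) b i j e * Y (fst p) b i j e)" for b i j e
          by (subst mult.commute, subst sum_product) (simp add: sum.cartesian_product case_prod_unfold mult.commute)
        then have "(\<Sum>b\<in>B. \<Sum>i\<in>C. \<Sum>j\<in>C. \<Sum>e\<in>E. (\<Sum>a2\<in>A. X a2 b i j e) * (\<Sum>a1\<in>A. Y a1 b i j e)) =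
            (\<Sum>b\<in>B. \<Sum>i\<in>C. \<Sum>j\<in>C. \<Sum>e\<in>E. \<Sum>p\<in>A \<times> A. X (snd p) b i j e * Y (fst p) b i j e)" by simp
        also have "\<dots> = (\<Sum>p\<in>A \<times> A. \<Sum>b\<in>B. \<Sum>i\<in>C. \<Sum>j\<in>C. \<Sum>e\<in>E. X (snd p) b i j e * Y (fst p) b i j e)"
          by (simp only: sum.swap[of _ "A \<times> A"])
        finally have *: "(\<Sum>b\<in>B. \<Sum>i\<in>C. \<Sum>j\<in>C. \<Sum>e\<in>E. (\<Sum>a2\<in>A. X a2 b i j e) * (\<Sum>a1\<in>A. Y a1 b i j e)) =
            (\<Sum>p\<in>A \<times> A. \<Sum>b\<in>B. \<Sum>i\<in>C. \<Sum>j\<in>C. \<Sum>e\<in>E. X (snd p) b i j e * Y (fst p) b i j e)" .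
        have "(\<Sum>a1\<in>A. \<Sum>a2\<in>A. Z a1 a2) = (\<Sum>p\<in>A \<times> A. Z (fst p) (snd p))" for Z :: "_ \<Rightarrow> _ \<Rightarrow> complex"
          by (simp add: sum.cartesian_product case_prod_unfold)
        then show ?thesis unfolding * .
      qed
      then show ?thesis .
    qed
    also have "\<dots> = (\<Sum>b1\<in>words N (q - d). \<Sum>I\<in>words N j. \<Sum>J\<in>words N j. \<Sum>e\<in>words N r.
          symker (mset b) (mset (I @ I @ e) + mset b1) * symker (mset (J @ J @ e) + mset b1) (mset c))"
    proof -
      have "I @ I @ e \<in> words N d" if "I \<in> words N j" "e \<in> words N r" for I e
        using that j by (auto simp: words_def r_def)
      then show ?thesis by (intro sum.cong refl arg_cong2[where f = "(*)"] sum_symker_swap(1,3))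
    qed
    also have "\<dots> = cupcap_kernel N q j (mset b) (mset c)"
    proof -
      \<comment> \<open>The through word e of the element and the untouched word b1 together form an
        arbitrary through word of length q - 2j, so that the kernel of degree d becomes the one of
        degree q.\<close>
      have "q - 2 * j = r + (q - d)" using j dq by (simp add: r_def)
      then have "cupcap_kernel N q j (mset b) (mset c) = (\<Sum>I\<in>words N j. \<Sum>J\<in>words N j. \<Sum>e\<in>words N r. \<Sum>b1\<in>words N (q - d).
          symker (mset b) (mset (I @ I @ e) + mset b1) * symker (mset (J @ J @ e) + mset b1) (mset c))"
        by (simp add: cupcap_kernel_def sum_words_add add.assoc)
      also have "\<dots> = (\<Sum>b1\<in>words N (q - d). \<Sum>I\<in>words N j. \<Sum>J\<in>words N j. \<Sum>e\<in>words N r.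
          symker (mset b) (mset (I @ I @ e) + mset b1) * symker (mset (J @ J @ e) + mset b1) (mset c))"
        by (simp only: sum.swap[of _ "words N (q - d)"])
      finally show ?thesis by simp
    qed
    also have "fact q / fact (q - d) * k = (of_nat ((q - 2 * j) choose (d - 2 * j)) * ((1 / 4) ^ j * (fact q / fact (q - 2 * j))) :: complex)"
    proof -
      have "q - 2 * j - (d - 2 * j) = q - d" using j dq by simp
      then have "(of_nat ((q - 2 * j) choose (d - 2 * j)) :: complex) = fact (q - 2 * j) / (fact (d - 2 * j) * fact (q - d))"
        using binomial_fact[OF diff_le_mono[OF dq, of "2 * j"], where 'a = complex] by simp
      then show ?thesis by (simp add: k_def mult_ac)
    qed
    finally show "entry (action (of_nat N) d d (?x (of_nat N)) q) b c =
        entry (of_nat ((q - 2 * j) choose (d - 2 * j)) \<cdot>\<^sub>B theta_delta q j) b c"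
      using jq b c by (simp add: theta_delta_def entry_sym_cupcap)
  qed
qed

section \<open>Polynomials in an endomorphism\<close>

lemma coprime_linear_factors:
  fixes c d :: complex
  assumes "c \<noteq> d"
  shows "coprime [:- c, 1:] [:- d, 1:]"
proof (rule coprimeI)
  fix k assume k: "k dvd [:- c, 1:]" "k dvd [:- d, 1:]"
  have "k dvd [:- c, 1:] - [:- d, 1:]" using k by (rule dvd_diff)
  then have "k dvd [:d - c:]" by simp
  moreover have "d - c \<noteq> 0" using assms by auto
  ultimately have "k dvd [:d - c:]" "[:d - c:] dvd 1" by (simp_all add: is_unit_const_poly_iff dvd_field_iff)
  then show "is_unit k" by (rule dvd_trans)
qed

locale endomorphism =
  fixes t :: complex and X :: kobject and f :: morphism
  assumes X: "is_object t X" and f: "f \<in> khom t X X"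
begin

abbreviation ep :: "complex poly \<Rightarrow> morphism" where "ep p \<equiv> endo_poly t X p f"

lemma ident_bhom: "ident X \<in> bhom (fst X) (fst X)" and ident_idem: "ident X \<odot>\<^bsub>t\<^esub> ident X = ident X"
  using X by (auto simp: is_object_def)

lemma f_bhom: "f \<in> bhom (fst X) (fst X)" and f_ident: "f \<odot>\<^bsub>t\<^esub> ident X = f" "ident X \<odot>\<^bsub>t\<^esub> f = f"
  using f by (auto simp: khom_def)

lemma endo_power_bhom: "endo_power t X f n \<in> bhom (fst X) (fst X)"
  by (induction n) (auto intro: ident_bhom f_bhom)

lemma ep_bhom: "ep p \<in> bhom (fst X) (fst X)"
  unfolding endo_poly_def by (intro bhom_sum bhom_bscale endo_power_bhom)

lemma ep_eq_sum:
  assumes "degree p \<le> n"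
  shows "ep p = (\<Sum>i\<le>n. coeff p i \<cdot>\<^sub>B endo_power t X f i)"
  unfolding endo_poly_def using assms
  by (intro sum.mono_neutral_left) (auto simp: coeff_eq_0)

lemma ep_0 [simp]: "ep 0 = 0"
  by (simp add: endo_poly_def)

lemma ep_add: "ep (p + q) = ep p + ep q"
  using ep_eq_sum[of p "max (degree p) (degree q)"] ep_eq_sum[of q "max (degree p) (degree q)"]
    ep_eq_sum[OF degree_add_le_max, of p q]
  by (simp add: bscale_left_distrib sum.distrib)

lemma ep_smult: "ep (smult c p) = c \<cdot>\<^sub>B ep p"
  using ep_eq_sum[OF degree_smult_le, of c p] by (simp add: endo_poly_def bscale_sum_right)

lemma ep_minus: "ep (- p) = - ep p"
  using ep_smult[of "- 1" p] by (simp add: bscale_minus_left)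

lemma ep_diff: "ep (p - q) = ep p - ep q"
  using ep_add[of p "- q"] by (simp add: ep_minus)

lemma ep_sum: "ep (sum g A) = (\<Sum>a\<in>A. ep (g a))"
  by (induction A rule: infinite_finite_induct) (auto simp: ep_add)

lemma ep_pCons: "ep (pCons a p) = a \<cdot>\<^sub>B ident X + f \<odot>\<^bsub>t\<^esub> ep p"
proof -
  have "ep (pCons a p) = (\<Sum>i\<le>Suc (degree p). coeff (pCons a p) i \<cdot>\<^sub>B endo_power t X f i)"
    by (rule ep_eq_sum) (simp add: degree_pCons_le)
  also have "\<dots> = a \<cdot>\<^sub>B ident X + (\<Sum>i\<le>degree p. coeff p i \<cdot>\<^sub>B (f \<odot>\<^bsub>t\<^esub> endo_power t X f i))"
    by (subst sum.atMost_Suc_shift) simp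
  also have "(\<Sum>i\<le>degree p. coeff p i \<cdot>\<^sub>B (f \<odot>\<^bsub>t\<^esub> endo_power t X f i)) = f \<odot>\<^bsub>t\<^esub> ep p"
    unfolding endo_poly_def
    by (subst bcomp_sum_right[OF f_bhom]) (auto intro: endo_power_bhom simp: bcomp_bscale_right[OF endo_power_bhom f_bhom])
  finally show ?thesis .
qed

lemma ep_const: "ep [:a:] = a \<cdot>\<^sub>B ident X"
  by (simp add: ep_pCons)

lemma ep_1 [simp]: "ep 1 = ident X"
  using ep_const[of 1] by (simp add: one_pCons)

lemma ep_linear: "ep [:a, 1:] = a \<cdot>\<^sub>B ident X + f"
  by (simp add: ep_pCons f_ident)

lemma ident_ep: "ident X \<odot>\<^bsub>t\<^esub> ep p = ep p"
proof (induction p)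
  case (pCons a p)
  have "f \<odot>\<^bsub>t\<^esub> ep p \<in> bhom (fst X) (fst X)" using f_bhom ep_bhom by blast
  then have "ident X \<odot>\<^bsub>t\<^esub> ep (pCons a p) = a \<cdot>\<^sub>B (ident X \<odot>\<^bsub>t\<^esub> ident X) + ident X \<odot>\<^bsub>t\<^esub> (f \<odot>\<^bsub>t\<^esub> ep p)"
    unfolding ep_pCons
    by (subst bcomp_add_right[OF bhom_bscale[OF ident_bhom] _ ident_bhom])
      (auto simp: bcomp_bscale_right[OF ident_bhom ident_bhom])
  also have "ident X \<odot>\<^bsub>t\<^esub> (f \<odot>\<^bsub>t\<^esub> ep p) = f \<odot>\<^bsub>t\<^esub> ep p"
    using bcomp_assoc[OF ep_bhom f_bhom ident_bhom, of t p] by (simp add: f_ident)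
  finally show ?case by (simp add: ident_idem ep_pCons)
qed simp

lemma ep_mult: "ep (p * q) = ep p \<odot>\<^bsub>t\<^esub> ep q"
proof (induction p)
  case (pCons a p)
  have fp: "f \<odot>\<^bsub>t\<^esub> ep p \<in> bhom (fst X) (fst X)" using f_bhom ep_bhom by blast
  have "ep (pCons a p * q) = a \<cdot>\<^sub>B ep q + f \<odot>\<^bsub>t\<^esub> (ep p \<odot>\<^bsub>t\<^esub> ep q)"
    by (simp add: ep_add ep_smult ep_pCons pCons.IH)
  also have "\<dots> = a \<cdot>\<^sub>B (ident X \<odot>\<^bsub>t\<^esub> ep q) + (f \<odot>\<^bsub>t\<^esub> ep p) \<odot>\<^bsub>t\<^esub> ep q"
    by (simp add: ident_ep bcomp_assoc[OF ep_bhom ep_bhom f_bhom])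
  also have "\<dots> = ep (pCons a p) \<odot>\<^bsub>t\<^esub> ep q"
    unfolding ep_pCons
    by (subst bcomp_add_left[OF ep_bhom bhom_bscale[OF ident_bhom] fp])
      (simp add: bcomp_bscale_left[OF ep_bhom ident_bhom])
  finally show ?case .
qed simp

lemma ep_ident: "ep p \<odot>\<^bsub>t\<^esub> ident X = ep p"
  using ep_mult[of p 1] by simp

lemma ep_khom: "ep p \<in> khom t X X"
  by (simp add: khom_def ep_bhom ep_ident ident_ep)

lemma ep_comp_assoc: "h \<in> bhom m (fst X) \<Longrightarrow> ep (p * q) \<odot>\<^bsub>t\<^esub> h = ep p \<odot>\<^bsub>t\<^esub> (ep q \<odot>\<^bsub>t\<^esub> h)"
  by (simp add: ep_mult bcomp_assoc[OF _ ep_bhom ep_bhom])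

lemma endo_power_ep: "endo_power t X (ep p) n = ep (p ^ n)"
  by (induction n) (simp_all add: ep_mult)

text \<open>Primary decomposition without subspaces: a Bezout identity for two coprime factors
  writes h as a sum of two morphisms, each killed by one of the factors, and induction splits off
  one root at a time.\<close>

lemma ep_comp_eq_0_of_factors:
  assumes "finite S" and Y: "is_object t Y" and h: "h \<in> khom t Y X" and g: "g \<in> bhom (fst X) n"
    and "ep (\<Prod>c\<in>S. [:- c, 1:] ^ e c) \<odot>\<^bsub>t\<^esub> h = 0"
    and "\<And>c h. c \<in> S \<Longrightarrow> h \<in> khom t Y X \<Longrightarrow> ep ([:- c, 1:] ^ e c) \<odot>\<^bsub>t\<^esub> h = 0 \<Longrightarrow> g \<odot>\<^bsub>t\<^esub> h = 0"
  shows "g \<odot>\<^bsub>t\<^esub> h = 0"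
  using assms(1,3,5,6)
proof (induction S arbitrary: h)
  case empty
  then show ?case by (simp add: khom_def)
next
  case (insert c S)
  let ?A = "[:- c, 1:] ^ e c" and ?B = "\<Prod>c\<in>S. [:- c, 1:] ^ e c"
  have "coprime [:- c, 1:] [:- d, 1:]" if "d \<in> S" for d
    using that insert.hyps by (intro coprime_linear_factors) auto
  then have "coprime ?A ?B"
    by (intro coprime_power_left_iff[THEN iffD2] disjI1 prod_coprime_right)
      (auto simp: coprime_power_right_iff coprime_power_left_iff)
  then have "fst (bezout_coefficients ?A ?B) * ?A + snd (bezout_coefficients ?A ?B) * ?B = 1"
    by (simp only: bezout_coefficients_fst_snd coprime_imp_gcd_eq_1)
  then obtain u v where uv: "u * ?A + v * ?B = 1" by blast
  have hh: "h \<in> bhom (fst Y) (fst X)" "h \<odot>\<^bsub>t\<^esub> ident Y = h" "ident X \<odot>\<^bsub>t\<^esub> h = h"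
    using insert.prems(1) by (auto simp: khom_def)
  have idY: "ident Y \<in> bhom (fst Y) (fst Y)" using Y by (simp add: is_object_def)
  have hY: "ep p \<odot>\<^bsub>t\<^esub> h \<in> khom t Y X" for p
    using hh ep_bhom
    by (auto simp: khom_def bcomp_assoc[OF idY hh(1) ep_bhom] bcomp_assoc[OF hh(1) ep_bhom ident_bhom, symmetric] ident_ep)
    have A: "ep (p * q) \<odot>\<^bsub>t\<^esub> h = ep p \<odot>\<^bsub>t\<^esub> (ep q \<odot>\<^bsub>t\<^esub> h)" for p q by (rule ep_comp_assoc[OF hh(1)])
    have AB: "ep (?A * ?B) \<odot>\<^bsub>t\<^esub> h = 0" using insert by simp
    have "ep ?B \<odot>\<^bsub>t\<^esub> (ep (u * ?A) \<odot>\<^bsub>t\<^esub> h) = ep (u * (?A * ?B)) \<odot>\<^bsub>t\<^esub> h"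
      unfolding A[symmetric] by (simp add: mult_ac)
    also have "\<dots> = 0" unfolding A[of u] AB by simp
    finally have 1: "g \<odot>\<^bsub>t\<^esub> (ep (u * ?A) \<odot>\<^bsub>t\<^esub> h) = 0"
      using insert.IH[OF hY[of "u * ?A"]] insert.prems(3) by blast
    have "ep ?A \<odot>\<^bsub>t\<^esub> (ep (v * ?B) \<odot>\<^bsub>t\<^esub> h) = ep (v * (?A * ?B)) \<odot>\<^bsub>t\<^esub> h"
      unfolding A[symmetric] by (simp add: mult_ac)
    also have "\<dots> = 0" unfolding A[of v] AB by simp
    finally have 2: "g \<odot>\<^bsub>t\<^esub> (ep (v * ?B) \<odot>\<^bsub>t\<^esub> h) = 0"
      using insert.prems(3)[OF _ hY[of "v * ?B"]] by blast
    have "h = ep (u * ?A + v * ?B) \<odot>\<^bsub>t\<^esub> h" unfolding uv by (simp add: hh)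
    also have "\<dots> = ep (u * ?A) \<odot>\<^bsub>t\<^esub> h + ep (v * ?B) \<odot>\<^bsub>t\<^esub> h"
      unfolding ep_add by (rule bcomp_add_left[OF hh(1) ep_bhom ep_bhom])
    finally have "g \<odot>\<^bsub>t\<^esub> h = g \<odot>\<^bsub>t\<^esub> (ep (u * ?A) \<odot>\<^bsub>t\<^esub> h) + g \<odot>\<^bsub>t\<^esub> (ep (v * ?B) \<odot>\<^bsub>t\<^esub> h)"
      using bcomp_add_right[OF bhom_bcomp[OF hh(1) ep_bhom] bhom_bcomp[OF hh(1) ep_bhom] g] by metis
    then show ?case using 1 2 by simp
qed

end

section \<open>The Casimir operator\<close>

lemma selfadjoint_khom: "selfadjoint d p \<Longrightarrow> p \<in> khom t (Sym d) (Sym d)"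
  by (simp add: khom_def Sym_def selfadjoint_bhom selfadjoint_symmetrizer_left selfadjoint_symmetrizer_right)

lemma is_object_Sym: "is_object t (Sym d)"
  by (simp add: is_object_def Sym_def bhom_symmetrizer symmetrizer_idem)

lemma raise_lower_eq: "raise_lower t d = theta_delta d 1"
proof (rule polyfam_eqI[where X = "\<lambda>t. raise_lower t d" and Y = "\<lambda>_. theta_delta d 1"])
  show "polyfam d d (\<lambda>_. theta_delta d 1)" by (rule polyfam_const) (rule bhom_theta_delta)
  fix N b c assume bc: "b \<in> words N d" "c \<in> words N d"
  show "entry (raise_lower (of_nat N) d) b c = entry (theta_delta d 1) b c"
  proof (cases "d < 2")
    case True
    then show ?thesis by (simp add: raise_lower_eq_0 theta_delta_def)
  next
    case False
    have "(\<Sum>e\<in>words N (d - 2). (\<Sum>i<N. symker (mset b) ({#i, i#} + mset e)) * (\<Sum>k<N. symker ({#k, k#} + mset e) (mset c))) =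
        cupcap_kernel N d 1 (mset b) (mset c)"
    proof -
      have "cupcap_kernel N d 1 (mset b) (mset c) =
          (\<Sum>i<N. \<Sum>k<N. \<Sum>e\<in>words N (d - 2). symker (mset b) ({#i, i#} + mset e) * symker ({#k, k#} + mset e) (mset c))"
        by (simp add: cupcap_kernel_def sum_words_Suc)
      also have "\<dots> = (\<Sum>e\<in>words N (d - 2). \<Sum>i<N. \<Sum>k<N. symker (mset b) ({#i, i#} + mset e) * symker ({#k, k#} + mset e) (mset c))"
        by (simp only: sum.swap[of _ "words N (d - 2)"])
      finally show ?thesis by (simp add: sum_product)
    qed
    then show ?thesis using False bc
      by (simp only: entry_raise_lower not_less) (simp add: theta_delta_def entry_sym_cupcap)
  qed
qed (rule polyfam_raise_lower)

lemma Casimir_theta_delta: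
  "Casimir t d = (of_nat d * (of_nat d + t - 2)) \<cdot>\<^sub>B symmetrizer d - 4 \<cdot>\<^sub>B theta_delta d 1"
  unfolding Casimir_eq raise_lower_eq ..

lemma selfadjoint_Casimir: "selfadjoint d (Casimir t d)"
proof -
  have "selfadjoint d ((of_nat d * (of_nat d + t - 2)) \<cdot>\<^sub>B symmetrizer d + (- 4) \<cdot>\<^sub>B theta_delta d 1)"
    by (intro selfadjoint_add selfadjoint_bscale selfadjoint_symmetrizer selfadjoint_theta_delta)
  then show ?thesis by (simp add: Casimir_theta_delta bscale_minus_left)
qed

lemma endomorphism_Casimir: "endomorphism t (Sym d) (Casimir t d)"
  by unfold_locales (simp_all add: is_object_Sym selfadjoint_khom selfadjoint_Casimir)

abbreviation casimir_eval :: "complex \<Rightarrow> nat \<Rightarrow> complex poly \<Rightarrow> morphism" where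
  "casimir_eval t d p \<equiv> endo_poly t (Sym d) p (Casimir t d)"

text \<open>
  The nodes are the eigenvalues of \<open>\<Theta>\<Delta>\<close> on \<open>S\<^sup>d(V)\<close>, and the levels those of the Casimir operator.
\<close>

definition node :: "complex \<Rightarrow> nat \<Rightarrow> nat \<Rightarrow> complex" where
  "node t d i = of_nat i * (of_nat d + t / 2 - 1 - of_nat i)"

definition level :: "complex \<Rightarrow> nat \<Rightarrow> nat \<Rightarrow> complex" where
  "level t d i = of_nat d * (of_nat d + t - 2) - 4 * node t d i"

lemma level_eq: "level t d i = (of_nat d - 2 * of_nat i) * (of_nat d - 2 * of_nat i + t - 2)"
  by (simp add: level_def node_def algebra_simps)

text \<open>On degree d the Casimir operator is a scalar minus 4\<Theta>\<Delta>, so that the factor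
  -1/4 turns C - level_i into \<Theta>\<Delta> - node_i.\<close>

definition newton :: "complex \<Rightarrow> nat \<Rightarrow> nat \<Rightarrow> complex poly" where
  "newton t d j = (\<Prod>i<j. smult (- 1 / 4) [:- level t d i, 1:])"

lemma newton_Suc: "newton t d (Suc j) = smult (- 1 / 4) [:- level t d j, 1:] * newton t d j"
  by (simp add: newton_def mult.commute)

lemma poly_newton: "poly (newton t d j) (level t d k) = (\<Prod>i<j. node t d k - node t d i)"
  unfolding newton_def poly_prod by (intro prod.cong refl) (simp add: level_def field_simps)

lemma newton_nonzero: "newton t d j \<noteq> 0"
  by (simp add: newton_def)

lemma degree_newton: "degree (newton t d j) = j"
proof (induction j)
  case (Suc j)
  have "degree (newton t d (Suc j)) = degree (smult (- 1 / 4) [:- level t d j, 1:]) + degree (newton t d j)"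
    unfolding newton_Suc by (rule degree_mult_eq) (simp_all add: newton_nonzero)
  then show ?case using Suc by simp
qed (simp add: newton_def)

text \<open>The recursion \<open>raise_lower_theta_delta\<close> says that \<Theta>\<Delta> - node_j
  takes \<Theta>^j\<Delta>^j to \<Theta>^(j+1)\<Delta>^(j+1). The nodes are chosen for this.\<close>

lemma casimir_eval_newton: "casimir_eval t d (newton t d j) = theta_delta d j"
proof (induction j)
  case 0
  interpret endomorphism t "Sym d" "Casimir t d" by (rule endomorphism_Casimir)
  show ?case by (simp add: newton_def theta_delta_0 Sym_def[symmetric]) (simp add: Sym_def)
next
  case (Suc j)
  interpret endomorphism t "Sym d" "Casimir t d" by (rule endomorphism_Casimir)
  have lin: "ep (smult (- 1 / 4) [:- level t d j, 1:]) = theta_delta d 1 - node t d j \<cdot>\<^sub>B symmetrizer d"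
    unfolding ep_smult ep_linear
    by (rule poly_mapping_eqI)
      (simp add: Sym_def Casimir_theta_delta level_def lookup_add lookup_minus field_simps)
  have "ep (newton t d (Suc j)) = (theta_delta d 1 - node t d j \<cdot>\<^sub>B symmetrizer d) \<odot>\<^bsub>t\<^esub> theta_delta d j"
    unfolding newton_Suc ep_mult lin Suc.IH ..
  also have "\<dots> = theta_delta d 1 \<odot>\<^bsub>t\<^esub> theta_delta d j - node t d j \<cdot>\<^sub>B theta_delta d j"
    by (subst bcomp_diff_left[OF bhom_theta_delta bhom_theta_delta bhom_bscale[OF bhom_symmetrizer]])
      (simp add: bcomp_bscale_left[OF bhom_theta_delta bhom_symmetrizer] selfadjoint_symmetrizer_left selfadjoint_theta_delta)
  also have "theta_delta d 1 \<odot>\<^bsub>t\<^esub> theta_delta d j = theta_delta d (Suc j) + node t d j \<cdot>\<^sub>B theta_delta d j"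
    using raise_lower_theta_delta[of t d j] by (simp add: raise_lower_eq node_def)
  finally show ?case by simp
qed

lemma poly_eq_sum_of_degrees:
  fixes b :: "nat \<Rightarrow> 'a::field poly"
  assumes b: "\<And>j. degree (b j) = j" "\<And>j. b j \<noteq> 0" and p: "degree p \<le> n"
  shows "\<exists>a. p = (\<Sum>j\<le>n. smult (a j) (b j))"
  using p
proof (induction n arbitrary: p)
  case 0
  then obtain c where c: "p = [:c:]" by (metis degree_eq_zeroE le_zero_eq)
  obtain e where e: "b 0 = [:e:]" using b(1)[of 0] by (metis degree_eq_zeroE)
  then have "e \<noteq> 0" using b(2)[of 0] by simp
  then show ?case using c e by (intro exI[of _ "\<lambda>_. c / e"]) simp
next
  case (Suc n)
  define k where "k = coeff p (Suc n) / lead_coeff (b (Suc n))"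
  let ?p = "p - smult k (b (Suc n))"
  have "lead_coeff (b (Suc n)) \<noteq> 0" using b(2) by simp
  then have "coeff ?p (Suc n) = 0" using b(1)[of "Suc n"] by (simp add: k_def)
  moreover have "degree ?p \<le> Suc n"
    using Suc.prems b(1)[of "Suc n"] by (intro degree_diff_le) (auto intro: order_trans[OF degree_smult_le])
  ultimately have "degree ?p \<le> n"
  proof (intro degree_le allI impI)
    fix i assume "n < i"
    then consider "i = Suc n" | "Suc n < i" by linarith
    then show "coeff ?p i = 0"
    proof cases
      case 1
      then show ?thesis using \<open>coeff ?p (Suc n) = 0\<close> by blast
    next
      case 2
      then show ?thesis using \<open>degree ?p \<le> Suc n\<close> by (intro coeff_eq_0) linarith
    qed
  qed
  then obtain a where a: "?p = (\<Sum>j\<le>n. smult (a j) (b j))" using Suc.IH by blast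
  have "p = ?p + smult k (b (Suc n))" by simp
  also have "\<dots> = (\<Sum>j\<le>Suc n. smult ((a(Suc n := k)) j) (b j))"
    unfolding a by simp
  finally show ?case by blast
qed

definition casimir_poly :: "complex \<Rightarrow> nat \<Rightarrow> complex poly" where
  "casimir_poly t d = (\<Prod>i\<le>d div 2. [:- level t d i, 1:])"

lemma casimir_poly_nonzero: "casimir_poly t d \<noteq> 0"
  by (simp add: casimir_poly_def)

lemma lead_coeff_casimir_poly: "lead_coeff (casimir_poly t d) = 1"
  by (simp add: casimir_poly_def lead_coeff_prod)

lemma degree_casimir_poly: "degree (casimir_poly t d) = Suc (d div 2)"
  unfolding casimir_poly_def by (subst degree_prod_eq_sum_degree) auto

text \<open>Up to a scalar this is the Newton polynomial of index d div 2 + 1, whose value would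
  need more than d source points for its caps.\<close>

lemma casimir_eval_casimir_poly: "casimir_eval t d (casimir_poly t d) = 0"
proof -
  interpret endomorphism t "Sym d" "Casimir t d" by (rule endomorphism_Casimir)
  have "newton t d (Suc (d div 2)) = smult ((- 1 / 4) ^ Suc (d div 2)) (casimir_poly t d)"
    unfolding newton_def casimir_poly_def lessThan_Suc_atMost by (subst prod_smult) simp
  then have "casimir_poly t d = smult (1 / (- 1 / 4) ^ Suc (d div 2)) (newton t d (Suc (d div 2)))"
    by simp
  moreover have "casimir_eval t d (newton t d (Suc (d div 2))) = 0"
  proof -
    have "\<not> 2 * Suc (d div 2) \<le> d" by presburger
    then show ?thesis unfolding casimir_eval_newton theta_delta_def by (rule if_not_P)
  qed
  ultimately show ?thesis by (metis ep_smult bscale_simps(3))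
qed

text \<open>A remainder modulo \<open>casimir_poly\<close> is a combination of the Newton
  polynomials of index at most d div 2, and their values are linearly independent.\<close>

lemma casimir_eval_eq_0_iff: "casimir_eval t d p = 0 \<longleftrightarrow> casimir_poly t d dvd p"
proof
  interpret endomorphism t "Sym d" "Casimir t d" by (rule endomorphism_Casimir)
  show "ep p = 0" if dvd: "casimir_poly t d dvd p"
  proof -
    obtain q where "p = casimir_poly t d * q" using dvd by blast
    then show ?thesis by (simp add: ep_mult casimir_eval_casimir_poly)
  qed
  assume 0: "ep p = 0"
  let ?r = "p mod casimir_poly t d"
  have "ep p = ep (casimir_poly t d * (p div casimir_poly t d)) + ep ?r"
    unfolding ep_add[symmetric] by simp
  then have r0: "ep ?r = 0" using 0 by (simp add: ep_mult casimir_eval_casimir_poly)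
  have "degree ?r \<le> d div 2"
    using degree_mod_less[OF casimir_poly_nonzero, of p t d] by (auto simp: degree_casimir_poly)
  then obtain a where a: "?r = (\<Sum>j\<le>d div 2. smult (a j) (newton t d j))"
    using poly_eq_sum_of_degrees[of "newton t d" ?r "d div 2"] degree_newton newton_nonzero by blast
  have "(\<Sum>j\<le>d div 2. a j \<cdot>\<^sub>B theta_delta d j) = 0"
    using r0 unfolding a by (simp add: ep_sum ep_smult casimir_eval_newton)
  then have "a j = 0" if "j \<le> d div 2" for j using theta_delta_independent that by blast
  then have "?r = 0" unfolding a by simp
  then show "casimir_poly t d dvd p" by (simp add: mod_eq_0_iff_dvd)
qed

lemma minimal_poly_Casimir: "minimal_poly t (Sym d) (Casimir t d) = casimir_poly t d"
  unfolding minimal_poly_def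
proof (rule the_equality)
  have "degree (casimir_poly t d) \<le> degree q" if "q \<noteq> 0" "casimir_eval t d q = 0" for q
    using that casimir_eval_eq_0_iff dvd_imp_degree_le by blast
  then show "lead_coeff (casimir_poly t d) = 1 \<and> casimir_eval t d (casimir_poly t d) = 0 \<and>
      (\<forall>q. q \<noteq> 0 \<and> casimir_eval t d q = 0 \<longrightarrow> degree (casimir_poly t d) \<le> degree q)"
    by (simp add: lead_coeff_casimir_poly casimir_eval_casimir_poly)
next
  fix p assume p: "lead_coeff p = 1 \<and> casimir_eval t d p = 0 \<and>
      (\<forall>q. q \<noteq> 0 \<and> casimir_eval t d q = 0 \<longrightarrow> degree p \<le> degree q)"
  then have "casimir_poly t d dvd p" using casimir_eval_eq_0_iff by blast
  then obtain q where q: "p = casimir_poly t d * q" by blast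
  have "p \<noteq> 0" using p by auto
  then have "q \<noteq> 0" using q by auto
  have "degree p \<le> degree (casimir_poly t d)" using p casimir_eval_casimir_poly casimir_poly_nonzero by blast
  moreover have "degree p = degree (casimir_poly t d) + degree q"
    unfolding q by (rule degree_mult_eq[OF casimir_poly_nonzero \<open>q \<noteq> 0\<close>])
  ultimately obtain c where c: "q = [:c:]" by (metis add_le_same_cancel1 degree_eq_zeroE le_zero_eq)
  have "lead_coeff p = lead_coeff (casimir_poly t d) * lead_coeff q" unfolding q by (rule lead_coeff_mult)
  then have "c = 1" using p c lead_coeff_casimir_poly by simp
  then show "p = casimir_poly t d" using q c by simp
qed

definition level_multiplicity :: "complex \<Rightarrow> nat \<Rightarrow> complex \<Rightarrow> nat" where
  "level_multiplicity t d c = card {i. i \<le> d div 2 \<and> level t d i = c}"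

definition cofactor :: "complex \<Rightarrow> nat \<Rightarrow> complex \<Rightarrow> complex poly" where
  "cofactor t d c = (\<Prod>i | i \<le> d div 2 \<and> level t d i \<noteq> c. [:- level t d i, 1:])"

lemma casimir_poly_cofactor: "casimir_poly t d = [:- c, 1:] ^ level_multiplicity t d c * cofactor t d c"
proof -
  have "{..d div 2} = {i. i \<le> d div 2 \<and> level t d i = c} \<union> {i. i \<le> d div 2 \<and> level t d i \<noteq> c}" by auto
  then have "casimir_poly t d = (\<Prod>i | i \<le> d div 2 \<and> level t d i = c. [:- level t d i, 1:]) * cofactor t d c"
    unfolding casimir_poly_def cofactor_def by (simp only:) (rule prod.union_disjoint; auto)
  also have "(\<Prod>i | i \<le> d div 2 \<and> level t d i = c. [:- level t d i, 1:]) = [:- c, 1:] ^ level_multiplicity t d c"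
    by (simp add: level_multiplicity_def)
  finally show ?thesis .
qed

lemma poly_cofactor: "poly (cofactor t d c) c \<noteq> 0"
  unfolding cofactor_def poly_prod by (subst prod_zero_iff) auto

lemma cofactor_eq: "cofactor t d c = (\<Prod>e\<in>level t d ` {..d div 2} - {c}. [:- e, 1:] ^ level_multiplicity t d e)"
proof -
  let ?S = "{i. i \<le> d div 2 \<and> level t d i \<noteq> c}"
  have "cofactor t d c = (\<Prod>e\<in>level t d ` ?S. \<Prod>i | i \<in> ?S \<and> level t d i = e. [:- level t d i, 1:])"
    unfolding cofactor_def by (rule prod.image_gen) simp
  also have "level t d ` ?S = level t d ` {..d div 2} - {c}" by auto
  also have "(\<Prod>e\<in>level t d ` {..d div 2} - {c}. \<Prod>i | i \<in> ?S \<and> level t d i = e. [:- level t d i, 1:]) =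
      (\<Prod>e\<in>level t d ` {..d div 2} - {c}. [:- e, 1:] ^ level_multiplicity t d e)"
  proof (rule prod.cong[OF refl])
    fix e assume "e \<in> level t d ` {..d div 2} - {c}"
    then have "{i \<in> ?S. level t d i = e} = {i. i \<le> d div 2 \<and> level t d i = e}" by auto
    then show "(\<Prod>i | i \<in> ?S \<and> level t d i = e. [:- level t d i, 1:]) = [:- e, 1:] ^ level_multiplicity t d e"
      by (simp add: level_multiplicity_def)
  qed
  finally show ?thesis .
qed

lemma order_casimir_poly: "order c (casimir_poly t d) = level_multiplicity t d c"
proof -
  have "order c (casimir_poly t d) = order c ([:- c, 1:] ^ level_multiplicity t d c) + order c (cofactor t d c)"
    using casimir_poly_nonzero[of t d] unfolding casimir_poly_cofactor[of t d c] by (rule order_mult)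
  also have "order c (cofactor t d c) = 0" using poly_cofactor by (rule order_0I)
  also have "order c ([:- c, 1:] ^ level_multiplicity t d c) = level_multiplicity t d c" by (rule order_power_n_n)
  finally show ?thesis by simp
qed

section \<open>Partitions and levels\<close>

text \<open>The level is quadratic in i and invariant under the reflection of i to d + t/2 - 1 -
  i.\<close>

lemma level_eq_iff: "level t d i = level t d j \<longleftrightarrow> i = j \<or> of_nat i + of_nat j = of_nat d + t / 2 - (1 :: complex)"
proof -
  have "level t d i - level t d j = 4 * (of_nat i - of_nat j) * (of_nat i + of_nat j - (of_nat d + t / 2 - 1))"
    by (simp add: level_def node_def algebra_simps)
  then have "level t d i = level t d j \<longleftrightarrow> 4 * (of_nat i - of_nat j) * (of_nat i + of_nat j - (of_nat d + t / 2 - 1)) = (0 :: complex)"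
    by (metis eq_iff_diff_eq_0)
  then show ?thesis by simp
qed

lemma casimir_eigenvalue_level:
  assumes "l \<in> Partitions"
  shows "casimir_eigenvalue t l = level t (size2 l) (snd l)" "snd l \<le> size2 l div 2"
  using assms by (auto simp: Partitions_def casimir_eigenvalue_def level_eq size2_def of_nat_diff algebra_simps)

text \<open>Distinct i and j of at most d div 2 satisfy i + j + 1 \<le> d, so that a coincidence
  gives t = -2(d - 1 - i - j), an excluded value.\<close>

lemma level_eq_generic:
  assumes "t \<notin> nonpos_even" "i \<le> d div 2" "j \<le> d div 2" "level t d i = level t d j"
  shows "i = j"
proof (rule ccontr)
  assume ij: "i \<noteq> j"
  then have "i + j + 1 \<le> d" using assms(2,3) by linarith
  then obtain k where k: "d = i + j + 1 + k" using le_Suc_ex by blast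
  have "of_nat i + of_nat j = of_nat d + t / 2 - (1 :: complex)" using ij assms(4) level_eq_iff by blast
  then have "of_nat k + t / 2 = 0" unfolding k by simp
  then have "t / 2 = - of_nat k" by (rule add_eq_0_iff[THEN iffD1])
  then have "2 * (t / 2) = 2 * (- of_nat k)" by (simp only:)
  then have "t = - 2 * of_nat k" by simp
  then show False using assms(1) by (auto simp: nonpos_even_def)
qed

lemma level_eq_special:
  "level (- 2 * of_nat k) d i = level (- 2 * of_nat k) d j \<longleftrightarrow> i = j \<or> i + j + k + 1 = d"
proof -
  have "of_nat i + of_nat j = of_nat d + (- 2 * of_nat k) / 2 - (1 :: complex) \<longleftrightarrow>
      (of_nat (i + j + k + 1) :: complex) = of_nat d"
    by (auto simp: algebra_simps)
  then show ?thesis unfolding level_eq_iff of_nat_eq_iff by blast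
qed

lemma index_set_special:
  "l \<in> index_set (- 2 * of_nat k) \<longleftrightarrow> l \<in> Partitions \<and> (regular k l \<or> quasiregular k l)"
proof -
  have "- 2 * of_nat k \<in> nonpos_even" by (auto simp: nonpos_even_def)
  moreover have "- 2 * of_nat k = - 2 * (of_nat k' :: complex) \<longleftrightarrow> k = k'" for k' by auto
  ultimately show ?thesis unfolding index_set_def by auto
qed

lemma index_set_cases:
  obtains "t \<notin> nonpos_even" "index_set t = Partitions" | k where "t = - 2 * of_nat k"
  by (auto simp: index_set_def nonpos_even_def)

lemma index_set_Partitions: "l \<in> index_set t \<Longrightarrow> l \<in> Partitions"
  by (auto simp: index_set_def split: if_splits)

text \<open>If the levels i < j coincide for t = -2k, then i + j + k + 1 = d. This makes (d - i, i)
  singular, and singular partitions are not in the index set.\<close>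

lemma index_set_inj:
  assumes l: "l \<in> index_set t" and m: "m \<in> index_set t" and size: "size2 l = size2 m"
    and eq: "casimir_eigenvalue t l = casimir_eigenvalue t m"
  shows "l = m"
proof -
  have P: "l \<in> Partitions" "m \<in> Partitions" using l m index_set_Partitions by auto
  have lev: "level t (size2 l) (snd l) = level t (size2 l) (snd m)"
    using eq size casimir_eigenvalue_level P by metis
  have "snd l = snd m"
  proof (cases rule: index_set_cases[of t])
    case 1
    then show ?thesis
      using level_eq_generic[OF _ _ _ lev] casimir_eigenvalue_level(2)[OF P(1)] casimir_eigenvalue_level(2)[OF P(2)] size
      by simp
  next
    case (2 k)
    then show ?thesis
      using l m lev size P unfolding 2 level_eq_special index_set_special
      by (cases l; cases m) (auto simp: regular_def quasiregular_def size2_def Partitions_def)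
  qed
  then show ?thesis using size by (auto simp: size2_def prod_eq_iff)
qed

text \<open>A level whose own partition is missing is represented by the partition of its mirror
  image.\<close>

lemma index_set_cover:
  assumes i: "i \<le> d div 2"
  shows "\<exists>m\<in>index_set t. size2 m = d \<and> casimir_eigenvalue t m = level t d i"
proof -
  have part: "(d - j, j) \<in> Partitions" "size2 (d - j, j) = d" "casimir_eigenvalue t (d - j, j) = level t d j"
    if "j \<le> d div 2" for j
    using that casimir_eigenvalue_level(1)[of "(d - j, j)" t] by (auto simp: Partitions_def size2_def)
  show ?thesis
  proof (cases rule: index_set_cases[of t])
    case 1
    then show ?thesis using part[OF i] by metis
  next
    case (2 k)
    show ?thesis
    proof (cases "(d - i, i) \<in> index_set t")
      case True
      then show ?thesis using part[OF i] by metis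
    next
      case False
      then have sing: "k + 2 + 2 * i \<le> d" "d \<le> 2 * k + 2 + 2 * i"
        using part[OF i] i unfolding 2 index_set_special regular_def quasiregular_def by auto
      \<comment> \<open>The mirror index under the coincidence i + j + k + 1 = d. The bounds that
        make (d - i, i) singular place j in the range up to d div 2 and make (d - j, j)
        quasiregular.\<close>
      define j where "j = d - 1 - k - i"
      have j: "i + j + k + 1 = d" "j \<le> d div 2" using sing by (auto simp: j_def)
      have "quasiregular k (d - j, j)" using sing j by (auto simp: quasiregular_def)
      then have "(d - j, j) \<in> index_set t" unfolding 2 index_set_special using part(1)[OF j(2)] by blast
      moreover have "level t d j = level t d i" unfolding 2 level_eq_special using j by auto
      ultimately show ?thesis using part[OF j(2)] by metis
    qed
  qed
qed

text \<open>A second index on the same level is determined by i, through the value of i + j.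
  Consequently the nilpotent part of the Casimir operator on a component has square zero.\<close>

lemma level_multiplicity_le_2: "level_multiplicity t d c \<le> 2"
proof (cases "\<exists>i \<le> d div 2. level t d i = c")
  case True
  then obtain i where i: "level t d i = c" by blast
  let ?T = "{j. of_nat i + of_nat j = of_nat d + t / 2 - (1 :: complex)}"
  have T: "j = k" if "j \<in> ?T" "k \<in> ?T" for j k
  proof -
    have "of_nat j = (of_nat k :: complex)" using that by (metis (mono_tags) mem_Collect_eq add_left_cancel)
    then show ?thesis by simp
  qed
  obtain k where "?T \<subseteq> {k}" using T by blast
  have "{j. j \<le> d div 2 \<and> level t d j = c} \<subseteq> {i, k}"
  proof
    fix j assume "j \<in> {j. j \<le> d div 2 \<and> level t d j = c}"
    then have "j = i \<or> j \<in> ?T" using i level_eq_iff[of t d i j] by auto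
    then show "j \<in> {i, k}" using \<open>?T \<subseteq> {k}\<close> by blast
  qed
  then have "level_multiplicity t d c \<le> card {i, k}" unfolding level_multiplicity_def by (intro card_mono) auto
  also have "\<dots> \<le> 2" by (simp add: card_insert_if)
  finally show ?thesis .
next
  case False
  then have "{j. j \<le> d div 2 \<and> level t d j = c} = {}" by auto
  then show ?thesis by (simp only: level_multiplicity_def card.empty)
qed

text \<open>Regularity rules out the mirror index: i + j + k + 1 = d with i, j \<le> d div 2 and i
  \<noteq> j makes one of the two partitions singular and the other quasiregular.\<close>

lemma regular_level_unique:
  assumes l: "l \<in> Partitions"
    and reg: "t \<notin> nonpos_even \<or> (\<exists>k. t = - 2 * of_nat k \<and> regular k l)"
    and i: "i \<le> size2 l div 2" and eq: "level t (size2 l) i = level t (size2 l) (snd l)"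
  shows "i = snd l"
  using reg
proof
  assume "t \<notin> nonpos_even"
  then show ?thesis using level_eq_generic[OF _ i casimir_eigenvalue_level(2)[OF l] eq] by blast
next
  assume "\<exists>k. t = - 2 * of_nat k \<and> regular k l"
  then obtain k where k: "t = - 2 * of_nat k" "regular k l" by blast
  show ?thesis
    using eq l i k(2) unfolding k(1) level_eq_special
    by (cases l) (auto simp: regular_def size2_def Partitions_def)
qed

section \<open>Components\<close>

lemma component_operator_eq:
  assumes l: "l \<in> Partitions"
  shows "component_operator t l =
    casimir_eval t (size2 l) ([:- casimir_eigenvalue t l, 1:] ^ level_multiplicity t (size2 l) (casimir_eigenvalue t l))"
proof -
  let ?d = "size2 l" and ?c = "casimir_eigenvalue t l"
  interpret endomorphism t "Sym ?d" "Casimir t ?d" by (rule endomorphism_Casimir)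
  have "Casimir t ?d - ?c \<cdot>\<^sub>B ident (Sym ?d) = ep [:- ?c, 1:]"
    by (simp add: ep_linear bscale_minus_left)
  moreover have "root_multiplicity t l = level_multiplicity t ?d ?c"
    by (simp add: root_multiplicity_def minimal_poly_Casimir order_casimir_poly)
  ultimately show ?thesis unfolding component_operator_def Let_def by (simp only: endo_power_ep)
qed

text \<open>By the Chinese remainder theorem g is idempotent modulo the minimal polynomial. For
  uniqueness, a morphism p as in the definition fixes \<open>ep g\<close>, which factors through the
  kernel, and kills \<open>ep (1 - g)\<close>, which is composed of the other primary parts.\<close>

lemma component_proj_eq:
  assumes l: "l \<in> index_set t"
    and g0: "cofactor t (size2 l) (casimir_eigenvalue t l) dvd g"
    and g1: "[:- casimir_eigenvalue t l, 1:] ^ level_multiplicity t (size2 l) (casimir_eigenvalue t l) dvd g - 1"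
  shows "component_proj t l = casimir_eval t (size2 l) g"
proof -
  let ?d = "size2 l" and ?c = "casimir_eigenvalue t l"
  let ?A = "[:- ?c, 1:] ^ level_multiplicity t ?d ?c" and ?R = "cofactor t ?d ?c"
  interpret endomorphism t "Sym ?d" "Casimir t ?d" by (rule endomorphism_Casimir)
  have S: "fst (Sym ?d) = ?d" by (simp add: Sym_def)
  have l': "l \<in> Partitions" using l by (rule index_set_Partitions)
  have op: "component_operator t l = ep ?A" by (rule component_operator_eq[OF l'])
  have M: "casimir_poly t ?d = ?A * ?R" by (rule casimir_poly_cofactor)
  have Ag: "ep (?A * g) = 0" "ep (?R * (1 - g)) = 0" "ep (g * g) = ep g"
  proof -
    show "ep (?A * g) = 0" unfolding casimir_eval_eq_0_iff M using g0 by (intro mult_dvd_mono) auto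
    have A1: "?A dvd 1 - g" using g1 by (metis dvd_minus_iff minus_diff_eq)
    then have "?A * ?R dvd (1 - g) * ?R" by (intro mult_dvd_mono) auto
    then show "ep (?R * (1 - g)) = 0" unfolding casimir_eval_eq_0_iff M by (simp add: mult.commute)
    have "?A * ?R dvd (1 - g) * g" using A1 g0 by (intro mult_dvd_mono)
    then have "ep ((1 - g) * g) = 0" unfolding casimir_eval_eq_0_iff M .
    then show "ep (g * g) = ep g" by (simp add: left_diff_distrib ep_diff)
  qed
  have kernel_proj: "ep g \<odot>\<^bsub>t\<^esub> h = h" if Y: "is_object t Y" and h: "h \<in> khom t Y (Sym ?d)" and 0: "ep ?A \<odot>\<^bsub>t\<^esub> h = 0" for Y h
  proof -
    have hh: "h \<in> bhom (fst Y) (fst (Sym ?d))" "ident (Sym ?d) \<odot>\<^bsub>t\<^esub> h = h" using h by (auto simp: khom_def)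
    obtain u where u: "g - 1 = u * ?A" using g1 by (metis dvd_def mult.commute)
    have "ep (g - 1) \<odot>\<^bsub>t\<^esub> h = 0" unfolding u ep_comp_assoc[OF hh(1)] 0 by simp
    then show ?thesis
      unfolding ep_diff ep_1 using bcomp_diff_left[OF hh(1) ep_bhom ident_bhom, of t g] hh(2) by simp
  qed
  have others: "ep g \<odot>\<^bsub>t\<^esub> h = 0"
    if m: "m \<in> index_set t" "size2 m = ?d" "m \<noteq> l" and h: "h \<in> khom t Y (Sym ?d)"
      and 0: "component_operator t m \<odot>\<^bsub>t\<^esub> h = 0" for m Y h
  proof -
    let ?e = "casimir_eigenvalue t m"
    have hh: "h \<in> bhom (fst Y) (fst (Sym ?d))" using h by (auto simp: khom_def)
    have "?e \<noteq> ?c" using index_set_inj[OF m(1) l m(2)] m(3) by blast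
    moreover have "?e \<in> level t ?d ` {..?d div 2}"
      using casimir_eigenvalue_level[OF index_set_Partitions[OF m(1)]] m(2) by simp
    ultimately have "[:- ?e, 1:] ^ level_multiplicity t ?d ?e dvd ?R"
      unfolding cofactor_eq by (intro dvd_prodI) auto
    then have "[:- ?e, 1:] ^ level_multiplicity t ?d ?e dvd g" using g0 by (rule dvd_trans)
    then obtain u where u: "g = u * [:- ?e, 1:] ^ level_multiplicity t ?d ?e" by (metis dvd_def mult.commute)
    have "component_operator t m = ep ([:- ?e, 1:] ^ level_multiplicity t ?d ?e)"
      using component_operator_eq[OF index_set_Partitions[OF m(1)], of t] m(2) by simp
    then show ?thesis using 0 unfolding u ep_comp_assoc[OF hh] by simp
  qed
  show ?thesis
    unfolding component_proj_def
  proof (rule the_equality)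
    show "projects_onto_kernel t (Sym ?d) (component_operator t l) (ep g) \<and>
      (\<forall>m\<in>index_set t. size2 m = ?d \<and> m \<noteq> l \<longrightarrow>
        (\<forall>Y h. is_object t Y \<and> h \<in> khom t Y (Sym ?d) \<and> component_operator t m \<odot>\<^bsub>t\<^esub> h = 0 \<longrightarrow> ep g \<odot>\<^bsub>t\<^esub> h = 0))"
    proof (intro conjI ballI impI allI)
      show "projects_onto_kernel t (Sym ?d) (component_operator t l) (ep g)"
        unfolding projects_onto_kernel_def op
        using ep_khom Ag kernel_proj by (auto simp: ep_mult)
    qed (use others in blast)
  next
    fix p assume p: "projects_onto_kernel t (Sym ?d) (component_operator t l) p \<and>
      (\<forall>m\<in>index_set t. size2 m = ?d \<and> m \<noteq> l \<longrightarrow>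
        (\<forall>Y h. is_object t Y \<and> h \<in> khom t Y (Sym ?d) \<and> component_operator t m \<odot>\<^bsub>t\<^esub> h = 0 \<longrightarrow> p \<odot>\<^bsub>t\<^esub> h = 0))"
    then have pk: "p \<in> khom t (Sym ?d) (Sym ?d)" by (simp add: projects_onto_kernel_def)
    then have pb: "p \<in> bhom ?d ?d" "p \<odot>\<^bsub>t\<^esub> ident (Sym ?d) = p" by (auto simp: khom_def S)
    have "ep ?A \<odot>\<^bsub>t\<^esub> ep g = 0" using Ag(1) by (simp add: ep_mult)
    then have 1: "p \<odot>\<^bsub>t\<^esub> ep g = ep g"
      using p is_object_Sym ep_khom unfolding projects_onto_kernel_def op by blast
    \<comment> \<open>The definition lets p kill the components in the index set only. Since
      \<open>index_set_cover\<close> finds one for each level, this reaches all primary parts other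
      than that of l.\<close>
    have 2: "p \<odot>\<^bsub>t\<^esub> ep (1 - g) = 0"
    proof (rule ep_comp_eq_0_of_factors[where S = "level t ?d ` {..?d div 2} - {?c}" and e = "level_multiplicity t ?d"])
      show "ep (\<Prod>c\<in>level t ?d ` {..?d div 2} - {?c}. [:- c, 1:] ^ level_multiplicity t ?d c) \<odot>\<^bsub>t\<^esub> ep (1 - g) = 0"
        using Ag(2) unfolding cofactor_eq ep_mult .
      fix c h assume c: "c \<in> level t ?d ` {..?d div 2} - {?c}" and h: "h \<in> khom t (Sym ?d) (Sym ?d)"
        and 0: "ep ([:- c, 1:] ^ level_multiplicity t ?d c) \<odot>\<^bsub>t\<^esub> h = 0"
      obtain m where m: "m \<in> index_set t" "size2 m = ?d" "casimir_eigenvalue t m = c"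
        using index_set_cover c by blast
      have "m \<noteq> l" using m c by auto
      moreover have "component_operator t m \<odot>\<^bsub>t\<^esub> h = 0"
        using 0 component_operator_eq[OF index_set_Partitions[OF m(1)], of t] m by simp
      ultimately show "p \<odot>\<^bsub>t\<^esub> h = 0" using p m h is_object_Sym by blast
    qed (use pb ep_khom is_object_Sym S in auto)
    have "ident (Sym ?d) = ep g + ep (1 - g)" by (simp add: ep_diff)
    then have "p = p \<odot>\<^bsub>t\<^esub> ep g + p \<odot>\<^bsub>t\<^esub> ep (1 - g)"
      using bcomp_add_right[OF ep_bhom ep_bhom, of p ?d t g "1 - g"] pb S by metis
    then show "p = ep g" using 1 2 by simp
  qed
qed

lemma component_proj_exists:
  assumes "l \<in> index_set t"
  obtains g where "cofactor t (size2 l) (casimir_eigenvalue t l) dvd g"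
    "[:- casimir_eigenvalue t l, 1:] ^ level_multiplicity t (size2 l) (casimir_eigenvalue t l) dvd g - 1"
    "component_proj t l = casimir_eval t (size2 l) g"
proof -
  let ?d = "size2 l" and ?c = "casimir_eigenvalue t l"
  let ?A = "[:- ?c, 1:] ^ level_multiplicity t ?d ?c" and ?R = "cofactor t ?d ?c"
  have "coprime [:- ?c, 1:] ?R"
    unfolding cofactor_def by (rule prod_coprime_right) (auto intro: coprime_linear_factors)
  then have "coprime ?A ?R" by (simp add: coprime_power_left_iff)
  then have 1: "fst (bezout_coefficients ?A ?R) * ?A + snd (bezout_coefficients ?A ?R) * ?R = 1"
    by (simp only: bezout_coefficients_fst_snd coprime_imp_gcd_eq_1)
  let ?g = "snd (bezout_coefficients ?A ?R) * ?R"
  have "?g - 1 = - fst (bezout_coefficients ?A ?R) * ?A" using 1 by (simp add: algebra_simps)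
  then have "?A dvd ?g - 1" by (metis dvd_triv_right)
  then show ?thesis using that[of ?g] component_proj_eq[OF assms] by simp
qed

section \<open>Capelli operators\<close>

lemma selfadjoint_casimir_eval: "selfadjoint d (casimir_eval t d p)"
proof -
  interpret endomorphism t "Sym d" "Casimir t d" by (rule endomorphism_Casimir)
  obtain a where "p = (\<Sum>j\<le>degree p. smult (a j) (newton t d j))"
    using poly_eq_sum_of_degrees[of "newton t d" p "degree p"] degree_newton newton_nonzero by blast
  then have "ep p = (\<Sum>j\<le>degree p. a j \<cdot>\<^sub>B theta_delta d j)"
    by (metis (no_types, lifting) casimir_eval_newton ep_smult ep_sum sum.cong)
  then show ?thesis by (simp add: selfadjoint_sum selfadjoint_bscale selfadjoint_theta_delta)
qed

section \<open>Zigzag calculus with the identity, evaluation and coevaluation of a symmetric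
  power\<close>

context
  fixes t :: complex and d :: nat and s K V :: morphism
  defines "s \<equiv> symmetrizer d" and "K \<equiv> contraction t d d" and "V \<equiv> sym_coev t d"
begin

private lemma S: "s \<in> bhom d d" and KB: "K \<in> bhom (d + d) 0" and VB: "V \<in> bhom 0 (d + d)" and B0: "bid 0 \<in> bhom 0 0"
  unfolding s_def K_def V_def
  using bhom_symmetrizer polyfam_bhom[OF polyfam_full_contraction] polyfam_bhom[OF polyfam_sym_coev] by blast+

private lemma ss: "s \<odot>\<^bsub>t\<^esub> s = s"
  unfolding s_def by (rule symmetrizer_idem)

private lemma SV: "f \<in> bhom d d \<Longrightarrow> f \<otimes>\<^sub>B V \<in> bhom d (d + (d + d))"
  and VS: "f \<in> bhom d d \<Longrightarrow> V \<otimes>\<^sub>B f \<in> bhom d (d + (d + d))"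
  and SK: "f \<in> bhom d d \<Longrightarrow> f \<otimes>\<^sub>B K \<in> bhom (d + (d + d)) d"
  and KS: "f \<in> bhom d d \<Longrightarrow> K \<otimes>\<^sub>B f \<in> bhom (d + (d + d)) d"
  using bhom_btensor[OF _ VB, of f d d] bhom_btensor[OF VB, of f d d]
    bhom_btensor[OF _ KB, of f d d] bhom_btensor[OF KB, of f d d]
  by (simp_all add: add.assoc)

private lemma tensor3: "f \<in> bhom d d \<Longrightarrow> g \<in> bhom d d \<Longrightarrow> h \<in> bhom d d \<Longrightarrow> f \<otimes>\<^sub>B g \<otimes>\<^sub>B h \<in> bhom (d + (d + d)) (d + (d + d))"
  by (intro bhom_btensor)

private lemma VS_right: "f \<in> bhom d d \<Longrightarrow> s \<odot>\<^bsub>t\<^esub> f = f \<Longrightarrow> V \<otimes>\<^sub>B f = (V \<otimes>\<^sub>B s) \<odot>\<^bsub>t\<^esub> f"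
  using interchange[OF B0 VB _ S, of f d t] by (simp add: bcomp_bid[OF VB] bid_0_btensor)

private lemma SV_right: "f \<in> bhom d d \<Longrightarrow> s \<odot>\<^bsub>t\<^esub> f = f \<Longrightarrow> f \<otimes>\<^sub>B V = (s \<otimes>\<^sub>B V) \<odot>\<^bsub>t\<^esub> f"
  using interchange[OF _ S B0 VB, of f d t] by (simp add: bcomp_bid[OF VB] btensor_bid_0)

private lemma SK_left: "f \<in> bhom d d \<Longrightarrow> f \<odot>\<^bsub>t\<^esub> s = f \<Longrightarrow> f \<otimes>\<^sub>B K = f \<odot>\<^bsub>t\<^esub> (s \<otimes>\<^sub>B K)"
  using interchange[OF S _ KB B0, of f d t] by (simp add: bid_bcomp[OF KB] btensor_bid_0)

private lemma KS_left: "f \<in> bhom d d \<Longrightarrow> f \<odot>\<^bsub>t\<^esub> s = f \<Longrightarrow> K \<otimes>\<^sub>B f = f \<odot>\<^bsub>t\<^esub> (K \<otimes>\<^sub>B s)"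
  using interchange[OF KB B0 S, of f d t] by (simp add: bid_bcomp[OF KB] bid_0_btensor)

private lemma zig: "(s \<otimes>\<^sub>B K) \<odot>\<^bsub>t\<^esub> (V \<otimes>\<^sub>B s) = s" and zag: "(K \<otimes>\<^sub>B s) \<odot>\<^bsub>t\<^esub> (s \<otimes>\<^sub>B V) = s"
  unfolding s_def K_def V_def by (rule zigzag_left zigzag_right)+

private lemma ssV: "(s \<otimes>\<^sub>B s) \<odot>\<^bsub>t\<^esub> V = V" and Kss: "K \<odot>\<^bsub>t\<^esub> (s \<otimes>\<^sub>B s) = K"
  unfolding s_def K_def V_def by (rule symmetrizer_sym_coev contraction_symmetrizer)+

text \<open>Bending the strand with the coevaluation recovers an endomorphism from its pairing. A
  transpose is defined by its pairing only, hence it is unique.\<close>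

private lemma recover:
  assumes q: "q \<in> khom t (Sym d) (Sym d)"
  shows "((K \<odot>\<^bsub>t\<^esub> (q \<otimes>\<^sub>B s)) \<otimes>\<^sub>B s) \<odot>\<^bsub>t\<^esub> (s \<otimes>\<^sub>B V) = q"
proof -
  have qb: "q \<in> bhom d d" and qs: "q \<odot>\<^bsub>t\<^esub> s = q" "s \<odot>\<^bsub>t\<^esub> q = q"
    using q by (auto simp: khom_def Sym_def s_def)
  have "(K \<odot>\<^bsub>t\<^esub> (q \<otimes>\<^sub>B s)) \<otimes>\<^sub>B s = (K \<otimes>\<^sub>B s) \<odot>\<^bsub>t\<^esub> (q \<otimes>\<^sub>B s \<otimes>\<^sub>B s)"
    using interchange[OF bhom_btensor[OF qb S] KB S S, of t] by (simp add: ss btensor_assoc[OF qb S S])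
  then have "((K \<odot>\<^bsub>t\<^esub> (q \<otimes>\<^sub>B s)) \<otimes>\<^sub>B s) \<odot>\<^bsub>t\<^esub> (s \<otimes>\<^sub>B V) = (K \<otimes>\<^sub>B s) \<odot>\<^bsub>t\<^esub> ((q \<otimes>\<^sub>B s \<otimes>\<^sub>B s) \<odot>\<^bsub>t\<^esub> (s \<otimes>\<^sub>B V))"
    by (simp add: bcomp_assoc[OF SV[OF S] tensor3[OF qb S S] KS[OF S]])
  also have "(q \<otimes>\<^sub>B s \<otimes>\<^sub>B s) \<odot>\<^bsub>t\<^esub> (s \<otimes>\<^sub>B V) = q \<otimes>\<^sub>B V"
    by (simp add: interchange[OF S qb VB bhom_btensor[OF S S]] qs ssV)
  also have "\<dots> = (s \<otimes>\<^sub>B V) \<odot>\<^bsub>t\<^esub> q" by (rule SV_right[OF qb qs(2)])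
  also have "(K \<otimes>\<^sub>B s) \<odot>\<^bsub>t\<^esub> ((s \<otimes>\<^sub>B V) \<odot>\<^bsub>t\<^esub> q) = q"
    using bcomp_assoc[OF qb SV[OF S] KS[OF S], of t] by (simp add: zag qs)
  finally show ?thesis .
qed

lemma transpose_endo_selfadjoint:
  assumes p: "selfadjoint d p"
  shows "transpose_endo t d p = p"
  unfolding transpose_endo_def
proof (rule the_equality)
  show "p \<in> khom t (Sym d) (Sym d) \<and> contraction t d d \<odot>\<^bsub>t\<^esub> (p \<otimes>\<^sub>B ident (Sym d)) =
      contraction t d d \<odot>\<^bsub>t\<^esub> (ident (Sym d) \<otimes>\<^sub>B p)"
    using selfadjoint_khom[OF p] contraction_adjoint[OF p] by (simp add: Sym_def)
  fix q assume "q \<in> khom t (Sym d) (Sym d) \<and> contraction t d d \<odot>\<^bsub>t\<^esub> (q \<otimes>\<^sub>B ident (Sym d)) =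
      contraction t d d \<odot>\<^bsub>t\<^esub> (ident (Sym d) \<otimes>\<^sub>B p)"
  then have q: "q \<in> khom t (Sym d) (Sym d)" "K \<odot>\<^bsub>t\<^esub> (q \<otimes>\<^sub>B s) = K \<odot>\<^bsub>t\<^esub> (p \<otimes>\<^sub>B s)"
    using contraction_adjoint[OF p] by (auto simp: Sym_def s_def K_def)
  have "q = ((K \<odot>\<^bsub>t\<^esub> (q \<otimes>\<^sub>B s)) \<otimes>\<^sub>B s) \<odot>\<^bsub>t\<^esub> (s \<otimes>\<^sub>B V)" by (rule recover[OF q(1), symmetric])
  also have "\<dots> = p" unfolding q(2) by (rule recover[OF selfadjoint_khom[OF p]])
  finally show "q = p" .
qed

text \<open>Both are equal to p \<otimes> E \<otimes> p applied to c \<otimes> c': a zigzag identity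
  of c contracts this to c', and one of c' contracts it to c.\<close>

lemma coevaluation_unique:
  assumes X: "is_object t (d, p)"
    and c: "is_coevaluation t (d, p) (d, p) E c" and c': "is_coevaluation t (d, p) (d, p) E c'"
    and EB: "E \<in> bhom (d + d) 0"
  shows "c = c'"
proof -
  have pb: "p \<in> bhom d d" and pp: "p \<odot>\<^bsub>t\<^esub> p = p" using X by (auto simp: is_object_def)
  have cb: "c \<in> bhom 0 (d + d)" "(p \<otimes>\<^sub>B p) \<odot>\<^bsub>t\<^esub> c = c" and cb': "c' \<in> bhom 0 (d + d)" "(p \<otimes>\<^sub>B p) \<odot>\<^bsub>t\<^esub> c' = c'"
    and h1: "(p \<otimes>\<^sub>B E) \<odot>\<^bsub>t\<^esub> (c \<otimes>\<^sub>B p) = p" and h2: "(E \<otimes>\<^sub>B p) \<odot>\<^bsub>t\<^esub> (p \<otimes>\<^sub>B c') = p"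
    using c c' by (auto simp: is_coevaluation_def khom_def kunit_def ktensor_def)
  let ?D = "d + (d + d)"
  have pE: "p \<otimes>\<^sub>B E \<in> bhom ?D d" and Ep: "E \<otimes>\<^sub>B p \<in> bhom ?D d"
    using bhom_btensor[OF pb EB] bhom_btensor[OF EB pb] by (simp_all add: add.assoc)
  have cp: "c \<otimes>\<^sub>B p \<in> bhom d ?D" and pc: "p \<otimes>\<^sub>B c' \<in> bhom d ?D"
    using bhom_btensor[OF cb(1) pb] bhom_btensor[OF pb cb'(1)] by (simp_all add: add.assoc)
  have A1: "(c \<otimes>\<^sub>B p) \<otimes>\<^sub>B p \<in> bhom (d + d) (?D + d)" and A2: "(p \<otimes>\<^sub>B E) \<otimes>\<^sub>B p \<in> bhom (?D + d) (d + d)"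
    using bhom_btensor[OF cp pb] bhom_btensor[OF pE pb] .
  have B1: "p \<otimes>\<^sub>B p \<otimes>\<^sub>B c' \<in> bhom (d + d) (d + ?D)" and B2: "p \<otimes>\<^sub>B E \<otimes>\<^sub>B p \<in> bhom (d + ?D) (d + d)"
    using bhom_btensor[OF pb pc] bhom_btensor[OF pb Ep] .
  have "c' = (((p \<otimes>\<^sub>B E) \<odot>\<^bsub>t\<^esub> (c \<otimes>\<^sub>B p)) \<otimes>\<^sub>B (p \<odot>\<^bsub>t\<^esub> p)) \<odot>\<^bsub>t\<^esub> c'" unfolding h1 pp cb' ..
  also have "\<dots> = ((p \<otimes>\<^sub>B E) \<otimes>\<^sub>B p) \<odot>\<^bsub>t\<^esub> (((c \<otimes>\<^sub>B p) \<otimes>\<^sub>B p) \<odot>\<^bsub>t\<^esub> c')"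
    unfolding interchange[OF cp pE pb pb, symmetric] by (rule bcomp_assoc[OF cb'(1) A1 A2])
  also have "((c \<otimes>\<^sub>B p) \<otimes>\<^sub>B p) \<odot>\<^bsub>t\<^esub> c' = c \<otimes>\<^sub>B c'"
    using interchange[OF B0 cb(1) cb'(1) bhom_btensor[OF pb pb], of t]
    by (simp add: btensor_assoc[OF cb(1) pb pb] bid_0_btensor[OF cb'(1)] cb' bcomp_bid[OF cb(1)])
  finally have 1: "c' = ((p \<otimes>\<^sub>B E) \<otimes>\<^sub>B p) \<odot>\<^bsub>t\<^esub> (c \<otimes>\<^sub>B c')" .
  have "c = ((p \<odot>\<^bsub>t\<^esub> p) \<otimes>\<^sub>B ((E \<otimes>\<^sub>B p) \<odot>\<^bsub>t\<^esub> (p \<otimes>\<^sub>B c'))) \<odot>\<^bsub>t\<^esub> c" unfolding h2 pp cb ..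
  also have "\<dots> = (p \<otimes>\<^sub>B E \<otimes>\<^sub>B p) \<odot>\<^bsub>t\<^esub> ((p \<otimes>\<^sub>B p \<otimes>\<^sub>B c') \<odot>\<^bsub>t\<^esub> c)"
    unfolding interchange[OF pb pb pc Ep, symmetric] by (rule bcomp_assoc[OF cb(1) B1 B2])
  also have "(p \<otimes>\<^sub>B p \<otimes>\<^sub>B c') \<odot>\<^bsub>t\<^esub> c = c \<otimes>\<^sub>B c'"
    using interchange[OF cb(1) bhom_btensor[OF pb pb] B0 cb'(1), of t]
    by (simp add: btensor_assoc[OF pb pb cb'(1)] btensor_bid_0[OF cb(1)] cb bcomp_bid[OF cb'(1)])
  finally show ?thesis using 1 by (simp add: btensor_assoc[OF pb EB pb])
qed

text \<open>Being self-adjoint, p slides around the bends of the evaluation and of the coevaluation.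
  All copies meet on one strand, where they merge because p is idempotent, and the zigzag of the
  full symmetric power remains.\<close>

lemma is_coevaluation_selfadjoint:
  assumes p: "selfadjoint d p" and pp: "p \<odot>\<^bsub>t\<^esub> p = p"
  shows "is_coevaluation t (d, p) (d, p) (K \<odot>\<^bsub>t\<^esub> (p \<otimes>\<^sub>B p)) ((p \<otimes>\<^sub>B s) \<odot>\<^bsub>t\<^esub> V)"
proof -
  note pb = selfadjoint_bhom[OF p]
  have ps: "p \<odot>\<^bsub>t\<^esub> s = p" "s \<odot>\<^bsub>t\<^esub> p = p"
    unfolding s_def by (rule selfadjoint_symmetrizer_right[OF p] selfadjoint_symmetrizer_left[OF p])+
  have adjK: "K \<odot>\<^bsub>t\<^esub> (p \<otimes>\<^sub>B s) = K \<odot>\<^bsub>t\<^esub> (s \<otimes>\<^sub>B p)" unfolding K_def s_def by (rule contraction_adjoint[OF p])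
  have adjV: "(s \<otimes>\<^sub>B p) \<odot>\<^bsub>t\<^esub> V = (p \<otimes>\<^sub>B s) \<odot>\<^bsub>t\<^esub> V" unfolding V_def s_def by (rule sym_coev_adjoint[OF p])
  define c where "c = (p \<otimes>\<^sub>B s) \<odot>\<^bsub>t\<^esub> V"
  define E where "E = K \<odot>\<^bsub>t\<^esub> (p \<otimes>\<^sub>B p)"
  have cb: "c \<in> bhom 0 (d + d)" unfolding c_def using VB bhom_btensor[OF pb S] by (rule bhom_bcomp)
  have T: "f \<otimes>\<^sub>B g \<in> bhom (d + d) (d + d)" if "f \<in> bhom d d" "g \<in> bhom d d" for f g using that by (rule bhom_btensor)
  have split: "p \<otimes>\<^sub>B p = (p \<otimes>\<^sub>B s) \<odot>\<^bsub>t\<^esub> (s \<otimes>\<^sub>B p)" "p \<otimes>\<^sub>B p = (s \<otimes>\<^sub>B p) \<odot>\<^bsub>t\<^esub> (p \<otimes>\<^sub>B s)"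
    by (simp_all add: interchange[OF S pb pb S] interchange[OF pb S S pb] ps)
  have ppc: "(p \<otimes>\<^sub>B p) \<odot>\<^bsub>t\<^esub> c = c"
  proof -
    have "(p \<otimes>\<^sub>B p) \<odot>\<^bsub>t\<^esub> c = ((p \<otimes>\<^sub>B p) \<odot>\<^bsub>t\<^esub> (p \<otimes>\<^sub>B s)) \<odot>\<^bsub>t\<^esub> V"
      unfolding c_def by (rule bcomp_assoc[OF VB T[OF pb S] T[OF pb pb], symmetric])
    also have "(p \<otimes>\<^sub>B p) \<odot>\<^bsub>t\<^esub> (p \<otimes>\<^sub>B s) = (p \<otimes>\<^sub>B s) \<odot>\<^bsub>t\<^esub> (s \<otimes>\<^sub>B p)"
      by (simp add: interchange[OF pb pb S pb] interchange[OF S pb pb S] pp ps)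
    also have "((p \<otimes>\<^sub>B s) \<odot>\<^bsub>t\<^esub> (s \<otimes>\<^sub>B p)) \<odot>\<^bsub>t\<^esub> V = (p \<otimes>\<^sub>B s) \<odot>\<^bsub>t\<^esub> ((p \<otimes>\<^sub>B s) \<odot>\<^bsub>t\<^esub> V)"
      unfolding bcomp_assoc[OF VB T[OF S pb] T[OF pb S]] adjV ..
    also have "\<dots> = ((p \<otimes>\<^sub>B s) \<odot>\<^bsub>t\<^esub> (p \<otimes>\<^sub>B s)) \<odot>\<^bsub>t\<^esub> V"
      by (rule bcomp_assoc[OF VB T[OF pb S] T[OF pb S], symmetric])
    finally show ?thesis by (simp add: interchange[OF pb pb S S] pp ss c_def)
  qed
  have ssc: "(s \<otimes>\<^sub>B s) \<odot>\<^bsub>t\<^esub> c = c"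
    unfolding c_def bcomp_assoc[OF VB T[OF pb S] T[OF S S], symmetric] by (simp add: interchange[OF pb S S S] ps ss)
  have E1: "E = K \<odot>\<^bsub>t\<^esub> (s \<otimes>\<^sub>B p)"
  proof -
    have "E = (K \<odot>\<^bsub>t\<^esub> (p \<otimes>\<^sub>B s)) \<odot>\<^bsub>t\<^esub> (s \<otimes>\<^sub>B p)"
      unfolding E_def split(1) by (rule bcomp_assoc[OF T[OF S pb] T[OF pb S] KB, symmetric])
    also have "\<dots> = K \<odot>\<^bsub>t\<^esub> ((s \<otimes>\<^sub>B p) \<odot>\<^bsub>t\<^esub> (s \<otimes>\<^sub>B p))"
      unfolding adjK by (rule bcomp_assoc[OF T[OF S pb] T[OF S pb] KB])
    finally show ?thesis by (simp add: interchange[OF S S pb pb] ss pp)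
  qed
  have E2: "E = K \<odot>\<^bsub>t\<^esub> (p \<otimes>\<^sub>B s)" using E1 adjK by simp
  have zigzag1: "(p \<otimes>\<^sub>B E) \<odot>\<^bsub>t\<^esub> (c \<otimes>\<^sub>B p) = p"
  proof -
    have cp: "c \<otimes>\<^sub>B p \<in> bhom d (d + (d + d))" using bhom_btensor[OF cb pb] by (simp add: add.assoc)
    have "p \<otimes>\<^sub>B E = (p \<otimes>\<^sub>B K) \<odot>\<^bsub>t\<^esub> (s \<otimes>\<^sub>B s \<otimes>\<^sub>B p)"
      unfolding E1 by (simp add: interchange[OF S pb T[OF S pb] KB] ps)
    then have "(p \<otimes>\<^sub>B E) \<odot>\<^bsub>t\<^esub> (c \<otimes>\<^sub>B p) = (p \<otimes>\<^sub>B K) \<odot>\<^bsub>t\<^esub> (((s \<otimes>\<^sub>B s) \<otimes>\<^sub>B p) \<odot>\<^bsub>t\<^esub> (c \<otimes>\<^sub>B p))"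
      by (simp add: bcomp_assoc[OF cp tensor3[OF S S pb] SK[OF pb]] btensor_assoc[OF S S pb])
    also have "((s \<otimes>\<^sub>B s) \<otimes>\<^sub>B p) \<odot>\<^bsub>t\<^esub> (c \<otimes>\<^sub>B p) = c \<otimes>\<^sub>B p"
      by (simp add: interchange[OF cb T[OF S S] pb pb] ssc pp)
    also have "(p \<otimes>\<^sub>B K) \<odot>\<^bsub>t\<^esub> (c \<otimes>\<^sub>B p) = (p \<otimes>\<^sub>B K) \<odot>\<^bsub>t\<^esub> ((p \<otimes>\<^sub>B s \<otimes>\<^sub>B s) \<odot>\<^bsub>t\<^esub> (V \<otimes>\<^sub>B p))"
      unfolding btensor_assoc[OF pb S S, symmetric] by (simp add: interchange[OF VB T[OF pb S] pb S] c_def ps)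
    also have "(p \<otimes>\<^sub>B K) \<odot>\<^bsub>t\<^esub> ((p \<otimes>\<^sub>B s \<otimes>\<^sub>B s) \<odot>\<^bsub>t\<^esub> (V \<otimes>\<^sub>B p)) = (p \<otimes>\<^sub>B K) \<odot>\<^bsub>t\<^esub> (V \<otimes>\<^sub>B p)"
      unfolding bcomp_assoc[OF VS[OF pb] tensor3[OF pb S S] SK[OF pb], symmetric]
      by (simp add: interchange[OF pb pb T[OF S S] KB] pp Kss)
    also have "\<dots> = (p \<odot>\<^bsub>t\<^esub> (s \<otimes>\<^sub>B K)) \<odot>\<^bsub>t\<^esub> ((V \<otimes>\<^sub>B s) \<odot>\<^bsub>t\<^esub> p)"
      unfolding SK_left[OF pb ps(1)] VS_right[OF pb ps(2)] ..
    also have "\<dots> = p \<odot>\<^bsub>t\<^esub> (((s \<otimes>\<^sub>B K) \<odot>\<^bsub>t\<^esub> (V \<otimes>\<^sub>B s)) \<odot>\<^bsub>t\<^esub> p)"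
      by (simp add: bcomp_assoc[OF bhom_bcomp[OF pb VS[OF S]] SK[OF S] pb] bcomp_assoc[OF pb VS[OF S] SK[OF S]])
    finally show ?thesis by (simp add: zig ps pp)
  qed
  have zigzag2: "(E \<otimes>\<^sub>B p) \<odot>\<^bsub>t\<^esub> (p \<otimes>\<^sub>B c) = p"
  proof -
    have pc: "p \<otimes>\<^sub>B c \<in> bhom d (d + (d + d))" using bhom_btensor[OF pb cb] by simp
    have "E \<otimes>\<^sub>B p = (K \<otimes>\<^sub>B p) \<odot>\<^bsub>t\<^esub> (p \<otimes>\<^sub>B s \<otimes>\<^sub>B s)"
      unfolding E2 btensor_assoc[OF pb S S, symmetric] by (simp add: interchange[OF T[OF pb S] KB S pb] ps)
    then have "(E \<otimes>\<^sub>B p) \<odot>\<^bsub>t\<^esub> (p \<otimes>\<^sub>B c) = (K \<otimes>\<^sub>B p) \<odot>\<^bsub>t\<^esub> ((p \<otimes>\<^sub>B s \<otimes>\<^sub>B s) \<odot>\<^bsub>t\<^esub> (p \<otimes>\<^sub>B c))"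
      by (simp add: bcomp_assoc[OF pc tensor3[OF pb S S] KS[OF pb]])
    also have "(p \<otimes>\<^sub>B s \<otimes>\<^sub>B s) \<odot>\<^bsub>t\<^esub> (p \<otimes>\<^sub>B c) = p \<otimes>\<^sub>B c"
      by (simp add: interchange[OF pb pb cb T[OF S S]] ssc pp)
    also have "(K \<otimes>\<^sub>B p) \<odot>\<^bsub>t\<^esub> (p \<otimes>\<^sub>B c) = (K \<otimes>\<^sub>B p) \<odot>\<^bsub>t\<^esub> ((s \<otimes>\<^sub>B s \<otimes>\<^sub>B p) \<odot>\<^bsub>t\<^esub> (p \<otimes>\<^sub>B V))"
      by (simp add: interchange[OF pb S VB T[OF S pb]] c_def ps adjV)
    also have "(K \<otimes>\<^sub>B p) \<odot>\<^bsub>t\<^esub> ((s \<otimes>\<^sub>B s \<otimes>\<^sub>B p) \<odot>\<^bsub>t\<^esub> (p \<otimes>\<^sub>B V)) = (K \<otimes>\<^sub>B p) \<odot>\<^bsub>t\<^esub> (p \<otimes>\<^sub>B V)"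
      unfolding bcomp_assoc[OF SV[OF pb] tensor3[OF S S pb] KS[OF pb], symmetric]
      unfolding btensor_assoc[OF S S pb, symmetric]
      by (simp add: interchange[OF T[OF S S] KB pb pb] pp Kss)
    also have "\<dots> = (p \<odot>\<^bsub>t\<^esub> (K \<otimes>\<^sub>B s)) \<odot>\<^bsub>t\<^esub> ((s \<otimes>\<^sub>B V) \<odot>\<^bsub>t\<^esub> p)"
      unfolding KS_left[OF pb ps(1)] SV_right[OF pb ps(2)] ..
    also have "\<dots> = p \<odot>\<^bsub>t\<^esub> (((K \<otimes>\<^sub>B s) \<odot>\<^bsub>t\<^esub> (s \<otimes>\<^sub>B V)) \<odot>\<^bsub>t\<^esub> p)"
      by (simp add: bcomp_assoc[OF bhom_bcomp[OF pb SV[OF S]] KS[OF S] pb] bcomp_assoc[OF pb SV[OF S] KS[OF S]])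
    finally show ?thesis by (simp add: zag ps pp)
  qed
  have "c \<in> khom t kunit ((d, p) \<otimes>\<^sub>K (d, p))"
    using cb ppc by (simp add: khom_def kunit_def ktensor_def bcomp_bid)
  then show ?thesis
    using zigzag1 zigzag2 by (simp add: is_coevaluation_def c_def E_def)
qed

end

lemma component_proj_selfadjoint:
  assumes "l \<in> index_set t"
  shows "selfadjoint (size2 l) (component_proj t l)"
    "component_proj t l \<odot>\<^bsub>t\<^esub> component_proj t l = component_proj t l"
proof -
  interpret endomorphism t "Sym (size2 l)" "Casimir t (size2 l)" by (rule endomorphism_Casimir)
  let ?c = "casimir_eigenvalue t l"
  obtain g where g: "cofactor t (size2 l) ?c dvd g" "[:- ?c, 1:] ^ level_multiplicity t (size2 l) ?c dvd g - 1"
    and p: "component_proj t l = ep g"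
    using component_proj_exists[OF assms] .
  show "selfadjoint (size2 l) (component_proj t l)" unfolding p by (rule selfadjoint_casimir_eval)
  have "casimir_poly t (size2 l) dvd (g - 1) * g"
    unfolding casimir_poly_cofactor[of t "size2 l" ?c] using g by (intro mult_dvd_mono)
  then have "ep ((g - 1) * g) = 0" unfolding casimir_eval_eq_0_iff .
  then have "ep (g * g) = ep g" by (simp add: left_diff_distrib ep_diff)
  then show "component_proj t l \<odot>\<^bsub>t\<^esub> component_proj t l = component_proj t l" by (simp add: p ep_mult)
qed

lemma Capelli_eq:
  assumes l: "l \<in> index_set t"
  shows "Capelli t l = Poly_Mapping.single (size2 l)
    ((component_proj t l \<otimes>\<^sub>B symmetrizer (size2 l)) \<odot>\<^bsub>t\<^esub> sym_coev t (size2 l))"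
proof -
  let ?d = "size2 l" and ?p = "component_proj t l"
  note p = component_proj_selfadjoint[OF l]
  have comp: "component t l = (?d, ?p)" "component_dual t l = (?d, ?p)"
    by (simp_all add: component_def component_dual_def transpose_endo_selfadjoint[OF p(1)])
  have ev: "component_ev t l = contraction t ?d ?d \<odot>\<^bsub>t\<^esub> (?p \<otimes>\<^sub>B ?p)"
    by (simp add: component_ev_def comp)
  have evb: "component_ev t l \<in> bhom (?d + ?d) 0"
    unfolding ev using selfadjoint_bhom[OF p(1)] polyfam_bhom[OF polyfam_full_contraction] by blast
  have obj: "is_object t (?d, ?p)" using p selfadjoint_bhom by (simp add: is_object_def)
  have coev: "is_coevaluation t (component t l) (component_dual t l) (component_ev t l)
      ((?p \<otimes>\<^sub>B symmetrizer ?d) \<odot>\<^bsub>t\<^esub> sym_coev t ?d)"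
    unfolding comp ev by (rule is_coevaluation_selfadjoint[OF p])
  have "(THE c. is_coevaluation t (component t l) (component_dual t l) (component_ev t l) c) =
      (?p \<otimes>\<^sub>B symmetrizer ?d) \<odot>\<^bsub>t\<^esub> sym_coev t ?d"
  proof (rule the_equality)
    fix c assume "is_coevaluation t (component t l) (component_dual t l) (component_ev t l) c"
    then show "c = (?p \<otimes>\<^sub>B symmetrizer ?d) \<odot>\<^bsub>t\<^esub> sym_coev t ?d"
      using coevaluation_unique[OF obj _ _ evb] coev unfolding comp by blast
  qed (rule coev)
  then show ?thesis by (simp add: Capelli_def)
qed

section \<open>Action of a Capelli operator with a simple Casimir eigenvalue\<close>

lemma action_linear:
  assumes x: "\<And>j. j \<in> J \<Longrightarrow> x j \<in> bhom 0 (r + s)"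
  shows "action t r s (\<Sum>j\<in>J. a j \<cdot>\<^sub>B x j) q = (\<Sum>j\<in>J. a j \<cdot>\<^sub>B action t r s (x j) q)"
proof -
  let ?C = "symmetrizer r \<otimes>\<^sub>B contraction t s q"
  have tens: "y \<otimes>\<^sub>B symmetrizer q \<in> bhom q (r + (s + q))" if "y \<in> bhom 0 (r + s)" for y
    using bhom_btensor[OF that bhom_symmetrizer[of q]] by (simp add: add.assoc)
  have C: "?C \<in> bhom (r + (s + q)) (r + (q - s))"
    using bhom_btensor[OF bhom_symmetrizer polyfam_bhom[OF polyfam_contraction]] .
  have M: "multiplication t r (q - s) \<in> bhom (r + (q - s)) (r + (q - s))"
    unfolding multiplication_eq by (rule bhom_symmetrizer)
  have add: "action t r s (y + y') q = action t r s y q + action t r s y' q"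
    if "y \<in> bhom 0 (r + s)" "y' \<in> bhom 0 (r + s)" for y y'
    unfolding action_def btensor_add_left[OF that bhom_symmetrizer]
      bcomp_add_right[OF tens[OF that(1)] tens[OF that(2)] C]
    by (rule bcomp_add_right[OF bhom_bcomp[OF tens[OF that(1)] C] bhom_bcomp[OF tens[OF that(2)] C] M])
  have scale: "action t r s (c \<cdot>\<^sub>B y) q = c \<cdot>\<^sub>B action t r s y q" if "y \<in> bhom 0 (r + s)" for c y
    unfolding action_def btensor_bscale_left[OF that bhom_symmetrizer] bcomp_bscale_right[OF tens[OF that] C]
    by (rule bcomp_bscale_right[OF bhom_bcomp[OF tens[OF that] C] M])
  show ?thesis
    using x
  proof (induction J rule: infinite_finite_induct)
    case (insert j J)
    have "(\<Sum>j\<in>J. a j \<cdot>\<^sub>B x j) \<in> bhom 0 (r + s)" using insert.prems by (intro bhom_sum bhom_bscale) auto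
    then show ?case using insert add[OF bhom_bscale] scale by simp
  qed (simp_all add: action_def)
qed

text \<open>
  In the basis of Newton polynomials the projection onto a component with a simple Casimir
  eigenvalue is the interpolation polynomial of a Kronecker delta.
\<close>

definition newton_coeff :: "complex \<Rightarrow> nat \<Rightarrow> nat \<Rightarrow> nat \<Rightarrow> complex" where
  "newton_coeff t d m j = 1 / (\<Prod>i\<in>{..j} - {m}. node t d m - node t d i)"

text \<open>The right side is the Lagrange polynomial of m on the nodes up to h. The Newton sum
  starts at j = m because a delta at m vanishes at all earlier nodes, and
  \<open>newton_coeff\<close> is its divided difference.\<close>

lemma newton_interpolation:
  assumes "m \<le> h" and nodes: "\<And>i. i \<le> h \<Longrightarrow> i \<noteq> m \<Longrightarrow> node t d i \<noteq> node t d m"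
  shows "(\<Sum>j=m..h. smult (newton_coeff t d m j) (newton t d j)) =
    smult (newton_coeff t d m h) (\<Prod>i\<in>{..h} - {m}. smult (- 1 / 4) [:- level t d i, 1:])"
  using assms
proof (induction h rule: dec_induct)
  case base
  have "{..m} - {m} = {..<m}" by auto
  then show ?case by (simp add: newton_def)
next
  case (step h)
  let ?lin = "\<lambda>i. smult (- 1 / 4) [:- level t d i, 1:]"
  let ?P = "\<Prod>i\<in>{..h} - {m}. ?lin i" and ?w = "newton_coeff t d m"
  have set: "{..Suc h} - {m} = insert (Suc h) ({..h} - {m})" using step.hyps by auto
  have D: "node t d m - node t d (Suc h) \<noteq> 0" using step.prems[of "Suc h"] step.hyps by auto
  have w: "?w h = ?w (Suc h) * (node t d m - node t d (Suc h))"
    unfolding newton_coeff_def set using D by simp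
  have "newton t d (Suc h) = ?lin m * ?P"
    unfolding newton_def lessThan_Suc_atMost using step.hyps by (subst prod.remove[of _ m]) auto
  then have "(\<Sum>j=m..Suc h. smult (?w j) (newton t d j)) = smult (?w h) ?P + smult (?w (Suc h)) (?lin m * ?P)"
    using step by simp
  also have "\<dots> = smult (?w (Suc h)) ((smult (node t d m - node t d (Suc h)) 1 + ?lin m) * ?P)"
    unfolding w by (simp only: smult_smult[symmetric] distrib_right smult_add_right mult_smult_left mult_1)
  \<comment> \<open>In terms of the eigenvalue X of \<Theta>\<Delta> this reads (node_m -
    node_(h+1)) + (X - node_m) = X - node_(h+1).\<close>
  also have "smult (node t d m - node t d (Suc h)) 1 + ?lin m = ?lin (Suc h)"
    by (simp add: one_pCons level_def field_simps)
  also have "?lin (Suc h) * ?P = (\<Prod>i\<in>{..Suc h} - {m}. ?lin i)"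
    unfolding set by (subst prod.insert) auto
  finally show ?case .
qed

text \<open>With multiplicity one, being 1 modulo the primary factor means taking the value 1 at the
  level of l. The remaining levels may coincide among themselves; the Lagrange product then vanishes
  at them to the order that the cofactor asks for.\<close>

lemma component_proj_simple:
  assumes l: "l \<in> index_set t"
    and simple: "\<And>i. i \<le> size2 l div 2 \<Longrightarrow> level t (size2 l) i = level t (size2 l) (snd l) \<Longrightarrow> i = snd l"
  shows "component_proj t l = (\<Sum>j=snd l..size2 l div 2. newton_coeff t (size2 l) (snd l) j \<cdot>\<^sub>B theta_delta (size2 l) j)"
proof -
  let ?d = "size2 l" and ?m = "snd l"
  let ?h = "?d div 2" and ?c = "casimir_eigenvalue t l"
  interpret endomorphism t "Sym ?d" "Casimir t ?d" by (rule endomorphism_Casimir)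
  have c: "?c = level t ?d ?m" and mh: "?m \<le> ?h"
    using casimir_eigenvalue_level[OF index_set_Partitions[OF l]] by auto
  have nodes: "node t ?d i \<noteq> node t ?d ?m" if "i \<le> ?h" "i \<noteq> ?m" for i
    using simple that by (auto simp: level_def)
  define g where "g = (\<Sum>j=?m..?h. smult (newton_coeff t ?d ?m j) (newton t ?d j))"
  have g: "g = smult (newton_coeff t ?d ?m ?h) (\<Prod>i\<in>{..?h} - {?m}. smult (- 1 / 4) [:- level t ?d i, 1:])"
    unfolding g_def by (rule newton_interpolation[OF mh nodes])
  have others: "{i. i \<le> ?h \<and> level t ?d i \<noteq> ?c} = {..?h} - {?m}" "{i. i \<le> ?h \<and> level t ?d i = ?c} = {?m}"
    using simple mh unfolding c by auto
  have "g = smult (newton_coeff t ?d ?m ?h * (\<Prod>i\<in>{..?h} - {?m}. - 1 / 4)) (cofactor t ?d ?c)"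
    unfolding g cofactor_def others prod_smult smult_smult ..
  then have g0: "cofactor t ?d ?c dvd g" by (simp add: dvd_smult)
  have "poly g ?c = newton_coeff t ?d ?m ?h * (\<Prod>i\<in>{..?h} - {?m}. node t ?d ?m - node t ?d i)"
    unfolding g poly_smult poly_prod c
    by (intro arg_cong2[where f = "(*)"] prod.cong refl) (simp add: level_def field_simps)
  also have "\<dots> = 1"
  proof -
    have "(\<Prod>i\<in>{..?h} - {?m}. node t ?d ?m - node t ?d i) \<noteq> 0"
      using nodes by (subst prod_zero_iff) (auto dest: sym)
    then show ?thesis by (simp add: newton_coeff_def)
  qed
  finally have "[:- ?c, 1:] dvd g - 1" by (simp add: poly_eq_0_iff_dvd[symmetric])
  moreover have "level_multiplicity t ?d ?c = 1" unfolding level_multiplicity_def others by simp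
  ultimately have "component_proj t l = ep g" by (intro component_proj_eq[OF l g0]) simp
  then show ?thesis by (simp add: g_def ep_sum ep_smult casimir_eval_newton)
qed

lemma Capelli_action:
  assumes l: "l \<in> index_set t"
    and simple: "\<And>i. i \<le> size2 l div 2 \<Longrightarrow> level t (size2 l) i = level t (size2 l) (snd l) \<Longrightarrow> i = snd l"
  shows "op_action t (Capelli t l) q = casimir_eval t q (\<Sum>j=snd l..size2 l div 2.
    smult (newton_coeff t (size2 l) (snd l) j * of_nat ((q - 2 * j) choose (size2 l - 2 * j))) (newton t q j))"
proof -
  let ?d = "size2 l" and ?w = "newton_coeff t (size2 l) (snd l)"
  let ?J = "{snd l..?d div 2}" and ?s = "symmetrizer (size2 l)"
  interpret endomorphism t "Sym q" "Casimir t q" by (rule endomorphism_Casimir)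
  have V: "sym_coev t ?d \<in> bhom 0 (?d + ?d)" using polyfam_bhom[OF polyfam_sym_coev] .
  have tb: "theta_delta ?d j \<otimes>\<^sub>B ?s \<in> bhom (?d + ?d) (?d + ?d)" for j by (intro bhom_btensor bhom_theta_delta bhom_symmetrizer)
  have "(component_proj t l \<otimes>\<^sub>B ?s) = (\<Sum>j\<in>?J. ?w j \<cdot>\<^sub>B (theta_delta ?d j \<otimes>\<^sub>B ?s))"
  proof -
    have "(\<Sum>j\<in>J. ?w j \<cdot>\<^sub>B theta_delta ?d j) \<otimes>\<^sub>B ?s = (\<Sum>j\<in>J. ?w j \<cdot>\<^sub>B (theta_delta ?d j \<otimes>\<^sub>B ?s))" if "finite J" for J
      using that
    proof (induction J)
      case (insert j J)
      have "(\<Sum>j\<in>J. ?w j \<cdot>\<^sub>B theta_delta ?d j) \<in> bhom ?d ?d" by (intro bhom_sum bhom_bscale bhom_theta_delta)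
      then show ?case using insert btensor_add_left[OF bhom_bscale[OF bhom_theta_delta] _ bhom_symmetrizer]
        by (simp add: btensor_bscale_left[OF bhom_theta_delta bhom_symmetrizer])
    qed simp
    then show ?thesis by (simp add: component_proj_simple[OF l simple])
  qed
  then have "(component_proj t l \<otimes>\<^sub>B ?s) \<odot>\<^bsub>t\<^esub> sym_coev t ?d =
      (\<Sum>j\<in>?J. ?w j \<cdot>\<^sub>B ((theta_delta ?d j \<otimes>\<^sub>B ?s) \<odot>\<^bsub>t\<^esub> sym_coev t ?d))"
    using bcomp_sum_left[OF V, of ?J "\<lambda>j. ?w j \<cdot>\<^sub>B (theta_delta ?d j \<otimes>\<^sub>B ?s)" "?d + ?d"] tb
    by (simp add: bhom_bscale bcomp_bscale_left[OF V tb])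
  then have "op_action t (Capelli t l) q =
      (\<Sum>j\<in>?J. ?w j \<cdot>\<^sub>B action t ?d ?d ((theta_delta ?d j \<otimes>\<^sub>B ?s) \<odot>\<^bsub>t\<^esub> sym_coev t ?d) q)"
    by (simp add: Capelli_eq[OF l] op_action_single action_linear[OF bhom_bcomp[OF V tb]])
  also have "\<dots> = (\<Sum>j\<in>?J. ?w j \<cdot>\<^sub>B (of_nat ((q - 2 * j) choose (?d - 2 * j)) \<cdot>\<^sub>B theta_delta q j))"
    by (intro sum.cong refl arg_cong[where f = "bscale _"] action_theta_delta) auto
  finally show ?thesis by (simp add: ep_sum ep_smult casimir_eval_newton)
qed

section \<open>Eigenvalue polynomials\<close>

text \<open>These points are Zariski dense: for each m there are infinitely many zeros in the inner
  variable, and then infinitely many m in the outer one.\<close>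

lemma eval2_eqI:
  fixes f g :: "complex poly poly"
  assumes eq: "\<And>n m. start \<le> n \<Longrightarrow> eval2 f (of_nat n + of_nat m + c) (of_nat m) = eval2 g (of_nat n + of_nat m + c) (of_nat m)"
  shows "f = g"
proof -
  let ?h = "f - g"
  have "poly ?h [:of_nat m:] = 0" for m
  proof (rule ccontr)
    assume "poly ?h [:of_nat m:] \<noteq> 0"
    then have "finite {x. poly (poly ?h [:of_nat m:]) x = 0}" by (rule poly_roots_finite)
    moreover have "(\<lambda>n. of_nat n + of_nat m + c) ` {start..} \<subseteq> {x. poly (poly ?h [:of_nat m:]) x = 0}"
      using eq by (auto simp: eval2_def)
    moreover have "infinite ((\<lambda>n. of_nat n + of_nat m + c) ` {start..})"
      by (subst finite_image_iff) (auto simp: inj_on_def infinite_Ici)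
    ultimately show False using finite_subset by blast
  qed
  then have "range (\<lambda>m. [:of_nat m:]) \<subseteq> {x. poly ?h x = 0}" by auto
  moreover have "infinite (range (\<lambda>m. [:of_nat m:] :: complex poly))"
    by (subst finite_image_iff) (auto simp: inj_on_def)
  ultimately have "?h = 0" using poly_roots_finite finite_subset by blast
  then show ?thesis by simp
qed

lemma index_set_large: "\<exists>start. \<forall>n m. start \<le> n \<longrightarrow> (n + m, m) \<in> index_set t"
proof (cases rule: index_set_cases[of t])
  case 1
  then show ?thesis by (auto simp: Partitions_def)
next
  case (2 k)
  show ?thesis unfolding 2 index_set_special
    by (intro exI[of _ "2 * k + 3"]) (auto simp: Partitions_def regular_def)
qed

text \<open>With b = a - a' the square of h' = b p + h gives b^2 p + 2b h = 0. For b \<noteq> 0 this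
  makes h a multiple of p, and then h^2 = 0 forces p = 0. Eigenvalues are thus determined in spite
  of the nilpotent terms.\<close>

lemma square_zero_scalar_unique:
  assumes p: "p \<in> bhom d d" "p \<odot>\<^bsub>t\<^esub> p = p" "p \<noteq> 0"
    and h: "h \<in> bhom d d" "h \<odot>\<^bsub>t\<^esub> p = h" "p \<odot>\<^bsub>t\<^esub> h = h" "h \<odot>\<^bsub>t\<^esub> h = 0"
    and h': "h' \<in> bhom d d" "h' \<odot>\<^bsub>t\<^esub> h' = 0"
    and eq: "a \<cdot>\<^sub>B p + h = a' \<cdot>\<^sub>B p + h'"
  shows "a = a'"
proof (rule ccontr)
  assume ne: "a \<noteq> a'"
  define b where "b = a - a'"
  have nz: "b \<noteq> 0" using ne by (simp add: b_def)
  have h'_eq: "h' = b \<cdot>\<^sub>B p + h" using eq by (simp add: b_def bscale_diff_left algebra_simps)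
  have bp: "b \<cdot>\<^sub>B p \<in> bhom d d" using p by blast
  have sum: "b \<cdot>\<^sub>B p + h \<in> bhom d d" using bp h by blast
  have "h' \<odot>\<^bsub>t\<^esub> h' = (b \<cdot>\<^sub>B p) \<odot>\<^bsub>t\<^esub> (b \<cdot>\<^sub>B p) + (b \<cdot>\<^sub>B p) \<odot>\<^bsub>t\<^esub> h + (h \<odot>\<^bsub>t\<^esub> (b \<cdot>\<^sub>B p) + h \<odot>\<^bsub>t\<^esub> h)"
    unfolding h'_eq
    by (simp only: bcomp_add_left[OF sum bp h(1)] bcomp_add_right[OF bp h(1) bp] bcomp_add_right[OF bp h(1) h(1)])
  also have "\<dots> = (b * b) \<cdot>\<^sub>B p + (2 * b) \<cdot>\<^sub>B h"
    using p h by (simp add: bcomp_bscale_left[OF bhom_bscale[OF p(1)] p(1)] bcomp_bscale_right[OF p(1) p(1)]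
        bcomp_bscale_left[OF h(1) p(1)] bcomp_bscale_right[OF p(1) h(1)])
      (simp add: poly_mapping_eq_iff fun_eq_iff lookup_add algebra_simps)
  finally have *: "(b * b) \<cdot>\<^sub>B p + (2 * b) \<cdot>\<^sub>B h = 0" using h' by simp
  have "h = (- b / 2) \<cdot>\<^sub>B p"
  proof (rule poly_mapping_eqI)
    fix D
    have "b * b * Poly_Mapping.lookup p D + 2 * b * Poly_Mapping.lookup h D = 0"
      using arg_cong[OF *, of "\<lambda>f. Poly_Mapping.lookup f D"] by (simp add: lookup_add)
    then have "b * (b * Poly_Mapping.lookup p D + 2 * Poly_Mapping.lookup h D) = 0" by (simp add: algebra_simps)
    then have "b * Poly_Mapping.lookup p D + 2 * Poly_Mapping.lookup h D = 0" using nz by simp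
    then have "2 * Poly_Mapping.lookup h D = - (b * Poly_Mapping.lookup p D)" by (simp only: add_eq_0_iff)
    then have "2 * Poly_Mapping.lookup h D / 2 = - (b * Poly_Mapping.lookup p D) / 2" by (simp only:)
    then have "Poly_Mapping.lookup h D = - (b * Poly_Mapping.lookup p D) / 2" by simp
    then show "Poly_Mapping.lookup h D = Poly_Mapping.lookup ((- b / 2) \<cdot>\<^sub>B p) D" by simp
  qed
  then have "h \<odot>\<^bsub>t\<^esub> h = (b * b / 4) \<cdot>\<^sub>B p"
    using p by (simp add: bcomp_bscale_left[OF bhom_bscale[OF p(1)] p(1)] bcomp_bscale_right[OF p(1) p(1)])
  then have "(b * b / 4) \<cdot>\<^sub>B p = 0" using h by simp
  then have "b * b / 4 * Poly_Mapping.lookup p D = 0" for D by (metis lookup_bscale lookup_zero)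
  then have "p = 0" using nz by (intro poly_mapping_eqI) simp
  then show False using p by simp
qed

lemma component_proj_nonzero:
  assumes "m \<in> index_set t"
  shows "component_proj t m \<noteq> 0"
proof
  let ?d = "size2 m" and ?c = "casimir_eigenvalue t m"
  assume "component_proj t m = 0"
  then obtain g where g: "[:- ?c, 1:] ^ level_multiplicity t ?d ?c dvd g - 1" "casimir_eval t ?d g = 0"
    using component_proj_exists[OF assms] by metis
  have "snd m \<in> {i. i \<le> ?d div 2 \<and> level t ?d i = ?c}"
    using casimir_eigenvalue_level[OF index_set_Partitions[OF assms]] by auto
  then have "level_multiplicity t ?d ?c \<noteq> 0" unfolding level_multiplicity_def by (subst card_0_eq) auto
  then have lin: "[:- ?c, 1:] dvd [:- ?c, 1:] ^ level_multiplicity t ?d ?c" by (simp add: dvd_power)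
  then have "[:- ?c, 1:] dvd g - 1" using g(1) by (rule dvd_trans)
  moreover have "[:- ?c, 1:] dvd g"
    using g(2) lin unfolding casimir_eval_eq_0_iff casimir_poly_cofactor[of t ?d ?c] by (meson dvd_mult_left dvd_trans)
  ultimately show False by (simp add: poly_eq_0_iff_dvd[symmetric])
qed

text \<open>A polynomial in the Casimir operator acts on a component by its value at the eigenvalue
  plus a multiple of C - c, whose square vanishes there because multiplicities are at most 2.
  Uniqueness follows since the index set contains all partitions with a large difference of
  parts.\<close>

lemma eigenvalue_poly_eqI:
  assumes op: "\<And>q. op_action t D q = casimir_eval t q (G q)"
    and sym: "symmetric2 f"
    and val: "\<And>m. m \<in> index_set t \<Longrightarrow>
      eval2 f (of_nat (fst m) - (- t / 2) - 1) (of_nat (snd m)) = poly (G (size2 m)) (casimir_eigenvalue t m)"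
  shows "eigenvalue_poly t D = f"
proof -
  let ?good = "\<lambda>f m. \<exists>\<eta>\<in>khom t (component t m) (component t m).
        op_action t D (size2 m) \<odot>\<^bsub>t\<^esub> ident (component t m) =
          eval2 f (of_nat (fst m) - (- t / 2) - 1) (of_nat (snd m)) \<cdot>\<^sub>B ident (component t m) + \<eta>
        \<and> \<eta> \<odot>\<^bsub>t\<^esub> \<eta> = 0"
  have good: "?good f m" if m: "m \<in> index_set t" for m
  proof -
    let ?d = "size2 m" and ?c = "casimir_eigenvalue t m"
    interpret endomorphism t "Sym ?d" "Casimir t ?d" by (rule endomorphism_Casimir)
    obtain g where g: "cofactor t ?d ?c dvd g" "[:- ?c, 1:] ^ level_multiplicity t ?d ?c dvd g - 1"
      and p: "component_proj t m = ep g"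
      using component_proj_exists[OF m] .
    have pp: "ep g \<odot>\<^bsub>t\<^esub> ep g = ep g" using component_proj_selfadjoint(2)[OF m] by (simp add: p)
    \<comment> \<open>Division by the linear factor splits the operator into its scalar part and the
      nilpotent part that is to serve as \<eta>.\<close>
    obtain u where u: "G ?d = [:poly (G ?d) ?c:] + [:- ?c, 1:] * u"
      using synthetic_div_correct'[of ?c "G ?d"] by (metis add.commute)
    let ?\<eta> = "ep ([:- ?c, 1:] * u * g)"
    have comp: "component t m = (?d, ep g)" by (simp add: component_def p)
    have "casimir_poly t ?d dvd [:- ?c, 1:] * u * g * ([:- ?c, 1:] * u * g)"
    proof -
      have "[:- ?c, 1:] ^ level_multiplicity t ?d ?c dvd [:- ?c, 1:] ^ 2"
        by (rule le_imp_power_dvd) (rule level_multiplicity_le_2)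
      then have "casimir_poly t ?d dvd [:- ?c, 1:] ^ 2 * g"
        unfolding casimir_poly_cofactor[of t ?d ?c] using g(1) by (rule mult_dvd_mono)
      moreover have "[:- ?c, 1:] * u * g * ([:- ?c, 1:] * u * g) = [:- ?c, 1:] ^ 2 * g * (u * u * g)"
        by (simp only: power2_eq_square mult_ac)
      ultimately show ?thesis by (metis dvd_mult2)
    qed
    then have "?\<eta> \<odot>\<^bsub>t\<^esub> ?\<eta> = 0" unfolding casimir_eval_eq_0_iff[symmetric] ep_mult[symmetric] .
    moreover have "?\<eta> \<in> khom t (component t m) (component t m)"
    proof -
      have "?\<eta> = ep ([:- ?c, 1:] * u) \<odot>\<^bsub>t\<^esub> ep g" "?\<eta> = ep g \<odot>\<^bsub>t\<^esub> ep ([:- ?c, 1:] * u)"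
        unfolding ep_mult[symmetric] by (simp_all only: mult_ac)
      then have "?\<eta> \<odot>\<^bsub>t\<^esub> ep g = ?\<eta>" "ep g \<odot>\<^bsub>t\<^esub> ?\<eta> = ?\<eta>"
        using bcomp_assoc[OF ep_bhom ep_bhom ep_bhom] pp by metis+
      then show ?thesis using ep_bhom[of "[:- ?c, 1:] * u * g"] by (simp add: khom_def comp Sym_def)
    qed
    moreover have "op_action t D ?d \<odot>\<^bsub>t\<^esub> ident (component t m) =
        eval2 f (of_nat (fst m) - (- t / 2) - 1) (of_nat (snd m)) \<cdot>\<^sub>B ident (component t m) + ?\<eta>"
    proof -
      have "op_action t D ?d \<odot>\<^bsub>t\<^esub> ident (component t m) = ep (G ?d * g)" by (simp add: op comp ep_mult)
      also have "G ?d * g = smult (poly (G ?d) ?c) g + [:- ?c, 1:] * u * g"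
        by (subst u) (simp add: distrib_right)
      finally show ?thesis unfolding val[OF m] by (simp add: comp ep_add ep_smult)
    qed
    ultimately show ?thesis by blast
  qed
  show ?thesis
    unfolding eigenvalue_poly_def
  proof (rule the_equality)
    show "symmetric2 f \<and> (\<forall>m\<in>index_set t. ?good f m)" using sym good by blast
    fix f' assume f': "symmetric2 f' \<and> (\<forall>m\<in>index_set t. ?good f' m)"
    have eq: "eval2 f' (of_nat (fst m) - (- t / 2) - 1) (of_nat (snd m)) =
        eval2 f (of_nat (fst m) - (- t / 2) - 1) (of_nat (snd m))" if m: "m \<in> index_set t" for m
    proof -
      let ?p = "component_proj t m"
      let ?op = "op_action t D (size2 m) \<odot>\<^bsub>t\<^esub> ?p"
      note ps = component_proj_selfadjoint[OF m]
      have comp: "component t m = (size2 m, ?p)" by (simp add: component_def)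
      have "?good f' m" using f' m by blast
      then obtain \<eta>' where \<eta>': "\<eta>' \<in> khom t (component t m) (component t m)" "\<eta>' \<odot>\<^bsub>t\<^esub> \<eta>' = 0"
        "op_action t D (size2 m) \<odot>\<^bsub>t\<^esub> ident (component t m) =
          eval2 f' (of_nat (fst m) - (- t / 2) - 1) (of_nat (snd m)) \<cdot>\<^sub>B ident (component t m) + \<eta>'" by blast
      obtain \<eta> where \<eta>: "\<eta> \<in> khom t (component t m) (component t m)" "\<eta> \<odot>\<^bsub>t\<^esub> \<eta> = 0"
        "op_action t D (size2 m) \<odot>\<^bsub>t\<^esub> ident (component t m) =
          eval2 f (of_nat (fst m) - (- t / 2) - 1) (of_nat (snd m)) \<cdot>\<^sub>B ident (component t m) + \<eta>"
        using good[OF m] by blast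
      show ?thesis
        by (rule square_zero_scalar_unique[OF selfadjoint_bhom[OF ps(1)] ps(2) component_proj_nonzero[OF m], of \<eta>' \<eta>])
          (use \<eta> \<eta>' in \<open>auto simp: khom_def comp\<close>)
    qed
    obtain start where start: "\<And>n m. start \<le> n \<Longrightarrow> (n + m, m) \<in> index_set t" using index_set_large by blast
    show "f' = f"
    proof (rule eval2_eqI[where start = start and c = "t / 2 - 1"])
      fix n m assume "start \<le> n"
      from eq[OF start[OF this, of m]] show "eval2 f' (of_nat n + of_nat m + (t / 2 - 1)) (of_nat m) =
          eval2 f (of_nat n + of_nat m + (t / 2 - 1)) (of_nat m)" by (simp add: algebra_simps)
    qed
  qed
qed

section \<open>Specialization\<close>

text \<open>Specialization respects the ring operations only away from poles, so that homomorphisms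
  are needed whose laws hold on a subring of the type.\<close>

locale subring_hom =
  fixes R :: "'a::comm_ring_1 set" and h :: "'a \<Rightarrow> 'b::comm_ring_1"
  assumes one: "1 \<in> R" and diff: "x \<in> R \<Longrightarrow> y \<in> R \<Longrightarrow> x - y \<in> R" and mult: "x \<in> R \<Longrightarrow> y \<in> R \<Longrightarrow> x * y \<in> R"
    and h_1: "h 1 = 1" and h_diff: "x \<in> R \<Longrightarrow> y \<in> R \<Longrightarrow> h (x - y) = h x - h y"
    and h_mult: "x \<in> R \<Longrightarrow> y \<in> R \<Longrightarrow> h (x * y) = h x * h y"
begin

lemma zero: "0 \<in> R" using diff[OF one one] by simp

lemma h_0: "h 0 = 0" using h_diff[OF one one] by simp

lemma add: assumes "x \<in> R" "y \<in> R" shows "x + y \<in> R" "h (x + y) = h x + h y"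
proof -
  have m: "0 - y \<in> R" "h (0 - y) = 0 - h y" using diff[OF zero assms(2)] h_diff[OF zero assms(2)] h_0 by auto
  show "x + y \<in> R" using diff[OF assms(1) m(1)] by simp
  show "h (x + y) = h x + h y" using h_diff[OF assms(1) m(1)] m(2) by simp
qed

lemma sum: assumes "\<And>a. a \<in> A \<Longrightarrow> f a \<in> R" shows "(\<Sum>a\<in>A. f a) \<in> R" "h (\<Sum>a\<in>A. f a) = (\<Sum>a\<in>A. h (f a))"
  using assms by (induction A rule: infinite_finite_induct) (auto simp: zero h_0 add)

lemma of_nat: "of_nat n \<in> R" "h (of_nat n) = of_nat n"
  by (induction n) (auto simp: zero h_0 add one h_1)

lemma ffact: assumes "x \<in> R" shows "ffact x k \<in> R" "h (ffact x k) = ffact (h x) k"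
  unfolding ffact_def using assms by (induction k) (auto simp: one h_1 mult h_mult diff h_diff of_nat)

lemma map_poly_hom: "subring_hom {p. \<forall>i. coeff p i \<in> R} (map_poly h)"
proof
  have c: "coeff (map_poly h p) i = h (coeff p i)" for p i by (simp add: coeff_map_poly h_0)
  show "1 \<in> {p. \<forall>i. coeff p i \<in> R}" "map_poly h 1 = 1"
    by (auto simp: zero one h_1 h_0 coeff_map_poly one_pCons map_poly_pCons split: nat.splits simp: coeff_pCons)
  fix p q assume pq: "p \<in> {p. \<forall>i. coeff p i \<in> R}" "q \<in> {p. \<forall>i. coeff p i \<in> R}"
  then show "p - q \<in> {p. \<forall>i. coeff p i \<in> R}" "map_poly h (p - q) = map_poly h p - map_poly h q"
    by (auto simp: diff h_diff c intro!: poly_eqI)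
  show "p * q \<in> {p. \<forall>i. coeff p i \<in> R}" "map_poly h (p * q) = map_poly h p * map_poly h q"
    using pq by (auto simp: coeff_mult sum mult h_mult c intro!: poly_eqI)
qed

end

definition rat_eval :: "complex \<Rightarrow> rat poly \<Rightarrow> complex" where
  "rat_eval z p = poly (map_poly of_rat p) z"

lemma subring_hom_rat_eval: "subring_hom UNIV (rat_eval z)"
proof -
  interpret subring_hom UNIV "of_rat :: rat \<Rightarrow> complex"
    by unfold_locales (auto simp: of_rat_diff of_rat_mult)
  interpret p: subring_hom "{p. \<forall>i. coeff p i \<in> UNIV}" "map_poly of_rat :: rat poly \<Rightarrow> complex poly"
    by (rule map_poly_hom)
  show ?thesis
    by unfold_locales (auto simp: rat_eval_def p.h_1 p.h_diff p.h_mult)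
qed

text \<open>The local ring of the rational functions without a pole at z, described by arbitrary and
  not by reduced fractions.\<close>

definition regular_at :: "complex \<Rightarrow> rat poly fract set" where
  "regular_at z = {to_fract a / to_fract b | a b. rat_eval z b \<noteq> 0}"

text \<open>The reduced denominator divides every other denominator of the same function, so it does
  not vanish at z either, and cross multiplication compares the values.\<close>

lemma specialize_quotient:
  assumes "rat_eval z b \<noteq> 0"
  shows "specialize z (to_fract a / to_fract b) = rat_eval z a / rat_eval z b"
proof -
  interpret subring_hom UNIV "rat_eval z" by (rule subring_hom_rat_eval)
  let ?r = "to_fract a / to_fract b"
  obtain a' b' where q: "quot_of_fract ?r = (a', b')" by fastforce
  have b: "b \<noteq> 0" using assms h_0 by auto
  have b': "b' \<noteq> 0" using snd_quot_of_fract_nonzero[of ?r] q by simp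
  have "coprime a' b'" using coprime_quot_of_fract[of ?r] q by simp
  moreover have "?r = to_fract a' / to_fract b'" using quot_to_fract_quot_of_fract[of ?r] q by (simp add: quot_to_fract_def Fract_conv_to_fract)
  then have "to_fract a * to_fract b' = to_fract a' * to_fract b" using b b' by (simp add: frac_eq_eq)
  then have cross: "a * b' = a' * b" by (simp only: to_fract_mult[symmetric] to_fract_eq_iff)
  ultimately have "b' dvd b" by (metis coprime_commute coprime_dvd_mult_right_iff dvd_triv_right)
  then obtain u where "b = b' * u" by blast
  then have nz: "rat_eval z b' \<noteq> 0" using assms h_mult[of b' u] by auto
  have "rat_eval z a * rat_eval z b' = rat_eval z a' * rat_eval z b"
    using arg_cong[OF cross, of "rat_eval z"] h_mult by simp
  then show ?thesis using assms nz by (simp add: specialize_def q rat_eval_def[symmetric] field_simps)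
qed

lemma subring_hom_specialize: "subring_hom (regular_at z) (specialize z)"
proof -
  interpret subring_hom UNIV "rat_eval z" by (rule subring_hom_rat_eval)
  have nz: "b \<noteq> 0" if "rat_eval z b \<noteq> 0" for b using that h_0 by auto
  have "to_fract (1 :: rat poly) / to_fract 1 = 1" by simp
  show ?thesis
  proof
    show "1 \<in> regular_at z" unfolding regular_at_def mem_Collect_eq
      by (intro exI[of _ 1]) (simp add: h_1)
    show "specialize z 1 = 1" using specialize_quotient[of z 1 1] by (simp add: h_1)
    fix x y assume "x \<in> regular_at z" "y \<in> regular_at z"
    then obtain a b c d where x: "x = to_fract a / to_fract b" "rat_eval z b \<noteq> 0"
      and y: "y = to_fract c / to_fract d" "rat_eval z d \<noteq> 0"
      by (auto simp: regular_at_def)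
    have bd: "rat_eval z (b * d) \<noteq> 0" using x y by (simp add: h_mult)
    have xy: "x - y = to_fract (a * d - c * b) / to_fract (b * d)" "x * y = to_fract (a * c) / to_fract (b * d)"
      using nz[OF x(2)] nz[OF y(2)] by (simp_all add: x y field_simps)
    show "x - y \<in> regular_at z" "x * y \<in> regular_at z"
      unfolding regular_at_def xy using bd by blast+
    show "specialize z (x - y) = specialize z x - specialize z y" "specialize z (x * y) = specialize z x * specialize z y"
      unfolding xy specialize_quotient[OF bd] unfolding x(1) y(1) specialize_quotient[OF x(2)] specialize_quotient[OF y(2)]
      using x(2) y(2) by (simp_all add: h_mult h_diff field_simps)
  qed
qed

section \<open>Knop--Sahi polynomials\<close>

lemma ffact_0 [simp]: "ffact a 0 = 1" by (simp add: ffact_def)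

lemma ffact_add: "ffact a (m + n) = ffact a m * ffact (a - of_nat m) n"
proof (induction n)
  case (Suc n)
  then show ?case by (simp add: ffact_def algebra_simps)
qed simp

lemma ffact_eq_0_iff: "ffact (a :: 'a::idom) n = 0 \<longleftrightarrow> (\<exists>i<n. a = of_nat i)"
  by (auto simp: ffact_def)

lemma gbinomial_ffact: "a gchoose n = ffact a n / (fact n :: complex)"
  by (simp add: ffact_def gbinomial_prod_rev atLeast0LessThan)

lemma to_fract_of_nat: "to_fract (of_nat n) = of_nat n"
  by (induction n) (auto simp: to_fract_add)

lemma to_fract_ffact: "to_fract (ffact a n) = ffact (to_fract a) n"
  by (induction n) (auto simp: ffact_def to_fract_of_nat)

lemma to_fract_fact: "to_fract (fact n) = fact n"
  by (metis of_nat_fact to_fract_of_nat)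

text \<open>The excluded values are the poles of the coefficients at \<open>n = \<lambda>\<^sub>1 - \<lambda>\<^sub>2\<close>.\<close>

definition KS_regular :: "complex \<Rightarrow> nat \<Rightarrow> bool" where
  "KS_regular z n \<longleftrightarrow> (\<forall>k<n. n \<le> 2 * k \<longrightarrow> z + 1 \<noteq> of_nat k)"

text \<open>A vanishing factor gives z + 1 = n - i + s with s < i, and 2i \<le> n puts this number
  into the excluded range.\<close>

lemma KS_regular_ffact:
  assumes "KS_regular z n" "2 * i \<le> n"
  shows "ffact (z + 1 - of_nat (n - i)) i \<noteq> 0"
proof
  assume "ffact (z + 1 - of_nat (n - i)) i = 0"
  then obtain s where s: "s < i" "z + 1 - of_nat (n - i) = of_nat s" unfolding ffact_eq_0_iff by blast
  then have "z + 1 = of_nat (n - i + s)" by (simp add: algebra_simps)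
  moreover have "n - i + s < n" "n \<le> 2 * (n - i + s)" using s assms(2) by auto
  ultimately show False using assms(1) unfolding KS_regular_def by blast
qed

text \<open>The coefficient for \<open>i \<le> j\<close>, after cancelling the first \<open>n - i\<close> factors of its denominator.\<close>

definition KS_value :: "complex \<Rightarrow> nat \<Rightarrow> nat \<Rightarrow> nat \<Rightarrow> complex" where
  "KS_value z n i j = fact n * ffact (z + 1) (n - j) / (fact i * fact j * fact (n - i - j) * ffact (z + 1 - of_nat (n - i)) i)"

lemma KS_coeff_commute: "KS_coeff n i j = KS_coeff n j i"
  by (simp add: KS_coeff_def mult_ac diff_commute add.commute)

lemma KS_coeff_specialize:
  assumes reg: "KS_regular z n" and ij: "i + j \<le> n" "i \<le> j"
  shows "KS_coeff n i j \<in> regular_at z" "specialize z (KS_coeff n i j) = KS_value z n i j"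
proof -
  interpret subring_hom UNIV "rat_eval z" by (rule subring_hom_rat_eval)
  let ?K = "[:1, 1:] :: rat poly"
  define a where "a = fact n * ffact ?K (n - j)"
  define b where "b = fact i * fact j * fact (n - i - j) * ffact (?K - of_nat (n - i)) i"
  have evK: "rat_eval z ?K = z + 1" by (simp add: rat_eval_def map_poly_pCons)
  have evfact: "rat_eval z (fact k) = fact k" for k by (metis of_nat(2) of_nat_fact)
  have ea: "rat_eval z a = fact n * ffact (z + 1) (n - j)"
    by (simp add: a_def h_mult evfact ffact(2) evK)
  have eb: "rat_eval z b = fact i * fact j * fact (n - i - j) * ffact (z + 1 - of_nat (n - i)) i"
    by (simp add: b_def h_mult evfact ffact(2) h_diff evK of_nat(2))
  have nz: "rat_eval z b \<noteq> 0" unfolding eb using KS_regular_ffact[OF reg, of i] ij by simp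
  have K: "kappa + 1 = to_fract ?K"
  proof -
    have "kappa + 1 = to_fract ([:0, 1:] + 1)" by (simp only: kappa_def to_fract_add to_fract_1)
    also have "[:0, 1:] + 1 = ?K" by (simp add: one_pCons)
    finally show ?thesis .
  qed
  have "ffact ?K (n - i) \<noteq> 0"
    unfolding ffact_eq_0_iff by (auto simp: of_nat_poly)
  then have nz2: "ffact (kappa + 1) (n - i) \<noteq> 0" unfolding K to_fract_ffact[symmetric] by simp
  \<comment> \<open>The factors to be cancelled may vanish at z; over the function field they do
    not, so that they are cancelled before specialization.\<close>
  have "ffact (kappa + 1) n = ffact (kappa + 1) (n - i) * ffact (kappa + 1 - of_nat (n - i)) i"
    using ffact_add[of "kappa + 1" "n - i" i] ij by simp
  then have "KS_coeff n i j = fact n * ffact (kappa + 1) (n - j) /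
      (fact i * fact j * fact (n - i - j) * ffact (kappa + 1 - of_nat (n - i)) i)"
    using nz2 by (simp add: KS_coeff_def)
  also have "\<dots> = to_fract a / to_fract b"
    unfolding K a_def b_def by (simp add: to_fract_fact to_fract_ffact to_fract_of_nat)
  finally have eq: "KS_coeff n i j = to_fract a / to_fract b" .
  show "KS_coeff n i j \<in> regular_at z" unfolding eq regular_at_def using nz by blast
  show "specialize z (KS_coeff n i j) = KS_value z n i j"
    unfolding eq specialize_quotient[OF nz] ea eb KS_value_def ..
qed

lemma finite_KS_index [simp]: "finite {(i, j). i + j \<le> (n :: nat)}"
  by (rule finite_subset[of _ "{..n} \<times> {..n}"]) auto

lemma eval2_KS_at:
  assumes reg: "KS_regular z n" and n: "n = fst l - snd l"
  shows "eval2 (KS_at z l) x y = (\<Sum>(i, j)\<in>{(i, j). i + j \<le> n}.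
    KS_value z n (min i j) (max i j) * (ffact x (snd l + i) * ffact y (snd l + j)))"
proof -
  interpret s: subring_hom "regular_at z" "specialize z" by (rule subring_hom_specialize)
  interpret s1: subring_hom "{p. \<forall>i. coeff p i \<in> regular_at z}" "map_poly (specialize z)" by (rule s.map_poly_hom)
  let ?R = "{p. \<forall>i. coeff p i \<in> {p. \<forall>i. coeff p i \<in> regular_at z}}"
  let ?h = "map_poly (map_poly (specialize z))"
  interpret s2: subring_hom ?R ?h by (rule s1.map_poly_hom)
  interpret e: subring_hom UNIV "\<lambda>f. eval2 f x y"
    by unfold_locales (auto simp: eval2_def)
  have coeff: "KS_coeff n i j \<in> regular_at z" "specialize z (KS_coeff n i j) = KS_value z n (min i j) (max i j)"
    if "i + j \<le> n" for i j
  proof -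
    have "KS_coeff n i j \<in> regular_at z \<and> specialize z (KS_coeff n i j) = KS_value z n (min i j) (max i j)"
    proof (cases "i \<le> j")
      case True
      then show ?thesis using KS_coeff_specialize[OF reg that] by (simp add: min_absorb1 max_absorb2)
    next
      case False
      then show ?thesis using KS_coeff_specialize[OF reg, of j i] that
        unfolding KS_coeff_commute[of n i j] by (simp add: min_absorb2 max_absorb1 add.commute)
    qed
    then show "KS_coeff n i j \<in> regular_at z" "specialize z (KS_coeff n i j) = KS_value z n (min i j) (max i j)" by auto
  qed
  have const: "[:[:c:]:] \<in> ?R" "?h [:[:c:]:] = [:[:specialize z c:]:]" if "c \<in> regular_at z" for c
    using that by (auto simp: coeff_pCons s.zero s.h_0 map_poly_pCons split: nat.splits)
  have X: "[:[:0, 1:]:] \<in> ?R" "?h [:[:0, 1:]:] = [:[:0, 1:]:]"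
    by (auto simp: coeff_pCons s.zero s.one s.h_0 s.h_1 map_poly_pCons split: nat.splits)
  have Y: "[:0, 1:] \<in> ?R" "?h [:0, 1:] = [:0, 1:]"
    by (auto simp: coeff_pCons s.zero s.one s.h_0 s.h_1 s1.h_1 map_poly_pCons one_pCons split: nat.splits)
  let ?term = "\<lambda>(i, j). [:[:KS_coeff n i j:]:] * ffact [:[:0, 1:]:] (snd l + i) * ffact [:0, 1:] (snd l + j)"
  have termR: "?term p \<in> ?R" if pn: "p \<in> {(i, j). i + j \<le> n}" for p
  proof -
    obtain i j where p: "p = (i, j)" "i + j \<le> n" using pn by auto
    show ?thesis unfolding p(1) prod.case
      by (intro s2.mult s2.ffact(1) const(1) coeff(1) p(2) X(1) Y(1))
  qed
  have "KS_at z l = (\<Sum>p\<in>{(i, j). i + j \<le> n}. ?h (?term p))"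
    unfolding KS_at_def KS_def Let_def n[symmetric] by (rule s2.sum(2)[OF termR])
  also have "\<dots> = (\<Sum>(i, j)\<in>{(i, j). i + j \<le> n}.
      [:[:KS_value z n (min i j) (max i j):]:] * ffact [:[:0, 1:]:] (snd l + i) * ffact [:0, 1:] (snd l + j))"
  proof (intro sum.cong refl)
    fix p assume "p \<in> {(i, j). i + j \<le> n}"
    then obtain i j where p: "p = (i, j)" "i + j \<le> n" by auto
    show "?h (?term p) = (case p of (i, j) \<Rightarrow> [:[:KS_value z n (min i j) (max i j):]:] *
        ffact [:[:0, 1:]:] (snd l + i) * ffact [:0, 1:] (snd l + j))"
      unfolding p prod.case
      by (simp only: s2.h_mult[OF s2.mult[OF const(1)[OF coeff(1)[OF p(2)]] s2.ffact(1)[OF X(1)]] s2.ffact(1)[OF Y(1)]]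
          s2.h_mult[OF const(1)[OF coeff(1)[OF p(2)]] s2.ffact(1)[OF X(1)]] s2.ffact(2)[OF X(1)] s2.ffact(2)[OF Y(1)]
          const(2)[OF coeff(1)[OF p(2)]] coeff(2)[OF p(2)] X(2) Y(2))
  qed
  finally have KS: "KS_at z l = (\<Sum>(i, j)\<in>{(i, j). i + j \<le> n}.
      [:[:KS_value z n (min i j) (max i j):]:] * ffact [:[:0, 1:]:] (snd l + i) * ffact [:0, 1:] (snd l + j))" .
  have eX: "eval2 [:[:0, 1:]:] x y = x" "eval2 [:0, 1:] x y = y" "eval2 [:[:c:]:] x y = c" for c
    by (simp_all add: eval2_def)
  have "eval2 ([:[:c:]:] * ffact [:[:0, 1:]:] a * ffact [:0, 1:] b) x y = c * (ffact x a * ffact y b)" for c a b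
    by (simp only: e.h_mult[OF UNIV_I UNIV_I] e.ffact(2)[OF UNIV_I] eX mult.assoc)
  then show ?thesis
    unfolding KS by (subst e.sum(2)) (auto intro!: sum.cong simp del: smult_conv_map_poly mult_pCons_left)
qed

text \<open>The factor that is attached to the r-th term when the Knop-Sahi polynomial is expanded
  in the products of equal falling powers of x and y; divided by \<open>H_norm\<close> it is a
  Newton coefficient of the idempotent.\<close>

definition KS_weight :: "complex \<Rightarrow> nat \<Rightarrow> nat \<Rightarrow> complex" where
  "KS_weight z n r = fact n / (fact r * ffact (z + 1 - of_nat (n - r)) r)"

text \<open>After a common factor is taken out, the r-th summand is the binomial of A over i - r
  times the binomial of j over r, where A = z + 1 - (n - i). By Chu-Vandermonde the sum is the
  binomial of A + j over i, and A + j = z + 1 - (n - i - j) continues the falling factorial of z +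
  1.\<close>

lemma KS_value_sum:
  assumes reg: "KS_regular z n" and ij: "i + j \<le> n" "i \<le> j"
  shows "KS_value z n i j =
    (\<Sum>r\<le>i. KS_weight z n r * ffact (z + 1) (n - i - j) / (fact (i - r) * fact (j - r) * fact (n - i - j)))"
proof -
  let ?K = "z + 1" and ?A = "z + 1 - of_nat (n - i)"
  have D: "ffact ?A i \<noteq> 0" using KS_regular_ffact[OF reg, of i] ij by simp
  have summand: "KS_weight z n r * ffact ?K (n - i - j) / (fact (i - r) * fact (j - r) * fact (n - i - j)) =
      fact n * ffact ?K (n - i - j) / (fact (n - i - j) * fact j * ffact ?A i) *
      ((?A gchoose (i - r)) * (of_nat j gchoose r))" if r: "r \<le> i" for r
  proof -
    have "ffact ?A i = ffact ?A (i - r) * ffact (?A - of_nat (i - r)) r"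
      using ffact_add[of ?A "i - r" r] r by simp
    also have "?A - of_nat (i - r) = ?K - of_nat (n - r)"
      using r ij by (simp add: of_nat_diff)
    finally have A: "ffact ?A i = ffact ?A (i - r) * ffact (?K - of_nat (n - r)) r" .
    then have nz: "ffact ?A (i - r) \<noteq> 0" "ffact (?K - of_nat (n - r)) r \<noteq> 0" using D by auto
    have "(of_nat j :: complex) gchoose r = fact j / (fact r * fact (j - r))"
      using binomial_fact[of r j, where 'a = complex] r ij by (simp add: binomial_gbinomial)
    then show ?thesis
      unfolding KS_weight_def A gbinomial_ffact using nz by (simp add: field_simps)
  qed
  have "(\<Sum>r\<le>i. (?A gchoose (i - r)) * (of_nat j gchoose r)) = (of_nat j + ?A) gchoose i"
    unfolding gbinomial_Vandermonde[of "of_nat j" ?A i, symmetric] atMost_atLeast0 by (intro sum.cong refl mult.commute)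
  also have "of_nat j + ?A = ?K - of_nat (n - i - j)" using ij by (simp add: of_nat_diff)
  finally have V: "(\<Sum>r\<le>i. (?A gchoose (i - r)) * (of_nat j gchoose r)) = ffact (?K - of_nat (n - i - j)) i / fact i"
    by (simp add: gbinomial_ffact)
  have split: "ffact ?K (n - j) = ffact ?K (n - i - j) * ffact (?K - of_nat (n - i - j)) i"
  proof -
    have "n - j = (n - i - j) + i" using ij by simp
    then show ?thesis by (metis ffact_add)
  qed
  have "(\<Sum>r\<le>i. KS_weight z n r * ffact ?K (n - i - j) / (fact (i - r) * fact (j - r) * fact (n - i - j))) =
      fact n * ffact ?K (n - i - j) / (fact (n - i - j) * fact j * ffact ?A i) *
      (\<Sum>r\<le>i. (?A gchoose (i - r)) * (of_nat j gchoose r))"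
    unfolding sum_distrib_left by (intro sum.cong refl summand) simp
  also have "\<dots> = KS_value z n i j" unfolding V KS_value_def split by (simp add: mult_ac)
  finally show ?thesis by simp
qed

lemma gbinomial_trinomial:
  "(a + b + c) gchoose N = (\<Sum>(i, j)\<in>{(i, j). i + j \<le> N}. ffact a i / fact i * (ffact b j / fact j) * (ffact c (N - i - j) / fact (N - i - j)) :: complex)"
proof -
  have "(a + b + c) gchoose N = (\<Sum>i\<le>N. (a gchoose i) * (\<Sum>j\<le>N - i. (b gchoose j) * (c gchoose (N - i - j))))"
    by (simp only: atMost_atLeast0 gbinomial_Vandermonde add.assoc)
  also have "\<dots> = (\<Sum>(i, j)\<in>Sigma {..N} (\<lambda>i. {..N - i}). (a gchoose i) * ((b gchoose j) * (c gchoose (N - i - j))))"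
    by (simp add: sum_distrib_left sum.Sigma)
  also have "Sigma {..N} (\<lambda>i. {..N - i}) = {(i, j). i + j \<le> N}" by auto
  finally show ?thesis by (simp add: gbinomial_ffact mult.assoc case_prod_unfold)
qed

text \<open>Split the falling power of order m + r + a after its first m + r factors. For fixed r
  the rest is a threefold Vandermonde sum in x - m - r, y - m - r and z + 1, which gives one
  binomial in x + y.\<close>

lemma eval2_KS_at_expansion:
  assumes reg: "KS_regular z n" and n: "n = fst l - snd l"
  defines "m \<equiv> snd l"
  shows "eval2 (KS_at z l) x y = (\<Sum>r\<le>n div 2. KS_weight z n r *
    ((x + y - 2 * of_nat m + (z + 1) - 2 * of_nat r) gchoose (n - 2 * r)) * (ffact x (m + r) * ffact y (m + r)))"
proof -
  let ?K = "z + 1"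
  let ?T = "\<lambda>r a b c. KS_weight z n r * ffact ?K c / (fact a * fact b * fact c)"
  have "(\<Sum>r\<le>n div 2. KS_weight z n r *
      ((x + y - 2 * of_nat m + ?K - 2 * of_nat r) gchoose (n - 2 * r)) * (ffact x (m + r) * ffact y (m + r))) =
    (\<Sum>r\<le>n div 2. \<Sum>(a, b)\<in>{(a, b). a + b \<le> n - 2 * r}.
      ?T r a b (n - 2 * r - a - b) * (ffact x (m + (r + a)) * ffact y (m + (r + b))))"
  proof (intro sum.cong refl)
    fix r
    have sh: "ffact w (m + (r + a)) = ffact w (m + r) * ffact (w - of_nat (m + r)) a" for w a
      using ffact_add[of w "m + r" a] by (simp add: add.assoc)
    have "x + y - 2 * of_nat m + ?K - 2 * of_nat r = (x - of_nat (m + r)) + (y - of_nat (m + r)) + ?K"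
      by (simp add: algebra_simps)
    then show "KS_weight z n r * ((x + y - 2 * of_nat m + ?K - 2 * of_nat r) gchoose (n - 2 * r)) * (ffact x (m + r) * ffact y (m + r)) =
        (\<Sum>(a, b)\<in>{(a, b). a + b \<le> n - 2 * r}. ?T r a b (n - 2 * r - a - b) * (ffact x (m + (r + a)) * ffact y (m + (r + b))))"
      by (simp only: gbinomial_trinomial sh sum_distrib_left sum_distrib_right)
        (intro sum.cong refl, auto simp: field_simps)
  qed
  also have "\<dots> = (\<Sum>(r, a, b)\<in>Sigma {..n div 2} (\<lambda>r. {(a, b). a + b \<le> n - 2 * r}).
      ?T r a b (n - 2 * r - a - b) * (ffact x (m + (r + a)) * ffact y (m + (r + b))))"
    by (rule sum.Sigma) (blast intro: finite_atMost finite_KS_index)+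
  \<comment> \<open>Regroup by the orders i = r + a and j = r + b of the falling powers, so that r
    runs up to the smaller of the two.\<close>
  also have "\<dots> = (\<Sum>((i, j), r)\<in>Sigma {(i, j). i + j \<le> n} (\<lambda>(i, j). {..min i j}).
      ?T r (i - r) (j - r) (n - i - j) * (ffact x (m + i) * ffact y (m + j)))"
    by (rule sum.reindex_bij_witness[where i = "\<lambda>((i, j), r). (r, i - r, j - r)" and j = "\<lambda>(r, a, b). ((r + a, r + b), r)"])
      (auto simp: diff_diff_left add_ac mult_2)
  also have "\<dots> = (\<Sum>(i, j)\<in>{(i, j). i + j \<le> n}. \<Sum>r\<le>min i j.
      ?T r (i - r) (j - r) (n - i - j) * (ffact x (m + i) * ffact y (m + j)))"
    by (subst sum.Sigma[symmetric, OF finite_KS_index]) (auto simp: case_prod_unfold)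
  also have "\<dots> = (\<Sum>(i, j)\<in>{(i, j). i + j \<le> n}. KS_value z n (min i j) (max i j) * (ffact x (m + i) * ffact y (m + j)))"
  proof (intro sum.cong refl, clarify)
    fix i j assume ij: "i + j \<le> n"
    have "KS_value z n (min i j) (max i j) = (\<Sum>r\<le>min i j. ?T r (i - r) (j - r) (n - i - j))"
    proof (cases "i \<le> j")
      case True
      then show ?thesis using KS_value_sum[OF reg ij] by (simp add: min_absorb1 max_absorb2)
    next
      case False
      then show ?thesis using KS_value_sum[OF reg, of j i] ij by (simp add: min_absorb2 max_absorb1 mult_ac add.commute diff_commute)
    qed
    then show "(\<Sum>r\<le>min i j. ?T r (i - r) (j - r) (n - i - j) * (ffact x (m + i) * ffact y (m + j))) =
        KS_value z n (min i j) (max i j) * (ffact x (m + i) * ffact y (m + j))"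
      by (simp add: sum_distrib_right)
  qed
  finally show ?thesis using eval2_KS_at[OF reg n, of x y] by (simp add: m_def)
qed

section \<open>Polynomials in two variables and their values\<close>

lemma eval2_injective:
  fixes f g :: "complex poly poly"
  assumes "\<And>x y. eval2 f x y = eval2 g x y"
  shows "f = g"
  by (rule eval2_eqI[where start = 0 and c = 0]) (rule assms)

lemma poly_eq_sum:
  assumes "degree p \<le> n"
  shows "poly p (x :: 'a::comm_semiring_1) = (\<Sum>i\<le>n. coeff p i * x ^ i)"
proof -
  have "(\<Sum>i\<le>degree p. coeff p i * x ^ i) = (\<Sum>i\<le>n. coeff p i * x ^ i)"
    using assms by (intro sum.mono_neutral_left) (auto simp: coeff_eq_0)
  then show ?thesis by (simp add: poly_altdef)
qed

lemma eval2_eq_sum: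
  assumes "degree f \<le> d" "\<And>i. degree (coeff f i) \<le> d"
  shows "eval2 f x y = (\<Sum>i\<le>d. \<Sum>j\<le>d. coeff (coeff f i) j * x ^ j * y ^ i :: complex)"
proof -
  have "poly f [:y:] = (\<Sum>i\<le>d. coeff f i * [:y:] ^ i)" by (rule poly_eq_sum) (rule assms)
  then have "eval2 f x y = (\<Sum>i\<le>d. poly (coeff f i) x * y ^ i)"
    by (simp add: eval2_def poly_sum)
  also have "\<dots> = (\<Sum>i\<le>d. (\<Sum>j\<le>d. coeff (coeff f i) j * x ^ j) * y ^ i)"
    by (intro sum.cong refl arg_cong2[where f = "(*)"] poly_eq_sum assms)
  finally show ?thesis by (simp add: sum_distrib_right)
qed

lemma symmetric2I:
  fixes f :: "complex poly poly"
  assumes sym: "\<And>x y. eval2 f x y = eval2 f y x"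
  shows "symmetric2 f"
proof -
  define d where "d = Max (insert (degree f) ((\<lambda>i. degree (coeff f i)) ` {..degree f}))"
  have d: "degree f \<le> d" "degree (coeff f i) \<le> d" for i
  proof -
    show "degree f \<le> d" by (simp add: d_def)
    show "degree (coeff f i) \<le> d"
    proof (cases "i \<le> degree f")
      case True
      then show ?thesis unfolding d_def by (intro Max_ge) auto
    next
      case False
      then show ?thesis by (simp add: coeff_eq_0)
    qed
  qed
  \<comment> \<open>The polynomial f with its two variables exchanged.\<close>
  define g where "g = (\<Sum>i\<le>d. \<Sum>j\<le>d. monom (monom (coeff (coeff f j) i) j) i)"
  have "eval2 g x y = eval2 f x y" for x y
  proof -
    have "eval2 g x y = (\<Sum>i\<le>d. \<Sum>j\<le>d. coeff (coeff f j) i * x ^ j * y ^ i)"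
      by (simp add: g_def eval2_def poly_sum poly_monom)
    also have "\<dots> = (\<Sum>j\<le>d. \<Sum>i\<le>d. coeff (coeff f j) i * y ^ i * x ^ j)"
      by (subst sum.swap) (simp add: mult_ac)
    also have "\<dots> = eval2 f y x" by (rule eval2_eq_sum[OF d, symmetric])
    finally show ?thesis using sym by simp
  qed
  then have gf: "g = f" by (rule eval2_injective)
  have "coeff (coeff f i) j = coeff (coeff f j) i" for i j
  proof (cases "i \<le> d \<and> j \<le> d")
    case True
    have "coeff (coeff g i) j = (\<Sum>k\<le>d. \<Sum>l\<le>d. if k = i then (if l = j then coeff (coeff f l) k else 0) else 0)"
      unfolding g_def coeff_sum by (intro sum.cong refl) (simp add: coeff_monom)
    also have "\<dots> = (\<Sum>k\<le>d. if k = i then (\<Sum>l\<le>d. if l = j then coeff (coeff f l) k else 0) else 0)"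
      by (intro sum.cong refl) simp
    also have "\<dots> = coeff (coeff f j) i" using True by (simp only: sum.delta finite_atMost atMost_iff) simp
    finally show ?thesis by (simp add: gf)
  next
    case False
    have 0: "coeff (coeff f i) j = 0" if "\<not> (i \<le> d \<and> j \<le> d)" for i j
    proof (cases "i \<le> d")
      case True
      then show ?thesis using that d(2)[of i] by (intro coeff_eq_0) linarith
    next
      case False
      then show ?thesis using d(1) by (simp add: coeff_eq_0)
    qed
    show ?thesis using 0[OF False] 0[of j i] False by auto
  qed
  then show ?thesis by (simp add: symmetric2_def)
qed

section \<open>The eigenvalue polynomial of a Capelli operator\<close>

text \<open>The difference of the nodes m and i is (m - i)(\<lambda>_1 - 1 - \<kappa> - i). The
  indices below m produce the factors of \<open>H_norm\<close> other than n!, and those above m the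
  denominator of \<open>KS_weight\<close>.\<close>

lemma newton_coeff_eq:
  assumes l: "l \<in> Partitions" and \<kappa>: "\<kappa> = - t / 2"
  defines "n \<equiv> fst l - snd l" and "m \<equiv> snd l"
  assumes r: "2 * r \<le> n"
  shows "newton_coeff t (size2 l) m (m + r) = KS_weight \<kappa> n r / H_norm l \<kappa>"
proof -
  let ?d = "size2 l"
  have node: "node t ?d m - node t ?d i = (of_nat m - of_nat i) * (of_nat (fst l) - 1 - \<kappa> - of_nat i)" for i
    by (simp add: node_def \<kappa> size2_def m_def algebra_simps)
  have lo: "(\<Prod>i<m. node t ?d m - node t ?d i) = fact m * ffact (of_nat (fst l) - 1 - \<kappa>) m"
  proof -
    have "(\<Prod>i<m. of_nat m - of_nat i :: complex) = fact m"
      unfolding fact_prod_rev of_nat_prod atLeast0LessThan by (intro prod.cong refl) (simp add: of_nat_diff)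
    then show ?thesis unfolding node prod.distrib ffact_def by simp
  qed
  have fstl: "of_nat (fst l) = (of_nat n + of_nat m :: complex)"
    using l by (auto simp: n_def m_def Partitions_def of_nat_diff)
  have hi: "(\<Prod>i\<in>{m<..m + r}. node t ?d m - node t ?d i) = fact r * ffact (\<kappa> + 1 - of_nat (n - r)) r"
  proof -
    have "(\<Prod>i\<in>{m<..m + r}. node t ?d m - node t ?d i) = (\<Prod>s<r. node t ?d m - node t ?d (m + Suc s))"
      by (rule prod.reindex_bij_witness[where i = "\<lambda>s. m + Suc s" and j = "\<lambda>i. i - m - 1"]) auto
    \<comment> \<open>For i = m + s + 1 both factors of the difference change sign, and the signs
      cancel.\<close>
    also have "\<dots> = (\<Prod>s<r. of_nat (Suc s) * (\<kappa> + 1 - of_nat (n - r) - of_nat (r - Suc s)))"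
    proof (intro prod.cong refl)
      fix s assume "s \<in> {..<r}"
      then have s: "of_nat (r - Suc s) = (of_nat r - of_nat s - 1 :: complex)" by (simp add: of_nat_diff)
      have nr: "of_nat (n - r) = (of_nat n - of_nat r :: complex)" using r by (simp add: of_nat_diff)
      then show "node t ?d m - node t ?d (m + Suc s) = of_nat (Suc s) * (\<kappa> + 1 - of_nat (n - r) - of_nat (r - Suc s))"
        unfolding node fstl s nr by (simp add: algebra_simps)
    qed
    also have "\<dots> = (\<Prod>s<r. of_nat (Suc s)) * (\<Prod>s<r. \<kappa> + 1 - of_nat (n - r) - of_nat (r - Suc s))"
      by (rule prod.distrib)
    also have "(\<Prod>s<r. of_nat (Suc s) :: complex) = fact r"
      by (simp add: fact_prod_Suc atLeast0LessThan)
    also have "(\<Prod>s<r. \<kappa> + 1 - of_nat (n - r) - of_nat (r - Suc s)) = ffact (\<kappa> + 1 - of_nat (n - r)) r"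
      unfolding ffact_def by (rule prod.nat_diff_reindex)
    finally show ?thesis .
  qed
  have indices: "{..m + r} - {m} = {..<m} \<union> {m<..m + r}" by auto
  have prod: "(\<Prod>i\<in>{..m + r} - {m}. node t ?d m - node t ?d i) =
      (\<Prod>i<m. node t ?d m - node t ?d i) * (\<Prod>i\<in>{m<..m + r}. node t ?d m - node t ?d i)"
    unfolding indices by (rule prod.union_disjoint) auto
  \<comment> \<open>The number n! occurs in the numerator of \<open>KS_weight\<close> and in
    \<open>H_norm\<close>; it is the a that cancels here.\<close>
  have cancel: "1 / (b * c * (d * e)) = a / (d * e) / (a * b * c)" if "a \<noteq> 0" for a b c d e :: complex
    using that by (simp add: mult.assoc mult.commute[of _ "d * e"])
  show ?thesis
    unfolding newton_coeff_def prod lo hi KS_weight_def H_norm_def n_def[symmetric] m_def[symmetric] n_def[unfolded m_def[symmetric], symmetric] by (rule cancel) simp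
qed

text \<open>Here the coordinates of the eigenvalue polynomial appear: a Newton product of length j
  at the eigenvalue of m becomes the product of the j-th falling powers of the shifted first part
  and of the second part.\<close>

lemma node_diff_split:
  assumes m: "m \<in> Partitions"
  shows "node t (size2 m) (snd m) - node t (size2 m) i =
    (of_nat (snd m) - of_nat i) * (of_nat (fst m) - (- t / 2) - 1 - of_nat i)"
  by (simp add: node_def size2_def algebra_simps)

text \<open>A pole requires \<kappa> to be a nonnegative integer with \<kappa> + 2 \<le> \<lambda>_1
  - \<lambda>_2 \<le> 2\<kappa> + 2, which is the range of the singular partitions.\<close>

lemma KS_regular_if_regular:
  assumes \<kappa>: "\<kappa> = - t / 2" and reg: "t \<notin> nonpos_even \<or> (\<exists>k. \<kappa> = of_nat k \<and> regular k l)"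
    and l: "l \<in> Partitions"
  shows "KS_regular \<kappa> (fst l - snd l)"
  unfolding KS_regular_def
proof (intro allI impI notI)
  fix k assume k: "k < fst l - snd l" "fst l - snd l \<le> 2 * k" and eq: "\<kappa> + 1 = of_nat k"
  have t: "t = - 2 * \<kappa>" using \<kappa> by simp
  have k1: "\<kappa> = of_nat (k - 1)" using k eq by (cases k) auto
  have "t \<in> nonpos_even" unfolding nonpos_even_def t k1 by blast
  then have "regular (k - 1) l" using reg k1 by auto
  then show False using k l by (auto simp: regular_def Partitions_def)
qed

theorem mainTheorem6:
  fixes t \<kappa> :: complex and l :: "nat \<times> nat"
  assumes "\<kappa> = - t / 2"
    and "l \<in> Partitions"
    and "t \<notin> nonpos_even \<or> (t \<in> nonpos_even \<and> (\<exists>k::nat. \<kappa> = of_nat k \<and> regular k l))"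
  shows "eigenvalue_poly t (Capelli t l) = [:[:1 / H_norm l \<kappa>:]:] * KS_at \<kappa> l"
proof -
  let ?d = "size2 l" and ?m = "snd l" and ?n = "fst l - snd l" and ?f = "[:[:1 / H_norm l \<kappa>:]:] * KS_at \<kappa> l"
  have reg: "KS_regular \<kappa> ?n" using KS_regular_if_regular assms by blast
  have special: "t = - 2 * of_nat k" if "\<kappa> = of_nat k" for k
  proof -
    have "t = - 2 * \<kappa>" using assms(1) by simp
    then show ?thesis using that by simp
  qed
  have index: "l \<in> index_set t"
    using assms(2,3) special index_set_special[of l] by (cases "t \<in> nonpos_even") (auto simp: index_set_def)
  have simple: "i = ?m" if "i \<le> ?d div 2" "level t ?d i = level t ?d ?m" for i
    using regular_level_unique[OF assms(2) _ that] assms(3) special by blast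
  have eval: "eval2 ?f x y = (\<Sum>r\<le>?n div 2. newton_coeff t ?d ?m (?m + r) *
      ((x + y - 2 * of_nat ?m + (\<kappa> + 1) - 2 * of_nat r) gchoose (?n - 2 * r)) * (ffact x (?m + r) * ffact y (?m + r)))" for x y
  proof -
    have "eval2 ?f x y = 1 / H_norm l \<kappa> * eval2 (KS_at \<kappa> l) x y" by (simp add: eval2_def)
    also have "\<dots> = (\<Sum>r\<le>?n div 2. newton_coeff t ?d ?m (?m + r) *
      ((x + y - 2 * of_nat ?m + (\<kappa> + 1) - 2 * of_nat r) gchoose (?n - 2 * r)) * (ffact x (?m + r) * ffact y (?m + r)))"
      unfolding eval2_KS_at_expansion[OF reg refl] sum_distrib_left
    proof (intro sum.cong refl)
      fix r assume "r \<in> {..?n div 2}"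
      then have "2 * r \<le> ?n" by auto
      from newton_coeff_eq[OF assms(2,1) this]
      show "1 / H_norm l \<kappa> * (KS_weight \<kappa> ?n r * (x + y - 2 * of_nat ?m + (\<kappa> + 1) - 2 * of_nat r gchoose (?n - 2 * r)) *
          (ffact x (?m + r) * ffact y (?m + r))) = newton_coeff t ?d ?m (?m + r) *
          (x + y - 2 * of_nat ?m + (\<kappa> + 1) - 2 * of_nat r gchoose (?n - 2 * r)) * (ffact x (?m + r) * ffact y (?m + r))"
        by simp
    qed
    finally show ?thesis .
  qed
  have n: "?d = ?n + 2 * ?m" using assms(2) by (auto simp: size2_def Partitions_def)
  show ?thesis
  proof (rule eigenvalue_poly_eqI[OF Capelli_action[OF index simple]])
    \<comment> \<open>In the expanded form x and y enter only through their sum and through products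
      of equal falling powers.\<close>
    show "symmetric2 ?f" by (rule symmetric2I, unfold eval) (intro sum.cong refl, simp only: add.commute mult.commute)
    fix m assume "m \<in> index_set t"
    then have m: "m \<in> Partitions" by (rule index_set_Partitions)
    let ?q = "size2 m" and ?x = "of_nat (fst m) - (- t / 2) - 1 :: complex" and ?y = "of_nat (snd m) :: complex"
    have newton: "poly (newton t ?q j) (casimir_eigenvalue t m) = ffact ?x j * ffact ?y j" for j
      unfolding casimir_eigenvalue_level(1)[OF m] poly_newton node_diff_split[OF m] prod.distrib ffact_def by (rule mult.commute)
    have "poly (\<Sum>j=?m..?d div 2. smult (newton_coeff t ?d ?m j * of_nat ((?q - 2 * j) choose (?d - 2 * j))) (newton t ?q j))
        (casimir_eigenvalue t m) =
      (\<Sum>j=?m..?d div 2. newton_coeff t ?d ?m j * of_nat ((?q - 2 * j) choose (?d - 2 * j)) * (ffact ?x j * ffact ?y j))"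
      by (simp add: poly_sum newton)
    also have "\<dots> = (\<Sum>r\<le>?n div 2. newton_coeff t ?d ?m (?m + r) *
        of_nat ((?q - 2 * (?m + r)) choose (?d - 2 * (?m + r))) * (ffact ?x (?m + r) * ffact ?y (?m + r)))"
      by (rule sum.reindex_bij_witness[where i = "\<lambda>r. ?m + r" and j = "\<lambda>j. j - ?m"]) (auto simp: n)
    also have "\<dots> = (\<Sum>r\<le>?n div 2. newton_coeff t ?d ?m (?m + r) *
        of_nat ((?q - 2 * (?m + r)) choose (?n - 2 * r)) * (ffact ?x (?m + r) * ffact ?y (?m + r)))"
      by (simp add: n)
    also have "\<dots> = eval2 ?f ?x ?y"
      unfolding eval
    proof (intro sum.cong refl)
      fix r
      show "newton_coeff t ?d ?m (?m + r) * of_nat ((?q - 2 * (?m + r)) choose (?n - 2 * r)) * (ffact ?x (?m + r) * ffact ?y (?m + r)) =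
        newton_coeff t ?d ?m (?m + r) *
        ((?x + ?y - 2 * of_nat ?m + (\<kappa> + 1) - 2 * of_nat r) gchoose (?n - 2 * r)) * (ffact ?x (?m + r) * ffact ?y (?m + r))"
      \<comment> \<open>Since x + y + \<kappa> + 1 is the size q of m, the two binomials agree as
        long as q - 2(m + r) is not truncated. Otherwise m + r exceeds the second part of the
        partition, and the falling power of y vanishes.\<close>
      proof (cases "2 * (?m + r) \<le> ?q")
        case True
        have "?x + ?y - 2 * of_nat ?m + (\<kappa> + 1) - 2 * of_nat r = of_nat (?q - 2 * (?m + r))"
          unfolding of_nat_diff[OF True] by (simp add: assms(1) size2_def)
        then show ?thesis by (simp only: binomial_gbinomial)
      next
        case False
        then have "ffact ?y (?m + r) = 0"
          unfolding ffact_eq_0_iff using m by (intro exI[of _ "snd m"]) (auto simp: Partitions_def size2_def)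
        then show ?thesis by simp
      qed
    qed
    finally show "eval2 ?f ?x ?y = poly (\<Sum>j=?m..?d div 2. smult (newton_coeff t ?d ?m j *
        of_nat ((?q - 2 * j) choose (?d - 2 * j))) (newton t ?q j)) (casimir_eigenvalue t m)" by simp
  qed
qed

end
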